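(* Let $d\ge3$ and let $V:(0,1)\to\mathbb{C}$ be measurable with $\int_0^1 r|V(r)|\,dr<\infty$ and $\alpha_m(1)\ne0$ for all $m\in\mathbb{N}_0$. If $f\in\mathcal{M}(\mathbb{S}^{d-1})$, then the function $$u_f(r\xi):=\big(f\,\big|\,P_V(r,\xi,\cdot)\big)_{C(\mathbb{S}^{d-1})},\qquad x=r\xi\in\mathbb{B}^d,$$ is a distributional solution of $-\Delta u+V(|x|)u=0$ in $\mathbb{B}^d$ which belongs to $C(\mathbb{B}^d)$, and its distributional boundary value is $(u_f)_{db}=f$. In particular, this is valid for $f\in L^2(\mathbb{S}^{d-1})$, and in this case $u_f\in L^2(\mathbb{B}^d)$.
   Context: $\mathbb{B}^d$ and $\mathbb{S}^{d-1}$ are the open unit ball and unit sphere of $\mathbb{R}^d$, $\sigma$ the surface measure; $\mathbb{N}_0=\{0,1,2,\dots\}$. $\mathcal{M}(\mathbb{S}^{d-1})=(C(\mathbb{S}^{d-1}))'$ is the space of complex Radon measures on $\mathbb{S}^{d-1}$, $(f|\varphi)_{C(\mathbb{S}^{d-1})}$ the (bilinear) action of $f$ on $\varphi$; $f\in L^2(\mathbb{S}^{d-1})$ is identified with $\varphi\mapsto\int f\varphi\,d\sigma$. $\mathscr{D}(\mathbb{S}^{d-1})=C^\infty(\mathbb{S}^{d-1})$ and $\mathscr{D}'(\mathbb{S}^{d-1})$ is its dual, so $\mathcal{M}(\mathbb{S}^{d-1})\subset\mathscr{D}'(\mathbb{S}^{d-1})$. Distributional solution: $u\in L^1_{loc}(\mathbb{B}^d)$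 with $\int_{\mathbb{B}^d}u(-\Delta\phi+V(|x|)\phi)\,dx=0$ for all $\phi\in C_0^\infty(\mathbb{B}^d)$ (with $Vu\phi$ integrable). Distributional boundary value: $u_{db}=f\in\mathscr{D}'(\mathbb{S}^{d-1})$ means $\lim_{r\to1^-}\int_{\mathbb{S}^{d-1}}u(r\xi)\varphi(\xi)\,d\sigma_\xi=(f|\varphi)_{\mathscr{D}(\mathbb{S}^{d-1})}$ for all $\varphi\in C^\infty(\mathbb{S}^{d-1})$. Radial functions: for $m\in\mathbb{N}_0$ put $\ell_m=m+\frac{d-3}{2}$ and let $y_m$ be the regular solution of $$-y_m''+\frac{\ell_m(\ell_m+1)}{r^2}y_m+V(r)y_m=0\ \text{ a.e. on }(0,1),\qquad y_m(r)\sim r^{\ell_m+1},\ \ y_m'(r)\sim(\ell_m+1)r^{\ell_m}\ (r\to0^+),$$ given explicitly by $y_m=\sum_{k\ge0}\psi_k$, $\psi_0(r)=r^{\ell_m+1}$, $\psi_k(r)=\int_0^r\frac{1}{2\ell_m+1}\left(\frac{r^{\ell_m+1}}{s^{\ell_m}}-\frac{s^{\ell_m+1}}{r^{\ell_m}}\right)V(s)\psi_{k-1}(s)\,ds$ for $k\ge1$. Define $\alpha_m(r)=y_m(r)/r^{\ell_m+1}$ for $r\in(0,1]$ and $\alpha_m(0)=1$. Generalized Poisson kernel: $P_V(r,\xi,\zeta)=\sum_{m=0}^\infty\frac{r^m\alpha_m(r)}{\alpha_m(1)}Z_m(\xi,\zeta)$ for $0\le r<1$, $\xi,\zeta\in\mathbb{S}^{d-1}$,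 where $Z_m(\xi,\zeta)=\sum_{j=1}^{d_m}Y_j^{(m)}(\xi)\overline{Y_j^{(m)}(\zeta)}$ is the zonal harmonic, $\{Y_j^{(m)}\}_{j=1}^{d_m}$ being any orthonormal basis in $L^2(\mathbb{S}^{d-1},\sigma)$ of the space of spherical harmonics of degree $m$. *)

theory Defs
  imports "HOL-Analysis.Analysis"
begin

section \<open>Smooth functions and the Laplacian\<close>

text \<open>
  The following is intended for open \<open>S\<close>. Derivatives are real ones; \<open>\<complex>\<close> is regarded as a
  real vector space.
\<close>

primrec Ck_on :: "nat \<Rightarrow> 'a::euclidean_space set \<Rightarrow> ('a \<Rightarrow> complex) \<Rightarrow> bool" where
  "Ck_on 0 S u \<longleftrightarrow> continuous_on S u"
| "Ck_on (Suc k) S u \<longleftrightarrow>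
     (\<forall>x\<in>S. u differentiable (at x)) \<and>
     (\<forall>b\<in>Basis. Ck_on k S (\<lambda>x. frechet_derivative u (at x) b))"

definition smooth_on :: "'a::euclidean_space set \<Rightarrow> ('a \<Rightarrow> complex) \<Rightarrow> bool" where
  "smooth_on S u \<longleftrightarrow> (\<forall>k. Ck_on k S u)"

definition laplacian :: "('a::euclidean_space \<Rightarrow> complex) \<Rightarrow> 'a \<Rightarrow> complex" where
  "laplacian u x =
     (\<Sum>b\<in>Basis. frechet_derivative (\<lambda>y. frechet_derivative u (at y) b) (at x) b)"

definition test_function_ball :: "('a::euclidean_space \<Rightarrow> complex) \<Rightarrow> bool" where
  "test_function_ball \<phi> \<longleftrightarrow>
     smooth_on UNIV \<phi> \<and> (\<exists>K. compact K \<and> K \<subseteq> ball 0 1 \<and> (\<forall>x. x \<notin> K \<longrightarrow> \<phi> x = 0))"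

text \<open>
  A function on the unit sphere is represented by a function on the whole space of which only
  the values on the sphere matter. It is smooth on the sphere iff its extension constant
  along rays is smooth off the origin: \<open>x \<mapsto> x / |x|\<close> is a smooth retraction onto the sphere.
\<close>

definition smooth_on_sphere :: "('a::euclidean_space \<Rightarrow> complex) \<Rightarrow> bool" where
  "smooth_on_sphere \<phi> \<longleftrightarrow> smooth_on (- {0}) (\<lambda>x. \<phi> (x /\<^sub>R norm x))"

section \<open>Surface measure and Radon measures on the sphere\<close>

text \<open>
  The surface measure of \<open>A\<close> is \<open>d\<close> times the Lebesgue measure of the cone over \<open>A\<close>, that is,
  of the points \<open>x\<close> with \<open>0 < |x| < 1\<close> and \<open>x / |x| \<in> A\<close>.
\<close>

definition sphere_measure :: "'a::euclidean_space measure" where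
  "sphere_measure =
     scale_measure (of_nat DIM('a))
       (distr (restrict_space lborel (ball 0 1 - {0})) (restrict_space borel (sphere 0 1))
          (\<lambda>x. x /\<^sub>R norm x))"

text \<open>
  Complex Radon measures are the elements of the dual of \<open>C(sphere 0 1)\<close>. The bound implies
  that \<open>f \<phi>\<close> depends only on the values of \<open>\<phi>\<close> on the sphere.
\<close>

definition radon_measure_sphere :: "(('a::euclidean_space \<Rightarrow> complex) \<Rightarrow> complex) \<Rightarrow> bool" where
  "radon_measure_sphere f \<longleftrightarrow>
     (\<forall>\<phi> \<psi>. continuous_on (sphere 0 1) \<phi> \<longrightarrow> continuous_on (sphere 0 1) \<psi> \<longrightarrow>
        f (\<lambda>\<zeta>. \<phi> \<zeta> + \<psi> \<zeta>) = f \<phi> + f \<psi>) \<and>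
     (\<forall>c \<phi>. continuous_on (sphere 0 1) \<phi> \<longrightarrow> f (\<lambda>\<zeta>. c * \<phi> \<zeta>) = c * f \<phi>) \<and>
     (\<exists>C. \<forall>\<phi>. continuous_on (sphere 0 1) \<phi> \<longrightarrow>
        norm (f \<phi>) \<le> C * (SUP \<zeta>\<in>sphere 0 1. norm (\<phi> \<zeta>)))"

definition L2_sphere :: "('a::euclidean_space \<Rightarrow> complex) \<Rightarrow> bool" where
  "L2_sphere g \<longleftrightarrow>
     g \<in> borel_measurable sphere_measure \<and> integrable sphere_measure (\<lambda>\<xi>. (norm (g \<xi>))\<^sup>2)"

definition functional_of ::
    "('a::euclidean_space \<Rightarrow> complex) \<Rightarrow> ('a \<Rightarrow> complex) \<Rightarrow> complex" where
  "functional_of g \<phi> = (LINT \<xi>|sphere_measure. g \<xi> * \<phi> \<xi>)"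

definition L2_ball :: "('a::euclidean_space \<Rightarrow> complex) \<Rightarrow> bool" where
  "L2_ball u \<longleftrightarrow>
     u \<in> borel_measurable (lebesgue_on (ball 0 1)) \<and>
     set_integrable lebesgue (ball 0 1) (\<lambda>x. (norm (u x))\<^sup>2)"

section \<open>Distributional solutions and boundary values\<close>

definition distributional_solution ::
    "(real \<Rightarrow> complex) \<Rightarrow> ('a::euclidean_space \<Rightarrow> complex) \<Rightarrow> bool" where
  "distributional_solution V u \<longleftrightarrow>
     (\<forall>K. compact K \<and> K \<subseteq> ball 0 1 \<longrightarrow> set_integrable lebesgue K u) \<and>
     (\<forall>\<phi>. test_function_ball \<phi> \<longrightarrow>
        set_integrable lebesgue (ball 0 1) (\<lambda>x. V (norm x) * u x * \<phi> x) \<and>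
        (LINT x:ball 0 1|lebesgue. u x * (- laplacian \<phi> x + V (norm x) * \<phi> x)) = 0)"

text \<open>
  Integrability is required explicitly because the integral of a non-integrable function is 0.
\<close>

definition has_distributional_boundary_value ::
    "('a::euclidean_space \<Rightarrow> complex) \<Rightarrow> (('a \<Rightarrow> complex) \<Rightarrow> complex) \<Rightarrow> bool" where
  "has_distributional_boundary_value u f \<longleftrightarrow>
     (\<forall>\<phi>. smooth_on_sphere \<phi> \<longrightarrow>
        (\<forall>\<^sub>F r in at_left (1::real). integrable sphere_measure (\<lambda>\<xi>. u (r *\<^sub>R \<xi>) * \<phi> \<xi>)) \<and>
        ((\<lambda>r. LINT \<xi>|sphere_measure. u (r *\<^sub>R \<xi>) * \<phi> \<xi>) \<longlongrightarrow> f \<phi>) (at_left 1))"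

section \<open>Spherical harmonics\<close>

definition spherical_harmonic :: "nat \<Rightarrow> ('a::euclidean_space \<Rightarrow> complex) \<Rightarrow> bool" where
  "spherical_harmonic m h \<longleftrightarrow>
     (\<exists>p. polynomial_function p \<and> (\<forall>t x. p (t *\<^sub>R x) = t ^ m *\<^sub>R p x) \<and>
        (\<forall>x. laplacian p x = 0) \<and> (\<forall>\<xi>\<in>sphere 0 1. h \<xi> = p \<xi>))"

definition orthonormal_basis_spherical_harmonics ::
    "nat \<Rightarrow> nat \<Rightarrow> (nat \<Rightarrow> 'a::euclidean_space \<Rightarrow> complex) \<Rightarrow> bool" where
  "orthonormal_basis_spherical_harmonics m n Y \<longleftrightarrow>
     (\<forall>j<n. spherical_harmonic m (Y j)) \<and>
     (\<forall>i<n. \<forall>j<n. (LINT \<xi>|sphere_measure. Y i \<xi> * cnj (Y j \<xi>)) = (if i = j then 1 else 0)) \<and>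
     (\<forall>h. spherical_harmonic m h \<longrightarrow>
        (\<exists>c. \<forall>\<xi>\<in>sphere 0 1. h \<xi> = (\<Sum>j<n. c j * Y j \<xi>)))"

definition zonal :: "nat \<Rightarrow> (nat \<Rightarrow> 'a::euclidean_space \<Rightarrow> complex) \<Rightarrow> 'a \<Rightarrow> 'a \<Rightarrow> complex" where
  "zonal n Y \<xi> \<zeta> = (\<Sum>j<n. Y j \<xi> * cnj (Y j \<zeta>))"

section \<open>Radial functions\<close>

definition ell :: "nat \<Rightarrow> nat \<Rightarrow> real" where
  "ell d m = real m + (real d - 3) / 2"

primrec radial_term :: "real \<Rightarrow> (real \<Rightarrow> complex) \<Rightarrow> nat \<Rightarrow> real \<Rightarrow> complex" where
  "radial_term l V 0 r = of_real (r powr (l + 1))"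
| "radial_term l V (Suc k) r =
     (LINT s:{0<..<r}|lebesgue.
        of_real (1 / (2 * l + 1) * (r powr (l + 1) / s powr l - s powr (l + 1) / r powr l)) *
        V s * radial_term l V k s)"

text \<open>
  The regular solution of \<open>- y'' + l (l + 1) / r\<^sup>2 * y + V y = 0\<close> on \<open>(0,1)\<close> with
  \<open>y(r) \<sim> r powr (l + 1)\<close> at 0, as a Neumann series.
\<close>

definition regular_solution :: "real \<Rightarrow> (real \<Rightarrow> complex) \<Rightarrow> real \<Rightarrow> complex" where
  "regular_solution l V r = (\<Sum>k. radial_term l V k r)"

definition alpha :: "nat \<Rightarrow> (real \<Rightarrow> complex) \<Rightarrow> nat \<Rightarrow> real \<Rightarrow> complex" where
  "alpha d V m r =
     (if r = 0 then 1
      else regular_solution (ell d m) V r / of_real (r powr (ell d m + 1)))"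

section \<open>Generalized Poisson kernel and Poisson integral\<close>

definition poisson_kernel ::
    "(real \<Rightarrow> complex) \<Rightarrow> (nat \<Rightarrow> nat) \<Rightarrow> (nat \<Rightarrow> nat \<Rightarrow> 'a::euclidean_space \<Rightarrow> complex) \<Rightarrow>
     real \<Rightarrow> 'a \<Rightarrow> 'a \<Rightarrow> complex" where
  "poisson_kernel V n Y r \<xi> \<zeta> =
     (\<Sum>m. of_real (r ^ m) * alpha DIM('a) V m r / alpha DIM('a) V m 1 * zonal (n m) (Y m) \<xi> \<zeta>)"

text \<open>
  At the origin the kernel does not depend on the unit vector, so an arbitrary one is used there.
\<close>

definition direction :: "'a::euclidean_space \<Rightarrow> 'a" where
  "direction x = (if x = 0 then (SOME \<xi>. norm \<xi> = 1) else x /\<^sub>R norm x)"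

definition poisson_integral ::
    "(real \<Rightarrow> complex) \<Rightarrow> (nat \<Rightarrow> nat) \<Rightarrow> (nat \<Rightarrow> nat \<Rightarrow> 'a::euclidean_space \<Rightarrow> complex) \<Rightarrow>
     (('a \<Rightarrow> complex) \<Rightarrow> complex) \<Rightarrow> 'a \<Rightarrow> complex" where
  "poisson_integral V n Y f x = f (poisson_kernel V n Y (norm x) (direction x))"

end

theory Submission
  imports Defs
begin

text \<open>
  Write \<open>\<nu> = 2 m + d - 2\<close> for the degree \<open>m\<close>. The pairing of \<open>f\<close> with the \<open>m\<close>-th term of the kernel is a
  function \<open>\<alpha>\<^sub>m(|x|) / \<alpha>\<^sub>m(1) * p\<^sub>m(x)\<close> of \<open>x = r \<xi>\<close>, where \<open>p\<^sub>m\<close> is a harmonic homogeneous polynomial of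
  degree \<open>m\<close> (\<open>f_kernel_term\<close>). The Poisson integral is the sum of these modes, each of which solves
  the equation by separation of variables; the theorem says that the series converges well enough
  for this, for continuity and for the boundary values to pass to the sum.
\<close>

text \<open>
  Convergence. Divided by \<open>r powr (l + 1)\<close>, the Neumann series for \<open>y\<^sub>m\<close> is dominated by the exponential series
  in \<open>C / \<nu>\<close> with \<open>C = \<integral>s |V(s)| ds\<close> (\<open>normalized_solution\<close>). So \<open>|\<alpha>\<^sub>m|\<close> is bounded by \<open>exp C\<close>, and
  \<open>\<alpha>\<^sub>m(1)\<close> tends to \<open>1\<close>; since none of the \<open>\<alpha>\<^sub>m(1)\<close> vanishes, the quotients are uniformly bounded
  (\<open>radial_quotient_bounded\<close>). The zonal harmonics grow at most like a power of \<open>m\<close>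
  (\<open>zonal_diagonal_bound\<close>), a consequence of the mean value property (\<open>weighted_mean_value\<close>), and
  \<open>r ^ m\<close> beats every power of \<open>m\<close>, locally uniformly in the open ball.
\<close>

text \<open>
  The equation. The function \<open>\<alpha>\<^sub>m\<close> satisfies the integral equation \<open>\<alpha>\<^sub>m = 1 + T(V \<alpha>\<^sub>m)\<close>, where \<open>T\<close> inverts
  the radial part of the Laplacian on functions \<open>g(|x|) p\<^sub>m(x)\<close>. For a continuous source that vanishes
  near the end points of \<open>(0,1)\<close> the resulting function is \<open>C\<^sup>2\<close> and Green's formula
  (\<open>integral_laplacian_symmetric\<close>) applies. The weak form of this identity passes to all sources \<open>w\<close>
  with \<open>\<integral>s |w(s)| ds < \<infinity>\<close> by dominated convergence (\<open>weak_identity_source\<close>), thus to \<open>V \<alpha>\<^sub>m\<close>, and from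
  the single modes to their sum (\<open>extension_weak_solution\<close>). Throughout, \<open>V\<close> is replaced by a Borel
  function that is equal to it almost everywhere
  (\<open>radial_source_representative\<close>, \<open>alpha_eq_normalized_solution\<close>).
\<close>

text \<open>
  Boundary values. For smooth \<open>\<phi>\<close> the integral of the \<open>m\<close>-th mode at \<open>r \<xi>\<close> against \<open>\<phi>(\<xi>)\<close> over the
  unit sphere is \<open>r ^ m * \<alpha>\<^sub>m(r) / \<alpha>\<^sub>m(1)\<close> times \<open>f\<close> applied to the projection of \<open>\<phi>\<close> to degree \<open>m\<close>. The
  projections of a smooth function decay faster than any power of \<open>m\<close>, because harmonics are
  eigenfunctions of the spherical Laplacian (\<open>sphere_integral_laplacian\<close>, \<open>proj_summable\<close>), and they
  sum to \<open>\<phi>\<close>, because harmonics are complete (\<open>spherical_harmonics_complete\<close>, \<open>harmonic_expansion\<close>).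
  So the limit \<open>r \<rightarrow> 1\<close> can be taken term by term and gives \<open>f\<close> applied to \<open>\<phi>\<close>
  (\<open>extension_boundary_value\<close>). If \<open>f\<close> is given by a square-integrable function, Bessel's inequality
  bounds the \<open>L\<^sup>2\<close> norms on all spheres of radius less than \<open>1\<close>, and integration over the radius in
  polar coordinates (\<open>polar_measure\<close>) bounds the norm on the ball (\<open>extension_L2\<close>).
\<close>

section \<open>Smooth functions\<close>

abbreviation pd :: "'a::euclidean_space \<Rightarrow> ('a \<Rightarrow> complex) \<Rightarrow> 'a \<Rightarrow> complex" where
  "pd b u x \<equiv> frechet_derivative u (at x) b"

lemma pd_eqI: "(u has_derivative u') (at x) \<Longrightarrow> pd b u x = u' b"
  by (simp add: frechet_derivative_at[symmetric])

lemma pd_cong_open: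
  assumes "open S" "x \<in> S" "\<And>y. y \<in> S \<Longrightarrow> u y = v y" "u differentiable (at x)"
  shows "pd b u x = pd b v x"
  using frechet_derivative_transform_within_open[OF assms(4,1,2,3)] by simp

lemma differentiable_cong_open:
  assumes "open S" "x \<in> S" "\<And>y. y \<in> S \<Longrightarrow> u y = v y" "u differentiable (at x)"
  shows "v differentiable (at x)"
  using assms by (meson differentiable_def has_derivative_transform_within_open)

lemma pd_add:
  assumes "u differentiable (at x)" "v differentiable (at x)"
  shows "pd b (\<lambda>x. u x + v x) x = pd b u x + pd b v x"
proof (rule pd_eqI)
  show "((\<lambda>x. u x + v x) has_derivative (\<lambda>b. pd b u x + pd b v x)) (at x)"
    using assms by (intro has_derivative_add) (simp_all add: frechet_derivative_works[symmetric])
qed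

lemma pd_mult:
  assumes "u differentiable (at x)" "v differentiable (at x)"
  shows "pd b (\<lambda>x. u x * v x) x = u x * pd b v x + pd b u x * v x"
proof (rule pd_eqI)
  show "((\<lambda>x. u x * v x) has_derivative (\<lambda>b. u x * pd b v x + pd b u x * v x)) (at x)"
    using assms by (intro has_derivative_mult) (simp_all add: frechet_derivative_works[symmetric])
qed

lemma pd_diff:
  assumes "u differentiable (at x)" "v differentiable (at x)"
  shows "pd b (\<lambda>x. u x - v x) x = pd b u x - pd b v x"
proof (rule pd_eqI)
  show "((\<lambda>x. u x - v x) has_derivative (\<lambda>b. pd b u x - pd b v x)) (at x)"
    using assms by (intro has_derivative_diff) (simp_all add: frechet_derivative_works[symmetric])
qed

lemma pd_cnj:
  assumes "u differentiable (at x)"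
  shows "pd b (\<lambda>x. cnj (u x)) x = cnj (pd b u x)"
proof (rule pd_eqI)
  show "((\<lambda>x. cnj (u x)) has_derivative (\<lambda>b. cnj (pd b u x))) (at x)"
    using assms by (intro bounded_linear.has_derivative[OF bounded_linear_cnj])
      (simp_all add: frechet_derivative_works[symmetric])
qed

lemma Ck_on_cong:
  assumes "open S" "\<And>x. x \<in> S \<Longrightarrow> u x = v x" "Ck_on k S u"
  shows "Ck_on k S v"
  using assms(2,3)
proof (induction k arbitrary: u v)
  case 0
  then show ?case using continuous_on_cong by fastforce
next
  case (Suc k)
  have "pd b u x = pd b v x" if "x \<in> S" for b x
    using pd_cong_open[OF assms(1) that Suc.prems(1)] Suc.prems(2) that by auto
  then have "Ck_on k S (\<lambda>x. pd b v x)" if "b \<in> Basis" for b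
    using Suc.IH[of "\<lambda>x. pd b u x" "\<lambda>x. pd b v x"] Suc.prems(2) that by auto
  then show ?case
    using Suc.prems differentiable_cong_open[OF assms(1)] by (simp) blast
qed

lemma Ck_on_SucD: "Ck_on (Suc k) S u \<Longrightarrow> Ck_on k S u"
proof (induction k arbitrary: u)
  case 0
  then show ?case
    by (auto intro!: continuous_at_imp_continuous_on differentiable_imp_continuous_within)
next
  case (Suc k)
  then show ?case by auto
qed

lemma Ck_on_mono: "Ck_on k S u \<Longrightarrow> j \<le> k \<Longrightarrow> Ck_on j S u"
  by (induction k) (auto simp del: Ck_on.simps simp: le_Suc_eq intro: Ck_on_SucD)

lemma Ck_on_subset: "Ck_on k S u \<Longrightarrow> T \<subseteq> S \<Longrightarrow> Ck_on k T u"
  by (induction k arbitrary: u) (auto intro: continuous_on_subset)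

lemma Ck_on_const: "Ck_on k S (\<lambda>x. c)"
proof (induction k arbitrary: c)
  case (Suc k)
  have "(\<lambda>x. pd b (\<lambda>x. c) x) = (\<lambda>x::'a. 0)" for b
    by simp
  then show ?case using Suc[of 0] by (simp del: frechet_derivative_const)
qed auto

lemma Ck_on_add:
  assumes "open S" "Ck_on k S u" "Ck_on k S v"
  shows "Ck_on k S (\<lambda>x. u x + v x)"
  using assms(2,3)
proof (induction k arbitrary: u v)
  case 0
  then show ?case by (auto intro: continuous_intros)
next
  case (Suc k)
  have "Ck_on k S (\<lambda>x. pd b (\<lambda>x. u x + v x) x)" if "b \<in> Basis" for b
    by (rule Ck_on_cong[OF assms(1) _ Suc.IH[of "\<lambda>x. pd b u x" "\<lambda>x. pd b v x"]])
      (use Suc.prems that in \<open>auto simp: pd_add\<close>)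
  then show ?case using Suc.prems by (auto intro: differentiable_add)
qed

lemma Ck_on_mult:
  assumes "open S" "Ck_on k S u" "Ck_on k S v"
  shows "Ck_on k S (\<lambda>x. u x * v x)"
  using assms(2,3)
proof (induction k arbitrary: u v)
  case 0
  then show ?case by (auto intro: continuous_intros)
next
  case (Suc k)
  have "Ck_on k S u" "Ck_on k S v" using Suc.prems Ck_on_SucD by auto
  then have "Ck_on k S (\<lambda>x. u x * pd b v x + pd b u x * v x)" if "b \<in> Basis" for b
    using Suc.prems that by (intro Ck_on_add Suc.IH assms(1)) auto
  then have "Ck_on k S (\<lambda>x. pd b (\<lambda>x. u x * v x) x)" if "b \<in> Basis" for b
    using Ck_on_cong[OF assms(1), of "\<lambda>x. u x * pd b v x + pd b u x * v x"
        "\<lambda>x. pd b (\<lambda>x. u x * v x) x"] Suc.prems that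
    by (auto simp: pd_mult)
  then show ?case using Suc.prems by (auto intro: differentiable_mult)
qed

lemma Ck_on_cmult: "open S \<Longrightarrow> Ck_on k S u \<Longrightarrow> Ck_on k S (\<lambda>x. c * u x)"
  by (intro Ck_on_mult Ck_on_const)

lemma Ck_on_uminus: "open S \<Longrightarrow> Ck_on k S u \<Longrightarrow> Ck_on k S (\<lambda>x. - u x)"
  using Ck_on_cmult[of S k u "-1"] by simp

lemma Ck_on_diff:
  "open S \<Longrightarrow> Ck_on k S u \<Longrightarrow> Ck_on k S v \<Longrightarrow> Ck_on k S (\<lambda>x. u x - v x)"
  using Ck_on_add[OF _ _ Ck_on_uminus] by fastforce

lemma Ck_on_sum:
  assumes "open S" "\<And>i. i \<in> I \<Longrightarrow> Ck_on k S (u i)"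
  shows "Ck_on k S (\<lambda>x. \<Sum>i\<in>I. u i x)"
  using assms(2)
  by (induction I rule: infinite_finite_induct) (auto intro: Ck_on_const Ck_on_add assms(1))

lemma Ck_on_linear:
  assumes "bounded_linear f"
  shows "Ck_on k S f"
proof (cases k)
  case 0
  then show ?thesis using bounded_linear.continuous_on[OF assms continuous_on_id] by (simp add: id_def)
next
  case (Suc j)
  have "(f has_derivative f) (at x)" for x
    by (rule bounded_linear_imp_has_derivative[OF assms])
  then have "(\<lambda>x. pd b f x) = (\<lambda>x. f b)" for b
    by (auto intro: pd_eqI)
  moreover have "f differentiable at x" for x
    using assms bounded_linear_imp_differentiable by blast
  ultimately show ?thesis using Suc by (simp add: Ck_on_const)
qed

lemma Ck_on_real_polynomial:
  assumes "real_polynomial_function p" "open S"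
  shows "Ck_on k S (\<lambda>x. complex_of_real (p x))"
  using assms(1)
proof induction
  case (linear f)
  show ?case
    using bounded_linear_compose[OF bounded_linear_of_real linear] by (rule Ck_on_linear)
qed (auto intro: Ck_on_const Ck_on_add Ck_on_mult assms(2))

lemma Ck_on_polynomial:
  fixes p :: "'a::euclidean_space \<Rightarrow> complex"
  assumes "polynomial_function p" "open S"
  shows "Ck_on k S p"
proof -
  have "real_polynomial_function (Re \<circ> p)" "real_polynomial_function (Im \<circ> p)"
    using assms(1) bounded_linear_Re bounded_linear_Im unfolding polynomial_function_def by blast+
  from this[THEN Ck_on_real_polynomial[OF _ assms(2)]]
  have "Ck_on k S (\<lambda>x. complex_of_real (Re (p x)) + \<i> * complex_of_real (Im (p x)))"
    by (intro Ck_on_add Ck_on_cmult assms(2)) (auto simp: o_def)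
  then show ?thesis by (simp add: complex_eq[symmetric])
qed

lemma Ck_on_inner: "open S \<Longrightarrow> Ck_on k S (\<lambda>x. complex_of_real (x \<bullet> y))"
  by (rule Ck_on_real_polynomial) (auto intro!: real_polynomial_function.intros(1) bounded_linear_inner_left)

lemma Ck_on_norm_square:
  assumes "open S"
  shows "Ck_on k S (\<lambda>x. complex_of_real ((norm x)\<^sup>2))"
proof -
  have "Ck_on k S (\<lambda>x::'a. \<Sum>b\<in>Basis. complex_of_real (x \<bullet> b) * complex_of_real (x \<bullet> b))"
    by (intro Ck_on_sum Ck_on_mult Ck_on_inner assms)
  also have "(\<lambda>x::'a. \<Sum>b\<in>Basis. complex_of_real (x \<bullet> b) * complex_of_real (x \<bullet> b)) = (\<lambda>x. complex_of_real ((norm x)\<^sup>2))"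
    by (simp only: power2_norm_eq_inner euclidean_inner[of x x for x] of_real_sum of_real_mult)
  finally show ?thesis .
qed

lemma Ck_on_Un:
  "Ck_on k S u \<Longrightarrow> Ck_on k T u \<Longrightarrow> open S \<Longrightarrow> open T \<Longrightarrow> Ck_on k (S \<union> T) u"
  by (induction k arbitrary: u) (auto intro: continuous_on_open_Un)

text \<open>
  Smoothness is local, and the space is covered by the open sets \<open>S\<close> and \<open>- K\<close>; on the latter the
  function is zero.
\<close>

lemma Ck_on_extend_by_zero:
  assumes "open S" "closed K" "K \<subseteq> S" "Ck_on k S u" "\<And>x. x \<notin> K \<Longrightarrow> u x = 0"
  shows "Ck_on k UNIV u"
proof -
  have "Ck_on k (- K) u"
    by (rule Ck_on_cong[of _ "\<lambda>x. 0"]) (use assms in \<open>auto intro: Ck_on_const\<close>)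
  then have "Ck_on k (S \<union> - K) u"
    using assms by (intro Ck_on_Un) auto
  moreover have "S \<union> - K = UNIV" using assms(3) by auto
  ultimately show ?thesis by simp
qed

section \<open>Integration by parts\<close>

lemma integrable_compact_support:
  fixes f :: "'a::euclidean_space \<Rightarrow> complex"
  assumes "continuous_on UNIV f" "bounded K" "\<And>x. x \<notin> K \<Longrightarrow> f x = 0"
  shows "integrable lborel f"
proof -
  obtain a where a: "K \<subseteq> cbox (-a) a" using bounded_subset_cbox_symmetric[OF assms(2)] by blast
  have "integrable lborel (\<lambda>x. indicator (cbox (-a) a) x *\<^sub>R f x)"
    by (rule borel_integrable_compact) (auto intro: continuous_on_subset[OF assms(1)])
  also have "(\<lambda>x. indicator (cbox (-a) a) x *\<^sub>R f x) = f"
    using a assms(3) by (auto simp: indicator_def fun_eq_iff)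
  finally show ?thesis .
qed

lemma integral_compact_support:
  fixes f :: "'a::euclidean_space \<Rightarrow> complex"
  assumes "continuous_on UNIV f" "\<And>x. x \<notin> cbox a b \<Longrightarrow> f x = 0"
  shows "(\<integral>x. f x \<partial>lborel) = integral (cbox a b) f"
proof -
  have "set_integrable lborel (cbox a b) f"
    unfolding set_integrable_def
    by (rule borel_integrable_compact) (auto intro: continuous_on_subset[OF assms(1)])
  then have "set_lebesgue_integral lborel (cbox a b) f = integral (cbox a b) f"
    by (rule set_borel_integral_eq_integral)
  moreover have "(\<lambda>x. indicator (cbox a b) x *\<^sub>R f x) = f"
    using assms(2) by (auto simp: indicator_def fun_eq_iff)
  ultimately show ?thesis by (simp add: set_lebesgue_integral_def)
qed

lemma Ck_on_pd: "Ck_on (Suc k) S u \<Longrightarrow> b \<in> Basis \<Longrightarrow> Ck_on k S (\<lambda>x. pd b u x)"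
  by simp

lemma Ck_on_imp_continuous: "Ck_on k S u \<Longrightarrow> continuous_on S u"
  using Ck_on_mono[of k S u 0] by simp

lemma pd_expand:
  assumes "u differentiable (at x)"
  shows "frechet_derivative u (at x) h = (\<Sum>b\<in>Basis. (h \<bullet> b) *\<^sub>R pd b u x)"
proof -
  have l: "linear (frechet_derivative u (at x))"
    using assms linear_frechet_derivative by blast
  have "frechet_derivative u (at x) h = frechet_derivative u (at x) (\<Sum>b\<in>Basis. (h \<bullet> b) *\<^sub>R b)"
    by (simp add: euclidean_representation)
  also have "\<dots> = (\<Sum>b\<in>Basis. (h \<bullet> b) *\<^sub>R pd b u x)"
    by (simp add: linear_sum[OF l] linear_cmul[OF l])
  finally show ?thesis .
qed

lemma has_vector_derivative_line:
  assumes "u differentiable (at (x + t *\<^sub>R h))"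
  shows "((\<lambda>t. u (x + t *\<^sub>R h)) has_vector_derivative frechet_derivative u (at (x + t *\<^sub>R h)) h) (at t within T)"
proof -
  let ?D = "frechet_derivative u (at (x + t *\<^sub>R h))"
  have "(u has_derivative ?D) (at (x + t *\<^sub>R h))"
    using assms frechet_derivative_works by blast
  moreover have "((\<lambda>t. x + t *\<^sub>R h) has_derivative (\<lambda>t. t *\<^sub>R h)) (at t within T)"
    by (auto intro!: derivative_eq_intros)
  ultimately have "((\<lambda>t. u (x + t *\<^sub>R h)) has_derivative (\<lambda>s. ?D (s *\<^sub>R h))) (at t within T)"
    using has_derivative_compose[of "\<lambda>t. x + t *\<^sub>R h" "\<lambda>t. t *\<^sub>R h" t T u ?D] by (simp add: has_derivative_at_withinI)
  then show ?thesis
    unfolding has_vector_derivative_def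
    using linear_cmul[OF linear_frechet_derivative[OF assms]] by simp
qed

lemma integral_translate_lborel:
  fixes f :: "'a::euclidean_space \<Rightarrow> complex"
  assumes "f \<in> borel_measurable borel"
  shows "(\<integral>x. f (x + c) \<partial>lborel) = (\<integral>x. f x \<partial>lborel)"
proof -
  have "(\<integral>x. f x \<partial>lborel) = (\<integral>x. f x \<partial>distr lborel borel ((+) c))"
    by (simp add: lborel_distr_plus)
  also have "\<dots> = (\<integral>x. f (c + x) \<partial>lborel)"
    using assms by (subst integral_distr) auto
  finally show ?thesis by (simp add: add.commute)
qed

text \<open>
  Translation invariance makes \<open>t \<mapsto> \<integral>F (x + t b) dx\<close> constant, and the integral of the partial
  derivative is its derivative.
\<close>

lemma integral_pd_eq_0:
  fixes F :: "'a::euclidean_space \<Rightarrow> complex"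
  assumes F: "Ck_on 1 UNIV F" and K: "bounded K" "\<And>x. x \<notin> K \<Longrightarrow> F x = 0" and b: "b \<in> Basis"
  shows "(\<integral>x. pd b F x \<partial>lborel) = 0"
proof -
  have diff: "F differentiable (at x)" for x using F by simp
  have contD: "continuous_on UNIV (\<lambda>x. pd b F x)" using F b by simp
  have contF: "continuous_on UNIV F" using F Ck_on_imp_continuous by blast
  have "bounded (\<Union>t\<in>{-1..1::real}. (\<lambda>x. x - t *\<^sub>R b) ` K)"
  proof -
    obtain R where R: "\<And>x. x \<in> K \<Longrightarrow> norm x \<le> R" using K(1) bounded_iff by blast
    have "norm y \<le> R + 1" if y: "y \<in> (\<Union>t\<in>{-1..1::real}. (\<lambda>x. x - t *\<^sub>R b) ` K)" for y
    proof -
      obtain t :: real and x where "t \<in> {-1..1}" "x \<in> K" "y = x - t *\<^sub>R b" using y by blast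
      then show ?thesis using R[of x] norm_triangle_ineq4[of x "t *\<^sub>R b"] b by (auto simp: abs_le_iff)
    qed
    then show ?thesis unfolding bounded_iff by blast
  qed
  then obtain a where a: "(\<Union>t\<in>{-1..1::real}. (\<lambda>x. x - t *\<^sub>R b) ` K) \<subseteq> cbox (-a) a"
    using bounded_subset_cbox_symmetric by blast
  have supp: "F (x + t *\<^sub>R b) = 0" if "t \<in> {-1..1}" "x \<notin> cbox (-a) a" for x t
  proof (rule K(2), rule notI)
    assume "x + t *\<^sub>R b \<in> K"
    then have "x \<in> (\<lambda>x. x - t *\<^sub>R b) ` K" by (intro image_eqI[where x="x + t *\<^sub>R b"]) auto
    then show False using a that by blast
  qed
  have cF: "continuous_on UNIV (\<lambda>x. F (x + t *\<^sub>R b))" for t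
    by (intro continuous_on_compose2[OF contF] continuous_intros) auto
  have const: "integral (cbox (-a) a) (\<lambda>x. F (x + t *\<^sub>R b)) = (\<integral>x. F x \<partial>lborel)" if "t \<in> {-1..1}" for t
    using integral_compact_support[OF cF supp[OF that]] integral_translate_lborel[of F "t *\<^sub>R b"] contF
    by (simp add: borel_measurable_continuous_onI)
  have dI: "((\<lambda>t. integral (cbox (-a) a) (\<lambda>x. F (x + t *\<^sub>R b))) has_vector_derivative
      integral (cbox (-a) a) (\<lambda>x. pd b F (x + 0 *\<^sub>R b))) (at 0 within {-1..1})"
  proof (rule leibniz_rule_vector_derivative)
    show "((\<lambda>t. F (x + t *\<^sub>R b)) has_vector_derivative pd b F (x + t *\<^sub>R b)) (at t within {-1..1})"
      for t x by (rule has_vector_derivative_line[OF diff])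
    show "(\<lambda>x. F (x + t *\<^sub>R b)) integrable_on cbox (-a) a" for t
      by (rule integrable_continuous[OF continuous_on_subset[OF cF]]) auto
    show "continuous_on ({-1..1} \<times> cbox (- a) a) (\<lambda>(t, x). pd b F (x + t *\<^sub>R b))"
      unfolding split_beta by (intro continuous_on_compose2[OF contD] continuous_intros) auto
  qed auto
  have "((\<lambda>t. \<integral>x. F x \<partial>lborel) has_vector_derivative
      integral (cbox (-a) a) (\<lambda>x. pd b F x)) (at 0 within {-1..1::real})"
    by (intro has_vector_derivative_transform[OF _ _
      dI[unfolded scaleR_zero_left add_0_right]])
      (use const in auto)
  then have "integral (cbox (-a) a) (\<lambda>x. pd b F x) = 0"
    using vector_derivative_unique_within[of 0 "{-1..1::real}"]
      has_vector_derivative_const[of "\<integral>x. F x \<partial>lborel" "at 0 within {-1..1::real}"]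
    by (smt (verit) islimpt_Icc trivial_limit_within atLeastAtMost_iff)
  moreover have "pd b F x = 0" if "x \<notin> cbox (-a) a" for x
  proof -
    have "F y = 0" if "y \<in> - cbox (-a) a" for y using supp[of 0 y] that by auto
    then have "pd b F x = pd b (\<lambda>x. 0) x"
      by (intro pd_cong_open[of "- cbox (-a) a"]) (use that diff in auto)
    then show ?thesis by simp
  qed
  ultimately show ?thesis
    using integral_compact_support[OF contD] by metis
qed

lemma laplacian_eq_pd: "laplacian u x = (\<Sum>b\<in>Basis. pd b (\<lambda>y. pd b u y) x)"
  by (simp add: laplacian_def)

lemma continuous_on_laplacian:
  assumes "Ck_on 2 S u"
  shows "continuous_on S (laplacian u)"
  using assms unfolding numeral_2_eq_2 laplacian_eq_pd[abs_def]
  by (auto intro!: continuous_intros)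

lemma laplacian_cong_open:
  assumes "open S" "Ck_on 2 S u" "\<And>x. x \<in> S \<Longrightarrow> u x = v x" "x \<in> S"
  shows "laplacian u x = laplacian v x"
proof -
  have *: "u differentiable at y" "(\<lambda>y. pd b u y) differentiable at y" if "y \<in> S" "b \<in> Basis" for y b
    using assms(2) that by (auto simp: numeral_2_eq_2)
  show ?thesis unfolding laplacian_eq_pd
  proof (rule sum.cong)
    fix b :: 'a assume b: "b \<in> Basis"
    show "pd b (\<lambda>y. pd b u y) x = pd b (\<lambda>y. pd b v y) x"
      by (rule pd_cong_open[OF assms(1,4)])
        (use * b assms pd_cong_open[OF assms(1) _ assms(3)] in auto)
  qed simp
qed

lemma laplacian_eq_0_off_support:
  assumes "Ck_on 2 UNIV u" "closed K" "\<And>x. x \<notin> K \<Longrightarrow> u x = 0" "x \<notin> K"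
  shows "laplacian u x = 0"
proof -
  have "laplacian u x = laplacian (\<lambda>x. 0) x"
    by (rule laplacian_cong_open[of "- K"]) (use assms Ck_on_subset[OF assms(1)] in auto)
  then show ?thesis by (simp add: laplacian_eq_pd)
qed

lemma laplacian_mult:
  assumes "open S" "Ck_on 2 S u" "Ck_on 2 S v" "x \<in> S"
  shows "laplacian (\<lambda>x. u x * v x) x =
    u x * laplacian v x + 2 * (\<Sum>b\<in>Basis. pd b u x * pd b v x) + laplacian u x * v x"
proof -
  have *: "u differentiable at y" "(\<lambda>y. pd b u y) differentiable at y"
      "v differentiable at y" "(\<lambda>y. pd b v y) differentiable at y" if "y \<in> S" "b \<in> Basis" for y b
    using assms(2,3) that by (auto simp: numeral_2_eq_2)
  have "pd b (\<lambda>y. pd b (\<lambda>x. u x * v x) y) x =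
      u x * pd b (\<lambda>y. pd b v y) x + 2 * (pd b u x * pd b v x) + pd b (\<lambda>y. pd b u y) x * v x"
    if b: "b \<in> Basis" for b
  proof -
    have "pd b (\<lambda>y. u y * pd b v y + pd b u y * v y) x = pd b (\<lambda>y. pd b (\<lambda>x. u x * v x) y) x"
      by (rule pd_cong_open[OF assms(1,4)])
        (use * assms(4) b in \<open>auto simp: pd_mult intro!: differentiable_add differentiable_mult\<close>)
    moreover have "pd b (\<lambda>y. u y * pd b v y + pd b u y * v y) x =
      u x * pd b (\<lambda>y. pd b v y) x + 2 * (pd b u x * pd b v x) + pd b (\<lambda>y. pd b u y) x * v x"
      using * assms(4) b by (subst pd_add) (auto simp: pd_mult intro!: differentiable_mult)
    ultimately show ?thesis by simp
  qed
  then show ?thesis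
    unfolding laplacian_eq_pd by (simp add: sum.distrib sum_distrib_left sum_distrib_right)
qed

text \<open>The difference of the two integrands is the divergence of \<open>u \<nabla>v - v \<nabla>u\<close>.\<close>

lemma integral_laplacian_symmetric:
  fixes u v :: "'a::euclidean_space \<Rightarrow> complex"
  assumes S: "open S" "compact K" "K \<subseteq> S" "Ck_on 2 S u" "Ck_on 2 S v"
    and supp: "\<And>x. x \<notin> K \<Longrightarrow> v x = 0"
  shows "(\<integral>x. u x * laplacian v x \<partial>lborel) = (\<integral>x. v x * laplacian u x \<partial>lborel)"
    and "integrable lborel (\<lambda>x. u x * laplacian v x)"
    and "integrable lborel (\<lambda>x. v x * laplacian u x)"
proof -
  have K: "closed K" "bounded K" using S(2) compact_imp_closed compact_imp_bounded by auto
  have v2: "Ck_on 2 UNIV v"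
    using Ck_on_extend_by_zero[OF S(1) K(1) S(3,5)] supp by blast
  have supp1: "pd b v x = 0" if "x \<notin> K" for x b
  proof -
    have "pd b v x = pd b (\<lambda>x. 0) x"
      by (rule pd_cong_open[of "- K"]) (use that supp K v2 in \<open>auto simp: numeral_2_eq_2\<close>)
    then show ?thesis by simp
  qed
  have supp2: "pd b (\<lambda>y. pd b v y) x = 0" if "x \<notin> K" "b \<in> Basis" for x b
  proof -
    have "pd b (\<lambda>y. pd b v y) x = pd b (\<lambda>x. 0) x"
      by (rule pd_cong_open[of "- K"]) (use that supp1 K v2 in \<open>auto simp: numeral_2_eq_2\<close>)
    then show ?thesis by simp
  qed
  let ?F = "\<lambda>b x. u x * pd b v x - v x * pd b u x"
  have F: "Ck_on 1 UNIV (?F b)" "\<And>x. x \<notin> K \<Longrightarrow> ?F b x = 0" if "b \<in> Basis" for b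
  proof -
    show z: "?F b x = 0" if "x \<notin> K" for x using supp supp1 that by auto
    have "Ck_on 1 S (?F b)"
      using S(4,5) that Ck_on_mono[of 2 S _ 1] Ck_on_pd[of 1 S _ b]
      by (intro Ck_on_diff Ck_on_mult S(1)) (auto simp: numeral_2_eq_2 simp del: Ck_on.simps)
    then show "Ck_on 1 UNIV (?F b)"
      using Ck_on_extend_by_zero[OF S(1) K(1) S(3)] z by blast
  qed
  have pdF: "pd b (?F b) x = u x * pd b (\<lambda>y. pd b v y) x - v x * pd b (\<lambda>y. pd b u y) x"
    if b: "b \<in> Basis" for b x
  proof (cases "x \<in> K")
    case True
    then have xS: "x \<in> S" using S(3) by auto
    have *: "u differentiable at x" "(\<lambda>y. pd b u y) differentiable at x"
      "v differentiable at x" "(\<lambda>y. pd b v y) differentiable at x"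
      using S(4,5) xS b by (auto simp: numeral_2_eq_2)
    then show ?thesis by (simp add: pd_diff pd_mult differentiable_mult)
  next
    case False
    have "pd b (?F b) x = pd b (\<lambda>x. 0) x"
      by (rule pd_cong_open[of "- K"]) (use False F[OF b] K in auto)
    then show ?thesis using supp2[OF False b] supp[OF False] by simp
  qed
  have c0: "continuous_on UNIV (\<lambda>x. u x * laplacian v x)"
  proof -
    have "Ck_on 0 S (\<lambda>x. u x * laplacian v x)"
      using continuous_on_laplacian[OF S(5)] Ck_on_imp_continuous[OF S(4)] by (auto intro: continuous_intros)
    moreover have "u x * laplacian v x = 0" if "x \<notin> K" for x
      using supp2 that by (simp add: laplacian_eq_pd)
    ultimately have "Ck_on 0 UNIV (\<lambda>x. u x * laplacian v x)"
      by (rule Ck_on_extend_by_zero[OF S(1) K(1) S(3)])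
    then show ?thesis by simp
  qed
  have c1: "continuous_on UNIV (\<lambda>x. v x * laplacian u x)"
  proof -
    have "Ck_on 0 S (\<lambda>x. v x * laplacian u x)"
      using continuous_on_laplacian[OF S(4)] Ck_on_imp_continuous[OF S(5)] by (auto intro: continuous_intros)
    moreover have "v x * laplacian u x = 0" if "x \<notin> K" for x
      using supp that by simp
    ultimately have "Ck_on 0 UNIV (\<lambda>x. v x * laplacian u x)"
      by (rule Ck_on_extend_by_zero[OF S(1) K(1) S(3)])
    then show ?thesis by simp
  qed
  show i0: "integrable lborel (\<lambda>x. u x * laplacian v x)"
    by (rule integrable_compact_support[OF c0 K(2)]) (use supp2 in \<open>simp add: laplacian_eq_pd\<close>)
  show i1: "integrable lborel (\<lambda>x. v x * laplacian u x)"
    by (rule integrable_compact_support[OF c1 K(2)]) (use supp in simp)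
  have "(\<integral>x. u x * laplacian v x \<partial>lborel) - (\<integral>x. v x * laplacian u x \<partial>lborel) =
    (\<integral>x. (\<Sum>b\<in>Basis. pd b (?F b) x) \<partial>lborel)"
    using i0 i1 pdF by (subst Bochner_Integration.integral_diff[symmetric])
      (auto simp: laplacian_eq_pd sum_subtractf sum_distrib_left)
  also have "\<dots> = (\<Sum>b\<in>Basis. (\<integral>x. pd b (?F b) x \<partial>lborel))"
  proof (rule Bochner_Integration.integral_sum)
    fix b :: 'a assume b: "b \<in> Basis"
    show "integrable lborel (\<lambda>x. pd b (?F b) x)"
    proof (rule integrable_compact_support[OF _ K(2)])
      show "continuous_on UNIV (\<lambda>x. pd b (?F b) x)" using F(1)[OF b] b by simp
      show "pd b (?F b) x = 0" if "x \<notin> K" for x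
        using pdF[OF b] supp2[OF that b] supp[OF that] by simp
    qed
  qed
  also have "\<dots> = 0"
  proof (rule sum.neutral, rule ballI)
    fix b :: 'a assume b: "b \<in> Basis"
    show "(\<integral>x. pd b (?F b) x \<partial>lborel) = 0"
      by (rule integral_pd_eq_0[OF F(1)[OF b] K(2) F(2)[OF b] b])
  qed
  finally show "(\<integral>x. u x * laplacian v x \<partial>lborel) = (\<integral>x. v x * laplacian u x \<partial>lborel)" by simp
qed

section \<open>Radial and homogeneous functions\<close>

lemma has_derivative_radial:
  fixes x :: "'a::euclidean_space" and g :: "real \<Rightarrow> complex"
  assumes "x \<noteq> 0" "(g has_vector_derivative norm x *\<^sub>R g1) (at (norm x))"
  shows "((\<lambda>x. g (norm x)) has_derivative (\<lambda>h. complex_of_real (x \<bullet> h) * g1)) (at x)"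
proof -
  have "((\<lambda>x. g (norm x)) has_derivative (\<lambda>h. (h \<bullet> sgn x) *\<^sub>R (norm x *\<^sub>R g1))) (at x)"
    using has_derivative_compose[OF has_derivative_norm[OF assms(1)]] assms(2)
    unfolding has_vector_derivative_def by blast
  moreover have "(\<lambda>h. (h \<bullet> sgn x) *\<^sub>R (norm x *\<^sub>R g1)) = (\<lambda>h. complex_of_real (x \<bullet> h) * g1)"
    using assms(1) by (auto simp: fun_eq_iff sgn_div_norm inner_commute scaleR_conv_of_real)
  ultimately show ?thesis by simp
qed

lemma Ck_on_radial_Suc:
  fixes g g1 :: "real \<Rightarrow> complex"
  assumes "\<And>r. r > 0 \<Longrightarrow> (g has_vector_derivative r *\<^sub>R g1 r) (at r)"
    and "Ck_on k (- {0::'a::euclidean_space}) (\<lambda>x. g1 (norm x))"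
  shows "Ck_on (Suc k) (- {0::'a}) (\<lambda>x. g (norm x))"
proof -
  have d: "((\<lambda>x. g (norm x)) has_derivative (\<lambda>h. complex_of_real (x \<bullet> h) * g1 (norm x))) (at x)"
    if "x \<noteq> 0" for x :: 'a
    using has_derivative_radial[OF that] assms(1) that by simp
  have "Ck_on k (- {0::'a}) (\<lambda>x. complex_of_real (x \<bullet> b) * g1 (norm x))" for b
    by (intro Ck_on_mult Ck_on_inner assms(2)) auto
  then have "Ck_on k (- {0::'a}) (\<lambda>x. pd b (\<lambda>x. g (norm x)) x)" for b
    by (rule Ck_on_cong[rotated 2]) (use pd_eqI[OF d] in auto)
  then show ?thesis using d by (auto simp: differentiable_def)
qed

text \<open>
  The factor \<open>r\<close> in the hypotheses on the profile \<open>g\<close> spares divisions by the norm: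
  \<open>\<partial>\<^sub>b g(|x|) = (x \<bullet> b) g\<^sub>1(|x|)\<close>, and likewise for \<open>g\<^sub>1\<close>.
\<close>

lemma Ck_on_2_radial:
  fixes g g1 g2 :: "real \<Rightarrow> complex"
  assumes "\<And>r. r > 0 \<Longrightarrow> (g has_vector_derivative r *\<^sub>R g1 r) (at r)"
    and "\<And>r. r > 0 \<Longrightarrow> (g1 has_vector_derivative r *\<^sub>R g2 r) (at r)"
    and "continuous_on {0<..} g2"
  shows "Ck_on 2 (- {0::'a::euclidean_space}) (\<lambda>x. g (norm x))"
proof -
  have "Ck_on 0 (- {0::'a}) (\<lambda>x. g2 (norm x))"
    by (auto intro!: continuous_on_compose2[OF assms(3)] continuous_intros)
  then show ?thesis
    unfolding numeral_2_eq_2 by (intro Ck_on_radial_Suc[of _ g1] Ck_on_radial_Suc[of _ g2] assms(1,2))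
qed

lemma laplacian_radial:
  fixes g g1 g2 :: "real \<Rightarrow> complex" and x :: "'a::euclidean_space"
  assumes "\<And>r. r > 0 \<Longrightarrow> (g has_vector_derivative r *\<^sub>R g1 r) (at r)"
    and "\<And>r. r > 0 \<Longrightarrow> (g1 has_vector_derivative r *\<^sub>R g2 r) (at r)"
    and x: "x \<noteq> 0"
  shows "laplacian (\<lambda>x. g (norm x)) x = of_nat DIM('a) * g1 (norm x) + of_real ((norm x)\<^sup>2) * g2 (norm x)"
proof -
  have d: "((\<lambda>x. g (norm x)) has_derivative (\<lambda>h. complex_of_real (x \<bullet> h) * g1 (norm x))) (at x)"
    if "x \<noteq> 0" for x :: 'a
    using has_derivative_radial[OF that] assms(1) that by simp
  have d1: "((\<lambda>x. g1 (norm x)) has_derivative (\<lambda>h. complex_of_real (x \<bullet> h) * g2 (norm x))) (at x)"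
    using has_derivative_radial[OF x] assms(2) x by simp
  have "pd b (\<lambda>y. pd b (\<lambda>x. g (norm x)) y) x = g1 (norm x) + of_real ((x \<bullet> b)\<^sup>2) * g2 (norm x)"
    if b: "b \<in> Basis" for b
  proof -
    have i: "((\<lambda>x. complex_of_real (x \<bullet> b)) has_derivative (\<lambda>h. complex_of_real (h \<bullet> b))) (at x)"
      by (auto intro!: derivative_eq_intros)
    have D: "((\<lambda>x. complex_of_real (x \<bullet> b) * g1 (norm x)) has_derivative
        (\<lambda>h. complex_of_real (x \<bullet> b) * (complex_of_real (x \<bullet> h) * g2 (norm x))
          + complex_of_real (h \<bullet> b) * g1 (norm x))) (at x)"
      by (rule has_derivative_mult[OF i d1])
    have "pd b (\<lambda>y. complex_of_real (y \<bullet> b) * g1 (norm y)) x = pd b (\<lambda>y. pd b (\<lambda>x. g (norm x)) y) x"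
      by (rule pd_cong_open[of "- {0}"]) (use x D pd_eqI[OF d] in \<open>auto simp: differentiable_def\<close>)
    then have "pd b (\<lambda>y. pd b (\<lambda>x. g (norm x)) y) x
      = complex_of_real (x \<bullet> b) * (complex_of_real (x \<bullet> b) * g2 (norm x)) + complex_of_real (b \<bullet> b) * g1 (norm x)"
      using pd_eqI[OF D, of b] by metis
    also have "\<dots> = g1 (norm x) + of_real ((x \<bullet> b)\<^sup>2) * g2 (norm x)"
      using b by (simp add: power2_eq_square)
    finally show ?thesis .
  qed
  moreover have "(\<Sum>b\<in>Basis. (x \<bullet> b)\<^sup>2) = (norm x)\<^sup>2"
    by (simp only: power2_norm_eq_inner euclidean_inner[of x x]) (simp add: power2_eq_square)
  ultimately show ?thesis
    unfolding laplacian_eq_pd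
    by (simp add: sum.distrib sum_distrib_right[symmetric] flip: of_real_sum of_real_power)
qed

lemma Euler_homogeneous:
  fixes p :: "'a::euclidean_space \<Rightarrow> complex"
  assumes "p differentiable (at x)" "\<And>t. t > 0 \<Longrightarrow> p (t *\<^sub>R x) = t ^ m *\<^sub>R p x"
  shows "(\<Sum>b\<in>Basis. complex_of_real (x \<bullet> b) * pd b p x) = of_nat m * p x"
proof -
  have "((\<lambda>t. p (x + t *\<^sub>R x)) has_vector_derivative frechet_derivative p (at x) x) (at 0)"
    using has_vector_derivative_line[of p x 0 x UNIV] assms(1) by simp
  moreover have "((\<lambda>t. p (x + t *\<^sub>R x)) has_vector_derivative real m *\<^sub>R p x) (at 0)"
  proof (rule has_vector_derivative_transform_within_open[of _ _ _ "{-1<..}"])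
    show "((\<lambda>t. (1 + t) ^ m *\<^sub>R p x) has_vector_derivative real m *\<^sub>R p x) (at 0)"
      by (auto intro!: derivative_eq_intros)
    show "(1 + t) ^ m *\<^sub>R p x = p (x + t *\<^sub>R x)" if "t \<in> {-1<..}" for t
      using assms(2)[of "1 + t"] that by (simp add: scaleR_add_left)
  qed auto
  ultimately have "frechet_derivative p (at x) x = real m *\<^sub>R p x"
    by (rule vector_derivative_unique_at)
  then show ?thesis
    using pd_expand[OF assms(1), of x] by (simp add: scaleR_conv_of_real)
qed

text \<open>
  By Euler's identity \<open>x \<bullet> \<nabla>p = m p\<close>, the mixed term of the product rule only shifts the dimension
  \<open>d\<close> in the radial Laplacian to \<open>d + 2 m\<close>.
\<close>

lemma laplacian_radial_mult_homogeneous: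
  fixes g g1 g2 :: "real \<Rightarrow> complex" and p :: "'a::euclidean_space \<Rightarrow> complex"
  assumes g: "\<And>r. r > 0 \<Longrightarrow> (g has_vector_derivative r *\<^sub>R g1 r) (at r)"
    "\<And>r. r > 0 \<Longrightarrow> (g1 has_vector_derivative r *\<^sub>R g2 r) (at r)"
    "continuous_on {0<..} g2"
    and p: "Ck_on 2 (- {0}) p" "\<And>t x. t > 0 \<Longrightarrow> p (t *\<^sub>R x) = t ^ m *\<^sub>R p x"
    and x: "x \<noteq> 0"
  shows "laplacian (\<lambda>x. g (norm x) * p x) x = g (norm x) * laplacian p x
    + (of_nat (DIM('a) + 2 * m) * g1 (norm x) + of_real ((norm x)\<^sup>2) * g2 (norm x)) * p x"
proof -
  have "pd b (\<lambda>x. g (norm x)) x = complex_of_real (x \<bullet> b) * g1 (norm x)" for b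
    using has_derivative_radial[OF x g(1)] x by (auto intro: pd_eqI)
  then have "(\<Sum>b\<in>Basis. pd b (\<lambda>x. g (norm x)) x * pd b p x)
    = g1 (norm x) * (\<Sum>b\<in>Basis. complex_of_real (x \<bullet> b) * pd b p x)"
    by (simp add: sum_distrib_left ac_simps)
  also have "\<dots> = g1 (norm x) * (of_nat m * p x)"
    using p x by (subst Euler_homogeneous) (auto simp: numeral_2_eq_2)
  finally have 1: "(\<Sum>b\<in>Basis. pd b (\<lambda>x. g (norm x)) x * pd b p x) = g1 (norm x) * (of_nat m * p x)" .
  have "laplacian (\<lambda>x. g (norm x) * p x) x = g (norm x) * laplacian p x
    + 2 * (\<Sum>b\<in>Basis. pd b (\<lambda>x. g (norm x)) x * pd b p x) + laplacian (\<lambda>x. g (norm x)) x * p x"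
    using x by (intro laplacian_mult[OF _ Ck_on_2_radial[OF g] p(1)]) auto
  moreover have "laplacian (\<lambda>x. g (norm x)) x = of_nat DIM('a) * g1 (norm x) + of_real ((norm x)\<^sup>2) * g2 (norm x)"
    by (rule laplacian_radial[OF g(1,2) x])
  ultimately show ?thesis
    unfolding 1 by (simp add: ring_distribs)
qed

lemma pd_scale:
  fixes v :: "'a::euclidean_space \<Rightarrow> complex"
  assumes v: "\<And>x. x \<noteq> 0 \<Longrightarrow> v differentiable (at x)" "\<And>x. x \<noteq> 0 \<Longrightarrow> v (t *\<^sub>R x) = c * v x"
    and t: "t > 0" and x: "x \<noteq> 0"
  shows "pd b v (t *\<^sub>R x) = c / of_real t * pd b v x"
proof -
  let ?D = "frechet_derivative v (at (t *\<^sub>R x))"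
  have vd: "v differentiable at (t *\<^sub>R x)" using v(1)[of "t *\<^sub>R x"] x t by simp
  then have "(v has_derivative ?D) (at (t *\<^sub>R x))" using frechet_derivative_works by blast
  moreover have "((\<lambda>x. t *\<^sub>R x) has_derivative (\<lambda>h. t *\<^sub>R h)) (at x)"
    by (auto intro!: derivative_eq_intros)
  ultimately have D: "((\<lambda>x. v (t *\<^sub>R x)) has_derivative (\<lambda>h. ?D (t *\<^sub>R h))) (at x)"
    using has_derivative_compose by blast
  have "pd b (\<lambda>x. v (t *\<^sub>R x)) x = pd b (\<lambda>x. c * v x) x"
    by (rule pd_cong_open[of "- {0}"]) (use x v(2) D in \<open>auto simp: differentiable_def\<close>)
  also have "\<dots> = c * pd b v x" using v(1)[OF x] by (simp add: pd_mult)
  finally have "?D (t *\<^sub>R b) = c * pd b v x" using pd_eqI[OF D] by simp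
  then have "of_real t * ?D b = c * pd b v x"
    using linear_cmul[OF linear_frechet_derivative[OF vd]] by (simp add: scaleR_conv_of_real)
  then show ?thesis using t by (simp add: field_simps)
qed

lemma laplacian_scale:
  fixes v :: "'a::euclidean_space \<Rightarrow> complex"
  assumes v: "Ck_on 2 (- {0}) v" "\<And>x. x \<noteq> 0 \<Longrightarrow> v (t *\<^sub>R x) = c * v x"
    and t: "t > 0" and x: "x \<noteq> 0"
  shows "laplacian v (t *\<^sub>R x) = c / of_real (t\<^sup>2) * laplacian v x"
proof -
  have "pd b (\<lambda>y. pd b v y) (t *\<^sub>R x) = c / of_real (t\<^sup>2) * pd b (\<lambda>y. pd b v y) x" if "b \<in> Basis" for b
  proof -
    have 1: "v differentiable at x" "(\<lambda>y. pd b v y) differentiable at x" if "x \<noteq> 0" for x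
      using v(1) that \<open>b \<in> Basis\<close> by (auto simp: numeral_2_eq_2)
    have 2: "pd b v (t *\<^sub>R x) = c / of_real t * pd b v x" if "x \<noteq> 0" for x
      by (rule pd_scale[OF 1(1) v(2) t that])
    show ?thesis
      using pd_scale[of "\<lambda>y. pd b v y", OF 1(2) 2 t x] by (simp add: power2_eq_square)
  qed
  then show ?thesis unfolding laplacian_eq_pd by (simp add: sum_distrib_left)
qed

section \<open>Polar coordinates\<close>

lemma space_sphere_measure [simp]: "space (sphere_measure :: 'a::euclidean_space measure) = sphere 0 1"
  by (simp add: sphere_measure_def space_restrict_space space_scale_measure)

lemma sets_sphere_measure [measurable_cong]:
  "sets (sphere_measure :: 'a::euclidean_space measure) = sets (restrict_space borel (sphere 0 1))"
  by (simp add: sphere_measure_def)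

lemma measurable_direction [measurable]:
  "(\<lambda>x. x /\<^sub>R norm x) \<in> restrict_space borel (- {0}) \<rightarrow>\<^sub>M
     restrict_space borel (sphere 0 (1::real) :: 'a::euclidean_space set)"
  by (rule measurable_restrict_space2) (auto simp: space_restrict_space intro!: measurable_restrict_space1)

lemma measurable_polar:
  "(\<lambda>x::'a::euclidean_space. (norm x, x /\<^sub>R norm x)) \<in> restrict_space lborel (- {0}) \<rightarrow>\<^sub>M
     (borel \<Otimes>\<^sub>M restrict_space borel (sphere 0 1))"
proof (rule measurable_Pair)
  show "(norm :: 'a \<Rightarrow> real) \<in> restrict_space lborel (- {0}) \<rightarrow>\<^sub>M borel"
    by (rule measurable_restrict_space1) auto
  show "(\<lambda>x::'a. x /\<^sub>R norm x) \<in> restrict_space lborel (- {0}) \<rightarrow>\<^sub>M restrict_space borel (sphere 0 1)"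
    using measurable_direction by (simp add: measurable_cong_sets[OF sets_restrict_space_cong[OF sets_lborel] refl])
qed

text \<open>
  For \<open>a = 1\<close> this is the cone by which the surface measure of \<open>B\<close> is defined. The other radii
  enter through scaling.
\<close>

definition cone_over :: "real \<Rightarrow> 'a::euclidean_space set \<Rightarrow> 'a set" where
  "cone_over a B = {x. x \<noteq> 0 \<and> norm x < a \<and> x /\<^sub>R norm x \<in> B}"

lemma cone_over_measurable:
  assumes "B \<in> sets (restrict_space borel (sphere 0 1))"
  shows "cone_over a B \<in> sets borel"
proof -
  have "(\<lambda>x. x /\<^sub>R norm x) -` B \<inter> space (restrict_space borel (- {0})) \<in> sets (restrict_space borel (- {0}))"
    by (rule measurable_sets[OF measurable_direction assms])
  then have "(\<lambda>x. x /\<^sub>R norm x) -` B \<inter> - {0} \<in> sets borel"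
    by (auto simp: space_restrict_space sets_restrict_space_iff)
  then have "((\<lambda>x. x /\<^sub>R norm x) -` B \<inter> - {0}) \<inter> ball 0 a \<in> sets borel" by auto
  also have "((\<lambda>x. x /\<^sub>R norm x) -` B \<inter> - {0}) \<inter> ball 0 a = cone_over a B"
    by (auto simp: cone_over_def)
  finally show ?thesis .
qed

lemma emeasure_sphere_measure:
  assumes "B \<in> sets (restrict_space borel (sphere 0 (1::real) :: 'a::euclidean_space set))"
  shows "emeasure sphere_measure B = of_nat DIM('a) * emeasure lborel (cone_over 1 B)"
proof -
  have m: "(\<lambda>x::'a. x /\<^sub>R norm x) \<in> restrict_space lborel (ball 0 1 - {0}) \<rightarrow>\<^sub>M restrict_space borel (sphere 0 1)"
    by (rule measurable_restrict_space2) (auto simp: space_restrict_space intro!: measurable_restrict_space1)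
  have "emeasure sphere_measure B = of_nat DIM('a) *
      emeasure (restrict_space lborel (ball 0 1 - {0})) ((\<lambda>x::'a. x /\<^sub>R norm x) -` B \<inter> (ball 0 1 - {0}))"
    using assms m by (simp add: sphere_measure_def emeasure_distr space_restrict_space)
  also have "(\<lambda>x::'a. x /\<^sub>R norm x) -` B \<inter> (ball 0 1 - {0}) = cone_over 1 B"
    by (auto simp: cone_over_def)
  also have "emeasure (restrict_space lborel (ball 0 1 - {0})) (cone_over 1 B) = emeasure lborel (cone_over 1 B)"
    by (rule emeasure_restrict_space) (auto simp: cone_over_def)
  finally show ?thesis .
qed

lemma finite_measure_sphere [simp]: "finite_measure (sphere_measure :: 'a::euclidean_space measure)"
proof
  have "emeasure lborel (cone_over 1 (sphere 0 1) :: 'a set) \<le> emeasure lborel (ball 0 1 :: 'a set)"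
    by (rule emeasure_mono) (auto simp: cone_over_def)
  also have "\<dots> < \<infinity>" by (rule emeasure_lborel_ball_finite)
  finally have "emeasure lborel (cone_over 1 (sphere 0 1) :: 'a set) < \<infinity>" .
  moreover have "sphere 0 1 \<in> sets (restrict_space borel (sphere 0 (1::real) :: 'a set))"
    by (auto simp: sets_restrict_space_iff)
  ultimately show "emeasure (sphere_measure :: 'a measure) (space sphere_measure) \<noteq> \<infinity>"
    by (auto simp: emeasure_sphere_measure ennreal_mult_eq_top_iff)
qed

lemma emeasure_cone_over_scale:
  assumes "a > 0" "B \<in> sets (restrict_space borel (sphere 0 1))"
  shows "emeasure lborel (cone_over a B :: 'a::euclidean_space set) = ennreal (a ^ DIM('a)) * emeasure lborel (cone_over 1 B)"
proof -
  have c1: "cone_over 1 B \<in> sets borel" and ca: "cone_over a B \<in> sets borel"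
    using cone_over_measurable[OF assms(2)] by auto
  have "emeasure lborel (cone_over a B) =
      emeasure (density (distr lborel borel (\<lambda>x. 0 + a *\<^sub>R x)) (\<lambda>_. \<bar>a\<bar>^DIM('a))) (cone_over a B)"
    using lborel_affine[of a "0::'a"] assms(1) by simp
  also have "\<dots> = ennreal (a ^ DIM('a)) * emeasure lborel ((\<lambda>x. a *\<^sub>R x) -` cone_over a B)"
    using ca assms(1) by (subst emeasure_density_const) (auto simp: emeasure_distr)
  also have "(\<lambda>x. a *\<^sub>R x) -` cone_over a B = cone_over 1 B"
    using assms(1) by (auto simp: cone_over_def field_simps)
  finally show ?thesis .
qed

definition radial_measure :: "nat \<Rightarrow> real measure" where
  "radial_measure d = density lborel (\<lambda>r. ennreal (indicator {0<..} r * r ^ (d - 1)))"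

lemma sets_radial_measure [simp, measurable_cong]: "sets (radial_measure d) = sets borel"
  by (simp add: radial_measure_def)

lemma space_radial_measure [simp]: "space (radial_measure d) = UNIV"
  by (simp add: radial_measure_def)

lemma sigma_finite_radial_measure: "sigma_finite_measure (radial_measure d)"
  unfolding radial_measure_def
  by (subst sigma_finite_measure.sigma_finite_iff_density_finite) (auto intro: lborel.sigma_finite_measure_axioms)

lemma emeasure_radial_measure_lessThan:
  assumes "d \<ge> 1"
  shows "emeasure (radial_measure d) {..<a} = ennreal (if a \<le> 0 then 0 else a ^ d / d)"
proof (cases "a \<le> 0")
  case True
  have "emeasure (radial_measure d) {..<a} =
    (\<integral>\<^sup>+r. ennreal (indicator {0<..} r * r ^ (d - 1)) * indicator {..<a} r \<partial>lborel)"
    unfolding radial_measure_def by (rule emeasure_density) auto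
  also have "\<dots> = (\<integral>\<^sup>+r. 0 \<partial>(lborel :: real measure))"
    using True by (intro nn_integral_cong) (auto simp: indicator_def)
  finally show ?thesis using True by simp
next
  case False
  have "emeasure (radial_measure d) {..<a} =
    (\<integral>\<^sup>+r. ennreal (indicator {0<..} r * r ^ (d - 1)) * indicator {..<a} r \<partial>lborel)"
    unfolding radial_measure_def by (rule emeasure_density) auto
  also have "\<dots> = (\<integral>\<^sup>+r. ennreal (r ^ (d - 1)) * indicator {0..a} r \<partial>lborel)"
  proof (rule nn_integral_cong_AE)
    have "AE r in lborel. r \<noteq> 0 \<and> r \<noteq> a"
      using AE_lborel_singleton[of "0::real"] AE_lborel_singleton[of a] by eventually_elim auto
    then show "AE r in lborel. ennreal (indicator {0<..} r * r ^ (d - 1)) * indicator {..<a} r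
      = ennreal (r ^ (d - 1)) * indicator {0..a} r"
      by eventually_elim (auto simp: indicator_def)
  qed
  also have "\<dots> = ennreal (a ^ d / d - 0 ^ d / d)"
    using False assms
    by (intro nn_integral_FTC_Icc) (auto intro!: derivative_eq_intros)
  finally show ?thesis using False assms by (simp add: zero_power)
qed

text \<open>
  A measurable set \<open>B\<close> of directions being fixed, both sides are measures in the set of radii. They
  agree on the half-lines \<open>{..<a}\<close>, since the cone cut off at \<open>a\<close> has \<open>a ^ d\<close> times the measure of the
  cone cut off at \<open>1\<close>, and half-lines determine a Borel measure that is finite on them.
\<close>

theorem polar_measure:
  "radial_measure DIM('a) \<Otimes>\<^sub>M sphere_measure =
    distr (restrict_space lborel (- {0})) (borel \<Otimes>\<^sub>M restrict_space borel (sphere 0 1))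
      (\<lambda>x::'a::euclidean_space. (norm x, x /\<^sub>R norm x))" (is "_ = ?N")
proof (rule pair_measure_eqI)
  let ?L = "restrict_space lborel (- {0}) :: 'a measure"
  show "sigma_finite_measure (radial_measure DIM('a))" by (rule sigma_finite_radial_measure)
  show "sigma_finite_measure (sphere_measure :: 'a measure)"
    by (rule finite_measure.axioms(1)) simp
  show "sets (radial_measure DIM('a) \<Otimes>\<^sub>M (sphere_measure :: 'a measure)) = sets ?N"
    by (auto intro!: sets_pair_measure_cong sets_sphere_measure)
  fix A :: "real set" and B :: "'a set"
  assume A: "A \<in> sets (radial_measure DIM('a))" and "B \<in> sets sphere_measure"
  then have B: "B \<in> sets (restrict_space borel (sphere 0 1))" by (simp add: sets_sphere_measure)
  note mp = measurable_polar[where 'a='a]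
  let ?C = "(\<lambda>x. x /\<^sub>R norm x) -` B \<inter> - {0}"
  have C: "?C \<in> sets borel"
    using measurable_sets[OF measurable_direction B] by (auto simp: space_restrict_space sets_restrict_space_iff)
  let ?M1 = "scale_measure (emeasure sphere_measure B) (radial_measure DIM('a))"
  let ?M2 = "distr (restrict_space lborel ?C) borel norm"
  have mC: "(norm :: 'a \<Rightarrow> real) \<in> restrict_space lborel ?C \<rightarrow>\<^sub>M borel"
    by (rule measurable_restrict_space1) auto
  have eC: "emeasure ?M2 X = emeasure lborel (norm -` X \<inter> ?C)" if "X \<in> sets borel" for X
  proof -
    have "emeasure ?M2 X = emeasure (restrict_space lborel ?C) (norm -` X \<inter> ?C)"
      using that mC by (subst emeasure_distr) (auto simp: space_restrict_space)
    also have "\<dots> = emeasure lborel (norm -` X \<inter> ?C)"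
      using C by (intro emeasure_restrict_space) auto
    finally show ?thesis .
  qed
  have "?M1 = ?M2"
  proof (rule measure_eqI_generator_eq[where E="range lessThan" and \<Omega>=UNIV and A="\<lambda>i::nat. {..<real i}"])
    show "Int_stable (range lessThan :: real set set)"
    proof -
      have "{..<a} \<inter> {..<b} = {..<min a b}" for a b :: real by auto
      then show ?thesis unfolding Int_stable_def by blast
    qed
    have s: "sets borel = sigma_sets UNIV (range lessThan :: real set set)"
    proof -
      have "borel = sigma UNIV (range lessThan :: real set set)"
        using borel_eq_lessThan[where 'a=real] by (simp add: eucl_less_def[abs_def] lessThan_def)
      then have "sets borel = sets (sigma UNIV (range lessThan :: real set set))" by (rule arg_cong)
      then show ?thesis by simp
    qed
    show "sets ?M1 = sigma_sets UNIV (range lessThan)" "sets ?M2 = sigma_sets UNIV (range lessThan)"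
      using s by auto
    show "(\<Union>i::nat. {..<real i}) = UNIV" using reals_Archimedean2 by auto
    show "emeasure ?M1 {..<real i} \<noteq> \<infinity>" for i
      using finite_measure.emeasure_finite[of "sphere_measure :: 'a measure" B]
      by (auto simp: emeasure_radial_measure_lessThan ennreal_mult_eq_top_iff)
    fix X :: "real set" assume "X \<in> range lessThan"
    then obtain a where X: "X = {..<a}" by auto
    have "norm -` {..<a} \<inter> ?C = cone_over a B" by (auto simp: cone_over_def)
    then have e2: "emeasure ?M2 X = emeasure lborel (cone_over a B)"
      using eC[of "{..<a}"] X by simp
    show "emeasure ?M1 X = emeasure ?M2 X"
    proof (cases "a \<le> 0")
      case True
      then have "cone_over a B = {}" by (auto simp: cone_over_def dest: order_less_le_trans)
      then show ?thesis using e2 X True by (simp add: emeasure_radial_measure_lessThan)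
    next
      case False
      have "emeasure ?M1 X = of_nat DIM('a) * emeasure lborel (cone_over 1 B) * ennreal (a ^ DIM('a) / DIM('a))"
        using False X by (simp add: emeasure_radial_measure_lessThan emeasure_sphere_measure[OF B])
      also have "\<dots> = ennreal (real DIM('a) * (a ^ DIM('a) / DIM('a))) * emeasure lborel (cone_over 1 B)"
        using False by (subst ennreal_mult) (auto simp: ennreal_of_nat_eq_real_of_nat ac_simps)
      also have "\<dots> = emeasure ?M2 X"
        using False e2 emeasure_cone_over_scale[OF _ B, of a] by simp
      finally show ?thesis .
    qed
  qed auto
  then have "emeasure ?M1 A = emeasure ?M2 A" by simp
  also have "\<dots> = emeasure lborel (norm -` A \<inter> ?C)" using eC A by simp
  also have "\<dots> = emeasure ?N (A \<times> B)"
  proof -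
    have "emeasure ?N (A \<times> B) = emeasure ?L ((\<lambda>x. (norm x, x /\<^sub>R norm x)) -` (A \<times> B) \<inter> space ?L)"
      using A B by (intro emeasure_distr mp) auto
    also have "(\<lambda>x. (norm x, x /\<^sub>R norm x)) -` (A \<times> B) \<inter> space ?L = norm -` A \<inter> ?C"
      by (auto simp: space_restrict_space)
    also have "emeasure ?L (norm -` A \<inter> ?C) = emeasure lborel (norm -` A \<inter> ?C)"
      by (rule emeasure_restrict_space) auto
    finally show ?thesis ..
  qed
  finally show "emeasure (radial_measure DIM('a)) A * emeasure sphere_measure B = emeasure ?N (A \<times> B)"
    by (simp add: mult.commute)
qed

lemma AE_lborel_nonzero: "AE x in lborel. x \<noteq> (0::'a::euclidean_space)"
  using AE_lborel_singleton[of "0::'a"] by simp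

lemma nn_integral_polar:
  fixes f :: "'a::euclidean_space \<Rightarrow> ennreal"
  assumes [measurable]: "f \<in> borel_measurable borel"
  shows "(\<integral>\<^sup>+x. f x \<partial>lborel) =
    (\<integral>\<^sup>+r. ennreal (indicator {0<..} r * r ^ (DIM('a) - 1)) * (\<integral>\<^sup>+\<xi>. f (r *\<^sub>R \<xi>) \<partial>sphere_measure) \<partial>lborel)"
proof -
  interpret S: sigma_finite_measure "sphere_measure :: 'a measure"
    by (rule finite_measure.axioms(1)) simp
  note mp = measurable_polar[where 'a='a]
  have id: "(\<lambda>\<xi>::'a. \<xi>) \<in> restrict_space borel (sphere 0 1) \<rightarrow>\<^sub>M borel"
    by (rule measurable_restrict_space1) simp
  have fm: "(\<lambda>(r, \<xi>). f (r *\<^sub>R \<xi>)) \<in> borel_measurable (borel \<Otimes>\<^sub>M restrict_space borel (sphere 0 1))"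
    using id by measurable
  have fm': "(\<lambda>(r, \<xi>). f (r *\<^sub>R \<xi>)) \<in> borel_measurable (radial_measure DIM('a) \<Otimes>\<^sub>M sphere_measure)"
    using fm by (simp cong: measurable_cong_sets add: sets_sphere_measure cong: sets_pair_measure_cong)
  have "(\<integral>\<^sup>+x. f x \<partial>lborel) = (\<integral>\<^sup>+x. f x * indicator (- {0}) x \<partial>lborel)"
    using AE_lborel_nonzero by (intro nn_integral_cong_AE) (auto elim!: eventually_mono)
  also have "\<dots> = (\<integral>\<^sup>+x. f x \<partial>restrict_space lborel (- {0}))"
    by (subst nn_integral_restrict_space) auto
  also have "\<dots> = (\<integral>\<^sup>+x. (\<lambda>(r, \<xi>). f (r *\<^sub>R \<xi>)) (norm x, x /\<^sub>R norm x) \<partial>restrict_space lborel (- {0}))"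
    by (intro nn_integral_cong) (auto simp: space_restrict_space)
  also have "\<dots> = (\<integral>\<^sup>+z. (\<lambda>(r, \<xi>). f (r *\<^sub>R \<xi>)) z \<partial>(radial_measure DIM('a) \<Otimes>\<^sub>M sphere_measure))"
    unfolding polar_measure using fm by (subst nn_integral_distr[OF mp]) auto
  also have "\<dots> = (\<integral>\<^sup>+r. (\<integral>\<^sup>+\<xi>. f (r *\<^sub>R \<xi>) \<partial>sphere_measure) \<partial>radial_measure DIM('a))"
    using S.nn_integral_fst[OF fm'] by simp
  also have "\<dots> = (\<integral>\<^sup>+r. ennreal (indicator {0<..} r * r ^ (DIM('a) - 1)) * (\<integral>\<^sup>+\<xi>. f (r *\<^sub>R \<xi>) \<partial>sphere_measure) \<partial>lborel)"
  proof -
    have "(\<lambda>r. \<integral>\<^sup>+\<xi>. (\<lambda>(r, \<xi>). f (r *\<^sub>R \<xi>)) (r, \<xi>) \<partial>sphere_measure) \<in> borel_measurable (radial_measure DIM('a))"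
      by (rule S.borel_measurable_nn_integral_fst[OF fm'])
    then show ?thesis
      unfolding radial_measure_def by (subst nn_integral_density) (auto simp: radial_measure_def)
  qed
  finally show ?thesis .
qed

lemma integral_polar:
  fixes f :: "'a::euclidean_space \<Rightarrow> complex"
  assumes f: "integrable lborel f"
  shows "(\<integral>x. f x \<partial>lborel) =
    (\<integral>r. (indicator {0<..} r * r ^ (DIM('a) - 1)) *\<^sub>R (\<integral>\<xi>. f (r *\<^sub>R \<xi>) \<partial>sphere_measure) \<partial>lborel)"
proof -
  interpret R: sigma_finite_measure "radial_measure DIM('a)" by (rule sigma_finite_radial_measure)
  interpret S: sigma_finite_measure "sphere_measure :: 'a measure"
    by (rule finite_measure.axioms(1)) simp
  interpret RS: pair_sigma_finite "radial_measure DIM('a)" "sphere_measure :: 'a measure" ..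
  let ?L = "restrict_space lborel (- {0}) :: 'a measure"
  let ?F = "\<lambda>(r, \<xi>). f (r *\<^sub>R \<xi>)"
  note mp = measurable_polar[where 'a='a]
  have id: "(\<lambda>\<xi>::'a. \<xi>) \<in> restrict_space borel (sphere 0 1) \<rightarrow>\<^sub>M borel"
    by (rule measurable_restrict_space1) simp
  have [measurable]: "f \<in> borel_measurable borel" using f by auto
  have fm: "?F \<in> borel_measurable (borel \<Otimes>\<^sub>M restrict_space borel (sphere 0 1))"
    using id by measurable
  have eq: "?F (norm x, x /\<^sub>R norm x) = f x" if "x \<in> - {0}" for x
    using that by simp
  have "integrable ?L f"
    using f by (subst integrable_restrict_space) (auto intro: integrable_mult_indicator)
  then have "integrable ?L (\<lambda>x. ?F (norm x, x /\<^sub>R norm x))"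
    by (rule Bochner_Integration.integrable_cong[THEN iffD2, rotated -1]) (use eq in \<open>auto simp: space_restrict_space\<close>)
  then have iF: "integrable (radial_measure DIM('a) \<Otimes>\<^sub>M sphere_measure) ?F"
    unfolding polar_measure by (subst integrable_distr_eq[OF mp fm])
  have "(\<integral>x. f x \<partial>lborel) = (\<integral>x. indicator (- {0}) x *\<^sub>R f x \<partial>lborel)"
    using AE_lborel_nonzero by (intro integral_cong_AE) (auto elim!: eventually_mono)
  also have "\<dots> = (\<integral>x. f x \<partial>?L)"
    by (subst integral_restrict_space) auto
  also have "\<dots> = (\<integral>x. ?F (norm x, x /\<^sub>R norm x) \<partial>?L)"
    by (intro Bochner_Integration.integral_cong) (use eq in \<open>auto simp: space_restrict_space\<close>)
  also have "\<dots> = (\<integral>z. ?F z \<partial>(radial_measure DIM('a) \<Otimes>\<^sub>M sphere_measure))"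
    unfolding polar_measure by (rule integral_distr[OF mp fm, symmetric])
  also have "\<dots> = (\<integral>r. (\<integral>\<xi>. f (r *\<^sub>R \<xi>) \<partial>sphere_measure) \<partial>radial_measure DIM('a))"
    using RS.integral_fst'[OF iF] by simp
  also have "\<dots> = (\<integral>r. (indicator {0<..} r * r ^ (DIM('a) - 1)) *\<^sub>R (\<integral>\<xi>. f (r *\<^sub>R \<xi>) \<partial>sphere_measure) \<partial>lborel)"
  proof -
    have "(\<lambda>r. \<integral>\<xi>. ?F (r, \<xi>) \<partial>sphere_measure) \<in> borel_measurable (radial_measure DIM('a))"
      using iF by (intro S.borel_measurable_lebesgue_integral) auto
    then show ?thesis
      unfolding radial_measure_def by (subst integral_density) (auto simp: radial_measure_def indicator_def)
  qed
  finally show ?thesis .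
qed

lemma integral_polar_product:
  fixes f :: "'a::euclidean_space \<Rightarrow> complex"
  assumes f: "integrable lborel f"
    and prod: "\<And>r \<xi>. r > 0 \<Longrightarrow> norm \<xi> = 1 \<Longrightarrow> f (r *\<^sub>R \<xi>) = g r * h \<xi>"
  shows "(\<integral>x. f x \<partial>lborel) = (\<integral>r. (indicator {0<..} r * r ^ (DIM('a) - 1)) *\<^sub>R g r \<partial>lborel) * (\<integral>\<xi>. h \<xi> \<partial>sphere_measure)"
proof -
  have "(indicator {0<..} r * r ^ (DIM('a) - 1)) *\<^sub>R (\<integral>\<xi>. f (r *\<^sub>R \<xi>) \<partial>sphere_measure) =
    ((indicator {0<..} r * r ^ (DIM('a) - 1)) *\<^sub>R g r) * (\<integral>\<xi>. h \<xi> \<partial>sphere_measure)" for r :: real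
  proof (cases "r > 0")
    case True
    have "(\<integral>\<xi>. f (r *\<^sub>R \<xi>) \<partial>sphere_measure) = (\<integral>\<xi>. g r * h \<xi> \<partial>sphere_measure)"
      by (intro Bochner_Integration.integral_cong) (use prod True in auto)
    then show ?thesis by simp
  qed simp
  then show ?thesis
    unfolding integral_polar[OF f] by (simp only: integral_mult_left_zero)
qed

lemma measurable_continuous_sphere:
  fixes h :: "'a::euclidean_space \<Rightarrow> 'b::topological_space"
  assumes "continuous_on (sphere 0 1) h"
  shows "h \<in> borel_measurable sphere_measure"
  using borel_measurable_continuous_on_restrict[OF assms]
  by (simp cong: measurable_cong_sets add: sets_sphere_measure)

lemma integrable_sphere_bounded:
  fixes h :: "'a::euclidean_space \<Rightarrow> 'b::{banach, second_countable_topology}"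
  assumes "h \<in> borel_measurable sphere_measure" "\<And>\<xi>. norm \<xi> = 1 \<Longrightarrow> norm (h \<xi>) \<le> B"
  shows "integrable sphere_measure h"
  by (rule finite_measure.integrable_const_bound[where B=B]) (use assms in \<open>auto intro!: AE_I2\<close>)

lemma integrable_sphere_continuous:
  fixes h :: "'a::euclidean_space \<Rightarrow> 'b::{banach, second_countable_topology}"
  assumes "continuous_on (sphere 0 1) h"
  shows "integrable sphere_measure h"
proof -
  have "compact (h ` sphere 0 1)" by (intro compact_continuous_image assms) auto
  then obtain B where "\<And>y. y \<in> h ` sphere 0 1 \<Longrightarrow> norm y \<le> B"
    using compact_imp_bounded bounded_iff by metis
  then show ?thesis
    by (intro integrable_sphere_bounded[where B=B] measurable_continuous_sphere assms) auto
qed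

text \<open>
  In polar coordinates a null set of radii sweeps out a null set of points.
\<close>

lemma AE_radial:
  assumes "AE r in lborel. r > 0 \<longrightarrow> P r"
  shows "AE x in lborel. x \<noteq> 0 \<longrightarrow> P (norm (x::'a::euclidean_space))"
proof -
  obtain N where N: "N \<in> null_sets lborel" "{r. \<not> (r > 0 \<longrightarrow> P r)} \<subseteq> N"
    using assms(1) by (auto simp: eventually_ae_filter)
  have Nb: "N \<in> sets borel" using N(1) by auto
  have "(\<integral>\<^sup>+x. indicator N (norm (x::'a)) \<partial>lborel) =
    (\<integral>\<^sup>+r. ennreal (indicator {0<..} r * r ^ (DIM('a) - 1)) * (\<integral>\<^sup>+\<xi>. indicator N (norm (r *\<^sub>R (\<xi>::'a))) \<partial>sphere_measure) \<partial>lborel)"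
    using Nb by (intro nn_integral_polar) auto
  also have "\<dots> = (\<integral>\<^sup>+r. 0 \<partial>(lborel :: real measure))"
  proof (rule nn_integral_cong_AE)
    have "AE r in lborel. r \<notin> N" by (rule AE_not_in[OF N(1)])
    then show "AE r in lborel. ennreal (indicator {0<..} r * r ^ (DIM('a) - 1)) *
        (\<integral>\<^sup>+\<xi>. indicator N (norm (r *\<^sub>R (\<xi>::'a))) \<partial>sphere_measure) = 0"
    proof eventually_elim
      case (elim r)
      have "(\<integral>\<^sup>+\<xi>. indicator N (norm (r *\<^sub>R (\<xi>::'a))) \<partial>sphere_measure) = 0" if "r > 0"
      proof -
        have "(\<integral>\<^sup>+\<xi>. indicator N (norm (r *\<^sub>R (\<xi>::'a))) \<partial>sphere_measure) = (\<integral>\<^sup>+\<xi>. 0 \<partial>(sphere_measure :: 'a measure))"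
          using that elim by (intro nn_integral_cong) auto
        then show ?thesis by simp
      qed
      then show ?case by (cases "r > 0") auto
    qed
  qed
  finally have "(\<integral>\<^sup>+x. indicator N (norm (x::'a)) \<partial>lborel) = 0" by simp
  then have "AE x in lborel. indicator N (norm (x::'a)) = (0::ennreal)"
    using Nb by (subst (asm) nn_integral_0_iff_AE) auto
  then show ?thesis
  proof eventually_elim
    case (elim x)
    then have "norm x \<notin> N" by (auto simp: indicator_def split: if_splits)
    then show ?case using N(2) zero_less_norm_iff[of x] by blast
  qed
qed

section \<open>Eigenvalues of the spherical Laplacian\<close>

lemma has_derivative_max_power:
  fixes f :: "real \<Rightarrow> real"
  assumes "(f has_field_derivative f') (at x)"
  shows "((\<lambda>x. max 0 (f x) ^ Suc (Suc n)) has_field_derivative real (n + 2) * max 0 (f x) ^ Suc n * f') (at x)"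
proof -
  have "((\<lambda>y. max 0 y ^ Suc (Suc n)) has_field_derivative real (n + 2) * max 0 y ^ Suc n) (at y)" for y :: real
  proof (cases "y = 0")
    case True
    have "((\<lambda>y. max 0 y ^ Suc (Suc n)) has_field_derivative 0) (at (0::real))"
      unfolding DERIV_def
    proof (rule Lim_null_comparison)
      show "\<forall>\<^sub>F h in at (0::real). norm ((max 0 (0 + h) ^ Suc (Suc n) - max 0 0 ^ Suc (Suc n)) / h) \<le> \<bar>h\<bar> ^ Suc n"
      proof (intro always_eventually allI)
        fix h :: real
        show "norm ((max 0 (0 + h) ^ Suc (Suc n) - max 0 0 ^ Suc (Suc n)) / h) \<le> \<bar>h\<bar> ^ Suc n"
          by (cases "h \<le> 0") (auto simp: max_def abs_mult power_abs mult_nonpos_nonneg)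
      qed
      show "((\<lambda>h::real. \<bar>h\<bar> ^ Suc n) \<longlongrightarrow> 0) (at 0)"
        by (rule tendsto_eq_intros | simp)+
    qed
    then show ?thesis using True by simp
  next
    case False
    then consider "y > 0" | "y < 0" by linarith
    then show ?thesis
    proof cases
      case 1
      show ?thesis
        by (rule DERIV_cong[OF has_field_derivative_transform_within_open[OF DERIV_pow[of "Suc (Suc n)" y], of "{0<..}"]])
          (use 1 in \<open>auto simp: max_def\<close>)
    next
      case 2
      show ?thesis
        by (rule DERIV_cong[OF has_field_derivative_transform_within_open[of "\<lambda>y. 0" 0 y "{..<0}"]])
          (use 2 in \<open>auto simp: max_def\<close>)
    qed
  qed
  from DERIV_chain2[OF this assms] show ?thesis by simp
qed

text \<open>
  Green's formula is applied to \<open>h\<close> and \<open>u(x) = g(|x|) p(x)\<close>, with a bump \<open>g\<close> supported in \<open>[1,2]\<close>.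
  Both sides of it factor into a radial and a spherical integral. Integrating by parts, the radial
  integral belonging to \<open>h \<Delta>u\<close> becomes a multiple of the one belonging to \<open>u \<Delta>h\<close>, which is positive
  and cancels.
  
  There are two uses. If \<open>h\<close> is harmonic, then \<open>K = 0\<close>, and harmonics of different degrees are
  orthogonal. If \<open>h\<close> is constant along rays, then \<open>k = 0\<close>, and the factor is the eigenvalue
  \<open>- m (m + d - 2)\<close> of the spherical Laplacian.
\<close>

lemma sphere_integral_laplacian:
  fixes p h K :: "'a::euclidean_space \<Rightarrow> complex"
  assumes d: "3 \<le> DIM('a)"
    and p: "Ck_on 2 (- {0}) p" "\<And>t x. t > 0 \<Longrightarrow> p (t *\<^sub>R x) = t ^ m *\<^sub>R p x"
      "\<And>x. x \<noteq> 0 \<Longrightarrow> laplacian p x = 0"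
    and h: "Ck_on 2 (- {0}) h" "\<And>t x. t > 0 \<Longrightarrow> norm x = 1 \<Longrightarrow> h (t *\<^sub>R x) = t ^ k *\<^sub>R h x"
    and K: "\<And>t x. t > 0 \<Longrightarrow> norm x = 1 \<Longrightarrow> laplacian h (t *\<^sub>R x) = (t ^ k / t\<^sup>2) *\<^sub>R K x"
  shows "(\<integral>\<xi>. p \<xi> * K \<xi> \<partial>sphere_measure) =
    (of_nat k - of_nat m) * of_nat (k + m + DIM('a) - 2) * (\<integral>\<xi>. p \<xi> * h \<xi> \<partial>sphere_measure)"
proof -
  \<comment> \<open>The bump \<open>B 3\<close> is the cube of a positive part and therefore \<open>C\<^sup>2\<close>.\<close>
  define q :: "real \<Rightarrow> real" where "q r = (r - 1) * (2 - r)" for r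
  define B where "B j r = max 0 (q r) ^ j" for j r
  have dq: "(q has_field_derivative 3 - 2 * r) (at r)" for r
    unfolding q_def by (auto intro!: derivative_eq_intros)
  have dB3: "(B 3 has_field_derivative 3 * B 2 r * (3 - 2 * r)) (at r)" for r
    using has_derivative_max_power[OF dq, of 1 r] unfolding B_def by (simp add: numeral_3_eq_3 numeral_2_eq_2)
  have dB2: "(B 2 has_field_derivative 2 * B 1 r * (3 - 2 * r)) (at r)" for r
    using has_derivative_max_power[OF dq, of 0 r] unfolding B_def by (simp add: numeral_2_eq_2)
  have contB: "continuous_on A (B j)" for A j
    unfolding B_def q_def by (intro continuous_intros)
  have B0: "B j r = 0" if "r \<le> 1 \<or> 2 \<le> r" "j > 0" for j r
  proof -
    have "q r \<le> 0" using that(1) unfolding q_def by (auto simp: mult_le_0_iff)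
    then show ?thesis using that(2) by (simp add: B_def max_def)
  qed
  define g1 where "g1 r = 3 * B 2 r * (3 - 2 * r) / r" for r
  define g1' where "g1' r = (3 * (2 * B 1 r * (3 - 2 * r)) * (3 - 2 * r) + 3 * B 2 r * (-2)) / r
    - 3 * B 2 r * (3 - 2 * r) / r\<^sup>2" for r
  have d0: "(B 3 has_field_derivative r * g1 r) (at r)" if "r > 0" for r
    using dB3[of r] that by (simp add: g1_def)
  have d1: "(g1 has_field_derivative g1' r) (at r)" if "r > 0" for r
    unfolding g1_def g1'_def
    by (rule derivative_eq_intros dB2 refl | use that in \<open>simp add: field_simps power2_eq_square\<close>)+
  have c1: "continuous_on A g1" "continuous_on A g1'" if "A \<subseteq> {0<..}" for A
    unfolding g1_def g1'_def using that by (auto intro!: continuous_intros contB)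
  define g where "g r = complex_of_real (B 3 r)" for r
  define G1 where "G1 r = complex_of_real (g1 r)" for r
  define G2 where "G2 r = complex_of_real (g1' r / r)" for r
  have dg: "(g has_vector_derivative r *\<^sub>R G1 r) (at r)" if "r > 0" for r
    unfolding g_def G1_def using has_vector_derivative_of_real[OF d0[OF that]] by (simp add: scaleR_conv_of_real)
  have dG1: "(G1 has_vector_derivative r *\<^sub>R G2 r) (at r)" if "r > 0" for r
    unfolding G1_def G2_def using has_vector_derivative_of_real[OF d1[OF that]] that
    by (simp add: scaleR_conv_of_real)
  have cG2: "continuous_on {0<..} G2"
    unfolding G2_def by (intro continuous_intros c1) auto
  define u where "u x = g (norm x) * p x" for x
  have u2: "Ck_on 2 (- {0}) u"
    unfolding u_def by (intro Ck_on_mult Ck_on_2_radial[OF dg dG1 cG2] p) auto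
  have lap: "laplacian u x = (of_nat (DIM('a) + 2 * m) * G1 (norm x) + of_real ((norm x)\<^sup>2) * G2 (norm x)) * p x"
    if "x \<noteq> 0" for x
    unfolding u_def using laplacian_radial_mult_homogeneous[OF dg dG1 cG2 p(1,2) that] p(3)[OF that] by simp
  have sub: "cball 0 2 - ball 0 1 \<subseteq> - {0::'a}" by auto
  have comp: "compact (cball 0 2 - ball 0 1 :: 'a set)" by (intro compact_diff) auto
  have usupp: "u x = 0" if "x \<notin> cball 0 2 - ball 0 1" for x
    using that B0[of "norm x" 3] by (auto simp: u_def g_def)
  have G: "(\<integral>x. h x * laplacian u x \<partial>lborel) = (\<integral>x. u x * laplacian h x \<partial>lborel)"
    and i1: "integrable lborel (\<lambda>x. h x * laplacian u x)" and i2: "integrable lborel (\<lambda>x. u x * laplacian h x)"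
    using integral_laplacian_symmetric[OF _ comp sub h(1) u2 usupp] by auto
  define e where "e = m + k + DIM('a) - 1"
  have e2: "e \<ge> 2" using d by (simp add: e_def)
  have L: "(\<integral>x. h x * laplacian u x \<partial>lborel) = (\<integral>r. (indicator {0<..} r * r ^ (DIM('a) - 1)) *\<^sub>R
      ((of_nat (DIM('a) + 2 * m) * G1 r + of_real (r\<^sup>2) * G2 r) * of_real (r ^ (m + k))) \<partial>lborel)
      * (\<integral>\<xi>. p \<xi> * h \<xi> \<partial>sphere_measure)"
  proof (rule integral_polar_product[OF i1])
    fix r :: real and \<xi> :: 'a assume r: "r > 0" "norm \<xi> = 1"
    then have "r *\<^sub>R \<xi> \<noteq> 0" by auto
    from lap[OF this] r show "h (r *\<^sub>R \<xi>) * laplacian u (r *\<^sub>R \<xi>) =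
      (of_nat (DIM('a) + 2 * m) * G1 r + of_real (r\<^sup>2) * G2 r) * of_real (r ^ (m + k)) * (p \<xi> * h \<xi>)"
      by (simp add: h p power_add scaleR_conv_of_real ac_simps)
  qed
  have R: "(\<integral>x. u x * laplacian h x \<partial>lborel) = (\<integral>r. (indicator {0<..} r * r ^ (DIM('a) - 1)) *\<^sub>R
      (g r * of_real (r ^ (m + k) / r\<^sup>2)) \<partial>lborel)
      * (\<integral>\<xi>. p \<xi> * K \<xi> \<partial>sphere_measure)"
    by (rule integral_polar_product[OF i2])
      (auto simp: u_def K p power_add scaleR_conv_of_real)
  define I0 where "I0 = (\<integral>r. indicator {1..2} r *\<^sub>R (B 3 r * r ^ (e - 2)) \<partial>lborel)"
  have I0i: "integrable lborel (\<lambda>r. indicator {1..2} r *\<^sub>R (B 3 r * r ^ (e - 2)))"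
    by (rule borel_integrable_compact) (auto intro!: continuous_intros contB)
  have "I0 > 0"
  proof -
    have "0 < (\<integral>r. indicator {5/4..7/4} r *\<^sub>R ((3/16) ^ 3 :: real) \<partial>(lborel :: real measure))"
      by simp
    also have "\<dots> \<le> I0"
      unfolding I0_def
    proof (rule integral_mono[OF _ I0i])
      show "integrable lborel (\<lambda>r::real. indicator {5/4..7/4} r *\<^sub>R ((3/16) ^ 3 :: real))"
        by (rule borel_integrable_compact) auto
      fix r :: real
      have "(3/16) ^ 3 * 1 \<le> B 3 r * r ^ (e - 2)" if r: "r \<in> {5/4..7/4}"
      proof (rule mult_mono)
        have "0 \<le> (r - 5/4) * (7/4 - r)" using r by (intro mult_nonneg_nonneg) auto
        then have "3/16 \<le> q r" unfolding q_def by (simp add: algebra_simps)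
        then show "(3/16) ^ 3 \<le> B 3 r" unfolding B_def by (intro power_mono) auto
        show "1 \<le> r ^ (e - 2)" using r by (intro one_le_power) auto
      qed (auto simp: B_def)
      moreover have "0 \<le> B 3 r * r ^ (e - 2)" if "r \<in> {1..2}" using that by (auto simp: B_def)
      ultimately show "indicator {5/4..7/4} r *\<^sub>R ((3/16) ^ 3) \<le> indicator {1..2} r *\<^sub>R (B 3 r * r ^ (e - 2))"
        by (auto simp: indicator_def)
    qed
    finally show ?thesis .
  qed
  have R0: "(\<integral>r. (indicator {0<..} r * r ^ (DIM('a) - 1)) *\<^sub>R (g r * of_real (r ^ (m + k) / r\<^sup>2)) \<partial>lborel) = of_real I0"
  proof -
    have "(indicator {0<..} r * r ^ (DIM('a) - 1)) *\<^sub>R (g r * of_real (r ^ (m + k) / r\<^sup>2)) =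
      complex_of_real (indicator {1..2} r *\<^sub>R (B 3 r * r ^ (e - 2)))" for r
    proof (cases "r \<in> {1..2}")
      case True
      have "e - 2 + 2 = DIM('a) - 1 + (m + k)" using d by (simp add: e_def)
      then have "r ^ (e - 2) * r\<^sup>2 = r ^ (DIM('a) - 1) * r ^ (m + k)" by (metis power_add)
      then have *: "r ^ (DIM('a) - 1) * r ^ (m + k) / r\<^sup>2 = r ^ (e - 2)"
        using True by (simp add: field_simps)
      have "B 3 r * (r ^ (DIM('a) - 1) * r ^ (m + k)) / r\<^sup>2 = B 3 r * r ^ (e - 2)"
        unfolding *[symmetric] by simp
      then show ?thesis using True
        by (simp add: g_def scaleR_conv_of_real mult.left_commute flip: of_real_mult of_real_power of_real_divide)
    next
      case False
      then show ?thesis using B0[of r 3] by (auto simp: g_def)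
    qed
    then show ?thesis unfolding I0_def by (simp only: integral_complex_of_real)
  qed
  \<comment> \<open>The difference of the two radial integrands is the derivative of \<open>H\<close>, which vanishes at 1 and at 2.\<close>
  define H where "H r = g1 r * r ^ (e + 1) + (real m - real k) * (B 3 r * r ^ (e - 1))" for r
  define F where "F r = r ^ (DIM('a) - 1) * ((real (DIM('a) + 2 * m) * g1 r + r * g1' r) * r ^ (m + k))" for r
  have L0: "(\<integral>r. (indicator {0<..} r * r ^ (DIM('a) - 1)) *\<^sub>R
      ((of_nat (DIM('a) + 2 * m) * G1 r + of_real (r\<^sup>2) * G2 r) * of_real (r ^ (m + k))) \<partial>lborel)
     = of_real ((real k - real m) * real (e - 1) * I0)"
  proof -
    have cF: "continuous_on {1..2} F"
      unfolding F_def by (intro continuous_intros c1) auto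
    have Hd: "(H has_field_derivative (F r - (real k - real m) * real (e - 1) * (B 3 r * r ^ (e - 2)))) (at r)"
      if r: "r \<in> {1..2}" for r
    proof -
      have r0: "r > 0" using r by auto
      have rr: "r * r ^ (e - 1) = r ^ e" using e2 by (cases e) auto
      have D: "(H has_field_derivative
         (g1' r * r ^ (e + 1) + g1 r * (real (e + 1) * r ^ e))
          + (real m - real k) * ((r * g1 r) * r ^ (e - 1) + B 3 r * (real (e - 1) * r ^ (e - 2)))) (at r)"
        unfolding H_def using e2
        by (auto intro!: derivative_eq_intros d0[OF r0] d1[OF r0] simp: numeral_2_eq_2 algebra_simps rr[simplified])
      have "r * g1 r * r ^ (e - 1) = g1 r * (r * r ^ (e - 1))" by (simp only: ac_simps)
      then have rr': "r * g1 r * r ^ (e - 1) = g1 r * r ^ e" unfolding rr .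
      have "e = DIM('a) - 1 + (m + k)" using d by (simp add: e_def)
      then have "r ^ e = r ^ (DIM('a) - 1) * r ^ (m + k)" by (simp only: power_add)
      then have Fe: "F r = (real (DIM('a) + 2 * m) * g1 r + r * g1' r) * r ^ e"
        unfolding F_def by simp
      have re: "real (e + 1) = real m + real k + real DIM('a)" using d by (simp add: e_def of_nat_diff)
      show ?thesis
        by (rule DERIV_cong[OF D]) (unfold rr' Fe re, simp add: ring_distribs)
    qed
    have "has_bochner_integral lborel
      (\<lambda>r. indicator {1..2} r *\<^sub>R (F r - (real k - real m) * real (e - 1) * (B 3 r * r ^ (e - 2)))) (H 2 - H 1)"
    proof (rule has_bochner_integral_FTC_Icc[where F=H and a=1 and b=2])
      show "(H has_vector_derivative F r - (real k - real m) * real (e - 1) * (B 3 r * r ^ (e - 2))) (at r within {1..2})"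
        if "1 \<le> r" "r \<le> 2" for r
        unfolding has_real_derivative_iff_has_vector_derivative[symmetric]
        by (rule has_field_derivative_at_within[OF Hd]) (use that in auto)
      show "continuous_on {1..2} (\<lambda>r. F r - (real k - real m) * real (e - 1) * (B 3 r * r ^ (e - 2)))"
        by (intro continuous_intros cF contB)
    qed simp
    moreover have "H 2 = 0" "H 1 = 0" by (auto simp: H_def g1_def B0)
    ultimately have "(\<integral>r. indicator {1..2} r *\<^sub>R (F r - (real k - real m) * real (e - 1) * (B 3 r * r ^ (e - 2))) \<partial>lborel) = 0"
      by (simp add: has_bochner_integral_iff)
    moreover have "(\<integral>r. indicator {1..2} r *\<^sub>R (F r - (real k - real m) * real (e - 1) * (B 3 r * r ^ (e - 2))) \<partial>lborel)
      = (\<integral>r. indicator {1..2} r *\<^sub>R F r \<partial>lborel) - (real k - real m) * real (e - 1) * I0"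
    proof -
      have "integrable lborel (\<lambda>r. indicator {1..2} r *\<^sub>R F r)"
        by (rule borel_integrable_compact) (auto intro!: cF)
      then have "(\<integral>r. indicator {1..2} r *\<^sub>R F r - (real k - real m) * real (e - 1) * (indicator {1..2} r *\<^sub>R (B 3 r * r ^ (e - 2))) \<partial>lborel)
        = (\<integral>r. indicator {1..2} r *\<^sub>R F r \<partial>lborel) - (real k - real m) * real (e - 1) * I0"
        unfolding I0_def using I0i by (subst Bochner_Integration.integral_diff) auto
      then show ?thesis by (simp add: algebra_simps)
    qed
    ultimately have *: "(\<integral>r. indicator {1..2} r *\<^sub>R F r \<partial>lborel) = (real k - real m) * real (e - 1) * I0" by simp
    have "(indicator {0<..} r * r ^ (DIM('a) - 1)) *\<^sub>R
      ((of_nat (DIM('a) + 2 * m) * G1 r + of_real (r\<^sup>2) * G2 r) * of_real (r ^ (m + k)))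
      = complex_of_real (indicator {1..2} r *\<^sub>R F r)" for r
    proof (cases "r \<in> {1..2}")
      case True
      then show ?thesis
        by (simp add: F_def G1_def G2_def scaleR_conv_of_real power2_eq_square)
    next
      case False
      then have "g1 r = 0" "g1' r = 0" using B0[of r] by (auto simp: g1_def g1'_def)
      then show ?thesis using False by (simp add: G1_def G2_def)
    qed
    then have "(\<integral>r. (indicator {0<..} r * r ^ (DIM('a) - 1)) *\<^sub>R
      ((of_nat (DIM('a) + 2 * m) * G1 r + of_real (r\<^sup>2) * G2 r) * of_real (r ^ (m + k))) \<partial>lborel)
      = of_real (\<integral>r. indicator {1..2} r *\<^sub>R F r \<partial>lborel)"
      by (simp only: integral_complex_of_real)
    then show ?thesis unfolding * .
  qed
  have "e - 1 = k + m + DIM('a) - 2" by (simp add: e_def)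
  then have "of_real I0 * ((of_nat k - of_nat m) * of_nat (k + m + DIM('a) - 2) * (\<integral>\<xi>. p \<xi> * h \<xi> \<partial>sphere_measure))
    = of_real I0 * (\<integral>\<xi>. p \<xi> * K \<xi> \<partial>sphere_measure)"
    using G unfolding L R L0 R0 by (simp add: ac_simps)
  then show ?thesis using \<open>I0 > 0\<close> by simp
qed

section \<open>The mean value property and the size of spherical harmonics\<close>

lemma has_derivative_affine:
  assumes "u differentiable (at (a + t *\<^sub>R x))"
  shows "((\<lambda>x. u (a + t *\<^sub>R x)) has_derivative (\<lambda>h. t *\<^sub>R frechet_derivative u (at (a + t *\<^sub>R x)) h)) (at x)"
proof -
  let ?D = "frechet_derivative u (at (a + t *\<^sub>R x))"
  have "(u has_derivative ?D) (at (a + t *\<^sub>R x))"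
    using assms frechet_derivative_works by blast
  moreover have "((\<lambda>x. a + t *\<^sub>R x) has_derivative (\<lambda>h. t *\<^sub>R h)) (at x)"
    by (auto intro!: derivative_eq_intros)
  ultimately have "((\<lambda>x. u (a + t *\<^sub>R x)) has_derivative (\<lambda>h. ?D (t *\<^sub>R h))) (at x)"
    using has_derivative_compose[of "\<lambda>x. a + t *\<^sub>R x" "\<lambda>h. t *\<^sub>R h" x UNIV u ?D] by simp
  then show ?thesis
    using linear_cmul[OF linear_frechet_derivative[OF assms]] by simp
qed

lemma Ck_on_affine:
  "Ck_on k UNIV u \<Longrightarrow> Ck_on k UNIV (\<lambda>x. u (a + t *\<^sub>R x))"
proof (induction k arbitrary: u)
  case 0
  then show ?case by (auto intro!: continuous_on_compose2[of UNIV u] continuous_intros)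
next
  case (Suc k)
  have D: "((\<lambda>x. u (a + t *\<^sub>R x)) has_derivative (\<lambda>h. t *\<^sub>R frechet_derivative u (at (a + t *\<^sub>R x)) h)) (at x)" for x
    by (rule has_derivative_affine) (use Suc.prems in simp)
  have "Ck_on k UNIV (\<lambda>x. pd b (\<lambda>x. u (a + t *\<^sub>R x)) x)" if "b \<in> Basis" for b
  proof -
    have "Ck_on k UNIV (\<lambda>x. of_real t * pd b u (a + t *\<^sub>R x))"
      using Suc.prems that by (intro Ck_on_cmult Suc.IH[of "\<lambda>x. pd b u x"]) auto
    then show ?thesis
      by (rule Ck_on_cong[rotated 2]) (auto simp: pd_eqI[OF D] scaleR_conv_of_real)
  qed
  then show ?case using D by (auto simp: differentiable_def)
qed

lemma has_derivative_bump:
  fixes x :: "'a::euclidean_space"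
  shows "((\<lambda>x. complex_of_real (max 0 (1 - x \<bullet> x) ^ 3)) has_derivative
    (\<lambda>h. complex_of_real (- 6 * (x \<bullet> h) * max 0 (1 - x \<bullet> x) ^ 2))) (at x)"
proof -
  have "((\<lambda>y::real. max 0 y ^ 3) has_field_derivative 3 * max 0 y ^ 2) (at y)" for y
    using has_derivative_max_power[of "\<lambda>x. x" 1 y 1] by (simp add: numeral_3_eq_3 numeral_2_eq_2)
  moreover have "((\<lambda>x. 1 - x \<bullet> x) has_derivative (\<lambda>h. - (x \<bullet> h + h \<bullet> x))) (at x)"
    by (auto intro!: derivative_eq_intros)
  ultimately have "((\<lambda>x. max 0 (1 - x \<bullet> x) ^ 3) has_derivative (\<lambda>h. - (x \<bullet> h + h \<bullet> x) * (3 * max 0 (1 - x \<bullet> x) ^ 2))) (at x)"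
    by (rule DERIV_compose_FDERIV)
  then have "((\<lambda>x. complex_of_real (max 0 (1 - x \<bullet> x) ^ 3)) has_derivative
    (\<lambda>h. complex_of_real (- (x \<bullet> h + h \<bullet> x) * (3 * max 0 (1 - x \<bullet> x) ^ 2)))) (at x)"
    by (rule bounded_linear.has_derivative[OF bounded_linear_of_real])
  then show ?thesis by (simp add: inner_commute algebra_simps)
qed

text \<open>
  The weight \<open>(1 - |x|\<^sup>2)\<^sub>+\<^sup>2\<close> times \<open>x\<close> is a gradient, so the derivative in \<open>t\<close> of the weighted mean
  over the ball of radius \<open>t\<close> becomes, after an integration by parts, an integral of \<open>\<Delta>u\<close>. At
  \<open>t = 0\<close> the mean is \<open>u a\<close>.
\<close>

lemma weighted_mean_value:
  fixes u :: "'a::euclidean_space \<Rightarrow> complex"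
  assumes u: "Ck_on 2 UNIV u" and harm: "\<And>x. laplacian u x = 0"
  shows "(\<integral>x. u (a + t *\<^sub>R x) * complex_of_real (max 0 (1 - x \<bullet> x) ^ 2) \<partial>lborel) =
    u a * (\<integral>x. complex_of_real (max 0 (1 - x \<bullet> x) ^ 2) \<partial>(lborel :: 'a measure))"
proof -
  define \<eta> where "\<eta> x = complex_of_real (max 0 (1 - x \<bullet> x) ^ 2)" for x :: 'a
  define \<psi> where "\<psi> x = complex_of_real (max 0 (1 - x \<bullet> x) ^ 3)" for x :: 'a
  let ?Q = "cbox (- One) One :: 'a set"
  have \<psi>D: "(\<psi> has_derivative (\<lambda>h. complex_of_real (- 6 * (x \<bullet> h) * max 0 (1 - x \<bullet> x) ^ 2))) (at x)" for x
    unfolding \<psi>_def by (rule has_derivative_bump)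
  have pd\<psi>: "pd b \<psi> x = - 6 * (of_real (x \<bullet> b) * \<eta> x)" for b x
    by (simp add: pd_eqI[OF \<psi>D] \<eta>_def)
  have \<eta>c: "continuous_on A \<eta>" for A unfolding \<eta>_def by (intro continuous_intros)
  have \<psi>1: "Ck_on 1 UNIV \<psi>"
    using \<psi>D by (auto simp: pd\<psi> differentiable_def intro!: continuous_intros \<eta>c)
  have out: "max 0 (1 - x \<bullet> x) = 0" if xQ: "x \<notin> ?Q" for x
  proof -
    obtain i where i: "i \<in> Basis" "\<not> (- 1 \<le> x \<bullet> i \<and> x \<bullet> i \<le> 1)"
      using xQ by (auto simp: mem_box)
    then have "1 < norm x" using Basis_le_norm[OF i(1), of x] by (auto simp: abs_le_iff)
    then have "1 < x \<bullet> x" using power_strict_mono[of 1 "norm x" 2] by (simp add: power2_norm_eq_inner)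
    then show ?thesis by simp
  qed
  have \<eta>0: "\<eta> x = 0" and \<psi>0: "\<psi> x = 0" if "x \<notin> ?Q" for x using out[OF that] by (auto simp: \<eta>_def \<psi>_def)
  have ud: "u differentiable (at x)" for x using u by (simp add: numeral_2_eq_2)
  have pdu1: "Ck_on 1 UNIV (\<lambda>x. pd b u x)" if "b \<in> Basis" for b using u that by (simp add: numeral_2_eq_2)
  have uc: "continuous_on UNIV u" using u Ck_on_imp_continuous by blast
  have pduc: "continuous_on UNIV (\<lambda>x. pd b u x)" if "b \<in> Basis" for b
    using pdu1[OF that] Ck_on_imp_continuous by blast
  define fx where "fx t x = (\<Sum>b\<in>Basis. (x \<bullet> b) *\<^sub>R pd b u (a + t *\<^sub>R x)) * \<eta> x" for t x
  have fx0: "integral ?Q (fx t) = 0" for t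
  proof -
    let ?F = "\<lambda>b x. pd b u (a + t *\<^sub>R x) * \<psi> x"
    have F1: "Ck_on 1 UNIV (?F b)" if "b \<in> Basis" for b
      by (intro Ck_on_mult Ck_on_affine[of 1 "\<lambda>x. pd b u x"] pdu1 that \<psi>1) auto
    have F0: "(\<integral>x. pd b (?F b) x \<partial>lborel) = 0" if "b \<in> Basis" for b
      by (rule integral_pd_eq_0[OF F1[OF that] bounded_cbox[of "- One" One] _ that]) (use \<psi>0 in auto)
    have Fz: "pd b (?F b) x = 0" if "x \<notin> ?Q" "b \<in> Basis" for b x
    proof -
      have "pd b (?F b) x = pd b (\<lambda>x. 0) x"
        by (rule pd_cong_open[of "- ?Q"]) (use that \<psi>0 F1 in \<open>auto intro: closed_cbox\<close>)
      then show ?thesis by simp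
    qed
    have Fi: "integrable lborel (\<lambda>x. pd b (?F b) x)" if "b \<in> Basis" for b
      by (rule integrable_compact_support[OF _ bounded_cbox[of "- One" One]])
        (use F1[OF that] that Fz in auto)
    have pt: "(\<Sum>b\<in>Basis. pd b (?F b) x) = - 6 * fx t x" for x
    proof -
      have "pd b (?F b) x = pd b u (a + t *\<^sub>R x) * (- 6 * (of_real (x \<bullet> b) * \<eta> x))
        + t *\<^sub>R pd b (\<lambda>x. pd b u x) (a + t *\<^sub>R x) * \<psi> x" if b: "b \<in> Basis" for b
      proof -
        have A: "((\<lambda>x. pd b u (a + t *\<^sub>R x)) has_derivative
            (\<lambda>h. t *\<^sub>R frechet_derivative (\<lambda>x. pd b u x) (at (a + t *\<^sub>R x)) h)) (at x)"
          by (rule has_derivative_affine) (use pdu1[OF b] in simp)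
        have "(\<lambda>x. pd b u (a + t *\<^sub>R x)) differentiable (at x)" "\<psi> differentiable (at x)"
          using A \<psi>D by (auto simp: differentiable_def)
        then show ?thesis by (simp only: pd_mult pd\<psi> pd_eqI[OF A])
      qed
      then have "(\<Sum>b\<in>Basis. pd b (?F b) x) = - 6 * fx t x + t *\<^sub>R laplacian u (a + t *\<^sub>R x) * \<psi> x"
        unfolding fx_def laplacian_eq_pd
        by (simp add: sum.distrib sum_subtractf sum_negf sum_distrib_left sum_distrib_right scaleR_sum_right scaleR_conv_of_real ac_simps)
      then show ?thesis using harm by simp
    qed
    have "(\<integral>x. (\<Sum>b\<in>Basis. pd b (?F b) x) \<partial>lborel) = (\<Sum>b\<in>Basis. (\<integral>x. pd b (?F b) x \<partial>lborel))"
      by (rule Bochner_Integration.integral_sum) (rule Fi)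
    then have "(\<integral>x. - 6 * fx t x \<partial>lborel) = 0" using F0 pt by simp
    then have "(\<integral>x. fx t x \<partial>lborel) = 0" by simp
    moreover have "(\<integral>x. fx t x \<partial>lborel) = integral ?Q (fx t)"
    proof (rule integral_compact_support)
      show "continuous_on UNIV (fx t)"
        unfolding fx_def by (intro continuous_intros \<eta>c continuous_on_compose2[OF pduc]) auto
    qed (simp add: fx_def \<eta>0)
    ultimately show ?thesis by simp
  qed
  have fc: "continuous_on UNIV (\<lambda>x. u (a + t *\<^sub>R x) * \<eta> x)" for t
    by (intro continuous_intros \<eta>c continuous_on_compose2[OF uc]) auto
  have M: "(\<integral>x. u (a + t *\<^sub>R x) * \<eta> x \<partial>lborel) = integral ?Q (\<lambda>x. u (a + t *\<^sub>R x) * \<eta> x)" for t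
    by (rule integral_compact_support[OF fc]) (simp add: \<eta>0)
  have "((\<lambda>t. integral ?Q (\<lambda>x. u (a + t *\<^sub>R x) * \<eta> x)) has_vector_derivative integral ?Q (fx t)) (at t within UNIV)" for t
  proof (rule leibniz_rule_vector_derivative)
    show "((\<lambda>t. u (a + t *\<^sub>R x) * \<eta> x) has_vector_derivative fx t x) (at t within UNIV)" for t x
      unfolding fx_def pd_expand[OF ud, symmetric]
      by (rule has_vector_derivative_mult_left[OF has_vector_derivative_line[OF ud]])
    show "(\<lambda>x. u (a + t *\<^sub>R x) * \<eta> x) integrable_on ?Q" for t
      by (rule integrable_continuous[OF continuous_on_subset[OF fc]]) auto
    show "continuous_on (UNIV \<times> ?Q) (\<lambda>(t, x). fx t x)"
      unfolding fx_def split_beta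
      by (intro continuous_intros continuous_on_compose2[OF \<eta>c[of UNIV]] continuous_on_compose2[OF pduc]) auto
  qed auto
  then have Md: "((\<lambda>t. \<integral>x. u (a + t *\<^sub>R x) * \<eta> x \<partial>lborel) has_derivative (\<lambda>h. 0)) (at t within UNIV)" for t
    unfolding M by (simp add: fx0 has_vector_derivative_def)
  have "(\<integral>x. u (a + t *\<^sub>R x) * \<eta> x \<partial>lborel) = (\<integral>x. u (a + 0 *\<^sub>R x) * \<eta> x \<partial>lborel)"
    by (rule has_derivative_zero_unique[OF convex_UNIV Md]) auto
  then show ?thesis unfolding \<eta>_def by simp
qed

lemma bump_integral_pos:
  "0 < (\<integral>x. max 0 (1 - x \<bullet> x) ^ 2 \<partial>(lborel :: 'a::euclidean_space measure))"
  "integrable lborel (\<lambda>x::'a. max 0 (1 - x \<bullet> x) ^ 2 :: real)"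
proof -
  have out: "max 0 (1 - x \<bullet> x) = 0" if "x \<notin> cball 0 1" for x :: 'a
  proof -
    have "1 < norm x" using that by simp
    then have "1 < x \<bullet> x" using power_strict_mono[of 1 "norm x" 2] by (simp add: power2_norm_eq_inner)
    then show ?thesis by simp
  qed
  have "integrable lborel (\<lambda>x::'a. indicator (cball 0 1) x *\<^sub>R (max 0 (1 - x \<bullet> x) ^ 2 :: real))"
    by (rule borel_integrable_compact) (auto intro!: continuous_intros)
  also have "(\<lambda>x::'a. indicator (cball 0 1) x *\<^sub>R (max 0 (1 - x \<bullet> x) ^ 2 :: real)) = (\<lambda>x. max 0 (1 - x \<bullet> x) ^ 2)"
    using out by (auto simp: indicator_def fun_eq_iff)
  finally show i: "integrable lborel (\<lambda>x::'a. max 0 (1 - x \<bullet> x) ^ 2 :: real)" .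
  have fin: "emeasure lborel (ball 0 (1/2) :: 'a set) < \<infinity>" by (rule emeasure_lborel_ball_finite)
  have "0 < measure lborel (ball 0 (1/2) :: 'a set) * (1/4)"
    using content_ball_pos[of "1/2" "0::'a"] by simp
  also have "\<dots> = (\<integral>x. indicator (ball 0 (1/2)) x *\<^sub>R (1/4) \<partial>(lborel :: 'a measure))"
    using fin by simp
  also have "\<dots> \<le> (\<integral>x. max 0 (1 - x \<bullet> x) ^ 2 \<partial>(lborel :: 'a measure))"
  proof (rule integral_mono[OF _ i])
    show "integrable lborel (\<lambda>x::'a. indicator (ball 0 (1/2)) x *\<^sub>R (1/4 :: real))"
      using fin by (intro integrable_scaleR_left) auto
    fix x :: 'a
    have "(1/4::real) \<le> max 0 (1 - x \<bullet> x) ^ 2" if "norm x < 1/2"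
    proof -
      have "x \<bullet> x \<le> (1/2)^2" unfolding power2_norm_eq_inner[symmetric] using that by (intro power_mono) auto
      then have "(1/2::real)^2 \<le> max 0 (1 - x \<bullet> x) ^ 2" by (intro power_mono) (auto simp: power2_eq_square)
      then show ?thesis by (simp add: power2_eq_square)
    qed
    then show "indicator (ball 0 (1/2)) x *\<^sub>R (1/4) \<le> max 0 (1 - x \<bullet> x) ^ 2"
      by (auto simp: indicator_def)
  qed
  finally show "0 < (\<integral>x. max 0 (1 - x \<bullet> x) ^ 2 \<partial>(lborel :: 'a measure))" .
qed

text \<open>
  The mean value over a ball of radius \<open>1/(m+1)\<close> centred on the sphere costs only a power of \<open>m\<close>,
  because \<open>|p|\<close> grows by the bounded factor \<open>(1 + 1/(m+1))^m\<close> on that ball.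
\<close>

lemma harmonic_homogeneous_bound:
  fixes p :: "'a::euclidean_space \<Rightarrow> complex"
  assumes p: "Ck_on 2 UNIV p" "\<And>x. laplacian p x = 0"
    and hom: "\<And>t x. t > 0 \<Longrightarrow> p (t *\<^sub>R x) = t ^ m *\<^sub>R p x" and a: "norm a = 1"
  shows "norm (p a) \<le> 2 ^ DIM('a) * exp 1 / (\<integral>x. max 0 (1 - x \<bullet> x) ^ 2 \<partial>(lborel :: 'a measure))
    * real (m + 1) ^ DIM('a) * (\<integral>\<xi>. norm (p \<xi>) \<partial>sphere_measure)"
proof -
  define c0 where "c0 = (\<integral>x. max 0 (1 - x \<bullet> x) ^ 2 \<partial>(lborel :: 'a measure))"
  define \<delta> where "\<delta> = 1 / real (m + 1)"
  define J where "J = (\<integral>\<xi>. norm (p \<xi>) \<partial>sphere_measure)"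
  have c0: "c0 > 0" unfolding c0_def by (rule bump_integral_pos)
  have \<delta>: "0 < \<delta>" "\<delta> \<le> 1" by (auto simp: \<delta>_def)
  have pc: "continuous_on UNIV p" using p(1) Ck_on_imp_continuous by blast
  have pm: "(\<lambda>y. ennreal (norm (p y))) \<in> borel_measurable borel"
    by (intro measurable_compose[OF _ measurable_ennreal] borel_measurable_continuous_onI continuous_on_norm pc)
  have Ji: "integrable sphere_measure (\<lambda>\<xi>. norm (p \<xi>))"
    by (intro integrable_sphere_continuous continuous_intros continuous_on_subset[OF pc]) auto
  have J: "(\<integral>\<^sup>+\<xi>. ennreal (norm (p \<xi>)) \<partial>sphere_measure) = ennreal J" and "0 \<le> J"
    unfolding J_def by (auto intro!: nn_integral_eq_integral Ji)
  let ?f = "\<lambda>x. p (a + \<delta> *\<^sub>R x) * complex_of_real (max 0 (1 - x \<bullet> x) ^ 2)"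
  have out: "max 0 (1 - x \<bullet> x) = 0" if "norm x \<ge> 1" for x :: 'a
    using power_mono[OF that, of 2] by (simp add: power2_norm_eq_inner)
  have fi: "integrable lborel ?f"
    by (rule integrable_compact_support[where K="cball 0 1"])
      (auto intro!: continuous_intros continuous_on_compose2[OF pc] simp: out)
  let ?G = "\<lambda>y. indicator (ball 0 (1 + \<delta>)) y * ennreal (norm (p y))"
  have mG: "?G \<in> borel_measurable borel"
    by (intro borel_measurable_times_ennreal borel_measurable_indicator pm) auto
  have "ennreal (norm (p a) * c0) = ennreal (norm (\<integral>x. ?f x \<partial>lborel))"
  proof -
    have "(\<integral>x. complex_of_real (max 0 (1 - x \<bullet> x) ^ 2) \<partial>(lborel :: 'a measure)) = complex_of_real c0"
      unfolding c0_def by (rule integral_complex_of_real)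
    then show ?thesis
      unfolding weighted_mean_value[OF p] by (simp add: norm_mult c0 less_imp_le)
  qed
  also have "\<dots> \<le> (\<integral>\<^sup>+x. ennreal (norm (?f x)) \<partial>lborel)"
    by (rule integral_norm_bound_ennreal[OF fi])
  also have "\<dots> \<le> (\<integral>\<^sup>+x. ?G (a + \<delta> *\<^sub>R x) \<partial>lborel)"
  proof (rule nn_integral_mono)
    fix x :: 'a
    show "ennreal (norm (?f x)) \<le> ?G (a + \<delta> *\<^sub>R x)"
    proof (cases "norm x < 1")
      case True
      have "norm (a + \<delta> *\<^sub>R x) \<le> norm a + norm (\<delta> *\<^sub>R x)" by (rule norm_triangle_ineq)
      also have "\<dots> < 1 + \<delta>" using a \<delta> True by simp
      finally have "a + \<delta> *\<^sub>R x \<in> ball 0 (1 + \<delta>)" by simp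
      moreover have "max 0 (1 - x \<bullet> x) ^ 2 \<le> (1::real)" by (intro power_le_one) auto
      then have "norm (?f x) \<le> norm (p (a + \<delta> *\<^sub>R x))"
        unfolding norm_mult norm_of_real by (simp add: mult_left_le)
      ultimately show ?thesis by (simp add: ennreal_leI)
    qed (simp add: out)
  qed
  finally have 1: "ennreal (norm (p a) * c0) \<le> (\<integral>\<^sup>+x. ?G (a + \<delta> *\<^sub>R x) \<partial>lborel)" .
  have "(\<integral>\<^sup>+y. ?G y \<partial>lborel) = (\<integral>\<^sup>+y. ?G y \<partial>density (distr lborel borel (\<lambda>x. a + \<delta> *\<^sub>R x)) (\<lambda>_. \<bar>\<delta>\<bar>^DIM('a)))"
    using lborel_affine[of \<delta> a] \<delta>(1) by simp
  also have "\<dots> = ennreal (\<delta> ^ DIM('a)) * (\<integral>\<^sup>+x. ?G (a + \<delta> *\<^sub>R x) \<partial>lborel)"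
  proof -
    have "(\<integral>\<^sup>+y. ?G y \<partial>density (distr lborel borel (\<lambda>x. a + \<delta> *\<^sub>R x)) (\<lambda>_. \<bar>\<delta>\<bar>^DIM('a)))
      = (\<integral>\<^sup>+y. ennreal (\<bar>\<delta>\<bar>^DIM('a)) * ?G y \<partial>distr lborel borel (\<lambda>x. a + \<delta> *\<^sub>R x))"
      by (rule nn_integral_density) (use mG in auto)
    also have "\<dots> = (\<integral>\<^sup>+x. ennreal (\<bar>\<delta>\<bar>^DIM('a)) * ?G (a + \<delta> *\<^sub>R x) \<partial>lborel)"
      by (rule nn_integral_distr) (use mG in auto)
    also have "\<dots> = ennreal (\<bar>\<delta>\<bar>^DIM('a)) * (\<integral>\<^sup>+x. ?G (a + \<delta> *\<^sub>R x) \<partial>lborel)"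
      by (rule nn_integral_cmult) (use mG in measurable)
    finally show ?thesis using \<delta>(1) by simp
  qed
  finally have 2: "(\<integral>\<^sup>+y. ?G y \<partial>lborel) = ennreal (\<delta> ^ DIM('a)) * (\<integral>\<^sup>+x. ?G (a + \<delta> *\<^sub>R x) \<partial>lborel)" .
  have "(\<integral>\<^sup>+y. ?G y \<partial>lborel) =
    (\<integral>\<^sup>+r. ennreal (indicator {0<..} r * r ^ (DIM('a) - 1)) * (\<integral>\<^sup>+\<xi>. ?G (r *\<^sub>R \<xi>) \<partial>sphere_measure) \<partial>lborel)"
    by (rule nn_integral_polar[OF mG])
  also have "\<dots> \<le> (\<integral>\<^sup>+r. ennreal ((1 + \<delta>) ^ (DIM('a) - 1 + m) * J) * indicator {0..1+\<delta>} r \<partial>lborel)"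
  proof (rule nn_integral_mono)
    fix r :: real
    show "ennreal (indicator {0<..} r * r ^ (DIM('a) - 1)) * (\<integral>\<^sup>+\<xi>. ?G (r *\<^sub>R \<xi>) \<partial>sphere_measure)
      \<le> ennreal ((1 + \<delta>) ^ (DIM('a) - 1 + m) * J) * indicator {0..1+\<delta>} r"
    proof (cases "0 < r")
      case r: True
      have "(\<integral>\<^sup>+\<xi>. ?G (r *\<^sub>R \<xi>) \<partial>sphere_measure) = (\<integral>\<^sup>+\<xi>. indicator {..<1+\<delta>} r * ennreal (r ^ m) * ennreal (norm (p \<xi>)) \<partial>sphere_measure)"
        by (intro nn_integral_cong) (use r in \<open>auto simp: hom indicator_def ennreal_mult\<close>)
      also have "\<dots> = indicator {..<1+\<delta>} r * ennreal (r ^ m) * ennreal J"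
        by (subst nn_integral_cmult) (use Ji in \<open>auto simp: J\<close>)
      finally have e: "(\<integral>\<^sup>+\<xi>. ?G (r *\<^sub>R \<xi>) \<partial>sphere_measure) = indicator {..<1+\<delta>} r * ennreal (r ^ m) * ennreal J" .
      show ?thesis
      proof (cases "r < 1 + \<delta>")
        case True
        have "r ^ (DIM('a) - 1 + m) \<le> (1 + \<delta>) ^ (DIM('a) - 1 + m)"
          using r True by (intro power_mono) auto
        then have "ennreal (r ^ (DIM('a) - 1 + m) * J) \<le> ennreal ((1 + \<delta>) ^ (DIM('a) - 1 + m) * J)"
          using \<open>0 \<le> J\<close> by (intro ennreal_leI mult_right_mono) auto
        also have "r ^ (DIM('a) - 1 + m) * J = r ^ (DIM('a) - 1) * (r ^ m * J)"
          by (simp only: power_add mult.assoc)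
        also have "ennreal \<dots> = ennreal (r ^ (DIM('a) - 1)) * (ennreal (r ^ m) * ennreal J)"
          using r \<open>0 \<le> J\<close> by (simp only: ennreal_mult zero_le_power less_imp_le mult_nonneg_nonneg)
        finally have "ennreal (r ^ (DIM('a) - 1)) * (ennreal (r ^ m) * ennreal J)
            \<le> ennreal ((1 + \<delta>) ^ (DIM('a) - 1 + m) * J)" .
        then show ?thesis unfolding e using r True
          by (simp add: indicator_def)
      next
        case False
        then show ?thesis unfolding e by (simp add: indicator_def)
      qed
    next
      case False
      then have "(indicator {0<..} r :: real) = 0" by simp
      then show ?thesis by (simp only: mult_zero_left ennreal_0 zero_le)
    qed
  qed
  also have "\<dots> = ennreal ((1 + \<delta>) ^ (DIM('a) - 1 + m) * J) * ennreal (1 + \<delta>)"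
    using \<delta> by (subst nn_integral_cmult_indicator) auto
  also have "\<dots> = ennreal ((1 + \<delta>) ^ (DIM('a) - 1 + m) * J * (1 + \<delta>))"
    using \<delta> \<open>0 \<le> J\<close> by (intro ennreal_mult[symmetric]) auto
  also have "(1 + \<delta>) ^ (DIM('a) - 1 + m) * J * (1 + \<delta>) = (1 + \<delta>) ^ (DIM('a) + m) * J"
  proof -
    have "DIM('a) + m = Suc (DIM('a) - 1 + m)" using DIM_positive[where 'a='a] by linarith
    then have "(1 + \<delta>) ^ (DIM('a) + m) = (1 + \<delta>) ^ (DIM('a) - 1 + m) * (1 + \<delta>)"
      by (simp only: power_Suc2)
    then show ?thesis by (simp only: ac_simps)
  qed
  finally have 3: "(\<integral>\<^sup>+y. ?G y \<partial>lborel) \<le> ennreal ((1 + \<delta>) ^ (DIM('a) + m) * J)" .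
  have "ennreal (\<delta> ^ DIM('a) * (norm (p a) * c0)) = ennreal (\<delta> ^ DIM('a)) * ennreal (norm (p a) * c0)"
    using \<delta> c0 by (intro ennreal_mult) auto
  also have "\<dots> \<le> ennreal (\<delta> ^ DIM('a)) * (\<integral>\<^sup>+x. ?G (a + \<delta> *\<^sub>R x) \<partial>lborel)"
    by (rule mult_left_mono[OF 1]) auto
  also have "\<dots> \<le> ennreal ((1 + \<delta>) ^ (DIM('a) + m) * J)" using 2 3 by simp
  finally have "\<delta> ^ DIM('a) * (norm (p a) * c0) \<le> (1 + \<delta>) ^ (DIM('a) + m) * J"
    using \<delta> \<open>0 \<le> J\<close> by (subst (asm) ennreal_le_iff) auto
  also have "\<dots> \<le> 2 ^ DIM('a) * exp 1 * J"
  proof (rule mult_right_mono[OF _ \<open>0 \<le> J\<close>])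
    have "(1 + \<delta>) ^ m \<le> exp \<delta> ^ m" using \<delta> by (intro power_mono) auto
    also have "exp \<delta> ^ m = exp (real m * \<delta>)" by (simp add: exp_of_nat_mult)
    also have "\<dots> \<le> exp 1" by (simp add: \<delta>_def field_simps)
    finally have "(1 + \<delta>) ^ m \<le> exp 1" .
    moreover have "(1 + \<delta>) ^ DIM('a) \<le> 2 ^ DIM('a)" using \<delta> by (intro power_mono) auto
    ultimately show "(1 + \<delta>) ^ (DIM('a) + m) \<le> 2 ^ DIM('a) * exp 1"
      unfolding power_add using \<delta> by (intro mult_mono) auto
  qed
  finally have "\<delta> ^ DIM('a) * (norm (p a) * c0) \<le> 2 ^ DIM('a) * exp 1 * J" .
  then have "norm (p a) * c0 \<le> 2 ^ DIM('a) * exp 1 * J * real (m + 1) ^ DIM('a)"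
    using c0 unfolding \<delta>_def power_one_over by (simp add: field_simps)
  then show ?thesis
    using c0 unfolding c0_def[symmetric] J_def[symmetric] by (simp add: field_simps)
qed

section \<open>Spherical harmonics\<close>

lemma norm_square_orthonormal_sum:
  fixes e :: "'i \<Rightarrow> 'b \<Rightarrow> complex"
  assumes I: "finite I"
    and int: "\<And>i j. i \<in> I \<Longrightarrow> j \<in> I \<Longrightarrow> integrable M (\<lambda>x. e i x * cnj (e j x))"
    and orth: "\<And>i j. i \<in> I \<Longrightarrow> j \<in> I \<Longrightarrow> (\<integral>x. e i x * cnj (e j x) \<partial>M) = (if i = j then 1 else 0)"
  shows "integrable M (\<lambda>x. (norm (\<Sum>i\<in>I. c i * e i x))\<^sup>2)"
    and "(\<integral>x. (norm (\<Sum>i\<in>I. c i * e i x))\<^sup>2 \<partial>M) = (\<Sum>i\<in>I. (norm (c i))\<^sup>2)"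
proof -
  have eq: "complex_of_real ((norm (\<Sum>i\<in>I. c i * e i x))\<^sup>2) =
    (\<Sum>i\<in>I. \<Sum>j\<in>I. (c i * cnj (c j)) * (e i x * cnj (e j x)))" for x
    unfolding complex_norm_square by (simp add: sum_product ac_simps)
  have "integrable M (\<lambda>x. complex_of_real ((norm (\<Sum>i\<in>I. c i * e i x))\<^sup>2))"
    unfolding eq using int by (intro Bochner_Integration.integrable_sum integrable_mult_right) auto
  then show i: "integrable M (\<lambda>x. (norm (\<Sum>i\<in>I. c i * e i x))\<^sup>2)"
    by (simp only: complex_of_real_integrable_eq)
  have "complex_of_real (\<integral>x. (norm (\<Sum>i\<in>I. c i * e i x))\<^sup>2 \<partial>M)
    = (\<integral>x. (\<Sum>i\<in>I. \<Sum>j\<in>I. (c i * cnj (c j)) * (e i x * cnj (e j x))) \<partial>M)"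
    unfolding eq[symmetric] by (rule integral_complex_of_real[symmetric])
  also have "\<dots> = (\<Sum>i\<in>I. \<Sum>j\<in>I. (c i * cnj (c j)) * (\<integral>x. e i x * cnj (e j x) \<partial>M))"
    using int by (subst Bochner_Integration.integral_sum)
      (auto intro!: Bochner_Integration.integrable_sum integrable_mult_right sum.cong
        simp: Bochner_Integration.integral_sum)
  also have "\<dots> = (\<Sum>i\<in>I. \<Sum>j\<in>I. if j = i then c i * cnj (c j) else 0)"
    by (intro sum.cong) (auto simp: orth)
  also have "\<dots> = (\<Sum>i\<in>I. c i * cnj (c i))"
    using I by simp
  also have "\<dots> = complex_of_real (\<Sum>i\<in>I. (norm (c i))\<^sup>2)"
    by (simp only: of_real_sum complex_norm_square)
  finally show "(\<integral>x. (norm (\<Sum>i\<in>I. c i * e i x))\<^sup>2 \<partial>M) = (\<Sum>i\<in>I. (norm (c i))\<^sup>2)"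
    by (simp only: of_real_eq_iff)
qed

text \<open>
  In the definition of spherical harmonics these are the polynomials whose restrictions to the
  sphere are taken.
\<close>

definition solid_harmonic :: "nat \<Rightarrow> ('a::euclidean_space \<Rightarrow> complex) \<Rightarrow> bool" where
  "solid_harmonic m p \<longleftrightarrow> polynomial_function p \<and> (\<forall>t x. p (t *\<^sub>R x) = t ^ m *\<^sub>R p x) \<and> (\<forall>x. laplacian p x = 0)"

lemma spherical_harmonicE:
  assumes "spherical_harmonic m h"
  obtains p where "solid_harmonic m p" "\<And>\<xi>. norm \<xi> = 1 \<Longrightarrow> h \<xi> = p \<xi>"
  using assms unfolding spherical_harmonic_def solid_harmonic_def by auto

lemma solid_harmonicD:
  assumes "solid_harmonic m p"
  shows "open S \<Longrightarrow> Ck_on k S p" "p (t *\<^sub>R x) = t ^ m *\<^sub>R p x" "laplacian p x = 0" "continuous_on A p"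
  using assms Ck_on_polynomial[of p] unfolding solid_harmonic_def
  by (auto intro: continuous_on_polymonial_function)

lemma laplacian_add:
  assumes "Ck_on 2 UNIV u" "Ck_on 2 UNIV v"
  shows "laplacian (\<lambda>x. u x + v x) x = laplacian u x + laplacian v x"
proof -
  have *: "u differentiable at y" "(\<lambda>y. pd b u y) differentiable at y"
      "v differentiable at y" "(\<lambda>y. pd b v y) differentiable at y" if "b \<in> Basis" for y b
    using assms that by (auto simp: numeral_2_eq_2)
  show ?thesis unfolding laplacian_eq_pd using * by (simp add: pd_add sum.distrib)
qed

lemma laplacian_cmult:
  assumes "Ck_on 2 UNIV u"
  shows "laplacian (\<lambda>x. c * u x) x = c * laplacian u x"
proof -
  have *: "u differentiable at y" "(\<lambda>y. pd b u y) differentiable at y" if "b \<in> Basis" for y b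
    using assms that by (auto simp: numeral_2_eq_2)
  show ?thesis unfolding laplacian_eq_pd using * by (simp add: pd_mult sum_distrib_left)
qed

lemma solid_harmonic_cmult: "solid_harmonic m p \<Longrightarrow> solid_harmonic m (\<lambda>x. c * p x)"
  using polynomial_function_bounded_linear[OF bounded_linear_mult_right[of c]]
  unfolding solid_harmonic_def
  by (auto simp: laplacian_cmult Ck_on_polynomial polynomial_function_compose[unfolded o_def])

lemma solid_harmonic_sum:
  assumes "\<And>i. i \<in> I \<Longrightarrow> solid_harmonic m (p i)"
  shows "solid_harmonic m (\<lambda>x. \<Sum>i\<in>I. p i x)"
  using assms
proof (induction I rule: infinite_finite_induct)
  case (insert i I)
  then show ?case unfolding solid_harmonic_def
    by (auto simp: laplacian_add Ck_on_polynomial scaleR_add_right)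
qed (auto simp: solid_harmonic_def laplacian_eq_pd)

lemma solid_harmonic_cnj: 
  assumes "solid_harmonic m p"
  shows "solid_harmonic m (\<lambda>x. cnj (p x))"
proof -
  have c: "Ck_on 2 UNIV p" by (rule solid_harmonicD(1)[OF assms]) auto
  have *: "p differentiable at y" "(\<lambda>y. pd b p y) differentiable at y" if "b \<in> Basis" for y b
    using c that by (auto simp: numeral_2_eq_2)
  have "laplacian (\<lambda>x. cnj (p x)) x = cnj (laplacian p x)" for x
    unfolding laplacian_eq_pd using * by (simp add: pd_cnj)
  then show ?thesis using assms polynomial_function_bounded_linear[OF bounded_linear_cnj]
    unfolding solid_harmonic_def by (auto simp: polynomial_function_compose[unfolded o_def] complex_cnj_scaleR)
qed

lemma spherical_harmonic_continuous:
  assumes "spherical_harmonic m h" "A \<subseteq> sphere 0 1"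
  shows "continuous_on A h"
proof -
  obtain p where p: "solid_harmonic m p" "\<And>\<xi>. norm \<xi> = 1 \<Longrightarrow> h \<xi> = p \<xi>"
    using spherical_harmonicE[OF assms(1)] by metis
  show ?thesis
    by (rule continuous_on_eq[OF solid_harmonicD(4)[OF p(1)]]) (use p(2) assms(2) in auto)
qed

lemma spherical_harmonics_orthogonal:
  fixes h h' :: "'a::euclidean_space \<Rightarrow> complex"
  assumes d: "3 \<le> DIM('a)" and h: "spherical_harmonic m h" "spherical_harmonic k h'" and mk: "m \<noteq> k"
  shows "(\<integral>\<xi>. h \<xi> * cnj (h' \<xi>) \<partial>sphere_measure) = 0"
proof -
  obtain p where p: "solid_harmonic m p" "\<And>\<xi>. norm \<xi> = 1 \<Longrightarrow> h \<xi> = p \<xi>"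
    using spherical_harmonicE[OF h(1)] by metis
  obtain q where q: "solid_harmonic k q" "\<And>\<xi>. norm \<xi> = 1 \<Longrightarrow> h' \<xi> = q \<xi>"
    using spherical_harmonicE[OF h(2)] by metis
  note Q = solid_harmonic_cnj[OF q(1)]
  have op: "open (- {0::'a})" by auto
  have "(\<integral>\<xi>. p \<xi> * (\<lambda>\<xi>. 0) \<xi> \<partial>sphere_measure) =
    (of_nat k - of_nat m) * of_nat (k + m + DIM('a) - 2) * (\<integral>\<xi>. p \<xi> * cnj (q \<xi>) \<partial>sphere_measure)"
    by (rule sphere_integral_laplacian[OF d])
      (use solid_harmonicD[OF p(1)] solid_harmonicD[OF Q] op in auto)
  moreover have "(of_nat k - of_nat m) * of_nat (k + m + DIM('a) - 2) \<noteq> (0::complex)"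
  proof -
    have "k + m + DIM('a) - 2 \<noteq> 0" using d by auto
    then have "of_nat (k + m + DIM('a) - 2) \<noteq> (0::complex)" by (simp only: of_nat_eq_0_iff not_False_eq_True)
    moreover have "of_nat k - of_nat m \<noteq> (0::complex)" using mk by simp
    ultimately show ?thesis by (simp only: mult_eq_0_iff) blast
  qed
  ultimately have "(\<integral>\<xi>. p \<xi> * cnj (q \<xi>) \<partial>sphere_measure) = 0" by simp
  moreover have "(\<integral>\<xi>. h \<xi> * cnj (h' \<xi>) \<partial>sphere_measure) = (\<integral>\<xi>. p \<xi> * cnj (q \<xi>) \<partial>sphere_measure)"
    by (intro Bochner_Integration.integral_cong) (auto simp: p q)
  ultimately show ?thesis by simp
qed

lemma spherical_harmonic_bound:
  assumes "spherical_harmonic m h" "norm a = 1"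
  shows "norm (h a) \<le> 2 ^ DIM('a) * exp 1 / (\<integral>x. max 0 (1 - x \<bullet> x) ^ 2 \<partial>(lborel :: 'a::euclidean_space measure))
    * real (m + 1) ^ DIM('a) * (\<integral>\<xi>. norm (h \<xi>) \<partial>(sphere_measure :: 'a measure))"
proof -
  obtain p where p: "solid_harmonic m p" "\<And>\<xi>. norm \<xi> = 1 \<Longrightarrow> h \<xi> = p \<xi>"
    using spherical_harmonicE[OF assms(1)] by metis
  have "(\<integral>\<xi>. norm (h \<xi>) \<partial>sphere_measure) = (\<integral>\<xi>. norm (p \<xi>) \<partial>sphere_measure)"
    by (intro Bochner_Integration.integral_cong) (auto simp: p)
  then show ?thesis
    using harmonic_homogeneous_bound[of p m a] solid_harmonicD[OF p(1)] p(2) assms(2) by simp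
qed

text \<open>
  The diagonal value \<open>K = \<Sum>|Y\<^sub>j(\<zeta>)|\<^sup>2\<close> is both the value at \<open>\<zeta>\<close> and the squared \<open>L\<^sup>2\<close> norm of the
  harmonic \<open>\<Sum>\<^sub>j cnj (Y\<^sub>j(\<zeta>)) Y\<^sub>j\<close>. The sup bound by the \<open>L\<^sup>1\<close> norm therefore bounds \<open>K\<close> itself.
\<close>

lemma zonal_diagonal_bound:
  assumes d: "3 \<le> DIM('a::euclidean_space)"
  obtains A :: real where "A \<ge> 0"
    "\<And>m n (Y :: nat \<Rightarrow> 'a \<Rightarrow> complex) \<zeta>. orthonormal_basis_spherical_harmonics m n Y \<Longrightarrow> norm \<zeta> = 1 \<Longrightarrow>
      (\<Sum>j<n. (norm (Y j \<zeta>))\<^sup>2) \<le> A * real (m + 1) ^ (2 * DIM('a))"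
proof -
  define C where "C = 2 ^ DIM('a) * exp 1 / (\<integral>x. max 0 (1 - x \<bullet> x) ^ 2 \<partial>(lborel :: 'a measure))"
  define \<sigma> where "\<sigma> = measure (sphere_measure :: 'a measure) (sphere 0 1)"
  have C: "C > 0" unfolding C_def using bump_integral_pos(1)[where 'a='a] by (intro divide_pos_pos mult_pos_pos) auto
  show ?thesis
  proof (rule that[of "C\<^sup>2 * \<sigma>"])
    show "0 \<le> C\<^sup>2 * \<sigma>" by (simp add: \<sigma>_def)
    fix m n :: nat and Y :: "nat \<Rightarrow> 'a \<Rightarrow> complex" and \<zeta> :: 'a
    assume Y: "orthonormal_basis_spherical_harmonics m n Y" and \<zeta>: "norm \<zeta> = 1"
    have Yh: "spherical_harmonic m (Y j)" if "j < n" for j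
      using Y that unfolding orthonormal_basis_spherical_harmonics_def by blast
    have Yc: "continuous_on (sphere 0 1) (Y j)" if "j < n" for j
      by (rule spherical_harmonic_continuous[OF Yh[OF that]]) simp
    define K where "K = (\<Sum>j<n. (norm (Y j \<zeta>))\<^sup>2)"
    define h where "h \<xi> = (\<Sum>j<n. cnj (Y j \<zeta>) * Y j \<xi>)" for \<xi>
    have hc: "continuous_on (sphere 0 1) h" unfolding h_def by (intro continuous_intros Yc) auto
    have "\<forall>j\<in>{..<n}. \<exists>p. solid_harmonic m p \<and> (\<forall>\<xi>. norm \<xi> = 1 \<longrightarrow> Y j \<xi> = p \<xi>)"
      using Yh by (metis lessThan_iff spherical_harmonicE)
    then obtain p where p: "\<And>j. j < n \<Longrightarrow> solid_harmonic m (p j)" "\<And>j \<xi>. j < n \<Longrightarrow> norm \<xi> = 1 \<Longrightarrow> Y j \<xi> = p j \<xi>"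
      by (metis lessThan_iff bchoice)
    have "solid_harmonic m (\<lambda>x. \<Sum>j<n. cnj (Y j \<zeta>) * p j x)"
      by (intro solid_harmonic_sum solid_harmonic_cmult p) auto
    then have hs: "spherical_harmonic m h"
      unfolding spherical_harmonic_def solid_harmonic_def h_def using p(2) by (intro exI) auto
    have hK: "h \<zeta> = of_real K"
      unfolding h_def K_def by (simp only: of_real_sum complex_norm_square mult.commute)
    have ih: "integrable sphere_measure (\<lambda>\<xi>. (norm (h \<xi>))\<^sup>2)" and L2: "(\<integral>\<xi>. (norm (h \<xi>))\<^sup>2 \<partial>sphere_measure) = K"
    proof -
      have i: "integrable sphere_measure (\<lambda>\<xi>. Y i \<xi> * cnj (Y j \<xi>))" if "i \<in> {..<n}" "j \<in> {..<n}" for i j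
        using that by (intro integrable_sphere_continuous continuous_intros Yc) auto
      have o: "(\<integral>\<xi>. Y i \<xi> * cnj (Y j \<xi>) \<partial>sphere_measure) = (if i = j then 1 else 0)" if "i \<in> {..<n}" "j \<in> {..<n}" for i j
        using Y that unfolding orthonormal_basis_spherical_harmonics_def by blast
      show "integrable sphere_measure (\<lambda>\<xi>. (norm (h \<xi>))\<^sup>2)" "(\<integral>\<xi>. (norm (h \<xi>))\<^sup>2 \<partial>sphere_measure) = K"
        unfolding h_def K_def using norm_square_orthonormal_sum[OF finite_lessThan i o, where c="\<lambda>j. cnj (Y j \<zeta>)"] by auto
    qed
    define B where "B = C * real (m + 1) ^ DIM('a)"
    have B: "B > 0" unfolding B_def using C by simp
    have K0: "K \<ge> 0" unfolding K_def by (intro sum_nonneg) auto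
    have i1: "integrable sphere_measure (\<lambda>\<xi>. norm (h \<xi>))"
      by (intro integrable_sphere_continuous continuous_intros hc)
    have fm: "finite_measure (sphere_measure :: 'a measure)" by simp
    have ic: "integrable (sphere_measure :: 'a measure) (\<lambda>\<xi>. B / 2)"
      by (rule finite_measure.integrable_const[OF fm])
    have "K \<le> B * (\<integral>\<xi>. norm (h \<xi>) \<partial>sphere_measure)"
      using spherical_harmonic_bound[OF hs \<zeta>] hK K0 unfolding B_def C_def by simp
    \<comment> \<open>The weight \<open>B\<close> makes the first summand contribute \<open>K / 2\<close>, which the left-hand side absorbs.\<close>
    also have "(\<integral>\<xi>. norm (h \<xi>) \<partial>sphere_measure) \<le> (\<integral>\<xi>. (norm (h \<xi>))\<^sup>2 / (2 * B) + B / 2 \<partial>sphere_measure)"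
    proof (rule integral_mono[OF i1])
      show "integrable sphere_measure (\<lambda>\<xi>. (norm (h \<xi>))\<^sup>2 / (2 * B) + B / 2)"
        using ih ic by auto
      fix \<xi> :: 'a
      have "0 \<le> (norm (h \<xi>) - B)\<^sup>2" by simp
      then show "norm (h \<xi>) \<le> (norm (h \<xi>))\<^sup>2 / (2 * B) + B / 2"
        using B by (simp add: field_simps power2_eq_square)
    qed
    also have "\<dots> = K / (2 * B) + \<sigma> * (B / 2)"
      using ih ic by (subst Bochner_Integration.integral_add) (auto simp: L2 \<sigma>_def)
    finally have "K \<le> B * (K / (2 * B) + \<sigma> * (B / 2))" using B by simp
    then have "K \<le> B\<^sup>2 * \<sigma>" using B by (simp add: field_simps power2_eq_square)
    then show "(\<Sum>j<n. (norm (Y j \<zeta>))\<^sup>2) \<le> C\<^sup>2 * \<sigma> * real (m + 1) ^ (2 * DIM('a))"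
      unfolding K_def[symmetric] B_def by (simp add: power_mult_distrib power_mult[symmetric] ac_simps)
  qed
qed

lemma zonal_bound:
  assumes "\<And>\<zeta>. norm \<zeta> = 1 \<Longrightarrow> (\<Sum>j<n. (norm (Y j \<zeta>))\<^sup>2) \<le> B" "norm \<xi> = 1" "norm \<zeta> = 1"
  shows "(\<Sum>j<n. norm (Y j \<xi>) * norm (Y j \<zeta>)) \<le> B"
proof -
  have "(\<Sum>j<n. norm (Y j \<xi>) * norm (Y j \<zeta>)) \<le> (\<Sum>j<n. ((norm (Y j \<xi>))\<^sup>2 + (norm (Y j \<zeta>))\<^sup>2) / 2)"
  proof (rule sum_mono)
    fix j
    have "0 \<le> (norm (Y j \<xi>) - norm (Y j \<zeta>))\<^sup>2" by simp
    then show "norm (Y j \<xi>) * norm (Y j \<zeta>) \<le> ((norm (Y j \<xi>))\<^sup>2 + (norm (Y j \<zeta>))\<^sup>2) / 2"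
      by (simp add: power2_diff)
  qed
  also have "\<dots> = ((\<Sum>j<n. (norm (Y j \<xi>))\<^sup>2) + (\<Sum>j<n. (norm (Y j \<zeta>))\<^sup>2)) / 2"
    by (simp add: sum.distrib sum_divide_distrib add_divide_distrib)
  also have "\<dots> \<le> B" using assms(1)[OF assms(2)] assms(1)[OF assms(3)] by simp
  finally show ?thesis .
qed

section \<open>Completeness of spherical harmonics\<close>

primrec gegenbauer_coeff :: "nat \<Rightarrow> nat \<Rightarrow> nat \<Rightarrow> real" where
  "gegenbauer_coeff d k 0 = 1"
| "gegenbauer_coeff d k (Suc j) = - (real (k - 2 * j) * real (k - 2 * j - 1)
     / (real (2 * j + 2) * (real (2 * (k - 2 * (j + 1))) + real (2 * j) + real d))) * gegenbauer_coeff d k j"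

text \<open>
  Up to normalisation this is the Gegenbauer polynomial of \<open>x \<bullet> y\<close>, made homogeneous in \<open>x\<close> and
  in \<open>y\<close>; the recursion for the coefficients cancels the Laplacian term by term.
\<close>

definition gegenbauer :: "nat \<Rightarrow> 'a::euclidean_space \<Rightarrow> 'a \<Rightarrow> complex" where
  "gegenbauer k y x = (\<Sum>j\<le>k div 2. complex_of_real (gegenbauer_coeff DIM('a) k j
     * (x \<bullet> y) ^ (k - 2 * j) * (x \<bullet> x) ^ j * (y \<bullet> y) ^ j))"

lemma polynomial_function_of_real_power:
  "real_polynomial_function p \<Longrightarrow> polynomial_function (\<lambda>x. complex_of_real (p x))"
  using polynomial_function_compose[OF _ polynomial_function_bounded_linear[OF bounded_linear_of_real], of p]
  by (simp add: o_def real_polynomial_function_eq)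

lemma Ck_on_inner_power: "open S \<Longrightarrow> Ck_on k S (\<lambda>x. complex_of_real ((x \<bullet> y) ^ j))"
  by (rule Ck_on_real_polynomial, rule real_polynomial_function_power,
      rule real_polynomial_function.intros(1), rule bounded_linear_inner_left)

lemma laplacian_inner_power:
  fixes x y :: "'a::euclidean_space"
  shows "laplacian (\<lambda>x. complex_of_real ((x \<bullet> y) ^ a)) x
    = complex_of_real (real a * real (a - 1) * (x \<bullet> y) ^ (a - 2) * (y \<bullet> y))"
proof -
  have D: "((\<lambda>x. complex_of_real (c * (x \<bullet> y) ^ n)) has_derivative
      (\<lambda>h. complex_of_real (c * (real n * (x \<bullet> y) ^ (n - 1) * (h \<bullet> y))))) (at x)" for c n and x :: 'a
    by (auto intro!: derivative_eq_intros simp: ac_simps)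
  have "pd b (\<lambda>x. complex_of_real ((x \<bullet> y) ^ a)) = (\<lambda>x. complex_of_real ((real a * (b \<bullet> y)) * (x \<bullet> y) ^ (a - 1)))" for b
    using pd_eqI[OF D[of 1 a]] by (auto simp: fun_eq_iff ac_simps)
  then have "pd b (\<lambda>z. pd b (\<lambda>x. complex_of_real ((x \<bullet> y) ^ a)) z) x
    = complex_of_real (real a * (b \<bullet> y) * (real (a - 1) * (x \<bullet> y) ^ (a - 1 - 1) * (b \<bullet> y)))" for b
    using pd_eqI[OF D[of "real a * (b \<bullet> y)" "a - 1"]] by simp
  then have "laplacian (\<lambda>x. complex_of_real ((x \<bullet> y) ^ a)) x
    = complex_of_real (\<Sum>b\<in>Basis. real a * real (a - 1) * (x \<bullet> y) ^ (a - 2) * ((y \<bullet> b) * (y \<bullet> b)))"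
    unfolding laplacian_eq_pd by (simp add: inner_commute ac_simps numeral_2_eq_2)
  also have "(\<Sum>b\<in>Basis. real a * real (a - 1) * (x \<bullet> y) ^ (a - 2) * ((y \<bullet> b) * (y \<bullet> b)))
    = real a * real (a - 1) * (x \<bullet> y) ^ (a - 2) * (y \<bullet> y)"
    by (subst (4) euclidean_inner) (simp add: sum_distrib_left)
  finally show ?thesis .
qed

lemma laplacian_monomial:
  fixes x y :: "'a::euclidean_space"
  assumes "x \<noteq> 0"
  shows "laplacian (\<lambda>x. complex_of_real ((norm x) ^ (2 * j)) * complex_of_real ((x \<bullet> y) ^ a)) x
    = complex_of_real ((norm x) ^ (2 * j) * (real a * real (a - 1) * (x \<bullet> y) ^ (a - 2) * (y \<bullet> y))
      + real (2 * j) * (real DIM('a) + 2 * real a + 2 * real j - 2) * (norm x) ^ (2 * (j - 1)) * (x \<bullet> y) ^ a)"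
proof (cases j)
  case 0
  then show ?thesis by (simp add: laplacian_inner_power del: of_real_power of_real_mult)
next
  case (Suc i)
  define g where "g r = complex_of_real (r ^ (2 * j))" for r
  define g1 where "g1 r = complex_of_real (real (2 * j) * r ^ (2 * i))" for r
  define g2 where "g2 r = complex_of_real (real (2 * j) * (real (2 * i) * (r ^ (2 * i) / r\<^sup>2)))" for r
  have "((\<lambda>r. r ^ (2 * j)) has_field_derivative r * (real (2 * j) * r ^ (2 * i))) (at r)" for r :: real
    using Suc by (intro DERIV_cong[OF DERIV_pow]) simp
  from has_vector_derivative_of_real[OF this]
  have d0: "(g has_vector_derivative r *\<^sub>R g1 r) (at r)" for r
    unfolding g_def g1_def by (simp add: scaleR_conv_of_real)
  have "((\<lambda>r. real (2 * j) * r ^ (2 * i)) has_field_derivative r * (real (2 * j) * (real (2 * i) * (r ^ (2 * i) / r\<^sup>2)))) (at r)"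
    if "r > 0" for r :: real
  proof (cases i)
    case (Suc i')
    then show ?thesis using that
      by (intro DERIV_cong[OF DERIV_cmult[OF DERIV_pow]]) (simp add: power2_eq_square)
  qed (auto intro!: derivative_eq_intros)
  then have d1: "(g1 has_vector_derivative r *\<^sub>R g2 r) (at r)" if "r > 0" for r
    unfolding g1_def g2_def scaleR_conv_of_real of_real_mult[symmetric]
    by (rule has_vector_derivative_of_real) (use that in auto)
  have c2: "continuous_on {0<..} g2" unfolding g2_def by (intro continuous_intros) auto
  have "laplacian (\<lambda>x. g (norm x) * complex_of_real ((x \<bullet> y) ^ a)) x
    = g (norm x) * laplacian (\<lambda>x. complex_of_real ((x \<bullet> y) ^ a)) x
    + (of_nat (DIM('a) + 2 * a) * g1 (norm x) + of_real ((norm x)\<^sup>2) * g2 (norm x)) * complex_of_real ((x \<bullet> y) ^ a)"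
    by (rule laplacian_radial_mult_homogeneous[OF d0 d1 c2 Ck_on_inner_power])
      (use assms in \<open>auto simp: power_mult_distrib scaleR_conv_of_real\<close>)
  also have "of_nat (DIM('a) + 2 * a) * g1 (norm x) + of_real ((norm x)\<^sup>2) * g2 (norm x)
    = complex_of_real (real (2 * j) * (real DIM('a) + 2 * real a + 2 * real j - 2) * (norm x) ^ (2 * (j - 1)))"
  proof -
    have "(norm x)\<^sup>2 * (real (2 * j) * (real (2 * i) * ((norm x) ^ (2 * i) / (norm x)\<^sup>2)))
      = real (2 * j) * (real (2 * i) * (norm x) ^ (2 * i))" using assms by simp
    then have "real (DIM('a) + 2 * a) * (real (2 * j) * (norm x) ^ (2 * i))
        + (norm x)\<^sup>2 * (real (2 * j) * (real (2 * i) * ((norm x) ^ (2 * i) / (norm x)\<^sup>2)))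
      = real (2 * j) * (real DIM('a) + 2 * real a + 2 * real j - 2) * (norm x) ^ (2 * (j - 1))"
      unfolding Suc by (simp add: algebra_simps)
    from arg_cong[where f=complex_of_real, OF this] show ?thesis
      unfolding g1_def g2_def using assms by simp
  qed
  finally show ?thesis
    unfolding laplacian_inner_power unfolding g_def by simp
qed

text \<open>
  The Laplacian of the \<open>j\<close>-th monomial consists of two parts \<open>A j\<close> and \<open>B j\<close>, and the recursion for the
  coefficients says \<open>B (Suc j) = - A j\<close>. So the sum telescopes to its last term, where the factor
  \<open>(k - 2 j) (k - 2 j - 1)\<close> vanishes. The computation is valid off the origin, which suffices since
  the Laplacian of a polynomial is continuous.
\<close>

lemma gegenbauer_solid_harmonic: "solid_harmonic k (gegenbauer k (y :: 'a::euclidean_space))"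
proof -
  let ?c = "gegenbauer_coeff DIM('a) k"
  have poly: "polynomial_function (gegenbauer k y)"
    unfolding gegenbauer_def
  proof (intro polynomial_function_sum polynomial_function_of_real_power finite_atMost)
    fix j
    have i: "real_polynomial_function (\<lambda>x::'a. x \<bullet> z)" for z
      by (rule real_polynomial_function.intros(1), rule bounded_linear_inner_left)
    have "real_polynomial_function (\<lambda>x::'a. \<Sum>b\<in>Basis. (x \<bullet> b) * (x \<bullet> b))"
      by (intro real_polynomial_function_sum real_polynomial_function.intros(4) i) auto
    then have "real_polynomial_function (\<lambda>x::'a. x \<bullet> x)"
      by (subst euclidean_inner)
    then show "real_polynomial_function (\<lambda>x. ?c j * (x \<bullet> y) ^ (k - 2 * j) * (x \<bullet> x) ^ j * (y \<bullet> y) ^ j)"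
      using i[of y] by (intro real_polynomial_function.intros(4) real_polynomial_function_power real_polynomial_function.intros(2))
  qed
  have hom: "gegenbauer k y (t *\<^sub>R x) = t ^ k *\<^sub>R gegenbauer k y x" for t x
  proof -
    have "?c j * ((t *\<^sub>R x) \<bullet> y) ^ (k - 2 * j) * ((t *\<^sub>R x) \<bullet> (t *\<^sub>R x)) ^ j * (y \<bullet> y) ^ j
      = t ^ k * (?c j * (x \<bullet> y) ^ (k - 2 * j) * (x \<bullet> x) ^ j * (y \<bullet> y) ^ j)" if "j \<le> k div 2" for j
    proof -
      have "k = (k - 2 * j) + (j + j)" using that by linarith
      then have "t ^ k = t ^ (k - 2 * j) * (t ^ j * t ^ j)" by (metis power_add)
      then show ?thesis by (simp add: power_mult_distrib)
    qed
    then have "gegenbauer k y (t *\<^sub>R x) = (\<Sum>j\<le>k div 2. complex_of_real (t ^ k *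
        (?c j * (x \<bullet> y) ^ (k - 2 * j) * (x \<bullet> x) ^ j * (y \<bullet> y) ^ j)))"
      unfolding gegenbauer_def by (intro sum.cong refl arg_cong[where f=complex_of_real]) auto
    also have "\<dots> = t ^ k *\<^sub>R gegenbauer k y x"
      unfolding gegenbauer_def scaleR_conv_of_real of_real_mult[of "t ^ k"] sum_distrib_left[symmetric] ..
    finally show ?thesis .
  qed
  have C2: "Ck_on 2 UNIV (gegenbauer k y)" by (rule Ck_on_polynomial[OF poly]) auto
  have lap0: "laplacian (gegenbauer k y) x = 0" if x: "x \<noteq> 0" for x
  proof -
    define T where "T j x = complex_of_real ((norm x) ^ (2 * j)) * complex_of_real ((x \<bullet> y) ^ (k - 2 * j))" for j and x :: 'a
    define A where "A j = ?c j * (y \<bullet> y) ^ Suc j * (norm x) ^ (2 * j) * (real (k - 2 * j) * real (k - 2 * j - 1) * (x \<bullet> y) ^ (k - 2 * j - 2))" for j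
    define B where "B j = ?c j * (y \<bullet> y) ^ j * (real (2 * j) * (real DIM('a) + 2 * real (k - 2 * j) + 2 * real j - 2) * (norm x) ^ (2 * (j - 1)) * (x \<bullet> y) ^ (k - 2 * j))" for j
    have g: "gegenbauer k y = (\<lambda>x. \<Sum>j\<le>k div 2. complex_of_real (?c j * (y \<bullet> y) ^ j) * T j x)"
    proof -
      have nx: "(x \<bullet> x) ^ j = (norm x) ^ (2 * j)" for x :: 'a and j
        by (simp add: power_mult power2_norm_eq_inner)
      show ?thesis unfolding gegenbauer_def T_def nx by (simp add: ac_simps)
    qed
    have TC: "Ck_on 2 UNIV (T j)" for j
    proof -
      have "Ck_on 2 UNIV (\<lambda>x::'a. complex_of_real ((norm x)\<^sup>2) ^ i)" for i
        by (induction i) (auto intro!: Ck_on_const Ck_on_mult Ck_on_norm_square simp del: Ck_on.simps of_real_power)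
      from this[of j] have "Ck_on 2 UNIV (\<lambda>x::'a. complex_of_real ((norm x) ^ (2 * j)))"
        by (simp add: power_mult)
      then show ?thesis unfolding T_def by (intro Ck_on_mult Ck_on_inner_power) auto
    qed
    have lsum: "laplacian (\<lambda>x. \<Sum>j\<in>I. complex_of_real (c j) * T j x) x = (\<Sum>j\<in>I. complex_of_real (c j) * laplacian (T j) x)"
      if "finite I" for I c
      using that
    proof (induction I rule: finite_induct)
      case empty
      then show ?case by (simp add: laplacian_eq_pd)
    next
      case (insert i I)
      then show ?case
        by (simp add: laplacian_add laplacian_cmult Ck_on_cmult Ck_on_sum TC)
    qed
    have LT: "complex_of_real (?c j * (y \<bullet> y) ^ j) * laplacian (T j) x = complex_of_real (A j + B j)" for j
      unfolding T_def laplacian_monomial[OF x] unfolding A_def B_def of_real_mult[symmetric]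
      by (rule arg_cong[of _ _ complex_of_real]) (simp add: algebra_simps)
    have "(\<Sum>j\<le>n. A j + B j) = A n" if "n \<le> k div 2" for n
      using that
    proof (induction n)
      case 0
      then show ?case by (simp add: B_def)
    next
      case (Suc n)
      define D where "D = real (2 * n + 2) * (real (2 * (k - 2 * (n + 1))) + real (2 * n) + real DIM('a))"
      have "D > 0" unfolding D_def using DIM_positive[where 'a='a] by (intro mult_pos_pos add_nonneg_pos) auto
      then have cD: "?c (Suc n) * D = - (real (k - 2 * n) * real (k - 2 * n - 1)) * ?c n"
        unfolding gegenbauer_coeff.simps D_def[symmetric] by simp
      have "B (Suc n) = (?c (Suc n) * D) * (y \<bullet> y) ^ Suc n * (norm x) ^ (2 * n) * (x \<bullet> y) ^ (k - 2 * Suc n)"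
      proof -
        have D': "real (2 * Suc n) * (real DIM('a) + 2 * real (k - 2 * Suc n) + 2 * real (Suc n) - 2) = D"
        proof -
          define X where "X = k - 2 * (n + 1)"
          have "k - 2 * Suc n = X" by (simp add: X_def)
          then show ?thesis unfolding D_def X_def[symmetric] by (simp add: algebra_simps)
        qed
        show ?thesis unfolding B_def D' by (simp only: diff_Suc_1 ac_simps)
      qed
      also have "\<dots> = - A n" unfolding cD A_def by simp
      finally show ?case using Suc by simp
    qed
    from this[of "k div 2"] have "(\<Sum>j\<le>k div 2. A j + B j) = A (k div 2)" by simp
    also have "A (k div 2) = 0"
    proof -
      have "k - 2 * (k div 2) = 0 \<or> k - 2 * (k div 2) - 1 = 0" by linarith
      then show ?thesis unfolding A_def by auto
    qed
    finally have AB: "(\<Sum>j\<le>k div 2. A j + B j) = 0" .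
    have "laplacian (gegenbauer k y) x = complex_of_real (\<Sum>j\<le>k div 2. A j + B j)"
      unfolding g lsum[OF finite_atMost] LT by simp
    then show ?thesis unfolding AB by simp
  qed
  have "laplacian (gegenbauer k y) 0 = 0"
  proof -
    have "continuous_on UNIV (laplacian (gegenbauer k y))" by (rule continuous_on_laplacian[OF C2])
    then have "(laplacian (gegenbauer k y) \<longlongrightarrow> laplacian (gegenbauer k y) 0) (at 0)"
      by (simp add: continuous_on_def)
    moreover have "(laplacian (gegenbauer k y) \<longlongrightarrow> 0) (at 0)"
      by (rule tendsto_eventually) (auto simp: eventually_at_filter lap0)
    ultimately show ?thesis by (rule tendsto_unique[rotated]) simp
  qed
  with lap0 have "laplacian (gegenbauer k y) x = 0" for x by (cases "x = 0") auto
  then show ?thesis unfolding solid_harmonic_def using poly hom by auto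
qed

text \<open>
  Products of exponentials are exponentials and exponentials separate points, so the
  Stone-Weierstrass theorem applies to their sums.
\<close>

inductive exp_sum :: "('a::euclidean_space \<Rightarrow> real) \<Rightarrow> bool" where
  exp_sum_exp: "exp_sum (\<lambda>x. c * exp (x \<bullet> y))"
| exp_sum_add: "exp_sum f \<Longrightarrow> exp_sum g \<Longrightarrow> exp_sum (\<lambda>x. f x + g x)"

lemma exp_sum_mult:
  assumes "exp_sum f" "exp_sum g"
  shows "exp_sum (\<lambda>x. f x * g x)"
  using assms(1)
proof induction
  case (exp_sum_exp c y)
  show ?case using assms(2)
  proof induction
    case (exp_sum_exp c' y')
    have "(\<lambda>x. c * exp (x \<bullet> y) * (c' * exp (x \<bullet> y'))) = (\<lambda>x. (c * c') * exp (x \<bullet> (y + y')))"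
      by (auto simp: inner_add_right exp_add)
    then show ?case by (simp only: exp_sum.exp_sum_exp)
  next
    case (exp_sum_add f g)
    then show ?case using exp_sum.exp_sum_add by (fastforce simp: distrib_left)
  qed
next
  case (exp_sum_add f1 f2)
  then show ?case using exp_sum.exp_sum_add by (fastforce simp: distrib_right)
qed

lemma exp_sum_continuous: "exp_sum f \<Longrightarrow> continuous_on A f"
  by (induction rule: exp_sum.induct) (auto intro!: continuous_intros)

lemma exp_sum_function_ring: "function_ring_on (Collect exp_sum) (sphere 0 1 :: 'a::euclidean_space set)"
proof
  show "(\<lambda>_. c) \<in> Collect (exp_sum :: ('a \<Rightarrow> real) \<Rightarrow> bool)" for c
    using exp_sum_exp[of c "0::'a"] by simp
  show "\<exists>f\<in>Collect exp_sum. f x \<noteq> f y" if "x \<noteq> y" for x y :: 'a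
  proof (rule bexI)
    have "(x - y) \<bullet> (x - y) \<noteq> 0" using that by simp
    then show "1 * exp (x \<bullet> (x - y)) \<noteq> 1 * exp (y \<bullet> (x - y))"
      by (simp add: inner_diff_left)
    show "(\<lambda>z. 1 * exp (z \<bullet> (x - y))) \<in> Collect exp_sum" using exp_sum_exp by blast
  qed
qed (auto intro: exp_sum_continuous exp_sum_mult exp_sum_add)

text \<open>
  The cone over the set where \<open>\<psi>\<close> does not vanish is open, and an open set of measure zero is empty.
\<close>

lemma sphere_AE_zero_imp_zero:
  fixes \<psi> :: "'a::euclidean_space \<Rightarrow> complex"
  assumes \<psi>: "continuous_on (sphere 0 1) \<psi>" and ae: "AE \<xi> in sphere_measure. \<psi> \<xi> = 0" and \<xi>: "norm \<xi> = 1"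
  shows "\<psi> \<xi> = 0"
proof (rule ccontr)
  assume nz: "\<psi> \<xi> \<noteq> 0"
  let ?N = "{\<xi>\<in>sphere 0 1. \<psi> \<xi> \<noteq> 0}"
  have mN: "?N \<in> sets (restrict_space borel (sphere 0 1))"
    using measurable_sets[OF borel_measurable_continuous_on_restrict[OF \<psi>], of "- {0}"]
    by (auto simp: space_restrict_space vimage_def Int_def conj_commute)
  have "emeasure sphere_measure ?N = 0"
    using ae mN by (subst (asm) AE_iff_measurable[of ?N]) (auto simp: sets_sphere_measure)
  then have "emeasure lborel (cone_over 1 ?N) = 0"
    using emeasure_sphere_measure[OF mN] by simp
  then have "negligible (cone_over 1 ?N)"
    using cone_over_measurable[OF mN] by (auto simp: negligible_iff_null_sets null_sets_def)
  moreover have "open (cone_over 1 ?N)"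
  proof -
    have c: "continuous_on (- {0}) (\<lambda>x. \<psi> (x /\<^sub>R norm x))"
      by (intro continuous_on_compose2[OF \<psi>] continuous_intros) (auto, metis left_inverse norm_eq_zero)
    have "open (- {0} \<inter> (\<lambda>x. \<psi> (x /\<^sub>R norm x)) -` (- {0}))"
      by (rule continuous_open_preimage[OF c]) auto
    then have "open (- {0} \<inter> (\<lambda>x. \<psi> (x /\<^sub>R norm x)) -` (- {0}) \<inter> ball 0 1)" by auto
    also have "- {0} \<inter> (\<lambda>x. \<psi> (x /\<^sub>R norm x)) -` (- {0}) \<inter> ball 0 1 = cone_over 1 ?N"
      by (auto simp: cone_over_def field_simps)
    finally show ?thesis .
  qed
  moreover have "(1/2) *\<^sub>R \<xi> \<in> cone_over 1 ?N" using nz \<xi> by (auto simp: cone_over_def)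
  ultimately show False using open_not_negligible by blast
qed

text \<open>
  Orthogonality to the harmonics \<open>gegenbauer k y\<close> is, degree by degree, orthogonality to the powers
  \<open>(\<xi> \<bullet> y)\<^sup>k\<close>, hence to the exponentials \<open>exp (\<xi> \<bullet> y)\<close>, whose span is dense by the
  Stone-Weierstrass theorem.
\<close>

theorem spherical_harmonics_complete:
  fixes \<psi> :: "'a::euclidean_space \<Rightarrow> complex"
  assumes \<psi>: "continuous_on (sphere 0 1) \<psi>"
    and orth: "\<And>m h. spherical_harmonic m h \<Longrightarrow> (\<integral>\<xi>. h \<xi> * \<psi> \<xi> \<partial>sphere_measure) = 0"
    and \<xi>: "norm \<xi> = 1"
  shows "\<psi> \<xi> = 0"
proof -
  have i: "integrable sphere_measure (\<lambda>\<xi>. f \<xi> * \<psi> \<xi>)" if "continuous_on (sphere 0 1) f" for f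
    by (intro integrable_sphere_continuous continuous_intros \<psi> that)
  have pow: "(\<integral>\<xi>. complex_of_real ((\<xi> \<bullet> y) ^ k) * \<psi> \<xi> \<partial>sphere_measure) = 0" for k y
  proof (induction k rule: less_induct)
    case (less k)
    let ?c = "\<lambda>j. gegenbauer_coeff DIM('a) k j * (y \<bullet> y) ^ j"
    have "spherical_harmonic k (gegenbauer k y)"
      using gegenbauer_solid_harmonic[of k y] unfolding solid_harmonic_def spherical_harmonic_def by blast
    then have "0 = (\<integral>\<xi>. gegenbauer k y \<xi> * \<psi> \<xi> \<partial>sphere_measure)" using orth by simp
    also have "\<dots> = (\<integral>\<xi>. (\<Sum>j\<le>k div 2. of_real (?c j) * (complex_of_real ((\<xi> \<bullet> y) ^ (k - 2 * j)) * \<psi> \<xi>)) \<partial>sphere_measure)"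
      by (intro Bochner_Integration.integral_cong)
        (auto simp: gegenbauer_def sum_distrib_right power2_norm_eq_inner[symmetric] intro!: sum.cong)
    also have "\<dots> = (\<Sum>j\<le>k div 2. of_real (?c j) * (\<integral>\<xi>. complex_of_real ((\<xi> \<bullet> y) ^ (k - 2 * j)) * \<psi> \<xi> \<partial>sphere_measure))"
      by (subst Bochner_Integration.integral_sum)
        (auto intro!: integrable_mult_right i continuous_intros simp del: of_real_power)
    also have "\<dots> = (\<Sum>j\<le>k div 2. if j = 0 then (\<integral>\<xi>. complex_of_real ((\<xi> \<bullet> y) ^ k) * \<psi> \<xi> \<partial>sphere_measure) else 0)"
    proof (rule sum.cong)
      fix j assume "j \<in> {..k div 2}"
      then have "k - 2 * j < k" if "j \<noteq> 0" using that by auto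
      then show "of_real (?c j) * (\<integral>\<xi>. complex_of_real ((\<xi> \<bullet> y) ^ (k - 2 * j)) * \<psi> \<xi> \<partial>sphere_measure) =
        (if j = 0 then (\<integral>\<xi>. complex_of_real ((\<xi> \<bullet> y) ^ k) * \<psi> \<xi> \<partial>sphere_measure) else 0)"
        using less.IH[of "k - 2 * j"] by (cases "j = 0") (auto simp del: of_real_power)
    qed simp
    also have "\<dots> = (\<integral>\<xi>. complex_of_real ((\<xi> \<bullet> y) ^ k) * \<psi> \<xi> \<partial>sphere_measure)"
      by simp
    finally show ?case by simp
  qed
  have ex: "(\<integral>\<xi>. complex_of_real (exp (\<xi> \<bullet> y)) * \<psi> \<xi> \<partial>sphere_measure) = 0" for y
  proof -
    let ?S = "\<lambda>N \<xi>. (\<Sum>k<N. complex_of_real (1 / fact k) * (complex_of_real ((\<xi> \<bullet> y) ^ k) * \<psi> \<xi>))"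
    have S: "?S N \<xi> = complex_of_real (\<Sum>k<N. (\<xi> \<bullet> y) ^ k / fact k) * \<psi> \<xi>" for N \<xi>
      by (simp add: sum_distrib_right)
    have Sc: "continuous_on (sphere 0 1) (?S N)" for N by (intro continuous_intros \<psi>)
    have "(\<lambda>N. \<integral>\<xi>. ?S N \<xi> \<partial>sphere_measure) \<longlonglongrightarrow> (\<integral>\<xi>. complex_of_real (exp (\<xi> \<bullet> y)) * \<psi> \<xi> \<partial>sphere_measure)"
    proof (rule integral_dominated_convergence[where w="\<lambda>\<xi>. exp (norm y) * norm (\<psi> \<xi>)"])
      show "(\<lambda>\<xi>. complex_of_real (exp (\<xi> \<bullet> y)) * \<psi> \<xi>) \<in> borel_measurable sphere_measure"
        by (intro measurable_continuous_sphere continuous_intros \<psi>)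
      show "?S N \<in> borel_measurable sphere_measure" for N
        by (rule measurable_continuous_sphere[OF Sc])
      show "integrable sphere_measure (\<lambda>\<xi>. exp (norm y) * norm (\<psi> \<xi>))"
        by (intro integrable_sphere_continuous continuous_intros \<psi>)
      show "AE \<xi> in sphere_measure. (\<lambda>N. ?S N \<xi>) \<longlonglongrightarrow> complex_of_real (exp (\<xi> \<bullet> y)) * \<psi> \<xi>"
      proof (rule AE_I2)
        fix \<xi> :: 'a
        have "(\<lambda>k. (\<xi> \<bullet> y) ^ k / fact k) sums exp (\<xi> \<bullet> y)"
          using exp_converges[of "\<xi> \<bullet> y"] by (simp add: divide_inverse_commute)
        then show "(\<lambda>N. ?S N \<xi>) \<longlonglongrightarrow> complex_of_real (exp (\<xi> \<bullet> y)) * \<psi> \<xi>"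
          unfolding S sums_def by (intro tendsto_intros)
      qed
      show "AE \<xi> in sphere_measure. norm (?S N \<xi>) \<le> exp (norm y) * norm (\<psi> \<xi>)" for N
      proof (rule AE_I2)
        fix \<xi> :: 'a assume "\<xi> \<in> space sphere_measure"
        then have n: "\<bar>\<xi> \<bullet> y\<bar> \<le> norm y" using Cauchy_Schwarz_ineq2[of \<xi> y] by simp
        have sm: "(\<lambda>k. norm y ^ k / fact k) sums exp (norm y)"
          using exp_converges[of "norm y"] by (simp add: divide_inverse_commute)
        have "\<bar>\<Sum>k<N. (\<xi> \<bullet> y) ^ k / fact k\<bar> \<le> (\<Sum>k<N. norm y ^ k / fact k)"
          by (rule order_trans[OF sum_abs], rule sum_mono)
            (auto simp: power_abs intro!: divide_right_mono power_mono n)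
        also have "\<dots> \<le> exp (norm y)"
          by (subst sums_unique[OF sm], rule sum_le_suminf) (use sm in \<open>auto simp: sums_iff\<close>)
        finally show "norm (?S N \<xi>) \<le> exp (norm y) * norm (\<psi> \<xi>)"
          unfolding S norm_mult norm_of_real by (intro mult_right_mono) auto
      qed
    qed
    moreover have "(\<integral>\<xi>. ?S N \<xi> \<partial>sphere_measure) = 0" for N
      by (subst Bochner_Integration.integral_sum)
        (auto intro!: integrable_mult_right i continuous_intros simp: pow simp del: of_real_power of_real_divide)
    ultimately show ?thesis using LIMSEQ_unique[OF tendsto_const] by fastforce
  qed
  have es: "(\<integral>\<xi>. complex_of_real (f \<xi>) * \<psi> \<xi> \<partial>sphere_measure) = 0" if "exp_sum f" for f
    using that
  proof induction
    case (exp_sum_exp c y)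
    then show ?case using ex[of y] by (simp add: mult.assoc)
  next
    case (exp_sum_add f g)
    have if': "integrable sphere_measure (\<lambda>\<xi>. complex_of_real (f \<xi>) * \<psi> \<xi>)"
        "integrable sphere_measure (\<lambda>\<xi>. complex_of_real (g \<xi>) * \<psi> \<xi>)"
      using exp_sum_add.hyps by (auto intro!: i continuous_on_of_real exp_sum_continuous)
    show ?case
      using Bochner_Integration.integral_add[OF if'] exp_sum_add.IH by (simp add: distrib_right)
  qed
  have cont: "(\<integral>\<xi>. complex_of_real (f \<xi>) * \<psi> \<xi> \<partial>sphere_measure) = 0" if f: "continuous_on (sphere 0 1) f" for f
  proof -
    let ?I = "\<integral>\<xi>. complex_of_real (f \<xi>) * \<psi> \<xi> \<partial>sphere_measure"
    let ?N = "\<integral>\<xi>. norm (\<psi> \<xi>) \<partial>sphere_measure"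
    have iN: "integrable sphere_measure (\<lambda>\<xi>. norm (\<psi> \<xi>))" by (intro integrable_sphere_continuous continuous_intros \<psi>)
    have E: "norm ?I \<le> e * ?N" if "e > 0" for e
    proof -
      interpret function_ring_on "Collect exp_sum" "sphere 0 1 :: 'a set" by (rule exp_sum_function_ring)
      obtain g where g: "exp_sum g" "\<And>x. norm x = 1 \<Longrightarrow> \<bar>f x - g x\<bar> < e"
        using Stone_Weierstrass_basic[OF f \<open>e > 0\<close>] by auto
      have gc: "continuous_on (sphere 0 1) g" by (rule exp_sum_continuous[OF g(1)])
      have "?I = (\<integral>\<xi>. complex_of_real (f \<xi>) * \<psi> \<xi> \<partial>sphere_measure) - (\<integral>\<xi>. complex_of_real (g \<xi>) * \<psi> \<xi> \<partial>sphere_measure)"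
        using es[OF g(1)] by simp
      also have "\<dots> = (\<integral>\<xi>. complex_of_real (f \<xi> - g \<xi>) * \<psi> \<xi> \<partial>sphere_measure)"
      proof -
        have "(\<integral>\<xi>. complex_of_real (f \<xi>) * \<psi> \<xi> \<partial>sphere_measure) - (\<integral>\<xi>. complex_of_real (g \<xi>) * \<psi> \<xi> \<partial>sphere_measure)
          = (\<integral>\<xi>. complex_of_real (f \<xi>) * \<psi> \<xi> - complex_of_real (g \<xi>) * \<psi> \<xi> \<partial>sphere_measure)"
          by (intro Bochner_Integration.integral_diff[symmetric] i continuous_on_of_real f gc)
        then show ?thesis by (simp add: left_diff_distrib)
      qed
      also have "norm \<dots> \<le> (\<integral>\<xi>. e * norm (\<psi> \<xi>) \<partial>sphere_measure)"
      proof (rule order_trans[OF integral_norm_bound], rule integral_mono)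
        show "norm (complex_of_real (f \<xi> - g \<xi>) * \<psi> \<xi>) \<le> e * norm (\<psi> \<xi>)" if "\<xi> \<in> space sphere_measure" for \<xi>
          unfolding norm_mult norm_of_real using g(2)[of \<xi>] that by (intro mult_right_mono) auto
        show "integrable sphere_measure (\<lambda>\<xi>. norm (complex_of_real (f \<xi> - g \<xi>) * \<psi> \<xi>))"
          by (intro integrable_norm i continuous_intros f gc)
        show "integrable sphere_measure (\<lambda>\<xi>. e * norm (\<psi> \<xi>))"
          by (intro integrable_mult_right iN)
      qed
      finally show ?thesis by simp
    qed
    have "norm ?I \<le> 0"
    proof (rule field_le_epsilon)
      fix e :: real assume e: "e > 0"
      have N0: "?N \<ge> 0" by simp
      have "norm ?I \<le> e / (?N + 1) * ?N" by (rule E) (intro divide_pos_pos e add_nonneg_pos N0 zero_less_one)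
      also have "\<dots> \<le> e"
      proof -
        have "e * ?N \<le> e * (?N + 1)" using e by (intro mult_left_mono) auto
        moreover have "?N + 1 > 0" using N0 by linarith
        ultimately show ?thesis by (simp only: times_divide_eq_left pos_divide_le_eq)
      qed
      finally show "norm ?I \<le> 0 + e" by simp
    qed
    then show ?thesis by simp
  qed
  have cRe: "continuous_on (sphere 0 1) (\<lambda>\<xi>. Re (\<psi> \<xi>))" and cIm: "continuous_on (sphere 0 1) (\<lambda>\<xi>. Im (\<psi> \<xi>))"
    by (intro continuous_intros \<psi>)+
  have "(\<integral>\<xi>. complex_of_real ((norm (\<psi> \<xi>))\<^sup>2) \<partial>sphere_measure) =
    (\<integral>\<xi>. complex_of_real (Re (\<psi> \<xi>)) * \<psi> \<xi> - \<i> * (complex_of_real (Im (\<psi> \<xi>)) * \<psi> \<xi>) \<partial>sphere_measure)"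
  proof (rule Bochner_Integration.integral_cong[OF refl])
    fix \<xi> :: 'a
    have "cnj (\<psi> \<xi>) = complex_of_real (Re (\<psi> \<xi>)) - \<i> * complex_of_real (Im (\<psi> \<xi>))"
      by (simp add: complex_eq_iff)
    then show "complex_of_real ((norm (\<psi> \<xi>))\<^sup>2) =
        complex_of_real (Re (\<psi> \<xi>)) * \<psi> \<xi> - \<i> * (complex_of_real (Im (\<psi> \<xi>)) * \<psi> \<xi>)"
      unfolding complex_norm_square by (simp only: ring_distribs ac_simps)
  qed
  also have "\<dots> = 0"
    by (subst Bochner_Integration.integral_diff)
      (auto intro!: i integrable_mult_right continuous_intros \<psi> simp: cont[OF cRe] cont[OF cIm])
  finally have "(\<integral>\<xi>. (norm (\<psi> \<xi>))\<^sup>2 \<partial>sphere_measure) = 0"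
    by (simp only: integral_complex_of_real of_real_eq_0_iff)
  moreover have "integrable sphere_measure (\<lambda>\<xi>. (norm (\<psi> \<xi>))\<^sup>2)"
    by (intro integrable_sphere_continuous continuous_intros \<psi>)
  ultimately have "AE \<xi> in sphere_measure. (norm (\<psi> \<xi>))\<^sup>2 = 0"
    by (subst (asm) integral_nonneg_eq_0_iff_AE) auto
  then have "AE \<xi> in sphere_measure. \<psi> \<xi> = 0" by simp
  then show ?thesis by (rule sphere_AE_zero_imp_zero[OF \<psi> _ \<xi>])
qed

section \<open>Expansion of smooth functions\<close>

lemma Ck_on_laplacian:
  assumes "open S" "Ck_on (Suc (Suc k)) S u"
  shows "Ck_on k S (laplacian u)"
  unfolding laplacian_eq_pd[abs_def] using assms by (intro Ck_on_sum) auto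

text \<open>The spherical Laplacian, computed on the extension that is constant along rays.\<close>

definition spherical_laplacian :: "('a::euclidean_space \<Rightarrow> complex) \<Rightarrow> 'a \<Rightarrow> complex" where
  "spherical_laplacian \<phi> = laplacian (\<lambda>x. \<phi> (x /\<^sub>R norm x))"

lemma smooth_on_sphereD:
  assumes "smooth_on_sphere \<phi>"
  shows "Ck_on k (- {0}) (\<lambda>x. \<phi> (x /\<^sub>R norm x))"
  using assms unfolding smooth_on_sphere_def smooth_on_def by blast

lemma smooth_on_sphere_continuous:
  assumes "smooth_on_sphere \<phi>"
  shows "continuous_on (sphere 0 1) \<phi>"
proof (rule continuous_on_eq)
  show "continuous_on (sphere 0 1) (\<lambda>x. \<phi> (x /\<^sub>R norm x))"
    by (rule continuous_on_subset[OF Ck_on_imp_continuous[OF smooth_on_sphereD[OF assms]]]) auto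
qed auto

lemma spherical_laplacian_scale:
  assumes \<phi>: "smooth_on_sphere \<phi>" and t: "t > 0" and x: "x \<noteq> 0"
  shows "spherical_laplacian \<phi> (t *\<^sub>R x) = 1 / of_real (t\<^sup>2) * spherical_laplacian \<phi> x"
proof -
  have "(t *\<^sub>R x) /\<^sub>R norm (t *\<^sub>R x) = x /\<^sub>R norm x" for x :: 'a
    using t by (simp add: field_simps)
  then show ?thesis
    unfolding spherical_laplacian_def
    by (intro laplacian_scale[OF smooth_on_sphereD[OF \<phi>] _ t x, of 1]) (simp only: mult_1)
qed

text \<open>
  The Laplacian of a function that is constant along rays is homogeneous of degree -2, so
  multiplication by \<open>|x|\<^sup>2\<close> makes it constant along rays again.
\<close>

lemma smooth_on_sphere_spherical_laplacian:
  assumes \<phi>: "smooth_on_sphere \<phi>"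
  shows "smooth_on_sphere (spherical_laplacian \<phi>)"
  unfolding smooth_on_sphere_def smooth_on_def
proof
  fix k
  have op: "open (- {0::'a})" by auto
  have "Ck_on k (- {0}) (\<lambda>x. complex_of_real ((norm x)\<^sup>2) * spherical_laplacian \<phi> x)"
    unfolding spherical_laplacian_def
    by (intro Ck_on_mult Ck_on_norm_square Ck_on_laplacian op smooth_on_sphereD \<phi>)
  then show "Ck_on k (- {0}) (\<lambda>x. spherical_laplacian \<phi> (x /\<^sub>R norm x))"
  proof (rule Ck_on_cong[OF op, rotated])
    fix x :: 'a assume "x \<in> - {0}"
    then have "x \<noteq> 0" by simp
    then show "complex_of_real ((norm x)\<^sup>2) * spherical_laplacian \<phi> x = spherical_laplacian \<phi> (x /\<^sub>R norm x)"
      using spherical_laplacian_scale[OF \<phi>, of "inverse (norm x)" x] by (simp add: field_simps)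
  qed
qed

lemma integral_spherical_laplacian:
  fixes \<phi> :: "'a::euclidean_space \<Rightarrow> complex"
  assumes d: "3 \<le> DIM('a)" and \<phi>: "smooth_on_sphere \<phi>" and h: "spherical_harmonic m h"
  shows "(\<integral>\<xi>. h \<xi> * spherical_laplacian \<phi> \<xi> \<partial>sphere_measure) =
    - of_nat (m * (m + DIM('a) - 2)) * (\<integral>\<xi>. h \<xi> * \<phi> \<xi> \<partial>sphere_measure)"
proof -
  obtain p where p: "solid_harmonic m p" "\<And>\<xi>. norm \<xi> = 1 \<Longrightarrow> h \<xi> = p \<xi>"
    using spherical_harmonicE[OF h] by metis
  have op: "open (- {0::'a})" by auto
  have "(\<integral>\<xi>. p \<xi> * spherical_laplacian \<phi> \<xi> \<partial>sphere_measure) =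
    (of_nat 0 - of_nat m) * of_nat (0 + m + DIM('a) - 2) * (\<integral>\<xi>. p \<xi> * \<phi> (\<xi> /\<^sub>R norm \<xi>) \<partial>sphere_measure)"
  proof (rule sphere_integral_laplacian[OF d])
    show "Ck_on 2 (- {0}) (\<lambda>\<xi>. \<phi> (\<xi> /\<^sub>R norm \<xi>))" by (rule smooth_on_sphereD[OF \<phi>])
    fix t :: real and x :: 'a assume tx: "t > 0" "norm x = 1"
    then have "x \<noteq> 0" by auto
    then show "laplacian (\<lambda>\<xi>. \<phi> (\<xi> /\<^sub>R norm \<xi>)) (t *\<^sub>R x) = (t ^ 0 / t\<^sup>2) *\<^sub>R spherical_laplacian \<phi> x"
      using spherical_laplacian_scale[OF \<phi> tx(1), of x]
      by (simp add: spherical_laplacian_def scaleR_conv_of_real)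
  qed (use solid_harmonicD[OF p(1)] op in auto)
  moreover have "(\<integral>\<xi>. p \<xi> * \<phi> (\<xi> /\<^sub>R norm \<xi>) \<partial>sphere_measure) = (\<integral>\<xi>. h \<xi> * \<phi> \<xi> \<partial>sphere_measure)"
    "(\<integral>\<xi>. p \<xi> * spherical_laplacian \<phi> \<xi> \<partial>sphere_measure) = (\<integral>\<xi>. h \<xi> * spherical_laplacian \<phi> \<xi> \<partial>sphere_measure)"
    by (auto intro!: Bochner_Integration.integral_cong simp: p(2))
  ultimately show ?thesis by simp
qed

lemma smooth_on_sphere_iterate:
  "smooth_on_sphere \<phi> \<Longrightarrow> smooth_on_sphere ((spherical_laplacian ^^ N) \<phi>)"
  by (induction N) (auto intro: smooth_on_sphere_spherical_laplacian)

locale harmonic_basis =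
  fixes n :: "nat \<Rightarrow> nat" and Y :: "nat \<Rightarrow> nat \<Rightarrow> 'a::euclidean_space \<Rightarrow> complex"
  assumes dim: "3 \<le> DIM('a)"
    and basis: "\<And>m. orthonormal_basis_spherical_harmonics m (n m) (Y m)"
begin

lemma Y_harmonic: "j < n m \<Longrightarrow> spherical_harmonic m (Y m j)"
  using basis[of m] unfolding orthonormal_basis_spherical_harmonics_def by blast

lemma Y_continuous: "j < n m \<Longrightarrow> A \<subseteq> sphere 0 1 \<Longrightarrow> continuous_on A (Y m j)"
  by (rule spherical_harmonic_continuous[OF Y_harmonic])

lemma Y_orthonormal:
  assumes "i < n m" "j < n k"
  shows "(\<integral>\<xi>. Y m i \<xi> * cnj (Y k j \<xi>) \<partial>sphere_measure) = (if (m, i) = (k, j) then 1 else 0)"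
proof (cases "m = k")
  case True
  then show ?thesis using basis[of m] assms unfolding orthonormal_basis_spherical_harmonics_def by auto
next
  case False
  then show ?thesis using spherical_harmonics_orthogonal[OF dim Y_harmonic Y_harmonic] assms by simp
qed

lemma Y_span:
  assumes "spherical_harmonic m h"
  obtains c where "\<And>\<xi>. norm \<xi> = 1 \<Longrightarrow> h \<xi> = (\<Sum>j<n m. c j * Y m j \<xi>)"
  using basis[of m] assms unfolding orthonormal_basis_spherical_harmonics_def by force

lemma zonal_growth:
  obtains A :: real where "A \<ge> 0"
    "\<And>m \<xi> \<zeta>. norm \<xi> = 1 \<Longrightarrow> norm \<zeta> = 1 \<Longrightarrow> (\<Sum>j<n m. norm (Y m j \<xi>) * norm (Y m j \<zeta>)) \<le> A * real (m + 1) ^ (2 * DIM('a))"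
proof -
  obtain A :: real where A: "A \<ge> 0" and B: "\<And>m \<zeta>. norm \<zeta> = 1 \<Longrightarrow> (\<Sum>j<n m. (norm (Y m j \<zeta>))\<^sup>2) \<le> A * real (m + 1) ^ (2 * DIM('a))"
    using zonal_diagonal_bound[OF dim] basis by metis
  show ?thesis by (rule that[OF A]) (rule zonal_bound[OF B])
qed

text \<open>
  The pairing of measures with functions is bilinear, which decides where conjugates stand:
  \<open>proj m \<phi> \<zeta>\<close> is the integral of \<open>\<phi> \<xi>\<close> against the zonal harmonic \<open>Z\<^sub>m(\<xi>, \<zeta>)\<close> in its first variable, the
  transpose of the action of a measure on the second one.
\<close>

definition coeff :: "nat \<Rightarrow> nat \<Rightarrow> ('a \<Rightarrow> complex) \<Rightarrow> complex" where
  "coeff m j \<phi> = (\<integral>\<xi>. Y m j \<xi> * \<phi> \<xi> \<partial>sphere_measure)"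

definition proj :: "nat \<Rightarrow> ('a \<Rightarrow> complex) \<Rightarrow> 'a \<Rightarrow> complex" where
  "proj m \<phi> \<zeta> = (\<Sum>j<n m. cnj (Y m j \<zeta>) * coeff m j \<phi>)"

lemma proj_continuous: "A \<subseteq> sphere 0 1 \<Longrightarrow> continuous_on A (proj m \<phi>)"
  unfolding proj_def by (intro continuous_intros Y_continuous) auto

lemma proj_bound:
  assumes \<phi>: "continuous_on (sphere 0 1) \<phi>" and A: "\<And>\<xi>. norm \<xi> = 1 \<Longrightarrow> (\<Sum>j<n m. norm (Y m j \<xi>) * norm (Y m j \<zeta>)) \<le> B"
  shows "norm (proj m \<phi> \<zeta>) \<le> B * (\<integral>\<xi>. norm (\<phi> \<xi>) \<partial>sphere_measure)"
proof -
  have i: "integrable sphere_measure (\<lambda>\<xi>. norm (Y m j \<xi>) * norm (\<phi> \<xi>))" if "j < n m" for j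
    using that by (intro integrable_sphere_continuous continuous_intros Y_continuous \<phi>) auto
  have i0: "integrable sphere_measure (\<lambda>\<xi>. norm (\<phi> \<xi>))"
    by (intro integrable_sphere_continuous continuous_intros \<phi>)
  have "norm (proj m \<phi> \<zeta>) \<le> (\<Sum>j<n m. norm (Y m j \<zeta>) * (\<integral>\<xi>. norm (Y m j \<xi>) * norm (\<phi> \<xi>) \<partial>sphere_measure))"
    unfolding proj_def coeff_def
  proof (rule order_trans[OF norm_sum], rule sum_mono)
    fix j
    have "norm (\<integral>\<xi>. Y m j \<xi> * \<phi> \<xi> \<partial>sphere_measure) \<le> (\<integral>\<xi>. norm (Y m j \<xi>) * norm (\<phi> \<xi>) \<partial>sphere_measure)"
      by (rule order_trans[OF integral_norm_bound]) (simp add: norm_mult)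
    then show "norm (cnj (Y m j \<zeta>) * (\<integral>\<xi>. Y m j \<xi> * \<phi> \<xi> \<partial>sphere_measure))
      \<le> norm (Y m j \<zeta>) * (\<integral>\<xi>. norm (Y m j \<xi>) * norm (\<phi> \<xi>) \<partial>sphere_measure)"
      unfolding norm_mult complex_mod_cnj by (intro mult_left_mono) auto
  qed
  also have "\<dots> = (\<integral>\<xi>. (\<Sum>j<n m. norm (Y m j \<zeta>) * (norm (Y m j \<xi>) * norm (\<phi> \<xi>))) \<partial>sphere_measure)"
    using i by (subst Bochner_Integration.integral_sum) auto
  also have "\<dots> \<le> (\<integral>\<xi>. B * norm (\<phi> \<xi>) \<partial>sphere_measure)"
  proof (rule integral_mono)
    show "integrable sphere_measure (\<lambda>\<xi>. \<Sum>j<n m. norm (Y m j \<zeta>) * (norm (Y m j \<xi>) * norm (\<phi> \<xi>)))"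
      using i by (intro Bochner_Integration.integrable_sum integrable_mult_right) auto
    show "integrable sphere_measure (\<lambda>\<xi>. B * norm (\<phi> \<xi>))" using i0 by (rule integrable_mult_right)
    fix \<xi> :: 'a assume "\<xi> \<in> space sphere_measure"
    then have "(\<Sum>j<n m. norm (Y m j \<xi>) * norm (Y m j \<zeta>)) * norm (\<phi> \<xi>) \<le> B * norm (\<phi> \<xi>)"
      by (intro mult_right_mono A) auto
    then show "(\<Sum>j<n m. norm (Y m j \<zeta>) * (norm (Y m j \<xi>) * norm (\<phi> \<xi>))) \<le> B * norm (\<phi> \<xi>)"
      by (simp add: sum_distrib_right sum_distrib_left ac_simps)
  qed
  finally show ?thesis by simp
qed

lemma coeff_iterate:
  assumes "smooth_on_sphere \<phi>" "j < n m"
  shows "coeff m j ((spherical_laplacian ^^ N) \<phi>) = (- of_nat (m * (m + DIM('a) - 2))) ^ N * coeff m j \<phi>"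
proof (induction N)
  case (Suc N)
  then show ?case
    using integral_spherical_laplacian[OF dim smooth_on_sphere_iterate[OF assms(1), of N] Y_harmonic[OF assms(2)]]
    unfolding coeff_def by simp
qed simp

text \<open>
  A smooth function on the sphere and the \<open>N\<close>-th power of the spherical Laplacian of it have the
  same projections up to the factor \<open>(- m (m + d - 2)) ^ N\<close>, which beats the growth of the zonal
  harmonics if \<open>N\<close> is large.
\<close>

lemma proj_summable:
  assumes \<phi>: "smooth_on_sphere \<phi>"
  obtains M where "summable M" "\<And>m \<zeta>. norm \<zeta> = 1 \<Longrightarrow> norm (proj m \<phi> \<zeta>) \<le> M m"
proof -
  obtain A where A: "A \<ge> 0"
    "\<And>m \<xi> \<zeta>. norm \<xi> = 1 \<Longrightarrow> norm \<zeta> = 1 \<Longrightarrow> (\<Sum>j<n m. norm (Y m j \<xi>) * norm (Y m j \<zeta>)) \<le> A * real (m + 1) ^ (2 * DIM('a))"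
    using zonal_growth by metis
  \<comment> \<open>The zonal harmonics grow at most like \<open>m ^ (2 d)\<close>; dividing by \<open>m ^ (2 N)\<close> leaves \<open>1 / m\<^sup>2\<close>.\<close>
  define N where "N = DIM('a) + 1"
  define \<theta> where "\<theta> = (spherical_laplacian ^^ N) \<phi>"
  have c: "continuous_on (sphere 0 1) \<phi>" "continuous_on (sphere 0 1) \<theta>"
    unfolding \<theta>_def using \<phi> by (auto intro!: smooth_on_sphere_continuous smooth_on_sphere_iterate)
  define J0 where "J0 = (\<integral>\<xi>. norm (\<phi> \<xi>) \<partial>sphere_measure)"
  define J where "J = (\<integral>\<xi>. norm (\<theta> \<xi>) \<partial>sphere_measure)"
  have J: "J0 \<ge> 0" "J \<ge> 0" unfolding J0_def J_def by auto
  define M where "M m = (if m = 0 then A * J0 else A * J * 2 ^ N * (inverse (real (Suc m)))\<^sup>2)" for m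
  have "summable (\<lambda>m. A * J * 2 ^ N * (inverse (real (Suc m)))\<^sup>2)"
    by (intro summable_mult) (use inverse_squares_sums[THEN sums_summable] in \<open>simp add: field_simps\<close>)
  then have "summable M"
    by (rule summable_cong[THEN iffD1, rotated]) (auto simp: M_def eventually_sequentially intro!: exI[of _ 1])
  moreover have "norm (proj m \<phi> \<zeta>) \<le> M m" if \<zeta>: "norm \<zeta> = 1" for m \<zeta>
  proof (cases "m = 0")
    case True
    then show ?thesis
      using proj_bound[OF c(1) A(2)[OF _ \<zeta>], of m] by (simp add: M_def J0_def)
  next
    case False
    define lam where "lam = m * (m + DIM('a) - 2)"
    have "proj m \<theta> \<zeta> = (- of_nat lam) ^ N * proj m \<phi> \<zeta>"
      unfolding proj_def \<theta>_def lam_def by (simp add: coeff_iterate[OF \<phi>] sum_distrib_left ac_simps)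
    then have e: "norm (proj m \<theta> \<zeta>) = real lam ^ N * norm (proj m \<phi> \<zeta>)"
      by (simp add: norm_mult norm_power)
    have "m * (m + 1) \<le> lam" unfolding lam_def using dim by (intro mult_le_mono) auto
    then have "real m * (real m + 1) \<le> real lam" by (metis of_nat_1 of_nat_add of_nat_le_iff of_nat_mult)
    moreover have "(real m + 1) * (real m + 1) \<le> (2 * real m) * (real m + 1)"
      using False by (intro mult_right_mono) auto
    ultimately have "(real m + 1) * (real m + 1) \<le> 2 * real lam" by (simp only: mult.assoc)
    then have l: "(real (m + 1))\<^sup>2 \<le> 2 * real lam" by (simp add: power2_eq_square add.commute)
    have "(real (m + 1)) ^ (2 * DIM('a)) * (real (m + 1))\<^sup>2 * norm (proj m \<phi> \<zeta>) = ((real (m + 1))\<^sup>2) ^ N * norm (proj m \<phi> \<zeta>)"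
      unfolding N_def by (simp only: power_add power_mult power_one_right)
    also have "\<dots> \<le> (2 * real lam) ^ N * norm (proj m \<phi> \<zeta>)"
      by (intro mult_right_mono power_mono l) auto
    also have "\<dots> = 2 ^ N * norm (proj m \<theta> \<zeta>)" unfolding e by (simp add: power_mult_distrib)
    also have "\<dots> \<le> 2 ^ N * (A * real (m + 1) ^ (2 * DIM('a)) * J)"
      unfolding J_def by (intro mult_left_mono proj_bound[OF c(2) A(2)[OF _ \<zeta>]]) auto
    also have "\<dots> = (real (m + 1)) ^ (2 * DIM('a)) * (A * J * 2 ^ N)" by simp
    finally have "(real (m + 1)) ^ (2 * DIM('a)) * ((real (m + 1))\<^sup>2 * norm (proj m \<phi> \<zeta>))
      \<le> (real (m + 1)) ^ (2 * DIM('a)) * (A * J * 2 ^ N)" by (simp only: mult.assoc)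
    then have "(real (m + 1))\<^sup>2 * norm (proj m \<phi> \<zeta>) \<le> A * J * 2 ^ N"
      by (rule mult_left_le_imp_le) simp
    then have "norm (proj m \<phi> \<zeta>) \<le> A * J * 2 ^ N / (real (m + 1))\<^sup>2"
      by (simp add: pos_le_divide_eq mult.commute)
    then show ?thesis using False unfolding M_def by (simp add: field_simps power_inverse)
  qed
  ultimately show ?thesis by (rule that)
qed

text \<open>
  The series converges uniformly, so its sum is continuous and has the same coefficients as \<open>\<phi>\<close>. By
  completeness the difference vanishes.
\<close>

theorem harmonic_expansion:
  assumes \<phi>: "smooth_on_sphere \<phi>" and \<zeta>: "norm \<zeta> = 1"
  shows "(\<lambda>m. proj m \<phi> \<zeta>) sums \<phi> \<zeta>"
proof -
  obtain M where M: "summable M" "\<And>m \<zeta>. norm \<zeta> = 1 \<Longrightarrow> norm (proj m \<phi> \<zeta>) \<le> M m"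
    using proj_summable[OF \<phi>] by metis
  have \<phi>c: "continuous_on (sphere 0 1) \<phi>" by (rule smooth_on_sphere_continuous[OF \<phi>])
  have sm: "summable (\<lambda>m. norm (proj m \<phi> \<xi>))" if "norm \<xi> = 1" for \<xi>
    by (rule summable_comparison_test'[OF M(1)]) (use M(2) that in auto)
  define S where "S \<xi> = (\<Sum>m. proj m \<phi> \<xi>)" for \<xi>
  have "uniform_limit (sphere 0 1) (\<lambda>N \<xi>. \<Sum>m<N. proj m \<phi> \<xi>) S sequentially"
    unfolding S_def by (rule Weierstrass_m_test[OF _ M(1)]) (use M(2) in auto)
  then have Sc: "continuous_on (sphere 0 1) S"
    by (rule uniform_limit_theorem[rotated]) (auto intro!: always_eventually continuous_intros proj_continuous)
  have YS: "(\<integral>\<xi>. Y m i \<xi> * S \<xi> \<partial>sphere_measure) = coeff m i \<phi>" if i: "i < n m" for m i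
  proof -
    have "compact (Y m i ` sphere 0 1)" by (intro compact_continuous_image Y_continuous i) auto
    then obtain B where "\<And>y. y \<in> Y m i ` sphere 0 1 \<Longrightarrow> norm y \<le> B"
      using compact_imp_bounded bounded_iff by metis
    then have B: "norm (Y m i \<xi>) \<le> B" if "norm \<xi> = 1" for \<xi> using that by auto
    have ii: "integrable sphere_measure (\<lambda>\<xi>. Y m i \<xi> * proj k \<phi> \<xi>)" for k
      by (intro integrable_sphere_continuous continuous_intros Y_continuous proj_continuous i) auto
    have bd: "norm (Y m i \<xi> * proj k \<phi> \<xi>) \<le> B * M k" if "norm \<xi> = 1" for k \<xi>
      unfolding norm_mult by (intro mult_mono B M(2) that) (use B[OF that] norm_ge_zero order_trans in blast)+
    have "(\<integral>\<xi>. Y m i \<xi> * S \<xi> \<partial>sphere_measure) = (\<integral>\<xi>. (\<Sum>k. Y m i \<xi> * proj k \<phi> \<xi>) \<partial>sphere_measure)"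
      unfolding S_def using sm
      by (intro Bochner_Integration.integral_cong refl suminf_mult[symmetric]) (auto intro: summable_norm_cancel)
    also have "\<dots> = (\<Sum>k. \<integral>\<xi>. Y m i \<xi> * proj k \<phi> \<xi> \<partial>sphere_measure)"
    proof (rule integral_suminf[OF ii])
      show "AE \<xi> in sphere_measure. summable (\<lambda>k. norm (Y m i \<xi> * proj k \<phi> \<xi>))"
        by (rule AE_I2, rule summable_comparison_test'[OF summable_mult[OF M(1), of B]]) (use bd in auto)
      show "summable (\<lambda>k. \<integral>\<xi>. norm (Y m i \<xi> * proj k \<phi> \<xi>) \<partial>sphere_measure)"
      proof (rule summable_comparison_test'[OF summable_mult[OF summable_mult[OF M(1), of B], of "measure sphere_measure (sphere 0 1 :: 'a set)"]])
        fix k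
        have "(\<integral>\<xi>. norm (Y m i \<xi> * proj k \<phi> \<xi>) \<partial>sphere_measure) \<le> (\<integral>\<xi>. B * M k \<partial>(sphere_measure :: 'a measure))"
          by (intro integral_mono integrable_norm ii finite_measure.integrable_const bd) auto
        then show "norm (\<integral>\<xi>. norm (Y m i \<xi> * proj k \<phi> \<xi>) \<partial>sphere_measure) \<le> measure sphere_measure (sphere 0 1 :: 'a set) * (B * M k)"
          by simp
      qed
    qed
    also have "(\<lambda>k. \<integral>\<xi>. Y m i \<xi> * proj k \<phi> \<xi> \<partial>sphere_measure) = (\<lambda>k. if k = m then coeff m i \<phi> else 0)"
    proof
      fix k
      have "(\<integral>\<xi>. Y m i \<xi> * proj k \<phi> \<xi> \<partial>sphere_measure) =
        (\<integral>\<xi>. (\<Sum>j<n k. (Y m i \<xi> * cnj (Y k j \<xi>)) * coeff k j \<phi>) \<partial>sphere_measure)"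
        unfolding proj_def by (simp add: sum_distrib_left mult.assoc)
      also have "\<dots> = (\<Sum>j<n k. (if (m, i) = (k, j) then 1 else 0) * coeff k j \<phi>)"
        by (subst Bochner_Integration.integral_sum)
          (auto simp: Y_orthonormal[OF i] intro!: integrable_mult_left integrable_sphere_continuous continuous_intros Y_continuous i)
      also have "\<dots> = (if k = m then coeff m i \<phi> else 0)"
        using i by (auto simp: if_distrib[of "\<lambda>x. x * _"] cong: if_cong)
      finally show "(\<integral>\<xi>. Y m i \<xi> * proj k \<phi> \<xi> \<partial>sphere_measure) = (if k = m then coeff m i \<phi> else 0)" .
    qed
    also have "(\<Sum>k. if k = m then coeff m i \<phi> else 0) = coeff m i \<phi>"
      using sums_single[of m "\<lambda>_. coeff m i \<phi>"] by (simp add: sums_iff)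
    finally show ?thesis .
  qed
  have "\<phi> \<zeta> - S \<zeta> = 0"
  proof (rule spherical_harmonics_complete[OF _ _ \<zeta>])
    show "continuous_on (sphere 0 1) (\<lambda>\<zeta>. \<phi> \<zeta> - S \<zeta>)" by (intro continuous_intros \<phi>c Sc)
    fix m and h :: "'a \<Rightarrow> complex" assume "spherical_harmonic m h"
    then obtain c where c: "\<And>\<xi>. norm \<xi> = 1 \<Longrightarrow> h \<xi> = (\<Sum>j<n m. c j * Y m j \<xi>)"
      using Y_span by blast
    have i1: "integrable sphere_measure (\<lambda>\<xi>. Y m j \<xi> * \<phi> \<xi>)" "integrable sphere_measure (\<lambda>\<xi>. Y m j \<xi> * S \<xi>)" if "j < n m" for j
      by (intro integrable_sphere_continuous continuous_intros Y_continuous \<phi>c Sc that order_refl)+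
    have "(\<integral>\<xi>. h \<xi> * (\<phi> \<xi> - S \<xi>) \<partial>sphere_measure) =
      (\<integral>\<xi>. (\<Sum>j<n m. c j * (Y m j \<xi> * \<phi> \<xi> - Y m j \<xi> * S \<xi>)) \<partial>sphere_measure)"
    proof (intro Bochner_Integration.integral_cong refl)
      fix \<xi> :: 'a assume "\<xi> \<in> space sphere_measure"
      then have "h \<xi> * (\<phi> \<xi> - S \<xi>) = (\<Sum>j<n m. c j * Y m j \<xi>) * (\<phi> \<xi> - S \<xi>)" by (simp add: c)
      also have "\<dots> = (\<Sum>j<n m. c j * (Y m j \<xi> * \<phi> \<xi> - Y m j \<xi> * S \<xi>))"
        unfolding sum_distrib_right by (intro sum.cong refl) (simp add: algebra_simps)
      finally show "h \<xi> * (\<phi> \<xi> - S \<xi>) = (\<Sum>j<n m. c j * (Y m j \<xi> * \<phi> \<xi> - Y m j \<xi> * S \<xi>))" .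
    qed
    also have "\<dots> = (\<Sum>j<n m. c j * (\<integral>\<xi>. Y m j \<xi> * \<phi> \<xi> - Y m j \<xi> * S \<xi> \<partial>sphere_measure))"
      using i1 by (subst Bochner_Integration.integral_sum) auto
    also have "\<dots> = 0"
      using i1 YS by (intro sum.neutral) (auto simp: coeff_def)
    finally show "(\<integral>\<xi>. h \<xi> * (\<phi> \<xi> - S \<xi>) \<partial>sphere_measure) = 0" .
  qed
  then have "S \<zeta> = \<phi> \<zeta>" by simp
  then show ?thesis unfolding S_def using summable_sums[OF summable_norm_cancel[OF sm[OF \<zeta>]]] by simp
qed

end

section \<open>Radial functions\<close>

text \<open>
  These iterated integrals produce the factorials in the Neumann series. For continuous \<open>w\<close> the
  identity is the substitution \<open>dW = w ds\<close>. In general it follows from Fubini's theorem on the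
  triangle \<open>t < s < r\<close>.
\<close>

lemma integral_power_of_primitive:
  fixes w :: "real \<Rightarrow> real"
  assumes w: "integrable lborel w" "\<And>s. 0 \<le> w s"
  defines "W \<equiv> \<lambda>r. \<integral>s. indicator {..<r} s * w s \<partial>lborel"
  shows "integrable lborel (\<lambda>s. indicator {..<r} s * (w s * W s ^ k))"
    and "(\<integral>s. indicator {..<r} s * (w s * W s ^ k) \<partial>lborel) = W r ^ Suc k / real (Suc k)"
proof -
  have [measurable]: "w \<in> borel_measurable borel" using w(1) by auto
  have iw: "integrable lborel (\<lambda>s. indicator A s * w s)" if "A \<in> sets borel" for A
    using integrable_mult_indicator[OF _ w(1), of A] that by simp
  have W0: "0 \<le> W r" for r
    unfolding W_def by (intro integral_nonneg_AE AE_I2) (auto simp: w(2))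
  have W1: "W r \<le> integral\<^sup>L lborel w" for r
    unfolding W_def by (intro integral_mono iw w) (auto simp: indicator_def w(2))
  have [measurable]: "W \<in> borel_measurable borel"
    unfolding W_def
  proof (rule lborel.borel_measurable_lebesgue_integral)
    have "(\<lambda>(r, s). indicator {..<r} s * w s) = (\<lambda>z. if snd z < fst z then w (snd z) else 0)"
      by (auto simp: indicator_def)
    then show "(\<lambda>(r, s). indicator {..<r} s * w s) \<in> borel_measurable (borel \<Otimes>\<^sub>M lborel)" by simp
  qed
  define C where "C = integral\<^sup>L lborel w"
  have WC: "\<bar>W r ^ k\<bar> \<le> C ^ k" for r k
    unfolding power_abs C_def using W0 W1 by (intro power_mono) auto
  have iwk: "integrable lborel (\<lambda>s. indicator {..<r} s * (w s * W s ^ k))" for r k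
  proof (rule Bochner_Integration.integrable_bound)
    show "integrable lborel (\<lambda>s. C ^ k * w s)" using w(1) by simp
    show "AE s in lborel. norm (indicator {..<r} s * (w s * W s ^ k)) \<le> norm (C ^ k * w s)"
    proof (rule AE_I2)
      fix s
      have "\<bar>w s * W s ^ k\<bar> \<le> w s * C ^ k"
        unfolding abs_mult using WC[of s k] w(2)[of s] by (simp add: mult_left_mono)
      also have "\<dots> \<le> \<bar>C ^ k * w s\<bar>" by (simp add: mult.commute)
      finally show "norm (indicator {..<r} s * (w s * W s ^ k)) \<le> norm (C ^ k * w s)"
        by (auto simp: indicator_def)
    qed
  qed measurable
  show "integrable lborel (\<lambda>s. indicator {..<r} s * (w s * W s ^ k))" by (rule iwk)
  show "(\<integral>s. indicator {..<r} s * (w s * W s ^ k) \<partial>lborel) = W r ^ Suc k / real (Suc k)"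
  proof (induction k arbitrary: r)
    case 0
    then show ?case by (simp add: W_def)
  next
    case (Suc k)
    let ?I = "\<lambda>k r. \<integral>s. indicator {..<r} s * (w s * W s ^ k) \<partial>lborel"
    let ?g = "\<lambda>s t. indicator {..<r} s * w s * (indicator {..<s} t * (w t * W t ^ k))"
    have ig: "integrable (lborel \<Otimes>\<^sub>M lborel) (case_prod ?g)"
    proof (rule Bochner_Integration.integrable_bound)
      show "integrable (lborel \<Otimes>\<^sub>M lborel) (\<lambda>(s, t). w s * (C ^ k * w t))"
      proof (rule lborel_pair.Fubini_integrable)
        have "(\<lambda>s. \<integral>t. norm (case (s, t) of (s, t) \<Rightarrow> w s * (C ^ k * w t)) \<partial>lborel) = (\<lambda>s. w s * (\<integral>t. \<bar>C ^ k * w t\<bar> \<partial>lborel))"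
          by (simp add: abs_mult w(2))
        then show "integrable lborel (\<lambda>s. \<integral>t. norm (case (s, t) of (s, t) \<Rightarrow> w s * (C ^ k * w t)) \<partial>lborel)"
          using w(1) by simp
        show "AE s in lborel. integrable lborel (\<lambda>t. case (s, t) of (s, t) \<Rightarrow> w s * (C ^ k * w t))"
          using w(1) by simp
      qed measurable
      show "AE z in lborel \<Otimes>\<^sub>M lborel. norm (case_prod ?g z) \<le> norm (case z of (s, t) \<Rightarrow> w s * (C ^ k * w t))"
      proof (rule AE_I2, clarify)
        fix s t
        have "\<bar>w t * W t ^ k\<bar> \<le> \<bar>C ^ k * w t\<bar>"
          unfolding abs_mult using WC[of t k] w(2)[of t] by (simp add: mult_left_mono mult.commute)
        then have "\<bar>w s\<bar> * \<bar>w t * W t ^ k\<bar> \<le> \<bar>w s\<bar> * \<bar>C ^ k * w t\<bar>" by (intro mult_left_mono) auto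
        then show "norm (?g s t) \<le> norm (w s * (C ^ k * w t))"
          by (auto simp: indicator_def abs_mult)
      qed
      have "case_prod ?g = (\<lambda>z. (if fst z < r then w (fst z) else 0) * (if snd z < fst z then w (snd z) * W (snd z) ^ k else 0))"
        by (auto simp: indicator_def fun_eq_iff)
      then show "case_prod ?g \<in> borel_measurable (lborel \<Otimes>\<^sub>M lborel)" by simp
    qed
    have "?I (Suc k) r = (\<integral>s. real (Suc k) * (\<integral>t. ?g s t \<partial>lborel) \<partial>lborel)"
    proof (rule Bochner_Integration.integral_cong[OF refl])
      fix s
      have "(\<integral>t. ?g s t \<partial>lborel) = indicator {..<r} s * w s * (W s ^ Suc k / real (Suc k))"
        using Suc[of s] by (simp only: integral_mult_right_zero)
      then show "indicator {..<r} s * (w s * W s ^ Suc k) = real (Suc k) * (\<integral>t. ?g s t \<partial>lborel)"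
        by (simp only: ) (simp add: field_simps)
    qed
    also have "\<dots> = real (Suc k) * (\<integral>t. (\<integral>s. ?g s t \<partial>lborel) \<partial>lborel)"
      using lborel_pair.Fubini_integral[OF ig] by simp
    also have "(\<integral>t. (\<integral>s. ?g s t \<partial>lborel) \<partial>lborel) = (\<integral>t. W r * (indicator {..<r} t * (w t * W t ^ k)) - indicator {..<r} t * (w t * W t ^ Suc k) \<partial>lborel)"
    proof (rule Bochner_Integration.integral_cong[OF refl])
      fix t
      have "(\<integral>s. ?g s t \<partial>lborel) = (\<integral>s. (indicator {t<..<r} s * w s) * (w t * W t ^ k) \<partial>lborel)"
        by (intro Bochner_Integration.integral_cong) (auto simp: indicator_def)
      also have "\<dots> = (\<integral>s. indicator {t<..<r} s * w s \<partial>lborel) * (w t * W t ^ k)" by simp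
      also have "(\<integral>s. indicator {t<..<r} s * w s \<partial>lborel) = indicator {..<r} t * (W r - W t)"
      proof (cases "t < r")
        case True
        have "(\<integral>s. indicator {t<..<r} s * w s \<partial>lborel) = (\<integral>s. indicator {..<r} s * w s - indicator {..<t} s * w s \<partial>lborel)"
          by (rule integral_cong_AE)
            (use AE_lborel_singleton[of t] True in \<open>auto simp: indicator_def elim!: eventually_mono\<close>)
        then show ?thesis using True iw by (simp add: W_def)
      qed (auto simp: indicator_def)
      finally show "(\<integral>s. ?g s t \<partial>lborel) = W r * (indicator {..<r} t * (w t * W t ^ k)) - indicator {..<r} t * (w t * W t ^ Suc k)"
        by (simp add: algebra_simps)
    qed
    also have "\<dots> = W r * ?I k r - ?I (Suc k) r"
      unfolding Bochner_Integration.integral_diff[OF integrable_mult_right[OF iwk] iwk]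
      by (simp only: integral_mult_right_zero)
    finally have "(1 + real (Suc k)) * ?I (Suc k) r = real (Suc k) * (W r * ?I k r)"
      by (simp only: ring_distribs)
    also have "\<dots> = W r ^ Suc (Suc k)" unfolding Suc by (simp del: of_nat_Suc)
    finally show ?case by (simp add: field_simps)
  qed
qed

text \<open>
  For \<open>0 < s < r\<close> the value is \<open>s / \<nu> * (1 - (s / r) ^ \<nu>)\<close>, and the maximum in the denominator makes it
  vanish for \<open>s \<ge> r\<close>, so integrals against this kernel may run over the whole line.
\<close>

definition radial_kernel :: "nat \<Rightarrow> real \<Rightarrow> real \<Rightarrow> real" where
  "radial_kernel \<nu> r s = s / \<nu> * (1 - (s / max s r) ^ \<nu>)"

text \<open>
  The solution operator of \<open>(r ^ (\<nu> + 1) y')' = r ^ (\<nu> + 1) w\<close> with \<open>y = 0\<close> at the origin. For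
  \<open>\<nu> = 2 m + d - 2\<close> this is the radial equation behind \<open>\<Delta>(y(|x|) p(x)) = w(|x|) p(x)\<close> for a harmonic
  homogeneous polynomial \<open>p\<close> of degree \<open>m\<close>.
\<close>

definition radial_op :: "nat \<Rightarrow> (real \<Rightarrow> complex) \<Rightarrow> real \<Rightarrow> complex" where
  "radial_op \<nu> w r = (\<integral>s. of_real (radial_kernel \<nu> r s) * w s \<partial>lborel)"

text \<open>
  The right-hand sides for which the solution operator converges absolutely: its kernel is at most
  \<open>s / \<nu>\<close>. They are extended by zero to the line.
\<close>

definition radial_source :: "(real \<Rightarrow> complex) \<Rightarrow> bool" where
  "radial_source w \<longleftrightarrow> w \<in> borel_measurable borel \<and> (\<forall>s. s \<notin> {0<..<1} \<longrightarrow> w s = 0) \<and>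
     integrable lborel (\<lambda>s. s * norm (w s))"

lemma radial_source_eq_0: "radial_source w \<Longrightarrow> s \<notin> {0<..<1} \<Longrightarrow> w s = 0"
  unfolding radial_source_def by blast

lemma radial_source_nonneg:
  assumes "radial_source w"
  shows "0 \<le> s * norm (w s)"
  using radial_source_eq_0[OF assms, of s] by (cases "s \<in> {0<..<1}") auto

lemma radial_kernel_bounds:
  assumes "s > 0" "\<nu> \<ge> 1"
  shows "0 \<le> radial_kernel \<nu> r s" "radial_kernel \<nu> r s \<le> s / \<nu>" "r \<le> s \<Longrightarrow> radial_kernel \<nu> r s = 0"
proof -
  have m: "max s r > 0" using assms(1) by simp
  have q: "0 \<le> s / max s r" "s / max s r \<le> 1" using assms(1) m by (auto simp: pos_divide_le_eq)
  have p: "0 \<le> (s / max s r) ^ \<nu>" "(s / max s r) ^ \<nu> \<le> 1" using q by (auto intro: power_le_one)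
  show "0 \<le> radial_kernel \<nu> r s" unfolding radial_kernel_def using assms p by (intro mult_nonneg_nonneg) auto
  show "radial_kernel \<nu> r s \<le> s / \<nu>" unfolding radial_kernel_def using assms p by (intro mult_left_le) auto
  show "radial_kernel \<nu> r s = 0" if "r \<le> s" using that assms by (simp add: radial_kernel_def max_def)
qed

lemma radial_op_integrand_bound:
  assumes "radial_source w" "\<nu> \<ge> 1"
  shows "norm (of_real (radial_kernel \<nu> r s) * w s) \<le> indicator {..<r} s * (s * norm (w s)) / \<nu>"
    "norm (of_real (radial_kernel \<nu> r s) * w s) \<le> s * norm (w s)"
proof -
  have "norm (of_real (radial_kernel \<nu> r s) * w s) \<le> indicator {..<r} s * (s * norm (w s)) / \<nu>
      \<and> norm (of_real (radial_kernel \<nu> r s) * w s) \<le> s * norm (w s)"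
  proof (cases "s \<in> {0<..<1}")
    case True
    have k: "0 \<le> radial_kernel \<nu> r s" "radial_kernel \<nu> r s \<le> s / \<nu>" "r \<le> s \<Longrightarrow> radial_kernel \<nu> r s = 0"
      using radial_kernel_bounds[of s \<nu> r] True assms(2) by auto
    have "\<bar>radial_kernel \<nu> r s\<bar> \<le> indicator {..<r} s * s / \<nu>" using k by (cases "s < r") auto
    from mult_right_mono[OF this norm_ge_zero[of "w s"]]
    have 1: "norm (of_real (radial_kernel \<nu> r s) * w s) \<le> indicator {..<r} s * (s * norm (w s)) / \<nu>"
      unfolding norm_mult norm_of_real by simp
    have "s / \<nu> \<le> s" using True assms(2) by (simp add: pos_divide_le_eq)
    then have "\<bar>radial_kernel \<nu> r s\<bar> \<le> s" using k by auto
    from mult_right_mono[OF this norm_ge_zero[of "w s"]] show ?thesis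
      using 1 unfolding norm_mult norm_of_real by simp
  next
    case False
    then have "w s = 0" using assms(1) unfolding radial_source_def by blast
    then show ?thesis by simp
  qed
  then show "norm (of_real (radial_kernel \<nu> r s) * w s) \<le> indicator {..<r} s * (s * norm (w s)) / \<nu>"
    "norm (of_real (radial_kernel \<nu> r s) * w s) \<le> s * norm (w s)" by auto
qed

lemma radial_op_integrable:
  assumes "radial_source w" "\<nu> \<ge> 1"
  shows "integrable lborel (\<lambda>s. of_real (radial_kernel \<nu> r s) * w s)"
proof (rule Bochner_Integration.integrable_bound)
  show "integrable lborel (\<lambda>s. s * norm (w s))" using assms(1) by (simp add: radial_source_def)
  have [measurable]: "w \<in> borel_measurable borel" using assms(1) by (simp add: radial_source_def)
  show "(\<lambda>s. of_real (radial_kernel \<nu> r s) * w s) \<in> borel_measurable lborel"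
    unfolding radial_kernel_def by measurable
  show "AE s in lborel. norm (of_real (radial_kernel \<nu> r s) * w s) \<le> norm (s * norm (w s))"
    by (rule AE_I2) (use radial_op_integrand_bound(2)[OF assms] order_trans[OF _ abs_ge_self] in fastforce)
qed

lemma radial_op_bound:
  assumes "radial_source w" "\<nu> \<ge> 1"
  shows "norm (radial_op \<nu> w r) \<le> (\<integral>s. indicator {..<r} s * (s * norm (w s)) \<partial>lborel) / \<nu>"
proof -
  have i: "integrable lborel (\<lambda>s. indicator {..<r} s * (s * norm (w s)) / \<nu>)"
    using integrable_mult_indicator[of "{..<r}" lborel "\<lambda>s. s * norm (w s)"] assms(1)
    by (simp add: radial_source_def)
  have "norm (radial_op \<nu> w r) \<le> (\<integral>s. indicator {..<r} s * (s * norm (w s)) / \<nu> \<partial>lborel)"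
    unfolding radial_op_def
    by (rule order_trans[OF integral_norm_bound], rule integral_mono[OF integrable_norm[OF radial_op_integrable[OF assms]] i])
      (rule radial_op_integrand_bound(1)[OF assms])
  then show ?thesis by simp
qed

lemma radial_op_measurable [measurable]:
  assumes "radial_source w"
  shows "radial_op \<nu> w \<in> borel_measurable borel"
proof -
  have [measurable]: "w \<in> borel_measurable borel" using assms(1) by (simp add: radial_source_def)
  show ?thesis unfolding radial_op_def
    by (rule lborel.borel_measurable_lebesgue_integral) (unfold radial_kernel_def, measurable)
qed

lemma radial_op_continuous:
  assumes w: "radial_source w" and \<nu>: "\<nu> \<ge> 1"
  shows "continuous_on {0..} (radial_op \<nu> w)"
  unfolding continuous_on_sequentially o_def
proof (intro ballI allI impI, elim conjE)
  fix r :: real and x :: "nat \<Rightarrow> real"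
  assume r: "r \<in> {0..}" and x: "\<forall>i. x i \<in> {0..}" "x \<longlonglongrightarrow> r"
  have [measurable]: "w \<in> borel_measurable borel" using w by (simp add: radial_source_def)
  show "(\<lambda>i. radial_op \<nu> w (x i)) \<longlonglongrightarrow> radial_op \<nu> w r"
    unfolding radial_op_def
  proof (rule integral_dominated_convergence[where w="\<lambda>s. s * norm (w s)"])
    show "integrable lborel (\<lambda>s. s * norm (w s))" using w by (simp add: radial_source_def)
    show "AE s in lborel. norm (of_real (radial_kernel \<nu> (x i) s) * w s) \<le> s * norm (w s)" for i
      by (rule AE_I2) (rule radial_op_integrand_bound(2)[OF w \<nu>])
    show "AE s in lborel. (\<lambda>i. of_real (radial_kernel \<nu> (x i) s) * w s) \<longlonglongrightarrow> of_real (radial_kernel \<nu> r s) * w s"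
    proof (rule AE_I2)
      fix s
      show "(\<lambda>i. of_real (radial_kernel \<nu> (x i) s) * w s) \<longlonglongrightarrow> of_real (radial_kernel \<nu> r s) * w s"
      proof (cases "s \<in> {0<..<1}")
        case True
        then have "max s r \<noteq> 0" by auto
        then show ?thesis unfolding radial_kernel_def using x(2) by (intro tendsto_intros)
      next
        case False
        then have "w s = 0" using w unfolding radial_source_def by blast
        then show ?thesis by simp
      qed
    qed
  qed (unfold radial_kernel_def, measurable)
qed

lemma radial_source_mult:
  assumes "radial_source w" "f \<in> borel_measurable borel" "\<And>s. norm (f s) \<le> B"
  shows "radial_source (\<lambda>s. w s * f s)"
  unfolding radial_source_def
proof (intro conjI allI impI)
  have [measurable]: "w \<in> borel_measurable borel" using assms(1) by (simp add: radial_source_def)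
  note assms(2) [measurable]
  show "(\<lambda>s. w s * f s) \<in> borel_measurable borel" by measurable
  show "integrable lborel (\<lambda>s. s * norm (w s * f s))"
  proof (rule Bochner_Integration.integrable_bound)
    show "integrable lborel (\<lambda>s. B * (s * norm (w s)))" using assms(1) by (simp add: radial_source_def)
    show "AE s in lborel. norm (s * norm (w s * f s)) \<le> norm (B * (s * norm (w s)))"
    proof (rule AE_I2)
      fix s
      have "norm (f s) * \<bar>s * norm (w s)\<bar> \<le> \<bar>B\<bar> * \<bar>s * norm (w s)\<bar>"
        using assms(3)[of s] by (intro mult_right_mono) auto
      then show "norm (s * norm (w s * f s)) \<le> norm (B * (s * norm (w s)))"
        by (simp add: norm_mult abs_mult ac_simps)
    qed
  qed measurable
qed (use assms(1) in \<open>auto simp: radial_source_def\<close>)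

text \<open>
  The terms of the Neumann series for \<open>y\<close>, divided by \<open>r powr (l + 1)\<close>, with \<open>\<nu> = 2 l + 1\<close>.
\<close>

primrec radial_ratio :: "nat \<Rightarrow> (real \<Rightarrow> complex) \<Rightarrow> nat \<Rightarrow> real \<Rightarrow> complex" where
  "radial_ratio \<nu> V 0 r = 1"
| "radial_ratio \<nu> V (Suc k) r = radial_op \<nu> (\<lambda>s. V s * radial_ratio \<nu> V k s) r"

definition normalized_solution :: "nat \<Rightarrow> (real \<Rightarrow> complex) \<Rightarrow> real \<Rightarrow> complex" where
  "normalized_solution \<nu> V r = (\<Sum>k. radial_ratio \<nu> V k r)"

text \<open>
  Every application of the solution operator contributes a factor \<open>1 / \<nu>\<close> and an integration against
  the density \<open>s |V(s)| ds\<close>; the \<open>k\<close>-fold iterated integral has the usual factor \<open>1 / fact k\<close>.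
\<close>

lemma radial_ratio_bound:
  assumes V: "radial_source V" and \<nu>: "\<nu> \<ge> 1"
  shows "norm (radial_ratio \<nu> V k r) \<le> ((\<integral>s. indicator {..<r} s * (s * norm (V s)) \<partial>lborel) / \<nu>) ^ k / fact k
    \<and> radial_ratio \<nu> V k \<in> borel_measurable borel"
proof (induction k arbitrary: r)
  case 0
  then show ?case by simp
next
  case (Suc k)
  define w where "w s = s * norm (V s)" for s
  define W where "W r = (\<integral>s. indicator {..<r} s * w s \<partial>lborel)" for r
  have w: "integrable lborel w" "\<And>s. 0 \<le> w s"
  proof -
    show "integrable lborel w" using V by (simp add: radial_source_def w_def[abs_def])
    show "0 \<le> w s" for s unfolding w_def by (rule radial_source_nonneg[OF V])
  qed
  have W0: "0 \<le> W r" for r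
    unfolding W_def by (intro integral_nonneg_AE AE_I2) (auto simp: w(2))
  have W1: "W r \<le> integral\<^sup>L lborel w" for r
    unfolding W_def using integrable_mult_indicator[OF _ w(1), of "{..<r}"]
    by (intro integral_mono w) (auto simp: indicator_def w(2))
  have IH: "norm (radial_ratio \<nu> V k s) \<le> (W s / \<nu>) ^ k / fact k" and m: "radial_ratio \<nu> V k \<in> borel_measurable borel" for s
    using Suc unfolding W_def w_def by auto
  have src: "radial_source (\<lambda>s. V s * radial_ratio \<nu> V k s)"
  proof (rule radial_source_mult[OF V m])
    fix s
    have "(W s / \<nu>) ^ k / fact k \<le> (integral\<^sup>L lborel w / \<nu>) ^ k / fact k"
      using W0 W1 by (intro divide_right_mono power_mono) auto
    then show "norm (radial_ratio \<nu> V k s) \<le> (integral\<^sup>L lborel w / \<nu>) ^ k / fact k" using IH[of s] by linarith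
  qed
  have "norm (radial_ratio \<nu> V (Suc k) r) \<le> (\<integral>s. indicator {..<r} s * (s * norm (V s * radial_ratio \<nu> V k s)) \<partial>lborel) / \<nu>"
    using radial_op_bound[OF src \<nu>] by simp
  also have "\<dots> \<le> (\<integral>s. indicator {..<r} s * (w s * W s ^ k) / (\<nu> ^ k * fact k) \<partial>lborel) / \<nu>"
  proof (intro divide_right_mono integral_mono)
    show "integrable lborel (\<lambda>s. indicator {..<r} s * (s * norm (V s * radial_ratio \<nu> V k s)))"
      using integrable_mult_indicator[of "{..<r}" lborel "\<lambda>s. s * norm (V s * radial_ratio \<nu> V k s)"] src
      by (simp add: radial_source_def)
    show "integrable lborel (\<lambda>s. indicator {..<r} s * (w s * W s ^ k) / (\<nu> ^ k * fact k))"
      unfolding W_def by (intro integrable_divide integral_power_of_primitive(1)[OF w])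
    fix s
    have "w s * norm (radial_ratio \<nu> V k s) \<le> w s * ((W s / \<nu>) ^ k / fact k)"
      by (intro mult_left_mono IH w)
    then show "indicator {..<r} s * (s * norm (V s * radial_ratio \<nu> V k s)) \<le> indicator {..<r} s * (w s * W s ^ k) / (\<nu> ^ k * fact k)"
      by (auto simp: indicator_def norm_mult w_def power_divide)
  qed auto
  also have "\<dots> = (W r ^ Suc k / real (Suc k)) / (\<nu> ^ k * fact k) / \<nu>"
    using integral_power_of_primitive(2)[OF w, of r k] unfolding W_def by simp
  also have "\<dots> = (W r / \<nu>) ^ Suc k / fact (Suc k)"
    by (simp add: power_divide)
  finally show ?case
    using radial_op_measurable[OF src] unfolding W_def w_def by simp
qed

text \<open>
  The series is dominated by the exponential series in \<open>C / \<nu>\<close>, which gives both a bound that does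
  not depend on \<open>\<nu>\<close> and the convergence to 1 as \<open>\<nu>\<close> grows. Summing the recursion for its terms yields
  the integral equation.
\<close>

lemma normalized_solution:
  assumes V: "radial_source V" and \<nu>: "\<nu> \<ge> 1"
  defines "C \<equiv> \<integral>s. s * norm (V s) \<partial>lborel"
  shows "summable (\<lambda>k. norm (radial_ratio \<nu> V k r))"
    and "norm (normalized_solution \<nu> V r) \<le> exp C"
    and "norm (normalized_solution \<nu> V r - 1) \<le> exp (C / \<nu>) - 1"
    and "normalized_solution \<nu> V \<in> borel_measurable borel"
    and "radial_source (\<lambda>s. V s * normalized_solution \<nu> V s)"
    and "normalized_solution \<nu> V r = 1 + radial_op \<nu> (\<lambda>s. V s * normalized_solution \<nu> V s) r"
    and "continuous_on {0..} (normalized_solution \<nu> V)"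
proof -
  have Vi: "integrable lborel (\<lambda>s. s * norm (V s))" using V by (simp add: radial_source_def)
  note V0 = radial_source_nonneg[OF V]
  have C0: "0 \<le> C" unfolding C_def by (intro integral_nonneg_AE AE_I2 V0)
  have b: "norm (radial_ratio \<nu> V k r) \<le> (C / \<nu>) ^ k / fact k" for k r
  proof -
    have "(\<integral>s. indicator {..<r} s * (s * norm (V s)) \<partial>lborel) \<le> C"
      unfolding C_def using integrable_mult_indicator[OF _ Vi, of "{..<r}"]
      by (intro integral_mono Vi) (auto simp: indicator_def V0)
    moreover have "0 \<le> (\<integral>s. indicator {..<r} s * (s * norm (V s)) \<partial>lborel)"
      by (intro integral_nonneg_AE AE_I2) (auto simp: V0)
    ultimately have "((\<integral>s. indicator {..<r} s * (s * norm (V s)) \<partial>lborel) / \<nu>) ^ k / fact k \<le> (C / \<nu>) ^ k / fact k"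
      by (intro divide_right_mono power_mono) auto
    then show ?thesis using radial_ratio_bound[OF V \<nu>, of k r] by linarith
  qed
  have m: "radial_ratio \<nu> V k \<in> borel_measurable borel" for k using radial_ratio_bound[OF V \<nu>] by blast
  have ex: "(\<lambda>k. (C / \<nu>) ^ k / fact k) sums exp (C / \<nu>)"
    using exp_converges[of "C / \<nu>"] by (simp add: divide_inverse_commute)
  show sm: "summable (\<lambda>k. norm (radial_ratio \<nu> V k r))" for r
    by (rule summable_comparison_test'[OF sums_summable[OF ex]]) (use b in auto)
  have ns: "(\<lambda>k. radial_ratio \<nu> V k r) sums normalized_solution \<nu> V r" for r
    unfolding normalized_solution_def by (rule summable_sums[OF summable_norm_cancel[OF sm]])
  have "norm (normalized_solution \<nu> V r) \<le> exp (C / \<nu>)" for r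
    unfolding normalized_solution_def sums_unique[OF ex]
    by (rule order_trans[OF summable_norm[OF sm]], rule suminf_le[OF b sm sums_summable[OF ex]])
  moreover have "exp (C / \<nu>) \<le> exp C"
  proof -
    have "C * 1 \<le> C * \<nu>" using C0 \<nu> by (intro mult_left_mono) auto
    then show ?thesis using \<nu> by (simp add: pos_divide_le_eq)
  qed
  ultimately show nb: "norm (normalized_solution \<nu> V r) \<le> exp C" for r using order_trans by blast
  have tl: "(\<lambda>k. radial_ratio \<nu> V (Suc k) r) sums (normalized_solution \<nu> V r - 1)" for r
    using ns[of r] by (subst sums_Suc_iff) simp
  show "norm (normalized_solution \<nu> V r - 1) \<le> exp (C / \<nu>) - 1"
  proof -
    have ext: "(\<lambda>k. (C / \<nu>) ^ Suc k / fact (Suc k)) sums (exp (C / \<nu>) - 1)"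
      using ex by (subst sums_Suc_iff) simp
    have s: "summable (\<lambda>k. norm (radial_ratio \<nu> V (Suc k) r))" using sm[of r] by (subst summable_Suc_iff)
    have "norm (normalized_solution \<nu> V r - 1) \<le> (\<Sum>k. norm (radial_ratio \<nu> V (Suc k) r))"
      unfolding sums_unique[OF tl] by (rule summable_norm[OF s])
    also have "\<dots> \<le> (\<Sum>k. (C / \<nu>) ^ Suc k / fact (Suc k))"
      by (rule suminf_le[OF b s sums_summable[OF ext]])
    finally show ?thesis using sums_unique[OF ext] by simp
  qed
  show nm: "normalized_solution \<nu> V \<in> borel_measurable borel"
    unfolding normalized_solution_def[abs_def] using m by (rule borel_measurable_suminf)
  show src: "radial_source (\<lambda>s. V s * normalized_solution \<nu> V s)"
    by (rule radial_source_mult[OF V nm nb])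
  show eq: "normalized_solution \<nu> V r = 1 + radial_op \<nu> (\<lambda>s. V s * normalized_solution \<nu> V s) r" for r
  proof -
    let ?f = "\<lambda>k s. of_real (radial_kernel \<nu> r s) * (V s * radial_ratio \<nu> V k s)"
    have srck: "radial_source (\<lambda>s. V s * radial_ratio \<nu> V k s)" for k
      by (rule radial_source_mult[OF V m b])
    have "(\<Sum>k. radial_ratio \<nu> V (Suc k) r) = (\<Sum>k. \<integral>s. ?f k s \<partial>lborel)"
      by (simp add: radial_op_def)
    also have "\<dots> = (\<integral>s. (\<Sum>k. ?f k s) \<partial>lborel)"
    proof (rule integral_suminf[symmetric])
      show "integrable lborel (?f k)" for k by (rule radial_op_integrable[OF srck \<nu>])
      show "AE s in lborel. summable (\<lambda>k. norm (?f k s))"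
        by (rule AE_I2) (simp add: norm_mult sm summable_mult mult.assoc)
      show "summable (\<lambda>k. \<integral>s. norm (?f k s) \<partial>lborel)"
      proof (rule summable_comparison_test'[OF summable_mult[OF sums_summable[OF ex], of C]])
        fix k
        have "(\<integral>s. norm (?f k s) \<partial>lborel) \<le> (\<integral>s. ((C / \<nu>) ^ k / fact k) * (s * norm (V s)) \<partial>lborel)"
        proof (rule integral_mono[OF integrable_norm[OF radial_op_integrable[OF srck \<nu>]]])
          show "integrable lborel (\<lambda>s. ((C / \<nu>) ^ k / fact k) * (s * norm (V s)))" using Vi by simp
          fix s
          have "norm (?f k s) \<le> s * norm (V s * radial_ratio \<nu> V k s)"
            by (rule radial_op_integrand_bound(2)[OF srck \<nu>])
          also have "\<dots> = (s * norm (V s)) * norm (radial_ratio \<nu> V k s)" by (simp add: norm_mult)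
          also have "\<dots> \<le> (s * norm (V s)) * ((C / \<nu>) ^ k / fact k)" by (intro mult_left_mono b V0)
          finally show "norm (?f k s) \<le> ((C / \<nu>) ^ k / fact k) * (s * norm (V s))" by (simp add: mult.commute)
        qed
        also have "\<dots> = C * ((C / \<nu>) ^ k / fact k)" unfolding C_def by simp
        finally show "norm (\<integral>s. norm (?f k s) \<partial>lborel) \<le> C * ((C / \<nu>) ^ k / fact k)" by simp
      qed
    qed
    also have "\<dots> = radial_op \<nu> (\<lambda>s. V s * normalized_solution \<nu> V s) r"
      unfolding radial_op_def normalized_solution_def
      by (intro Bochner_Integration.integral_cong refl)
        (simp add: suminf_mult summable_norm_cancel[OF sm] summable_mult)
    finally show ?thesis using sums_unique[OF tl[of r]] by (simp add: algebra_simps)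
  qed
  have "continuous_on {0..} (\<lambda>r. 1 + radial_op \<nu> (\<lambda>s. V s * normalized_solution \<nu> V s) r)"
    by (intro continuous_intros radial_op_continuous[OF src \<nu>])
  then show "continuous_on {0..} (normalized_solution \<nu> V)" by (simp only: eq[symmetric])
qed

section \<open>Weak solutions with separated variables\<close>

text \<open>
  For \<open>s \<le> r\<close> the kernel is \<open>(s - s ^ (\<nu> + 1) / r ^ \<nu>) / \<nu>\<close>, so the solution is
  \<open>(H\<^sub>1(r) - H\<^sub>2(r) / r ^ \<nu>) / \<nu>\<close> with the primitives \<open>H\<^sub>1\<close> of \<open>s w(s)\<close> and \<open>H\<^sub>2\<close> of \<open>s ^ (\<nu> + 1) w(s)\<close>. In its
  derivative the terms with \<open>w\<close> cancel and \<open>H\<^sub>2(r) / r ^ (\<nu> + 1)\<close> remains.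
\<close>

lemma radial_op_profile:
  fixes w :: "real \<Rightarrow> complex"
  assumes w: "continuous_on UNIV w" "\<And>s. s \<notin> {a..b} \<Longrightarrow> w s = 0" and a: "0 < a" and \<nu>: "\<nu> \<ge> 1"
  obtains g1 g2 where
    "\<And>r. r > 0 \<Longrightarrow> (radial_op \<nu> w has_vector_derivative r *\<^sub>R g1 r) (at r)"
    "\<And>r. r > 0 \<Longrightarrow> (g1 has_vector_derivative r *\<^sub>R g2 r) (at r)"
    "continuous_on {0<..} g2"
    "\<And>r. r > 0 \<Longrightarrow> of_nat (\<nu> + 2) * g1 r + of_real (r\<^sup>2) * g2 r = w r"
    "\<And>r. r \<le> a \<Longrightarrow> radial_op \<nu> w r = 0"
proof -
  define H1 where "H1 r = integral {0..r} (\<lambda>s. s *\<^sub>R w s)" for r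
  define H2 where "H2 r = integral {0..r} (\<lambda>s. s ^ (\<nu> + 1) *\<^sub>R w s)" for r
  have wc: "continuous_on A w" for A using continuous_on_subset[OF w(1)] by blast
  have der: "((\<lambda>r. integral {0..r} f) has_vector_derivative f r) (at r)"
    if "r > 0" "continuous_on UNIV f" for r and f :: "real \<Rightarrow> complex"
  proof -
    have "((\<lambda>r. integral {0..r} f) has_vector_derivative f r) (at r within {0..r+1})"
      by (rule integral_has_vector_derivative) (use that in \<open>auto intro: continuous_on_subset\<close>)
    then show ?thesis using that(1) at_within_Icc_at[of 0 r "r + 1"] by simp
  qed
  have d1: "(H1 has_vector_derivative r *\<^sub>R w r) (at r)" if "r > 0" for r
    unfolding H1_def by (rule der[OF that]) (intro continuous_intros wc)
  have d2: "(H2 has_vector_derivative r ^ (\<nu> + 1) *\<^sub>R w r) (at r)" if "r > 0" for r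
    unfolding H2_def by (rule der[OF that]) (intro continuous_intros wc)
  have op: "radial_op \<nu> w r = (1 / \<nu>) *\<^sub>R (H1 r - inverse (r ^ \<nu>) *\<^sub>R H2 r)" if r: "r > 0" for r
  proof -
    have "radial_op \<nu> w r = (\<integral>s. indicator {0..r} s *\<^sub>R ((1 / \<nu>) *\<^sub>R (s *\<^sub>R w s - inverse (r ^ \<nu>) *\<^sub>R (s ^ (\<nu> + 1) *\<^sub>R w s))) \<partial>lborel)"
      unfolding radial_op_def
    proof (rule Bochner_Integration.integral_cong[OF refl])
      fix s
      consider "s \<le> 0" | "0 < s" "s \<le> r" | "s > r" by linarith
      then show "of_real (radial_kernel \<nu> r s) * w s = indicator {0..r} s *\<^sub>R ((1 / \<nu>) *\<^sub>R (s *\<^sub>R w s - inverse (r ^ \<nu>) *\<^sub>R (s ^ (\<nu> + 1) *\<^sub>R w s)))"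
      proof cases
        case 1
        then have "w s = 0" using w(2)[of s] a by auto
        then show ?thesis by simp
      next
        case 2
        then have k: "radial_kernel \<nu> r s = (1 / \<nu>) * (s - inverse (r ^ \<nu>) * s ^ (\<nu> + 1))"
          using r \<nu> by (simp add: radial_kernel_def max_def power_divide field_simps)
        show ?thesis unfolding k using 2 by (simp add: scaleR_conv_of_real algebra_simps)
      next
        case 3
        then have "radial_kernel \<nu> r s = 0" using r \<nu> by (intro radial_kernel_bounds(3)) auto
        then show ?thesis using 3 by simp
      qed
    qed
    also have "\<dots> = integral {0..r} (\<lambda>s. (1 / \<nu>) *\<^sub>R (s *\<^sub>R w s - inverse (r ^ \<nu>) *\<^sub>R (s ^ (\<nu> + 1) *\<^sub>R w s)))"
    proof -
      have "set_integrable lborel {0..r} (\<lambda>s. (1 / \<nu>) *\<^sub>R (s *\<^sub>R w s - inverse (r ^ \<nu>) *\<^sub>R (s ^ (\<nu> + 1) *\<^sub>R w s)))"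
        unfolding set_integrable_def by (rule borel_integrable_compact) (auto intro!: continuous_intros wc)
      from set_borel_integral_eq_integral(2)[OF this] show ?thesis by (simp only: set_lebesgue_integral_def)
    qed
    also have "\<dots> = (1 / \<nu>) *\<^sub>R (H1 r - inverse (r ^ \<nu>) *\<^sub>R H2 r)"
    proof -
      have i: "(\<lambda>s. s *\<^sub>R w s) integrable_on {0..r}" "(\<lambda>s. s ^ (\<nu> + 1) *\<^sub>R w s) integrable_on {0..r}"
        by (intro integrable_continuous_interval continuous_intros wc)+
      show ?thesis unfolding H1_def H2_def
        by (subst integral_cmul, subst Henstock_Kurzweil_Integration.integral_diff)
          (use i integrable_cmul[OF i(2)] in \<open>auto simp del: scaleR_scaleR\<close>)
    qed
    finally show ?thesis .
  qed
  define g1 where "g1 r = inverse (r ^ (\<nu> + 2)) *\<^sub>R H2 r" for r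
  define g2 where "g2 r = inverse (r\<^sup>2) *\<^sub>R w r - (real (\<nu> + 2) * inverse (r ^ (\<nu> + 4))) *\<^sub>R H2 r" for r
  have di: "((\<lambda>r. inverse (r ^ k)) has_field_derivative - (real k * inverse (r ^ (k + 1)))) (at r)" if "r > 0" for r :: real and k
  proof -
    have "((\<lambda>r. inverse (r ^ k)) has_field_derivative - (real k * r ^ (k - 1)) / (r ^ k)\<^sup>2) (at r)"
      using that by (auto intro!: derivative_eq_intros simp: power2_eq_square field_simps)
    moreover have "(real k * r ^ (k - 1)) / (r ^ k)\<^sup>2 = real k * inverse (r ^ (k + 1))"
      using that by (cases k) (auto simp: field_simps power2_eq_square)
    ultimately show ?thesis by simp
  qed
  show ?thesis
  proof (rule that[of g1 g2])
    fix r :: real assume r: "r > 0"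
    have "((\<lambda>r. (1 / \<nu>) *\<^sub>R (H1 r - inverse (r ^ \<nu>) *\<^sub>R H2 r)) has_vector_derivative
      (1 / \<nu>) *\<^sub>R (r *\<^sub>R w r - (inverse (r ^ \<nu>) *\<^sub>R (r ^ (\<nu> + 1) *\<^sub>R w r) + (- (real \<nu> * inverse (r ^ (\<nu> + 1)))) *\<^sub>R H2 r))) (at r)"
      by (intro bounded_linear.has_vector_derivative[OF bounded_linear_scaleR_right] has_vector_derivative_diff
          has_vector_derivative_scaleR d1 d2 di r)
    moreover have "(1 / \<nu>) *\<^sub>R (r *\<^sub>R w r - (inverse (r ^ \<nu>) *\<^sub>R (r ^ (\<nu> + 1) *\<^sub>R w r) + (- (real \<nu> * inverse (r ^ (\<nu> + 1)))) *\<^sub>R H2 r))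
      = r *\<^sub>R g1 r"
      using r \<nu> unfolding g1_def by (simp add: scaleR_conv_of_real field_simps)
    ultimately have "((\<lambda>r. (1 / \<nu>) *\<^sub>R (H1 r - inverse (r ^ \<nu>) *\<^sub>R H2 r)) has_vector_derivative r *\<^sub>R g1 r) (at r)" by simp
    then show "(radial_op \<nu> w has_vector_derivative r *\<^sub>R g1 r) (at r)"
      by (rule has_vector_derivative_transform_within_open[where S="{0<..}"]) (use r op in auto)
    have "(g1 has_vector_derivative
      inverse (r ^ (\<nu> + 2)) *\<^sub>R (r ^ (\<nu> + 1) *\<^sub>R w r) + (- (real (\<nu> + 2) * inverse (r ^ (\<nu> + 2 + 1)))) *\<^sub>R H2 r) (at r)"
      unfolding g1_def[abs_def] by (intro has_vector_derivative_scaleR d2 di r)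
    moreover have "inverse (r ^ (\<nu> + 2)) *\<^sub>R (r ^ (\<nu> + 1) *\<^sub>R w r) + (- (real (\<nu> + 2) * inverse (r ^ (\<nu> + 2 + 1)))) *\<^sub>R H2 r = r *\<^sub>R g2 r"
    proof -
      have "inverse (r ^ (\<nu> + 2)) * r ^ (\<nu> + 1) = r * inverse (r\<^sup>2)"
        "real (\<nu> + 2) * inverse (r ^ (\<nu> + 2 + 1)) = r * (real (\<nu> + 2) * inverse (r ^ (\<nu> + 4)))"
        using r by (auto simp: field_simps power2_eq_square eval_nat_numeral)
      then show ?thesis unfolding g2_def by (simp only: scaleR_scaleR scaleR_minus_left scaleR_minus_right scaleR_add_right diff_conv_add_uminus)
    qed
    ultimately show "(g1 has_vector_derivative r *\<^sub>R g2 r) (at r)" by simp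
    show "of_nat (\<nu> + 2) * g1 r + of_real (r\<^sup>2) * g2 r = w r"
    proof -
      have e: "r\<^sup>2 * inverse (r\<^sup>2) = 1" "r\<^sup>2 * (real (\<nu> + 2) * inverse (r ^ (\<nu> + 4))) = real (\<nu> + 2) * inverse (r ^ (\<nu> + 2))"
        using r by (auto simp: field_simps power_add power2_eq_square eval_nat_numeral)
      have "of_nat (\<nu> + 2) * g1 r + of_real (r\<^sup>2) * g2 r = real (\<nu> + 2) *\<^sub>R g1 r + r\<^sup>2 *\<^sub>R g2 r"
        by (simp add: scaleR_conv_of_real)
      also have "\<dots> = w r" unfolding g1_def g2_def scaleR_diff_right scaleR_scaleR e by simp
      finally show ?thesis .
    qed
  next
    have "isCont H2 r" if "r > 0" for r using d2[OF that] by (rule has_vector_derivative_continuous)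
    then have "continuous_on {0<..} H2" by (auto intro: continuous_at_imp_continuous_on)
    then show "continuous_on {0<..} g2" unfolding g2_def by (intro continuous_intros wc) auto
    fix r assume ra: "r \<le> a"
    have z0: "of_real (radial_kernel \<nu> r s) * w s = 0" for s
    proof (cases "s < a")
      case True then show ?thesis using w(2)[of s] by auto
    next
      case False
      then have "radial_kernel \<nu> r s = 0" using ra a \<nu> by (intro radial_kernel_bounds(3)) auto
      then show ?thesis by simp
    qed
    show "radial_op \<nu> w r = 0" unfolding radial_op_def z0 by simp
  qed
qed

text \<open>
  The identity \<open>\<Delta>(y(|x|) p(x)) = w(|x|) p(x)\<close> tested with \<open>\<phi>\<close>, where \<open>y\<close> is the image of \<open>w\<close> under the
  solution operator.
\<close>

definition weak_identity :: "('a::euclidean_space \<Rightarrow> complex) \<Rightarrow> ('a \<Rightarrow> complex) \<Rightarrow> nat \<Rightarrow> (real \<Rightarrow> complex) \<Rightarrow> bool" where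
  "weak_identity p \<phi> \<nu> w \<longleftrightarrow>
    (\<integral>x. radial_op \<nu> w (norm x) * (p x * laplacian \<phi> x) \<partial>lborel) = (\<integral>x. w (norm x) * (p x * \<phi> x) \<partial>lborel)"

text \<open>
  The source vanishes near the origin, hence so does its image under the solution operator. So
  \<open>y(|x|) p(x)\<close> is \<open>C\<^sup>2\<close> on the whole space, and Green's formula applies.
\<close>

lemma weak_identity_continuous:
  fixes p \<phi> :: "'a::euclidean_space \<Rightarrow> complex"
  assumes w: "continuous_on UNIV w" "\<And>s. s \<notin> {a..b} \<Longrightarrow> w s = 0" and a: "0 < a"
    and \<nu>: "\<nu> + 2 = DIM('a) + 2 * m" "\<nu> \<ge> 1"
    and p: "solid_harmonic m p" and \<phi>: "Ck_on 2 UNIV \<phi>" "compact K" "\<And>x. x \<notin> K \<Longrightarrow> \<phi> x = 0"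
  shows "weak_identity p \<phi> \<nu> w"
proof -
  obtain g1 g2 where g: "\<And>r. r > 0 \<Longrightarrow> (radial_op \<nu> w has_vector_derivative r *\<^sub>R g1 r) (at r)"
    "\<And>r. r > 0 \<Longrightarrow> (g1 has_vector_derivative r *\<^sub>R g2 r) (at r)"
    "continuous_on {0<..} g2"
    and ode: "\<And>r. r > 0 \<Longrightarrow> of_nat (\<nu> + 2) * g1 r + of_real (r\<^sup>2) * g2 r = w r"
    and z: "\<And>r. r \<le> a \<Longrightarrow> radial_op \<nu> w r = 0"
    using radial_op_profile[OF w a \<nu>(2)] by metis
  define u where "u x = radial_op \<nu> w (norm x) * p x" for x
  have op: "open (- {0::'a})" by auto
  have u0: "u x = 0" if "x \<in> ball 0 a" for x using that z[of "norm x"] by (simp add: u_def)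
  have "Ck_on 2 (- {0}) u"
    unfolding u_def by (intro Ck_on_mult Ck_on_2_radial[OF g] solid_harmonicD(1)[OF p] op)
  moreover have c0: "Ck_on 2 (ball 0 a) u"
    by (rule Ck_on_cong[OF _ _ Ck_on_const[of 2 _ 0]]) (use u0 in auto)
  ultimately have "Ck_on 2 (- {0} \<union> ball 0 a) u" by (rule Ck_on_Un) auto
  moreover have "- {0} \<union> ball 0 a = (UNIV :: 'a set)" using a by auto
  ultimately have u: "Ck_on 2 UNIV u" by simp
  have lap: "laplacian u x = w (norm x) * p x" for x
  proof (cases "x = 0")
    case True
    have "laplacian u x = laplacian (\<lambda>x. 0) x"
      by (rule laplacian_cong_open[OF _ c0]) (use True a u0 in auto)
    also have "\<dots> = 0" by (simp add: laplacian_eq_pd)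
    finally show ?thesis using True w(2)[of 0] a by simp
  next
    case False
    then have "laplacian u x = radial_op \<nu> w (norm x) * laplacian p x
      + (of_nat (DIM('a) + 2 * m) * g1 (norm x) + of_real ((norm x)\<^sup>2) * g2 (norm x)) * p x"
      unfolding u_def using solid_harmonicD[OF p] op
      by (intro laplacian_radial_mult_homogeneous[OF g]) auto
    then show ?thesis
      unfolding \<nu>(1)[symmetric] using ode[of "norm x"] False solid_harmonicD(3)[OF p] by simp
  qed
  have "(\<integral>x. u x * laplacian \<phi> x \<partial>lborel) = (\<integral>x. \<phi> x * laplacian u x \<partial>lborel)"
    by (rule integral_laplacian_symmetric(1)[OF open_UNIV \<phi>(2) subset_UNIV u \<phi>(1,3)])
  then show ?thesis unfolding weak_identity_def lap u_def by (simp add: ac_simps)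
qed

text \<open>
  In dimension at least 3 the polar density \<open>r ^ (d - 1)\<close> is at most \<open>r\<close> on the unit interval.
\<close>

lemma radial_source_integrable:
  assumes d: "3 \<le> DIM('a::euclidean_space)" and w: "radial_source w"
  shows "integrable lborel (\<lambda>x::'a. w (norm x))"
proof (rule integrableI_bounded)
  have wm [measurable]: "w \<in> borel_measurable borel" using w by (simp add: radial_source_def)
  show "(\<lambda>x::'a. w (norm x)) \<in> borel_measurable lborel" by measurable
  let ?\<sigma> = "emeasure (sphere_measure :: 'a measure) (sphere 0 1)"
  have fin: "?\<sigma> < \<infinity>"
    using finite_measure.emeasure_finite[OF finite_measure_sphere, where 'a1='a] by (simp add: less_top)
  have "(\<integral>\<^sup>+x. ennreal (norm (w (norm (x::'a)))) \<partial>lborel) =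
    (\<integral>\<^sup>+r. ennreal (indicator {0<..} r * r ^ (DIM('a) - 1)) * (\<integral>\<^sup>+\<xi>. ennreal (norm (w (norm (r *\<^sub>R (\<xi>::'a))))) \<partial>sphere_measure) \<partial>lborel)"
    by (rule nn_integral_polar) measurable
  also have "\<dots> \<le> (\<integral>\<^sup>+r. ?\<sigma> * ennreal (r * norm (w r)) \<partial>lborel)"
  proof (rule nn_integral_mono)
    fix r :: real
    show "ennreal (indicator {0<..} r * r ^ (DIM('a) - 1)) * (\<integral>\<^sup>+\<xi>. ennreal (norm (w (norm (r *\<^sub>R (\<xi>::'a))))) \<partial>sphere_measure)
      \<le> ?\<sigma> * ennreal (r * norm (w r))"
    proof (cases "r \<in> {0<..<1}")
      case True
      have "(\<integral>\<^sup>+\<xi>. ennreal (norm (w (norm (r *\<^sub>R (\<xi>::'a))))) \<partial>sphere_measure) = (\<integral>\<^sup>+\<xi>. ennreal (norm (w r)) \<partial>(sphere_measure :: 'a measure))"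
        using True by (intro nn_integral_cong) auto
      also have "\<dots> = ?\<sigma> * ennreal (norm (w r))" by (simp add: mult.commute)
      finally have e: "(\<integral>\<^sup>+\<xi>. ennreal (norm (w (norm (r *\<^sub>R (\<xi>::'a))))) \<partial>sphere_measure) = ?\<sigma> * ennreal (norm (w r))" .
      have "r ^ (DIM('a) - 1) \<le> r ^ 1" using True d by (intro power_decreasing) auto
      then have "ennreal (r ^ (DIM('a) - 1)) \<le> ennreal r" by (intro ennreal_leI) simp
      then have "ennreal (r ^ (DIM('a) - 1)) * (?\<sigma> * ennreal (norm (w r))) \<le> ennreal r * (?\<sigma> * ennreal (norm (w r)))"
        by (rule mult_right_mono) simp
      then show ?thesis unfolding e using True by (simp add: ennreal_mult ac_simps)
    next
      case False
      show ?thesis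
      proof (cases "r \<le> 0")
        case True
        then have "(indicator {0<..} r :: real) = 0" by simp
        then show ?thesis by (simp only: mult_zero_left ennreal_0 zero_le)
      next
        case r: False
        have "w r = 0" using w False unfolding radial_source_def by blast
        then have "(\<integral>\<^sup>+\<xi>. ennreal (norm (w (norm (r *\<^sub>R (\<xi>::'a))))) \<partial>sphere_measure) = (\<integral>\<^sup>+\<xi>. 0 \<partial>(sphere_measure :: 'a measure))"
          using r by (intro nn_integral_cong) auto
        then show ?thesis by simp
      qed
    qed
  qed
  also have "\<dots> = ?\<sigma> * (\<integral>\<^sup>+r. ennreal (r * norm (w r)) \<partial>lborel)" by (rule nn_integral_cmult) measurable
  also have "\<dots> < \<infinity>"
  proof -
    have "(\<integral>\<^sup>+r. ennreal (r * norm (w r)) \<partial>lborel) \<le> (\<integral>\<^sup>+r. ennreal (norm (r * norm (w r))) \<partial>lborel)"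
      by (intro nn_integral_mono ennreal_leI) simp
    also have "\<dots> < \<infinity>" using w by (simp add: radial_source_def integrable_iff_bounded)
    finally show ?thesis using fin by (simp add: ennreal_mult_less_top)
  qed
  finally show "(\<integral>\<^sup>+x. ennreal (norm (w (norm (x::'a)))) \<partial>lborel) < \<infinity>" .
qed

lemma radial_source_integrable_mult:
  fixes f :: "'a::euclidean_space \<Rightarrow> complex"
  assumes d: "3 \<le> DIM('a)" and w: "radial_source w" and f: "continuous_on UNIV f" "bounded K" "\<And>x. x \<notin> K \<Longrightarrow> f x = 0"
  shows "integrable lborel (\<lambda>x. w (norm x) * f x)"
proof -
  obtain a where a: "K \<subseteq> cbox (-a) a" using bounded_subset_cbox_symmetric[OF f(2)] by blast
  have "compact (f ` cbox (-a) a)" by (intro compact_continuous_image continuous_on_subset[OF f(1)]) auto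
  then obtain B where B: "\<And>y. y \<in> f ` cbox (-a) a \<Longrightarrow> norm y \<le> B"
    using compact_imp_bounded bounded_iff by metis
  have fB: "norm (f x) \<le> \<bar>B\<bar>" for x
  proof (cases "x \<in> cbox (-a) a")
    case True
    then have "norm (f x) \<le> B" using B by blast
    then show ?thesis by linarith
  next
    case False
    then have "f x = 0" using a f(3) by blast
    then show ?thesis by simp
  qed
  show ?thesis
  proof (rule Bochner_Integration.integrable_bound)
    show "integrable lborel (\<lambda>x::'a. of_real \<bar>B\<bar> * w (norm x))"
      by (intro integrable_mult_right radial_source_integrable d w)
    have [measurable]: "w \<in> borel_measurable borel" using w by (simp add: radial_source_def)
    have [measurable]: "f \<in> borel_measurable borel" using f(1) by (rule borel_measurable_continuous_onI)
    show "(\<lambda>x. w (norm x) * f x) \<in> borel_measurable lborel" by measurable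
    show "AE x in lborel. norm (w (norm x) * f x) \<le> norm (of_real \<bar>B\<bar> * w (norm x))"
    proof (rule AE_I2)
      fix x
      have "norm (w (norm x)) * norm (f x) \<le> norm (w (norm x)) * \<bar>B\<bar>" by (intro mult_left_mono fB) auto
      then show "norm (w (norm x) * f x) \<le> norm (of_real \<bar>B\<bar> * w (norm x))"
        by (simp add: norm_mult mult.commute)
    qed
  qed
qed

text \<open>
  Both sides depend continuously on the source under dominated convergence: on the left a source
  dominated by \<open>B\<close> has an image bounded by \<open>\<integral>s |B(s)| ds\<close>, on the right the integrand is dominated by
  \<open>B(|x|)\<close> times a bounded function with compact support.
\<close>

lemma weak_identity_limit:
  fixes p \<phi> :: "'a::euclidean_space \<Rightarrow> complex"
  assumes d: "3 \<le> DIM('a)" and \<nu>: "\<nu> \<ge> 1"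
    and p: "continuous_on UNIV p" and \<phi>: "Ck_on 2 UNIV \<phi>" "compact K" "\<And>x. x \<notin> K \<Longrightarrow> \<phi> x = 0"
    and w: "radial_source w" and wi: "\<And>i. radial_source (wi i)" and B: "radial_source B"
    and dom: "\<And>i s. norm (wi i s) \<le> norm (B s)"
    and lim: "AE s in lborel. (\<lambda>i. wi i s) \<longlonglongrightarrow> w s"
    and weak: "\<And>i. weak_identity p \<phi> \<nu> (wi i)"
  shows "weak_identity p \<phi> \<nu> w"
proof -
  have mw [measurable]: "w \<in> borel_measurable borel" "\<And>i. wi i \<in> borel_measurable borel" "B \<in> borel_measurable borel"
    using w wi B by (auto simp: radial_source_def)
  have Bi: "integrable lborel (\<lambda>s. s * norm (B s))" using B by (simp add: radial_source_def)
  have dom': "s * norm (wi i s) \<le> s * norm (B s)" for i s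
  proof (cases "s \<in> {0<..<1}")
    case False
    then have "wi i s = 0" "B s = 0" using wi B unfolding radial_source_def by blast+
    then show ?thesis by simp
  qed (auto intro!: mult_left_mono dom)
  have op_lim: "(\<lambda>i. radial_op \<nu> (wi i) r) \<longlonglongrightarrow> radial_op \<nu> w r" for r
    unfolding radial_op_def
  proof (rule integral_dominated_convergence[where w="\<lambda>s. s * norm (B s)", OF _ _ Bi])
    show "AE s in lborel. norm (of_real (radial_kernel \<nu> r s) * wi i s) \<le> s * norm (B s)" for i
      by (rule AE_I2) (use radial_op_integrand_bound(2)[OF wi \<nu>] dom' order_trans in blast)
    show "AE s in lborel. (\<lambda>i. of_real (radial_kernel \<nu> r s) * wi i s) \<longlonglongrightarrow> of_real (radial_kernel \<nu> r s) * w s"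
      using lim by eventually_elim (intro tendsto_intros)
  qed (unfold radial_kernel_def, measurable)
  have op_bound: "norm (radial_op \<nu> (wi i) r) \<le> (\<integral>s. s * norm (B s) \<partial>lborel)" for i r
    unfolding radial_op_def
    by (rule order_trans[OF integral_norm_bound], rule integral_mono[OF integrable_norm[OF radial_op_integrable[OF wi \<nu>]] Bi])
      (use radial_op_integrand_bound(2)[OF wi \<nu>] dom' order_trans in blast)
  have bK: "bounded K" using \<phi>(2) compact_imp_bounded by blast
  have cK: "closed K" using \<phi>(2) compact_imp_closed by blast
  have \<phi>c: "continuous_on UNIV \<phi>" using \<phi>(1) Ck_on_imp_continuous by blast
  have lapc: "continuous_on UNIV (laplacian \<phi>)" by (rule continuous_on_laplacian[OF \<phi>(1)])
  note lap0 = laplacian_eq_0_off_support[OF \<phi>(1) cK \<phi>(3)]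
  have [measurable]: "p \<in> borel_measurable borel" "\<phi> \<in> borel_measurable borel" "laplacian \<phi> \<in> borel_measurable borel"
    using p \<phi>c lapc by (auto intro: borel_measurable_continuous_onI)
  have [measurable]: "radial_op \<nu> w \<in> borel_measurable borel" "\<And>i. radial_op \<nu> (wi i) \<in> borel_measurable borel"
    using w wi by (auto intro: radial_op_measurable)
  have "(\<lambda>i. \<integral>x. radial_op \<nu> (wi i) (norm x) * (p x * laplacian \<phi> x) \<partial>lborel)
    \<longlonglongrightarrow> (\<integral>x. radial_op \<nu> w (norm x) * (p x * laplacian \<phi> x) \<partial>lborel)"
  proof (rule integral_dominated_convergence[where w="\<lambda>x. (\<integral>s. s * norm (B s) \<partial>lborel) * norm (p x * laplacian \<phi> x)"])
    have "integrable lborel (\<lambda>x. p x * laplacian \<phi> x)"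
      by (rule integrable_compact_support[OF _ bK]) (use lap0 in \<open>auto intro!: continuous_intros p lapc\<close>)
    then show "integrable lborel (\<lambda>x. (\<integral>s. s * norm (B s) \<partial>lborel) * norm (p x * laplacian \<phi> x))"
      by (intro integrable_mult_right integrable_norm)
    show "AE x in lborel. norm (radial_op \<nu> (wi i) (norm x) * (p x * laplacian \<phi> x)) \<le> (\<integral>s. s * norm (B s) \<partial>lborel) * norm (p x * laplacian \<phi> x)" for i
      unfolding norm_mult[of "radial_op _ _ _"] by (intro AE_I2 mult_right_mono op_bound) auto
    show "AE x in lborel. (\<lambda>i. radial_op \<nu> (wi i) (norm x) * (p x * laplacian \<phi> x)) \<longlonglongrightarrow> radial_op \<nu> w (norm x) * (p x * laplacian \<phi> x)"
      by (intro AE_I2 tendsto_intros op_lim)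
  qed measurable
  moreover have "(\<lambda>i. \<integral>x. wi i (norm x) * (p x * \<phi> x) \<partial>lborel) \<longlonglongrightarrow> (\<integral>x. w (norm x) * (p x * \<phi> x) \<partial>lborel)"
  proof (rule integral_dominated_convergence[where w="\<lambda>x. norm (B (norm x) * (p x * \<phi> x))"])
    show "integrable lborel (\<lambda>x. norm (B (norm x) * (p x * \<phi> x)))"
      by (intro integrable_norm radial_source_integrable_mult[OF d B _ bK]) (use \<phi>(3) in \<open>auto intro!: continuous_intros p \<phi>c\<close>)
    show "AE x in lborel. norm (wi i (norm x) * (p x * \<phi> x)) \<le> norm (B (norm x) * (p x * \<phi> x))" for i
      unfolding norm_mult by (intro AE_I2 mult_right_mono dom) auto
    have "AE r in lborel. r > 0 \<longrightarrow> (\<lambda>i. wi i r) \<longlonglongrightarrow> w r" using lim by eventually_elim simp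
    from AE_radial[OF this] AE_lborel_nonzero
    show "AE x in lborel. (\<lambda>i. wi i (norm x) * (p x * \<phi> x)) \<longlonglongrightarrow> w (norm x) * (p x * \<phi> x)"
      by eventually_elim (auto intro!: tendsto_intros)
  qed measurable
  moreover have "(\<lambda>i. \<integral>x. radial_op \<nu> (wi i) (norm x) * (p x * laplacian \<phi> x) \<partial>lborel) = (\<lambda>i. \<integral>x. wi i (norm x) * (p x * \<phi> x) \<partial>lborel)"
    using weak unfolding weak_identity_def by (rule ext)
  ultimately show ?thesis
    unfolding weak_identity_def by (simp only: LIMSEQ_unique)
qed

text \<open>
  For \<open>0 < a \<le> b < 1\<close> this is the continuous function that is 1 on \<open>{a..b}\<close>, 0 off
  \<open>{a / 2..(1 + b) / 2}\<close>, and linear in between.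
\<close>

definition cutoff :: "real \<Rightarrow> real \<Rightarrow> real \<Rightarrow> real" where
  "cutoff a b s = max 0 (min 1 (min ((2 * s - a) / a) ((1 + b - 2 * s) / (1 - b))))"

text \<open>
  The radial retraction of the plane onto the disc of radius \<open>N\<close>.
\<close>

definition clip :: "real \<Rightarrow> complex \<Rightarrow> complex" where
  "clip N z = z /\<^sub>R max 1 (norm z / N)"

lemma norm_clip:
  assumes "N > 0"
  shows "norm (clip N z) \<le> N"
proof -
  have m: "max 1 (norm z / N) > 0" by simp
  have "norm z \<le> N * max 1 (norm z / N)"
  proof -
    have "norm z = N * (norm z / N)" using assms by simp
    also have "\<dots> \<le> N * max 1 (norm z / N)" using assms by (intro mult_left_mono) auto
    finally show ?thesis .
  qed
  then have "norm z / max 1 (norm z / N) \<le> N" by (simp only: pos_divide_le_eq[OF m])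
  then show ?thesis using m unfolding clip_def norm_scaleR by (simp add: divide_inverse mult.commute)
qed

text \<open>
  A measurable function is the pointwise limit almost everywhere of continuous functions, and
  cutting these off makes them equibounded and supported in a compact part of \<open>(0,1)\<close>.
\<close>

lemma weak_identity_bounded:
  fixes p \<phi> :: "'a::euclidean_space \<Rightarrow> complex"
  assumes d: "3 \<le> DIM('a)" and \<nu>: "\<nu> + 2 = DIM('a) + 2 * m" "\<nu> \<ge> 1"
    and p: "solid_harmonic m p" and \<phi>: "Ck_on 2 UNIV \<phi>" "compact K" "\<And>x. x \<notin> K \<Longrightarrow> \<phi> x = 0"
    and w: "radial_source w" "\<And>s. norm (w s) \<le> N" "\<And>s. s \<notin> {a..b} \<Longrightarrow> w s = 0"
    and ab: "0 < a" "a \<le> b" "b < 1" and N: "N > 0"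
  shows "weak_identity p \<phi> \<nu> w"
proof -
  have "w \<in> borel_measurable lebesgue" using w(1) by (auto simp: radial_source_def intro: measurable_completion)
  then have "w measurable_on UNIV"
    by (subst measurable_on_iff_borel_measurable) (auto simp: lebesgue_on_UNIV_eq)
  then obtain Z g where Z: "negligible Z" and g: "\<And>n. continuous_on UNIV (g n)" "\<And>x. x \<notin> Z \<Longrightarrow> (\<lambda>n. g n x) \<longlonglongrightarrow> w x"
    unfolding measurable_on_def by auto
  define wi where "wi i s = of_real (cutoff a b s) * clip N (g i s)" for i :: nat and s
  have cut: "0 \<le> cutoff a b s" "cutoff a b s \<le> 1" for s by (auto simp: cutoff_def)
  have cut0: "cutoff a b s = 0" if "s \<notin> {a/2..(1+b)/2}" for s
  proof -
    have "(2 * s - a) / a \<le> 0 \<or> (1 + b - 2 * s) / (1 - b) \<le> 0"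
      using that ab by (auto simp: divide_le_0_iff)
    then show ?thesis by (auto simp: cutoff_def)
  qed
  have cut1: "cutoff a b s = 1" if "s \<in> {a..b}" for s
  proof -
    have "1 \<le> (2 * s - a) / a" "1 \<le> (1 + b - 2 * s) / (1 - b)" using that ab by (auto simp: pos_le_divide_eq)
    then show ?thesis by (simp add: cutoff_def)
  qed
  have wic: "continuous_on UNIV (wi i)" for i
    unfolding wi_def clip_def cutoff_def using ab N
    by (intro continuous_intros g) (auto simp: max_def)
  have wi0: "wi i s = 0" if "s \<notin> {a/2..(1+b)/2}" for i s using cut0[OF that] by (simp add: wi_def)
  have wib: "norm (wi i s) \<le> N" for i s
  proof -
    have "norm (wi i s) \<le> 1 * N"
      unfolding wi_def norm_mult norm_of_real using cut[of s] norm_clip[OF N] by (intro mult_mono) auto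
    then show ?thesis by simp
  qed
  define B where "B s = complex_of_real (N * indicator {0<..<1} s)" for s :: real
  have B: "radial_source B"
    unfolding radial_source_def
  proof (intro conjI allI impI)
    show "B \<in> borel_measurable borel" unfolding B_def by measurable
    show "B s = 0" if "s \<notin> {0<..<1}" for s using that by (simp add: B_def)
    show "integrable lborel (\<lambda>s. s * norm (B s))"
    proof (rule Bochner_Integration.integrable_bound)
      show "integrable lborel (\<lambda>s::real. indicator {0..1} s *\<^sub>R N)"
        by (rule borel_integrable_compact) auto
      show "AE s in lborel. norm (s * norm (B s)) \<le> norm (indicator {0..1} s *\<^sub>R N)"
        using N by (intro AE_I2) (auto simp: B_def indicator_def abs_mult mult_left_le_one_le)
    qed (unfold B_def, measurable)
  qed
  have dom: "norm (wi i s) \<le> norm (B s)" for i s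
  proof (cases "s \<in> {0<..<1}")
    case True
    then show ?thesis using wib[of i s] N by (simp add: B_def)
  next
    case False
    then have "wi i s = 0" using ab by (intro wi0) auto
    then show ?thesis by simp
  qed
  have wis: "radial_source (wi i)" for i
    unfolding radial_source_def
  proof (intro conjI allI impI)
    show m: "wi i \<in> borel_measurable borel" using wic by (rule borel_measurable_continuous_onI)
    show "wi i s = 0" if "s \<notin> {0<..<1}" for s using that ab by (intro wi0) auto
    show "integrable lborel (\<lambda>s. s * norm (wi i s))"
    proof (rule Bochner_Integration.integrable_bound)
      show "integrable lborel (\<lambda>s. s * norm (B s))" using B by (simp add: radial_source_def)
      show "AE s in lborel. norm (s * norm (wi i s)) \<le> norm (s * norm (B s))"
        unfolding norm_mult by (intro AE_I2 mult_left_mono) (auto simp: dom)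
    qed (use m in measurable)
  qed
  show ?thesis
  proof (rule weak_identity_limit[OF d \<nu>(2) solid_harmonicD(4)[OF p] \<phi> w(1) wis B dom])
    have "AE s in lebesgue. s \<notin> Z"
      using Z unfolding negligible_iff_null_sets by (rule AE_not_in)
    then have "AE s in lborel. s \<notin> Z" by (simp only: AE_completion_iff)
    then show "AE s in lborel. (\<lambda>i. wi i s) \<longlonglongrightarrow> w s"
    proof eventually_elim
      case (elim s)
      have "(\<lambda>i. wi i s) \<longlonglongrightarrow> of_real (cutoff a b s) * clip N (w s)"
        unfolding wi_def clip_def by (intro tendsto_intros g(2)[OF elim]) (use N in \<open>auto simp: max_def\<close>)
      moreover have "of_real (cutoff a b s) * clip N (w s) = w s"
      proof (cases "s \<in> {a..b}")
        case True
        have "norm (w s) / N \<le> 1" by (subst pos_divide_le_eq[OF N]) (use w(2)[of s] in linarith)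
        then show ?thesis using cut1[OF True] by (simp add: clip_def max_def)
      next
        case False
        then show ?thesis using w(3)[OF False] by (simp add: clip_def)
      qed
      ultimately show ?case by simp
    qed
    show "weak_identity p \<phi> \<nu> (wi i)" for i
    proof -
      have "0 < a / 2" using ab by simp
      show ?thesis by (rule weak_identity_continuous[OF wic wi0 \<open>0 < a / 2\<close> \<nu> p \<phi>])
    qed
  qed
qed

text \<open>
  The source is truncated to the set \<open>T i\<close> on which its modulus is at most \<open>i + 1\<close> and the distance to
  the end points of \<open>(0,1)\<close> is at least \<open>1 / (i + 2)\<close>; these sets exhaust \<open>(0,1)\<close>.
\<close>

lemma weak_identity_source:
  fixes p \<phi> :: "'a::euclidean_space \<Rightarrow> complex"
  assumes d: "3 \<le> DIM('a)" and \<nu>: "\<nu> + 2 = DIM('a) + 2 * m" "\<nu> \<ge> 1"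
    and p: "solid_harmonic m p" and \<phi>: "Ck_on 2 UNIV \<phi>" "compact K" "\<And>x. x \<notin> K \<Longrightarrow> \<phi> x = 0"
    and w: "radial_source w"
  shows "weak_identity p \<phi> \<nu> w"
proof -
  define T where "T i = {s\<in>{1 / real (i + 2)..1 - 1 / real (i + 2)}. norm (w s) \<le> real (i + 1)}" for i :: nat
  have wm [measurable]: "w \<in> borel_measurable borel" using w by (simp add: radial_source_def)
  have Tm [measurable]: "T i \<in> sets borel" for i unfolding T_def by measurable
  define wi where "wi i s = w s * indicator (T i) s" for i s
  have wis: "radial_source (wi i)" for i
    unfolding wi_def by (rule radial_source_mult[OF w, where B=1]) (auto simp: indicator_def)
  show ?thesis
  proof (rule weak_identity_limit[OF d \<nu>(2) solid_harmonicD(4)[OF p] \<phi> w wis w])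
    show "norm (wi i s) \<le> norm (w s)" for i s by (auto simp: wi_def indicator_def)
    show "AE s in lborel. (\<lambda>i. wi i s) \<longlonglongrightarrow> w s"
    proof (rule AE_I2)
      fix s
      show "(\<lambda>i. wi i s) \<longlonglongrightarrow> w s"
      proof (cases "s \<in> {0<..<1}")
        case True
        obtain i0 :: nat where i0: "max (norm (w s)) (max (1 / s) (1 / (1 - s))) \<le> real i0" using real_arch_simple by blast
        have "wi i s = w s" if i: "i \<ge> i0" for i
        proof -
          have "1 / s \<le> real (i + 2)" "1 / (1 - s) \<le> real (i + 2)" "norm (w s) \<le> real (i + 1)" using i0 i by auto
          then have "1 / real (i + 2) \<le> s" "1 / real (i + 2) \<le> 1 - s"
            using True by (auto simp: pos_divide_le_eq mult.commute)
          then have "s \<in> T i" using \<open>norm (w s) \<le> real (i + 1)\<close> by (auto simp: T_def)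
          then show ?thesis by (simp add: wi_def)
        qed
        then have "\<forall>\<^sub>F i in sequentially. wi i s = w s" using eventually_sequentially by blast
        then show ?thesis by (rule tendsto_eventually)
      next
        case False
        then have "w s = 0" using w unfolding radial_source_def by blast
        then show ?thesis by (simp add: wi_def)
      qed
    qed
    fix i
    have h: "1 / real (i + 2) \<le> 1 / 2" by (intro divide_left_mono) auto
    show "weak_identity p \<phi> \<nu> (wi i)"
    proof (rule weak_identity_bounded[OF d \<nu> p \<phi> wis])
      show "norm (wi i s) \<le> real (i + 1)" for s by (auto simp: wi_def indicator_def T_def)
      show "wi i s = 0" if "s \<notin> {1 / real (i + 2)..1 - 1 / real (i + 2)}" for s
        using that by (auto simp: wi_def indicator_def T_def)
    qed (use h in auto)
  qed
qed

text \<open>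
  By the integral equation the function is \<open>p(x)\<close>, which is harmonic, plus \<open>T(V y)(|x|) p(x)\<close>, where \<open>T\<close>
  is the solution operator. The source of the second summand is \<open>V y\<close>.
\<close>

lemma weak_solution_term:
  fixes p \<phi> :: "'a::euclidean_space \<Rightarrow> complex"
  assumes d: "3 \<le> DIM('a)" and \<nu>: "\<nu> + 2 = DIM('a) + 2 * m" "\<nu> \<ge> 1"
    and p: "solid_harmonic m p" and \<phi>: "Ck_on 2 UNIV \<phi>" "compact K" "\<And>x. x \<notin> K \<Longrightarrow> \<phi> x = 0"
    and V: "radial_source V"
  defines "u \<equiv> \<lambda>x. normalized_solution \<nu> V (norm x) * p x"
  shows "continuous_on UNIV u"
    and "integrable lborel (\<lambda>x. u x * laplacian \<phi> x)"
    and "integrable lborel (\<lambda>x. u x * (V (norm x) * \<phi> x))"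
    and "(\<integral>x. u x * laplacian \<phi> x \<partial>lborel) = (\<integral>x. u x * (V (norm x) * \<phi> x) \<partial>lborel)"
proof -
  define y where "y = normalized_solution \<nu> V"
  note ns = normalized_solution[OF V \<nu>(2), folded y_def]
  have bK: "bounded K" using \<phi>(2) compact_imp_bounded by blast
  have cK: "closed K" using \<phi>(2) compact_imp_closed by blast
  have pc: "continuous_on UNIV p" by (rule solid_harmonicD(4)[OF p])
  have \<phi>c: "continuous_on UNIV \<phi>" using \<phi>(1) Ck_on_imp_continuous by blast
  have lapc: "continuous_on UNIV (laplacian \<phi>)" by (rule continuous_on_laplacian[OF \<phi>(1)])
  note lap0 = laplacian_eq_0_off_support[OF \<phi>(1) cK \<phi>(3)]
  have yc: "continuous_on UNIV (\<lambda>x::'a. y (norm x))"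
    by (rule continuous_on_compose2[OF ns(7)]) (auto intro: continuous_intros)
  then show uc: "continuous_on UNIV u" unfolding u_def y_def by (intro continuous_intros pc)
  show i1: "integrable lborel (\<lambda>x. u x * laplacian \<phi> x)"
    by (rule integrable_compact_support[OF _ bK]) (use lap0 in \<open>auto intro!: continuous_intros uc lapc\<close>)
  have "integrable lborel (\<lambda>x. V (norm x) * (u x * \<phi> x))"
    by (rule radial_source_integrable_mult[OF d V _ bK]) (use \<phi>(3) in \<open>auto intro!: continuous_intros uc \<phi>c\<close>)
  then show "integrable lborel (\<lambda>x. u x * (V (norm x) * \<phi> x))" by (simp add: ac_simps)
  have ip: "integrable lborel (\<lambda>x. p x * laplacian \<phi> x)"
    by (rule integrable_compact_support[OF _ bK]) (use lap0 in \<open>auto intro!: continuous_intros pc lapc\<close>)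
  have p0: "(\<integral>x. p x * laplacian \<phi> x \<partial>lborel) = 0"
    using integral_laplacian_symmetric(1)[OF open_UNIV \<phi>(2) subset_UNIV solid_harmonicD(1)[OF p open_UNIV] \<phi>(1,3)]
    by (simp add: solid_harmonicD(3)[OF p])
  have "radial_op \<nu> (\<lambda>s. V s * y s) r = y r - 1" for r using ns(6)[of r] by simp
  then have "(\<integral>x. (y (norm x) - 1) * (p x * laplacian \<phi> x) \<partial>lborel) = (\<integral>x. V (norm x) * y (norm x) * (p x * \<phi> x) \<partial>lborel)"
    using weak_identity_source[OF d \<nu> p \<phi> ns(5)] by (simp add: weak_identity_def)
  moreover have "(\<integral>x. (y (norm x) - 1) * (p x * laplacian \<phi> x) \<partial>lborel) = (\<integral>x. u x * laplacian \<phi> x \<partial>lborel)"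
  proof -
    have "(\<integral>x. u x * laplacian \<phi> x - p x * laplacian \<phi> x \<partial>lborel) = (\<integral>x. u x * laplacian \<phi> x \<partial>lborel)"
      using Bochner_Integration.integral_diff[OF i1 ip] p0 by simp
    then show ?thesis unfolding u_def y_def by (simp add: algebra_simps)
  qed
  ultimately show "(\<integral>x. u x * laplacian \<phi> x \<partial>lborel) = (\<integral>x. u x * (V (norm x) * \<phi> x) \<partial>lborel)"
    unfolding u_def y_def by (simp add: ac_simps)
qed

section \<open>The regular solution for Lebesgue measurable potentials\<close>

text \<open>
  Composition with the norm and integration over products call for Borel functions on the line. A
  Lebesgue measurable potential is equal almost everywhere to one that vanishes off the unit
  interval.
\<close>

lemma radial_source_representative:
  assumes "V \<in> borel_measurable (lebesgue_on {0<..<1})"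
    and "set_integrable lebesgue {0<..<1} (\<lambda>r. r * norm (V r))"
  obtains V' where "radial_source V'" "AE s in lborel. s \<in> {0<..<1} \<longrightarrow> V s = V' s"
proof -
  define f where "f s = indicator {0<..<1::real} s *\<^sub>R V s" for s
  have f: "f \<in> borel_measurable lebesgue"
    unfolding f_def using assms(1) by (subst (asm) borel_measurable_restrict_space_iff) auto
  have "(\<lambda>s. Re (f s)) \<in> borel_measurable (completion lborel)" "(\<lambda>s. Im (f s)) \<in> borel_measurable (completion lborel)"
    using f by (auto intro: borel_measurable_Re borel_measurable_Im measurable_compose)
  then obtain f1 f2 where f1: "f1 \<in> borel_measurable lborel" "AE s in lborel. Re (f s) = f1 s"
    and f2: "f2 \<in> borel_measurable lborel" "AE s in lborel. Im (f s) = f2 s"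
    using completion_ex_borel_measurable_real by metis
  define V' where "V' s = indicator {0<..<1::real} s *\<^sub>R Complex (f1 s) (f2 s)" for s
  have ae: "AE s in lborel. f s = V' s"
    using f1(2) f2(2)
  proof eventually_elim
    case (elim s)
    then have "f s = Complex (f1 s) (f2 s)" by (simp add: complex_eq_iff)
    then show ?case by (auto simp: V'_def f_def indicator_def)
  qed
  have V'm: "V' \<in> borel_measurable borel"
    unfolding V'_def Complex_eq using f1(1) f2(1) by measurable
  have "radial_source V'"
    unfolding radial_source_def
  proof (intro conjI allI impI V'm)
    show "V' s = 0" if "s \<notin> {0<..<1}" for s using that by (simp add: V'_def)
    have "integrable lebesgue (\<lambda>s. s * norm (f s))"
      using assms(2) unfolding set_integrable_def f_def by (simp add: mult.left_commute abs_mult)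
    then have "integrable lebesgue (\<lambda>s. s * norm (V' s))"
    proof (rule integrable_cong_AE_imp)
      show "(\<lambda>s. s * norm (V' s)) \<in> borel_measurable lebesgue"
        by (rule measurable_completion) (use V'm in measurable)
      show "AE s in lebesgue. s * norm (f s) = s * norm (V' s)"
        by (rule AE_completion) (use ae in \<open>auto elim!: eventually_mono\<close>)
    qed
    then show "integrable lborel (\<lambda>s. s * norm (V' s))"
      by (subst (asm) integrable_completion) (use V'm in measurable)
  qed
  moreover have "AE s in lborel. s \<in> {0<..<1} \<longrightarrow> V s = V' s"
    using ae by eventually_elim (auto simp: f_def)
  ultimately show ?thesis by (rule that)
qed

text \<open>
  Changing the potential on a null set leaves all the iterated integrals unchanged. The powers
  of the radius split off because
  \<open>(r powr (l + 1) / s powr l - s powr (l + 1) / r powr l) * s powr (l + 1)\<close> is equal to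
  \<open>r powr (l + 1) * s * (1 - (s / r) powr (2 * l + 1))\<close>.
\<close>

lemma radial_term_eq:
  assumes V': "radial_source V'" and ae: "AE s in lborel. s \<in> {0<..<1} \<longrightarrow> V s = V' s"
    and \<nu>: "\<nu> \<ge> 1" "2 * l + 1 = real \<nu>"
  shows "0 < r \<Longrightarrow> r \<le> 1 \<Longrightarrow> radial_term l V k r = of_real (r powr (l + 1)) * radial_ratio \<nu> V' k r"
proof (induction k arbitrary: r)
  case 0
  then show ?case by simp
next
  case (Suc k)
  let ?L = "\<lambda>s. indicator {0<..<r} s *\<^sub>R (of_real (1 / (2 * l + 1) * (r powr (l + 1) / s powr l - s powr (l + 1) / r powr l)) *
        V s * radial_term l V k s)"
  let ?R = "\<lambda>s. of_real (r powr (l + 1)) * (of_real (radial_kernel \<nu> r s) * (V' s * radial_ratio \<nu> V' k s))"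
  have V'm: "V' \<in> borel_measurable borel" using V' by (simp add: radial_source_def)
  have rm: "radial_ratio \<nu> V' k \<in> borel_measurable borel" using radial_ratio_bound[OF V' \<nu>(1)] by blast
  have R: "?R \<in> borel_measurable borel"
    unfolding radial_kernel_def using V'm rm by measurable
  have R1: "?R \<in> borel_measurable lborel" using R by (simp only: measurable_lborel2)
  have eq: "AE s in lborel. ?R s = ?L s"
    using ae
  proof eventually_elim
    case (elim s)
    show ?case
    proof (cases "s \<in> {0<..<r}")
      case True
      then have s: "0 < s" "s < r" "s < 1" using Suc.prems by auto
      have "s powr (l + 1) / s powr l = s" using s by (simp add: powr_add)
      moreover have "s powr (l + 1) * s powr (l + 1) / r powr l = r powr (l + 1) * (s * (s / r) ^ \<nu>)"
      proof -
        have "(s / r) ^ \<nu> = s powr (2 * l + 1) / r powr (2 * l + 1)"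
          using s \<nu> by (simp add: powr_realpow[symmetric] power_divide)
        moreover have "s powr (l + 1) * s powr (l + 1) = s * s powr (2 * l + 1)"
          using s by (simp add: powr_add[symmetric] powr_mult_base add_ac)
        moreover have "r powr (2 * l + 1) = r powr (l + 1) * r powr l"
          using s by (simp add: powr_add[symmetric])
        ultimately show ?thesis using s by (simp add: field_simps)
      qed
      moreover have "(r powr (l + 1) / s powr l - s powr (l + 1) / r powr l) * s powr (l + 1)
        = r powr (l + 1) * (s powr (l + 1) / s powr l) - s powr (l + 1) * s powr (l + 1) / r powr l"
        by (simp add: left_diff_distrib)
      ultimately have "(r powr (l + 1) / s powr l - s powr (l + 1) / r powr l) * s powr (l + 1)
        = r powr (l + 1) * (s * (1 - (s / r) ^ \<nu>))"
        by (simp only: right_diff_distrib mult_1_right)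
      then have "1 / (2 * l + 1) * (r powr (l + 1) / s powr l - s powr (l + 1) / r powr l) * s powr (l + 1)
        = r powr (l + 1) * radial_kernel \<nu> r s"
        unfolding \<nu>(2) radial_kernel_def using s by (simp add: max_def)
      from arg_cong[where f=complex_of_real, OF this]
      have e: "complex_of_real (1 / (2 * l + 1) * (r powr (l + 1) / s powr l - s powr (l + 1) / r powr l)) * complex_of_real (s powr (l + 1))
        = complex_of_real (r powr (l + 1)) * complex_of_real (radial_kernel \<nu> r s)"
        by (simp only: of_real_mult)
      have Vs: "V s = V' s" using elim s by auto
      have IH: "radial_term l V k s = of_real (s powr (l + 1)) * radial_ratio \<nu> V' k s"
        using Suc.IH[of s] s by simp
      have "?L s = (complex_of_real (1 / (2 * l + 1) * (r powr (l + 1) / s powr l - s powr (l + 1) / r powr l)) * complex_of_real (s powr (l + 1)))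
        * (V' s * radial_ratio \<nu> V' k s)"
        using True unfolding IH Vs by (simp only: indicator_simps scaleR_one ac_simps)
      then show ?thesis unfolding e by (simp only: ac_simps)
    next
      case False
      then consider "s \<le> 0" | "r \<le> s" "s > 0" by fastforce
      then have "of_real (radial_kernel \<nu> r s) * (V' s * radial_ratio \<nu> V' k s) = 0"
      proof cases
        case 1
        then have "s \<notin> {0<..<1}" by auto
        then have "V' s = 0" using V' unfolding radial_source_def by blast
        then show ?thesis by simp
      next
        case 2
        then show ?thesis using radial_kernel_bounds(3)[OF 2(2) \<nu>(1) 2(1)] by simp
      qed
      then show ?thesis using False by simp
    qed
  qed
  have "radial_term l V (Suc k) r = (\<integral>s. ?L s \<partial>lebesgue)"
    by (simp only: radial_term.simps set_lebesgue_integral_def)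
  also have "\<dots> = (\<integral>s. ?R s \<partial>lebesgue)"
  proof (rule integral_cong_AE)
    show R': "?R \<in> borel_measurable lebesgue" by (rule measurable_completion[OF R1])
    show "?L \<in> borel_measurable lebesgue"
      by (rule borel_measurable_AE[OF R' AE_completion[OF eq]])
    show "AE s in lebesgue. ?L s = ?R s"
      using AE_completion[OF eq] by (rule eventually_mono) (rule sym)
  qed
  also have "\<dots> = (\<integral>s. ?R s \<partial>lborel)" by (rule integral_completion[OF R1])
  also have "\<dots> = of_real (r powr (l + 1)) * radial_ratio \<nu> V' (Suc k) r"
    unfolding integral_mult_right_zero by (simp only: radial_ratio.simps radial_op_def)
  finally show ?case .
qed

lemma alpha_eq_normalized_solution:
  assumes V': "radial_source V'" and ae: "AE s in lborel. s \<in> {0<..<1} \<longrightarrow> V s = V' s"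
    and d: "3 \<le> d" and r: "0 \<le> r" "r \<le> 1"
  shows "alpha d V m r = normalized_solution (2 * m + d - 2) V' r"
proof -
  let ?\<nu> = "2 * m + d - 2"
  have \<nu>: "?\<nu> \<ge> 1" using d by auto
  have l: "2 * ell d m + 1 = real ?\<nu>" unfolding ell_def using d by (simp add: of_nat_diff field_simps)
  note ns = normalized_solution[OF V' \<nu>]
  show ?thesis
  proof (cases "r = 0")
    case True
    have "norm (radial_op ?\<nu> (\<lambda>s. V' s * normalized_solution ?\<nu> V' s) 0)
      \<le> (\<integral>s. indicator {..<0} s * (s * norm (V' s * normalized_solution ?\<nu> V' s)) \<partial>lborel) / ?\<nu>"
      by (rule radial_op_bound[OF ns(5) \<nu>])
    also have "(\<lambda>s. indicator {..<0} s * (s * norm (V' s * normalized_solution ?\<nu> V' s))) = (\<lambda>s. 0)"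
    proof
      fix s :: real
      show "indicator {..<0} s * (s * norm (V' s * normalized_solution ?\<nu> V' s)) = 0"
      proof (cases "s < 0")
        case True
        then have "s \<notin> {0<..<1}" by auto
        then have "V' s = 0" using V' unfolding radial_source_def by blast
        then show ?thesis by simp
      qed simp
    qed
    finally have "radial_op ?\<nu> (\<lambda>s. V' s * normalized_solution ?\<nu> V' s) 0 = 0" by simp
    then show ?thesis using True ns(6)[of 0] by (simp add: alpha_def)
  next
    case False
    then have r0: "0 < r" using r by simp
    have "regular_solution (ell d m) V r = (\<Sum>k. of_real (r powr (ell d m + 1)) * radial_ratio ?\<nu> V' k r)"
      unfolding regular_solution_def radial_term_eq[OF V' ae \<nu> l r0 r(2)] ..
    also have "\<dots> = of_real (r powr (ell d m + 1)) * normalized_solution ?\<nu> V' r"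
      unfolding normalized_solution_def by (rule suminf_mult[OF summable_norm_cancel[OF ns(1)]])
    finally show ?thesis using False r0 by (simp add: alpha_def)
  qed
qed

section \<open>Functionals on continuous functions\<close>

lemma summable_polynomial_geometric:
  fixes r :: real
  assumes r: "0 \<le> r" "r < 1"
  shows "summable (\<lambda>m. real (m + 1) ^ k * r ^ m)"
proof (cases "r = 0")
  case True
  then show ?thesis by (intro summable_finite[of "{0}"]) auto
next
  case False
  have "(\<lambda>m. (1 + inverse (real (Suc m))) ^ k * r) \<longlonglongrightarrow> (1 + 0) ^ k * r"
    by (intro tendsto_intros LIMSEQ_inverse_real_of_nat)
  then have "(\<lambda>m. (1 + inverse (real (Suc m))) ^ k * r) \<longlonglongrightarrow> r" by simp
  then have "\<forall>\<^sub>F m in sequentially. (1 + inverse (real (Suc m))) ^ k * r < (1 + r) / 2"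
    by (rule order_tendstoD) (use r in auto)
  then obtain N where N: "\<And>m. m \<ge> N \<Longrightarrow> (1 + inverse (real (Suc m))) ^ k * r < (1 + r) / 2"
    unfolding eventually_sequentially by blast
  show ?thesis
  proof (rule summable_ratio_test[of "(1 + r) / 2" N])
    show "(1 + r) / 2 < 1" using r by simp
    fix m assume "m \<ge> N"
    have "1 + inverse (real (Suc m)) = real (Suc m + 1) / real (m + 1)" by (simp add: field_simps)
    then have "real (Suc m + 1) ^ k = (1 + inverse (real (Suc m))) ^ k * real (m + 1) ^ k"
      by (simp add: power_divide)
    then have "real (Suc m + 1) ^ k * r ^ Suc m = ((1 + inverse (real (Suc m))) ^ k * r) * (real (m + 1) ^ k * r ^ m)"
      by simp
    also have "\<dots> \<le> (1 + r) / 2 * (real (m + 1) ^ k * r ^ m)"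
      using N[OF \<open>m \<ge> N\<close>] r by (intro mult_right_mono) auto
    finally show "norm (real (Suc m + 1) ^ k * r ^ Suc m) \<le> (1 + r) / 2 * norm (real (m + 1) ^ k * r ^ m)"
      using r by (simp add: abs_mult power_abs)
  qed
qed

locale sphere_functional =
  fixes f :: "('a::euclidean_space \<Rightarrow> complex) \<Rightarrow> complex"
  assumes f: "radon_measure_sphere f"
begin

lemma f_add: "continuous_on (sphere 0 1) \<phi> \<Longrightarrow> continuous_on (sphere 0 1) \<psi> \<Longrightarrow> f (\<lambda>\<zeta>. \<phi> \<zeta> + \<psi> \<zeta>) = f \<phi> + f \<psi>"
  using f unfolding radon_measure_sphere_def by blast

lemma f_cmult: "continuous_on (sphere 0 1) \<phi> \<Longrightarrow> f (\<lambda>\<zeta>. c * \<phi> \<zeta>) = c * f \<phi>"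
  using f unfolding radon_measure_sphere_def by blast

lemma f_diff:
  assumes "continuous_on (sphere 0 1) \<phi>" "continuous_on (sphere 0 1) \<psi>"
  shows "f (\<lambda>\<zeta>. \<phi> \<zeta> - \<psi> \<zeta>) = f \<phi> - f \<psi>"
proof -
  have "continuous_on (sphere 0 1) (\<lambda>\<zeta>. (-1) * \<psi> \<zeta>)" using assms(2) by (intro continuous_intros)
  from f_add[OF assms(1) this] show ?thesis
    unfolding f_cmult[OF assms(2)] by simp
qed

lemma f_bounded:
  obtains C where "C \<ge> 0" "\<And>\<phi> B. continuous_on (sphere 0 1) \<phi> \<Longrightarrow> (\<And>\<zeta>. norm \<zeta> = 1 \<Longrightarrow> norm (\<phi> \<zeta>) \<le> B) \<Longrightarrow> norm (f \<phi>) \<le> C * B"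
proof -
  obtain C where C: "\<And>\<phi>. continuous_on (sphere 0 1) \<phi> \<Longrightarrow> norm (f \<phi>) \<le> C * (SUP \<zeta>\<in>sphere 0 1. norm (\<phi> \<zeta>))"
    using f unfolding radon_measure_sphere_def by blast
  show ?thesis
  proof (rule that[of "\<bar>C\<bar>"])
    fix \<phi> :: "'a \<Rightarrow> complex" and B
    assume \<phi>: "continuous_on (sphere 0 1) \<phi>" and B: "\<And>\<zeta>. norm \<zeta> = 1 \<Longrightarrow> norm (\<phi> \<zeta>) \<le> B"
    obtain e :: 'a where e: "norm e = 1" using vector_choose_size[of 1] by auto
    have bdd: "bdd_above ((\<lambda>\<zeta>. norm (\<phi> \<zeta>)) ` sphere 0 1)" using B by (auto intro!: bdd_aboveI[of _ B])
    have S: "(SUP \<zeta>\<in>sphere 0 1. norm (\<phi> \<zeta>)) \<le> B" using e B by (intro cSUP_least) auto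
    have S0: "0 \<le> (SUP \<zeta>\<in>sphere 0 1. norm (\<phi> \<zeta>))"
      by (rule cSUP_upper2[OF bdd, of e]) (use e in auto)
    have "norm (f \<phi>) \<le> C * (SUP \<zeta>\<in>sphere 0 1. norm (\<phi> \<zeta>))" by (rule C[OF \<phi>])
    also have "\<dots> \<le> \<bar>C\<bar> * B" using S S0 by (intro mult_mono) auto
    finally show "norm (f \<phi>) \<le> \<bar>C\<bar> * B" .
  qed simp
qed

text \<open>
  The bound by the supremum over the sphere implies that only the values there matter.
\<close>

lemma f_cong:
  assumes "continuous_on (sphere 0 1) \<phi>" "continuous_on (sphere 0 1) \<psi>" "\<And>\<zeta>. norm \<zeta> = 1 \<Longrightarrow> \<phi> \<zeta> = \<psi> \<zeta>"
  shows "f \<phi> = f \<psi>"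
proof -
  obtain C where "\<And>\<phi> B. continuous_on (sphere 0 1) \<phi> \<Longrightarrow> (\<And>\<zeta>. norm \<zeta> = 1 \<Longrightarrow> norm (\<phi> \<zeta>) \<le> B) \<Longrightarrow> norm (f \<phi>) \<le> C * B"
    using f_bounded by metis
  from this[of "\<lambda>\<zeta>. \<phi> \<zeta> - \<psi> \<zeta>" 0] have "norm (f (\<lambda>\<zeta>. \<phi> \<zeta> - \<psi> \<zeta>)) \<le> 0"
    using assms by (auto intro!: continuous_intros)
  then show ?thesis using f_diff[OF assms(1,2)] by simp
qed

lemma f_sum:
  assumes "finite I" "\<And>i. i \<in> I \<Longrightarrow> continuous_on (sphere 0 1) (g i)"
  shows "f (\<lambda>\<zeta>. \<Sum>i\<in>I. g i \<zeta>) = (\<Sum>i\<in>I. f (g i))"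
  using assms
proof (induction I rule: finite_induct)
  case empty
  then show ?case using f_cmult[of "\<lambda>_. 0" 0] by simp
next
  case (insert i I)
  then show ?case by (simp add: f_add continuous_on_sum)
qed

text \<open>
  The Weierstrass test gives uniform convergence, under which \<open>f\<close> is continuous.
\<close>

lemma f_suminf:
  assumes g: "\<And>m. continuous_on (sphere 0 1) (g m)"
    and bound: "\<And>m \<zeta>. norm \<zeta> = 1 \<Longrightarrow> norm (g m \<zeta>) \<le> M m" and M: "summable M"
  shows "continuous_on (sphere 0 1) (\<lambda>\<zeta>. \<Sum>m. g m \<zeta>)" "(\<lambda>m. f (g m)) sums f (\<lambda>\<zeta>. \<Sum>m. g m \<zeta>)"
proof -
  let ?S = "\<lambda>\<zeta>. \<Sum>m. g m \<zeta>"
  have ul: "uniform_limit (sphere 0 1) (\<lambda>N \<zeta>. \<Sum>m<N. g m \<zeta>) ?S sequentially"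
    by (rule Weierstrass_m_test[OF _ M]) (use bound in auto)
  have c: "continuous_on (sphere 0 1) (\<lambda>\<zeta>. \<Sum>m<N. g m \<zeta>)" for N by (intro continuous_intros g)
  show S: "continuous_on (sphere 0 1) ?S"
    by (rule uniform_limit_theorem[OF _ ul]) (auto intro!: always_eventually c)
  obtain C where C: "C \<ge> 0" "\<And>\<phi> B. continuous_on (sphere 0 1) \<phi> \<Longrightarrow> (\<And>\<zeta>. norm \<zeta> = 1 \<Longrightarrow> norm (\<phi> \<zeta>) \<le> B) \<Longrightarrow> norm (f \<phi>) \<le> C * B"
    using f_bounded by metis
  have "(\<lambda>N. f (\<lambda>\<zeta>. \<Sum>m<N. g m \<zeta>)) \<longlonglongrightarrow> f ?S"
  proof (rule LIMSEQ_I)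
    fix e :: real assume e: "e > 0"
    define e' where "e' = e / (C + 1) / 2"
    have e': "e' > 0" unfolding e'_def using e C(1) by (intro divide_pos_pos) auto
    have "\<forall>\<^sub>F N in sequentially. \<forall>\<zeta>\<in>sphere 0 1. dist (\<Sum>m<N. g m \<zeta>) (?S \<zeta>) < e'"
      by (rule uniform_limitD[OF ul e'])
    then obtain N0 where "\<forall>N\<ge>N0. \<forall>\<zeta>\<in>sphere 0 1. norm ((\<Sum>m<N. g m \<zeta>) - ?S \<zeta>) < e'"
      unfolding eventually_sequentially dist_norm by blast
    then have N0: "norm ((\<Sum>m<N. g m \<zeta>) - ?S \<zeta>) < e'" if "N \<ge> N0" "norm \<zeta> = 1" for N \<zeta>
      using that by auto
    have "norm (f (\<lambda>\<zeta>. \<Sum>m<N. g m \<zeta>) - f ?S) < e" if "N \<ge> N0" for N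
    proof -
      have "norm (f (\<lambda>\<zeta>. (\<Sum>m<N. g m \<zeta>) - ?S \<zeta>)) \<le> C * e'"
        by (rule C(2)) (use N0[OF that] in \<open>auto intro!: continuous_on_diff c S less_imp_le\<close>)
      also have "\<dots> < e"
      proof -
        have "C * e' \<le> (C + 1) * e'" using e' by (intro mult_right_mono) auto
        also have "\<dots> = e / 2"
        proof -
          have "C + 1 \<noteq> 0" using C(1) by linarith
          then show ?thesis unfolding e'_def by (simp only: times_divide_eq_right nonzero_mult_div_cancel_left not_False_eq_True)
        qed
        finally show ?thesis using e by simp
      qed
      finally show ?thesis unfolding f_diff[OF c S] .
    qed
    then show "\<exists>no. \<forall>N\<ge>no. norm (f (\<lambda>\<zeta>. \<Sum>m<N. g m \<zeta>) - f ?S) < e" by blast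
  qed
  then show "(\<lambda>m. f (g m)) sums f ?S"
    unfolding sums_def f_sum[OF finite_lessThan g] .
qed

end

section \<open>The generalized Poisson integral\<close>

text \<open>
  The potential is a Borel representative extended by zero. The second assumption says that no
  nonzero regular separated solution vanishes on the unit sphere.
\<close>

locale poisson_problem = harmonic_basis n Y
  for n :: "nat \<Rightarrow> nat" and Y :: "nat \<Rightarrow> nat \<Rightarrow> 'a::euclidean_space \<Rightarrow> complex" +
  fixes V :: "real \<Rightarrow> complex"
  assumes source: "radial_source V"
    and nonresonant: "\<And>m. normalized_solution (2 * m + DIM('a) - 2) V 1 \<noteq> 0"
begin

definition radial_quotient :: "nat \<Rightarrow> real \<Rightarrow> complex" where
  "radial_quotient m r = normalized_solution (2 * m + DIM('a) - 2) V r / normalized_solution (2 * m + DIM('a) - 2) V 1"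

definition kernel :: "real \<Rightarrow> 'a \<Rightarrow> 'a \<Rightarrow> complex" where
  "kernel r \<xi> \<zeta> = (\<Sum>m. of_real (r ^ m) * radial_quotient m r * zonal (n m) (Y m) \<xi> \<zeta>)"

lemma nu: "2 * m + DIM('a) - 2 \<ge> 1" "2 * m + DIM('a) - 2 + 2 = DIM('a) + 2 * m"
  using dim by auto

lemma radial_quotient_continuous: "continuous_on {0..} (radial_quotient m)"
  unfolding radial_quotient_def by (intro continuous_intros normalized_solution(7)[OF source nu(1)] ballI nonresonant)

lemma radial_quotient_tendsto: "(radial_quotient m \<longlongrightarrow> 1) (at_left 1)"
proof -
  have "(radial_quotient m \<longlongrightarrow> radial_quotient m 1) (at 1 within {0..})"
    using radial_quotient_continuous[of m] by (simp add: continuous_on_def)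
  moreover have "at_left (1::real) \<le> at 1 within {0..}"
  proof -
    have "at_left (1::real) = at 1 within {0..<1}"
      by (rule at_within_nhd[of _ "{0<..}"]) auto
    also have "\<dots> \<le> at 1 within {0..}" by (rule at_le) auto
    finally show ?thesis .
  qed
  moreover have "radial_quotient m 1 = 1" using nonresonant[of m] by (simp add: radial_quotient_def)
  ultimately show ?thesis using tendsto_mono by metis
qed

text \<open>
  The values of the normalized solutions at 1 are nonzero and tend to 1 as \<open>m\<close> grows, hence they are
  bounded away from 0.
\<close>

lemma radial_quotient_bounded: obtains C where "C \<ge> 0" "\<And>m r. norm (radial_quotient m r) \<le> C"
proof -
  let ?y = "\<lambda>m. normalized_solution (2 * m + DIM('a) - 2) V"
  define C0 where "C0 = (\<integral>s. s * norm (V s) \<partial>lborel)"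
  have C0: "C0 \<ge> 0" unfolding C0_def by (intro integral_nonneg_AE AE_I2 radial_source_nonneg[OF source])
  have "(\<lambda>m. exp (C0 * inverse (real (Suc m))) - 1) \<longlonglongrightarrow> exp (C0 * 0) - 1"
    by (intro tendsto_intros LIMSEQ_inverse_real_of_nat)
  then have "(\<lambda>m. exp (C0 * inverse (real (Suc m))) - 1) \<longlonglongrightarrow> 0" by simp
  then have "\<forall>\<^sub>F m in sequentially. exp (C0 * inverse (real (Suc m))) - 1 < 1/2"
    by (rule order_tendstoD) simp
  then obtain M where M: "\<And>m. m \<ge> M \<Longrightarrow> exp (C0 * inverse (real (Suc m))) - 1 < 1/2"
    unfolding eventually_sequentially by blast
  have large: "1/2 \<le> norm (?y m 1)" if "m \<ge> M" for m
  proof -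
    have "real (Suc m) \<le> real (2 * m + DIM('a) - 2)" using dim by (intro of_nat_mono) auto
    then have "C0 / real (2 * m + DIM('a) - 2) \<le> C0 * inverse (real (Suc m))"
      unfolding divide_inverse using C0 by (intro mult_left_mono le_imp_inverse_le) auto
    then have "exp (C0 / real (2 * m + DIM('a) - 2)) - 1 \<le> exp (C0 * inverse (real (Suc m))) - 1" by simp
    then have "norm (?y m 1 - 1) < 1/2"
      using normalized_solution(3)[OF source nu(1)[of m], of 1] M[OF that] unfolding C0_def[symmetric] by linarith
    moreover have "norm (1::complex) \<le> norm (?y m 1) + norm (1 - ?y m 1)" by (metis add.commute diff_add_cancel norm_triangle_ineq)
    ultimately show ?thesis by (simp add: norm_minus_commute)
  qed
  define \<delta> where "\<delta> = Min (insert (1/2) ((\<lambda>m. norm (?y m 1)) ` {..<M}))"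
  have "\<delta> > 0" unfolding \<delta>_def using nonresonant by (subst Min_gr_iff) auto
  have \<delta>: "\<delta> \<le> norm (?y m 1)" for m
  proof (cases "m < M")
    case True
    then show ?thesis unfolding \<delta>_def by (intro Min_le) auto
  next
    case False
    have "\<delta> \<le> 1/2" unfolding \<delta>_def by (intro Min_le) auto
    then show ?thesis using large[of m] False by linarith
  qed
  show ?thesis
  proof (rule that[of "exp C0 / \<delta>"])
    show "0 \<le> exp C0 / \<delta>" using \<open>\<delta> > 0\<close> by simp
    fix m r
    show "norm (radial_quotient m r) \<le> exp C0 / \<delta>"
      unfolding radial_quotient_def norm_divide
      using normalized_solution(2)[OF source nu(1)[of m], of r] \<delta>[of m] \<open>\<delta> > 0\<close> unfolding C0_def[symmetric]
      by (intro frac_le) auto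
  qed
qed

text \<open>
  The zonal harmonics grow at most polynomially in the degree, so for \<open>\<rho> < 1\<close> this is a convergent
  majorant of the kernel on the ball of radius \<open>\<rho>\<close>.
\<close>

lemma kernel_majorant:
  obtains D :: real and k :: nat where "D \<ge> 0"
    "\<And>m r \<rho> \<xi> \<zeta>. 0 \<le> r \<Longrightarrow> r \<le> \<rho> \<Longrightarrow> norm \<xi> = 1 \<Longrightarrow> norm \<zeta> = 1 \<Longrightarrow>
      norm (of_real (r ^ m) * radial_quotient m r * zonal (n m) (Y m) \<xi> \<zeta>) \<le> D * (real (m + 1) ^ k * \<rho> ^ m)"
proof -
  obtain A where A: "A \<ge> 0"
    "\<And>m \<xi> \<zeta>. norm \<xi> = 1 \<Longrightarrow> norm \<zeta> = 1 \<Longrightarrow> (\<Sum>j<n m. norm (Y m j \<xi>) * norm (Y m j \<zeta>)) \<le> A * real (m + 1) ^ (2 * DIM('a))"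
    using zonal_growth by metis
  obtain C where C: "C \<ge> 0" "\<And>m r. norm (radial_quotient m r) \<le> C" using radial_quotient_bounded by metis
  show ?thesis
  proof (rule that[of "C * A" "2 * DIM('a)"])
    show "0 \<le> C * A" using A C by simp
    fix m :: nat and r \<rho> :: real and \<xi> \<zeta> :: 'a
    assume r: "0 \<le> r" "r \<le> \<rho>" and n1: "norm \<xi> = 1" "norm \<zeta> = 1"
    have "norm (zonal (n m) (Y m) \<xi> \<zeta>) \<le> (\<Sum>j<n m. norm (Y m j \<xi>) * norm (Y m j \<zeta>))"
      unfolding zonal_def by (rule order_trans[OF norm_sum]) (simp add: norm_mult)
    then have z: "norm (zonal (n m) (Y m) \<xi> \<zeta>) \<le> A * real (m + 1) ^ (2 * DIM('a))"
      using A(2)[OF n1] order_trans by blast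
    have "norm (of_real (r ^ m) * radial_quotient m r * zonal (n m) (Y m) \<xi> \<zeta>) = r ^ m * norm (radial_quotient m r) * norm (zonal (n m) (Y m) \<xi> \<zeta>)"
      using r by (simp add: norm_mult norm_power)
    also have "\<dots> \<le> \<rho> ^ m * C * (A * real (m + 1) ^ (2 * DIM('a)))"
      using r C A z by (intro mult_mono power_mono mult_nonneg_nonneg) auto
    finally show "norm (of_real (r ^ m) * radial_quotient m r * zonal (n m) (Y m) \<xi> \<zeta>) \<le> C * A * (real (m + 1) ^ (2 * DIM('a)) * \<rho> ^ m)"
      by (simp add: ac_simps)
  qed
qed

lemma zonal_continuous: "continuous_on (sphere 0 1) (zonal (n m) (Y m) \<xi>)"
  unfolding zonal_def by (intro continuous_intros Y_continuous) auto

definition solid :: "nat \<Rightarrow> nat \<Rightarrow> 'a \<Rightarrow> complex" where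
  "solid m j = (SOME p. solid_harmonic m p \<and> (\<forall>\<xi>. norm \<xi> = 1 \<longrightarrow> Y m j \<xi> = p \<xi>))"

lemma solid:
  assumes "j < n m"
  shows "solid_harmonic m (solid m j)" "norm \<xi> = 1 \<Longrightarrow> Y m j \<xi> = solid m j \<xi>"
proof -
  have "\<exists>p. solid_harmonic m p \<and> (\<forall>\<xi>. norm \<xi> = 1 \<longrightarrow> Y m j \<xi> = p \<xi>)"
    using spherical_harmonicE[OF Y_harmonic[OF assms]] by metis
  from someI_ex[OF this] show "solid_harmonic m (solid m j)" "norm \<xi> = 1 \<Longrightarrow> Y m j \<xi> = solid m j \<xi>"
    unfolding solid_def by auto
qed

end

locale poisson_data = poisson_problem n Y V + sphere_functional f
  for n :: "nat \<Rightarrow> nat" and Y :: "nat \<Rightarrow> nat \<Rightarrow> 'a::euclidean_space \<Rightarrow> complex"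
    and V :: "real \<Rightarrow> complex" and f :: "('a \<Rightarrow> complex) \<Rightarrow> complex"
begin

definition moment :: "nat \<Rightarrow> nat \<Rightarrow> complex" where
  "moment m j = f (\<lambda>\<zeta>. cnj (Y m j \<zeta>))"

definition component :: "nat \<Rightarrow> 'a \<Rightarrow> complex" where
  "component m x = (\<Sum>j<n m. moment m j * solid m j x)"

definition mode :: "nat \<Rightarrow> 'a \<Rightarrow> complex" where
  "mode m x = radial_quotient m (norm x) * component m x"

lemma component_solid: "solid_harmonic m (component m)"
  unfolding component_def[abs_def] by (intro solid_harmonic_sum solid_harmonic_cmult solid) auto

lemma mode_continuous: "continuous_on UNIV (mode m)"
proof -
  have "continuous_on UNIV (\<lambda>x::'a. radial_quotient m (norm x))"
    by (rule continuous_on_compose2[OF radial_quotient_continuous]) (auto intro: continuous_intros)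
  then show ?thesis unfolding mode_def by (intro continuous_intros solid_harmonicD(4)[OF component_solid])
qed

text \<open>
  Applying \<open>f\<close> to the zonal harmonic in its second variable leaves a spherical harmonic in the first,
  and the factor \<open>r ^ m\<close> turns this into the values of a solid harmonic at \<open>r \<xi>\<close>.
\<close>

lemma f_kernel_term:
  assumes "norm \<xi> = 1" "0 \<le> r"
  shows "f (\<lambda>\<zeta>. of_real (r ^ m) * radial_quotient m r * zonal (n m) (Y m) \<xi> \<zeta>) = mode m (r *\<^sub>R \<xi>)"
proof -
  have c: "continuous_on (sphere 0 1) (\<lambda>\<zeta>. cnj (Y m j \<zeta>))" if "j < n m" for j
    using that by (intro continuous_intros Y_continuous) auto
  have "f (zonal (n m) (Y m) \<xi>) = (\<Sum>j<n m. f (\<lambda>\<zeta>. Y m j \<xi> * cnj (Y m j \<zeta>)))"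
    unfolding zonal_def[abs_def] by (rule f_sum) (auto intro!: continuous_on_mult continuous_on_const c)
  also have "\<dots> = (\<Sum>j<n m. Y m j \<xi> * moment m j)"
    using c by (intro sum.cong) (auto simp: f_cmult moment_def)
  also have "\<dots> = component m \<xi>"
    unfolding component_def using solid(2)[OF _ assms(1)] by (intro sum.cong) auto
  finally have z: "f (zonal (n m) (Y m) \<xi>) = component m \<xi>" .
  have "f (\<lambda>\<zeta>. of_real (r ^ m) * radial_quotient m r * zonal (n m) (Y m) \<xi> \<zeta>) = of_real (r ^ m) * radial_quotient m r * component m \<xi>"
    using f_cmult[OF zonal_continuous] z by simp
  also have "\<dots> = mode m (r *\<^sub>R \<xi>)"
    unfolding mode_def solid_harmonicD(2)[OF component_solid] using assms by (simp add: scaleR_conv_of_real)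
  finally show ?thesis .
qed

lemma kernel_continuous_and_sums:
  assumes "0 \<le> r" "r < 1" "norm \<xi> = 1"
  shows "continuous_on (sphere 0 1) (kernel r \<xi>)" "(\<lambda>m. mode m (r *\<^sub>R \<xi>)) sums f (kernel r \<xi>)"
proof -
  obtain D :: real and k :: nat where D: "D \<ge> 0"
    "\<And>m r \<rho> \<xi> \<zeta>. 0 \<le> r \<Longrightarrow> r \<le> \<rho> \<Longrightarrow> norm \<xi> = 1 \<Longrightarrow> norm \<zeta> = 1 \<Longrightarrow>
      norm (of_real (r ^ m) * radial_quotient m r * zonal (n m) (Y m) \<xi> \<zeta>) \<le> D * (real (m + 1) ^ k * \<rho> ^ m)"
    using kernel_majorant by metis
  let ?g = "\<lambda>m \<zeta>. of_real (r ^ m) * radial_quotient m r * zonal (n m) (Y m) \<xi> \<zeta>"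
  have g: "continuous_on (sphere 0 1) (?g m)" for m by (intro continuous_intros zonal_continuous)
  have b: "norm (?g m \<zeta>) \<le> D * (real (m + 1) ^ k * r ^ m)" if "norm \<zeta> = 1" for m \<zeta>
    by (rule D(2)) (use assms that in auto)
  have s: "summable (\<lambda>m. D * (real (m + 1) ^ k * r ^ m))"
    by (intro summable_mult summable_polynomial_geometric assms)
  show "continuous_on (sphere 0 1) (kernel r \<xi>)"
    unfolding kernel_def[abs_def] by (rule f_suminf(1)[OF g b s])
  show "(\<lambda>m. mode m (r *\<^sub>R \<xi>)) sums f (kernel r \<xi>)"
    using f_suminf(2)[OF g b s] unfolding kernel_def[abs_def] f_kernel_term[OF assms(3,1)] .
qed

definition extension :: "'a \<Rightarrow> complex" where
  "extension x = (\<Sum>m. mode m x)"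

lemma direction: "norm (direction x) = 1" "norm x *\<^sub>R direction x = x" for x :: 'a
proof -
  have "\<exists>\<xi>::'a. norm \<xi> = 1" using vector_choose_size[of 1] by auto
  from someI_ex[OF this] show "norm (direction x) = 1" by (auto simp: direction_def)
  show "norm x *\<^sub>R direction x = x" by (simp add: direction_def)
qed

text \<open>
  The right-hand side depends on the point \<open>r \<xi>\<close> only. So at the origin any direction may stand for \<open>\<xi>\<close>
  in the definition of the Poisson integral.
\<close>

lemma f_kernel_eq_extension:
  assumes "0 \<le> r" "r < 1" "norm \<xi> = 1"
  shows "f (kernel r \<xi>) = extension (r *\<^sub>R \<xi>)"
  using kernel_continuous_and_sums(2)[OF assms] unfolding extension_def by (rule sums_unique)

lemma mode_majorant:
  obtains M :: "real \<Rightarrow> nat \<Rightarrow> real" where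
    "\<And>\<rho> m x. norm x \<le> \<rho> \<Longrightarrow> norm (mode m x) \<le> M \<rho> m"
    "\<And>\<rho>. 0 \<le> \<rho> \<Longrightarrow> \<rho> < 1 \<Longrightarrow> summable (M \<rho>)"
proof -
  obtain D :: real and k :: nat where D: "D \<ge> 0"
    "\<And>m r \<rho> \<xi> \<zeta>. 0 \<le> r \<Longrightarrow> r \<le> \<rho> \<Longrightarrow> norm \<xi> = 1 \<Longrightarrow> norm \<zeta> = 1 \<Longrightarrow>
      norm (of_real (r ^ m) * radial_quotient m r * zonal (n m) (Y m) \<xi> \<zeta>) \<le> D * (real (m + 1) ^ k * \<rho> ^ m)"
    using kernel_majorant by metis
  obtain C where C: "C \<ge> 0" "\<And>\<phi> B. continuous_on (sphere 0 1) \<phi> \<Longrightarrow> (\<And>\<zeta>. norm \<zeta> = 1 \<Longrightarrow> norm (\<phi> \<zeta>) \<le> B) \<Longrightarrow> norm (f \<phi>) \<le> C * B"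
    using f_bounded by metis
  show ?thesis
  proof (rule that[of "\<lambda>\<rho> m. C * (D * (real (m + 1) ^ k * \<rho> ^ m))"])
    fix \<rho> m and x :: 'a assume "norm x \<le> \<rho>"
    then have "norm (f (\<lambda>\<zeta>. of_real (norm x ^ m) * radial_quotient m (norm x) * zonal (n m) (Y m) (direction x) \<zeta>)) \<le> C * (D * (real (m + 1) ^ k * \<rho> ^ m))"
      by (intro C(2) continuous_intros zonal_continuous D(2)) (auto simp: direction)
    then show "norm (mode m x) \<le> C * (D * (real (m + 1) ^ k * \<rho> ^ m))"
      by (subst (asm) f_kernel_term) (auto simp: direction)
  next
    fix \<rho> :: real assume "0 \<le> \<rho>" "\<rho> < 1"
    then show "summable (\<lambda>m. C * (D * (real (m + 1) ^ k * \<rho> ^ m)))"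
      by (intro summable_mult summable_polynomial_geometric)
  qed
qed

lemma mode_sums:
  assumes "norm x < 1"
  shows "(\<lambda>m. mode m x) sums extension x"
  using kernel_continuous_and_sums(2)[of "norm x" "direction x"] assms
  unfolding extension_def by (simp add: direction sums_iff)

lemma extension_continuous: "continuous_on (ball 0 1) extension"
proof -
  obtain M :: "real \<Rightarrow> nat \<Rightarrow> real" where M: "\<And>\<rho> m x. norm x \<le> \<rho> \<Longrightarrow> norm (mode m x) \<le> M \<rho> m"
    "\<And>\<rho>. 0 \<le> \<rho> \<Longrightarrow> \<rho> < 1 \<Longrightarrow> summable (M \<rho>)" using mode_majorant by metis
  have cont: "continuous_on (cball 0 \<rho>) extension" if "0 \<le> \<rho>" "\<rho> < 1" for \<rho>
  proof -
    have "uniform_limit (cball 0 \<rho>) (\<lambda>N x. \<Sum>m<N. mode m x) extension sequentially"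
      unfolding extension_def[abs_def] by (rule Weierstrass_m_test[OF _ M(2)[OF that]]) (use M(1) in auto)
    then show ?thesis
      by (rule uniform_limit_theorem[rotated])
        (auto intro!: always_eventually continuous_on_sum continuous_on_subset[OF mode_continuous])
  qed
  have "isCont extension x" if x: "norm x < 1" for x
  proof -
    obtain \<rho> where \<rho>: "norm x < \<rho>" "\<rho> < 1" using dense[OF x] by blast
    then have "0 \<le> \<rho>" using norm_ge_zero[of x] by linarith
    then have "continuous_on (ball 0 \<rho>) extension"
      by (rule continuous_on_subset[OF cont[OF _ \<rho>(2)]]) auto
    then show ?thesis using \<rho>(1) by (simp add: continuous_on_eq_continuous_at)
  qed
  then show ?thesis by (intro continuous_at_imp_continuous_on) auto
qed

text \<open>
  The weak equation holds for each mode, and on a compact subset of the ball the partial sums are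
  equibounded, so it passes to the limit.
\<close>

lemma extension_weak_solution:
  assumes \<phi>: "Ck_on 2 UNIV \<phi>" "compact K" "K \<subseteq> ball 0 1" "\<And>x. x \<notin> K \<Longrightarrow> \<phi> x = 0"
  defines "v \<equiv> \<lambda>x. indicator (ball 0 1) x *\<^sub>R extension x"
  shows "integrable lborel (\<lambda>x. v x * (V (norm x) * \<phi> x))"
    and "integrable lborel (\<lambda>x. v x * laplacian \<phi> x)"
    and "(\<integral>x. v x * laplacian \<phi> x \<partial>lborel) = (\<integral>x. v x * (V (norm x) * \<phi> x) \<partial>lborel)"
proof -
  obtain M :: "real \<Rightarrow> nat \<Rightarrow> real" where M: "\<And>\<rho> m x. norm x \<le> \<rho> \<Longrightarrow> norm (mode m x) \<le> M \<rho> m"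
    "\<And>\<rho>. 0 \<le> \<rho> \<Longrightarrow> \<rho> < 1 \<Longrightarrow> summable (M \<rho>)" using mode_majorant by metis
  have bK: "bounded K" using \<phi>(2) compact_imp_bounded by blast
  have cK: "closed K" using \<phi>(2) compact_imp_closed by blast
  obtain \<rho> where \<rho>: "0 \<le> \<rho>" "\<rho> < 1" "\<And>x. x \<in> K \<Longrightarrow> norm x \<le> \<rho>"
  proof (cases "K = {}")
    case True
    then show ?thesis using that[of 0] by auto
  next
    case False
    have "continuous_on K (norm :: 'a \<Rightarrow> real)" by (intro continuous_intros)
    from continuous_attains_sup[OF \<phi>(2) False this] obtain z where z: "z \<in> K" "\<And>x. x \<in> K \<Longrightarrow> norm x \<le> norm z"
      by blast
    then have "norm z < 1" using \<phi>(3) by auto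
    then show ?thesis using that[of "norm z"] z by auto
  qed
  have \<phi>c: "continuous_on UNIV \<phi>" using \<phi>(1) Ck_on_imp_continuous by blast
  have lapc: "continuous_on UNIV (laplacian \<phi>)" by (rule continuous_on_laplacian[OF \<phi>(1)])
  note lap0 = laplacian_eq_0_off_support[OF \<phi>(1) cK \<phi>(4)]
  have [measurable]: "V \<in> borel_measurable borel" using source by (simp add: radial_source_def)
  have [measurable]: "\<phi> \<in> borel_measurable borel" "laplacian \<phi> \<in> borel_measurable borel" "\<And>m. mode m \<in> borel_measurable borel"
    using \<phi>c lapc mode_continuous by (auto intro: borel_measurable_continuous_onI)
  have [measurable]: "v \<in> borel_measurable borel"
    unfolding v_def by (rule borel_measurable_continuous_on_indicator[OF _ extension_continuous]) auto
  have vlim: "(\<lambda>N. \<Sum>m<N. mode m x) \<longlonglongrightarrow> v x" if "x \<in> K" for x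
    using mode_sums[of x] that \<phi>(3) by (auto simp: v_def sums_def)
  define B where "B = (\<Sum>m. M \<rho> m)"
  have Sb: "norm (\<Sum>m<N. mode m x) \<le> B" if "x \<in> K" for N x
  proof -
    have "norm (\<Sum>m<N. mode m x) \<le> (\<Sum>m<N. M \<rho> m)"
      by (rule order_trans[OF norm_sum], rule sum_mono) (use M(1) \<rho>(3) that in auto)
    also have "\<dots> \<le> B"
    proof -
      have "0 \<le> M \<rho> m" for m using M(1)[of x \<rho> m] \<rho>(3)[OF that] norm_ge_zero order_trans by blast
      then show ?thesis unfolding B_def by (intro sum_le_suminf M(2) \<rho>) auto
    qed
    finally show ?thesis .
  qed
  have main: "integrable lborel (\<lambda>x. v x * h x)"
      "(\<lambda>N. \<integral>x. (\<Sum>m<N. mode m x) * h x \<partial>lborel) \<longlonglongrightarrow> (\<integral>x. v x * h x \<partial>lborel)"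
    if h: "integrable lborel h" "\<And>x. x \<notin> K \<Longrightarrow> h x = 0" for h :: "'a \<Rightarrow> complex"
  proof -
    have [measurable]: "h \<in> borel_measurable borel" using h(1) by auto
    have i: "integrable lborel (\<lambda>x. B * norm (h x))" using h(1) by simp
    have l: "AE x in lborel. (\<lambda>N. (\<Sum>m<N. mode m x) * h x) \<longlonglongrightarrow> v x * h x"
    proof (rule AE_I2)
      fix x show "(\<lambda>N. (\<Sum>m<N. mode m x) * h x) \<longlonglongrightarrow> v x * h x"
        by (cases "x \<in> K") (auto intro!: tendsto_mult_right vlim simp: h(2))
    qed
    have b: "AE x in lborel. norm ((\<Sum>m<N. mode m x) * h x) \<le> B * norm (h x)" for N
    proof (rule AE_I2)
      fix x show "norm ((\<Sum>m<N. mode m x) * h x) \<le> B * norm (h x)"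
        by (cases "x \<in> K") (auto simp: h(2) norm_mult intro!: mult_right_mono Sb)
    qed
    have m1: "(\<lambda>x. v x * h x) \<in> borel_measurable lborel" by measurable
    have m2: "(\<lambda>x. (\<Sum>m<N. mode m x) * h x) \<in> borel_measurable lborel" for N by measurable
    show "integrable lborel (\<lambda>x. v x * h x)"
      by (rule integrable_dominated_convergence[OF m1 m2 i l b])
    show "(\<lambda>N. \<integral>x. (\<Sum>m<N. mode m x) * h x \<partial>lborel) \<longlonglongrightarrow> (\<integral>x. v x * h x \<partial>lborel)"
      by (rule integral_dominated_convergence[OF m1 m2 i l b])
  qed
  have h1: "integrable lborel (\<lambda>x. V (norm x) * \<phi> x)"
    by (rule radial_source_integrable_mult[OF dim source \<phi>c bK \<phi>(4)])
  have h2: "integrable lborel (laplacian \<phi>)" by (rule integrable_compact_support[OF lapc bK lap0])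
  have z1: "V (norm x) * \<phi> x = 0" if "x \<notin> K" for x using \<phi>(4)[OF that] by simp
  show "integrable lborel (\<lambda>x. v x * (V (norm x) * \<phi> x))" by (rule main(1)[OF h1 z1])
  show "integrable lborel (\<lambda>x. v x * laplacian \<phi> x)" by (rule main(1)[OF h2 lap0])
  have "(\<integral>x. (\<Sum>m<N. mode m x) * laplacian \<phi> x \<partial>lborel) = (\<integral>x. (\<Sum>m<N. mode m x) * (V (norm x) * \<phi> x) \<partial>lborel)" for N
  proof -
    let ?u = "\<lambda>m x. normalized_solution (2 * m + DIM('a) - 2) V (norm x) * component m x"
    have md: "mode m x = inverse (normalized_solution (2 * m + DIM('a) - 2) V 1) * ?u m x" for m x
      by (simp add: mode_def radial_quotient_def divide_inverse ac_simps)
    note W = weak_solution_term[OF dim nu(2,1) component_solid \<phi>(1,2,4) source]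
    have i1: "integrable lborel (\<lambda>x. mode m x * laplacian \<phi> x)" for m
      unfolding md mult.assoc[of "inverse _"] by (rule integrable_mult_right, rule W(2))
    have i2: "integrable lborel (\<lambda>x. mode m x * (V (norm x) * \<phi> x))" for m
      unfolding md mult.assoc[of "inverse _"] by (rule integrable_mult_right, rule W(3))
    have e: "(\<integral>x. mode m x * laplacian \<phi> x \<partial>lborel) = (\<integral>x. mode m x * (V (norm x) * \<phi> x) \<partial>lborel)" for m
      unfolding md mult.assoc[of "inverse _"] integral_mult_right_zero by (intro arg_cong2[where f="(*)"] refl W(4))
    show ?thesis
      unfolding sum_distrib_right by (simp only: Bochner_Integration.integral_sum i1 i2 e)
  qed
  then have "(\<lambda>N. \<integral>x. (\<Sum>m<N. mode m x) * (V (norm x) * \<phi> x) \<partial>lborel) \<longlonglongrightarrow> (\<integral>x. v x * laplacian \<phi> x \<partial>lborel)"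
    using main(2)[OF h2 lap0] by simp
  from LIMSEQ_unique[OF this main(2)[OF h1 z1]]
  show "(\<integral>x. v x * laplacian \<phi> x \<partial>lborel) = (\<integral>x. v x * (V (norm x) * \<phi> x) \<partial>lborel)" .
qed

lemma mode_on_sphere:
  assumes "norm \<xi> = 1" "0 \<le> r"
  shows "mode m (r *\<^sub>R \<xi>) = (\<Sum>j<n m. (of_real (r ^ m) * radial_quotient m r * moment m j) * Y m j \<xi>)"
proof -
  have "mode m (r *\<^sub>R \<xi>) = radial_quotient m r * (of_real (r ^ m) * component m \<xi>)"
    unfolding mode_def solid_harmonicD(2)[OF component_solid] using assms by (simp add: scaleR_conv_of_real)
  also have "component m \<xi> = (\<Sum>j<n m. moment m j * Y m j \<xi>)"
    unfolding component_def using solid(2)[OF _ assms(1)] by (intro sum.cong) auto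
  finally show ?thesis by (simp add: sum_distrib_left ac_simps)
qed

text \<open>
  The integral of the \<open>m\<close>-th mode against \<open>\<phi>\<close> is \<open>r ^ m\<close> times the radial quotient times
  \<open>f (proj m \<phi>)\<close>. The first two factors are bounded and tend to 1, and the numbers \<open>f (proj m \<phi>)\<close> form
  an absolutely convergent series with sum \<open>f \<phi>\<close> by the expansion of \<open>\<phi>\<close>. Hence Tannery's theorem
  applies.
\<close>

theorem extension_boundary_value: "has_distributional_boundary_value extension f"
  unfolding has_distributional_boundary_value_def
proof (intro allI impI conjI)
  fix \<phi> :: "'a \<Rightarrow> complex" assume \<phi>: "smooth_on_sphere \<phi>"
  have \<phi>c: "continuous_on (sphere 0 1) \<phi>" by (rule smooth_on_sphere_continuous[OF \<phi>])
  have ev: "\<forall>\<^sub>F r in at_left (1::real). r \<in> {0<..<1}"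
    using eventually_at_left_real[of 0 1] by simp
  have uc: "continuous_on (sphere 0 1) (\<lambda>\<xi>. extension (r *\<^sub>R \<xi>))" if "r \<in> {0<..<1}" for r
    using that by (intro continuous_on_compose2[OF extension_continuous] continuous_intros) auto
  show "\<forall>\<^sub>F r in at_left (1::real). integrable sphere_measure (\<lambda>\<xi>. extension (r *\<^sub>R \<xi>) * \<phi> \<xi>)"
    using ev by eventually_elim (intro integrable_sphere_continuous continuous_intros uc \<phi>c)
  obtain M where M: "summable M" "\<And>m \<zeta>. norm \<zeta> = 1 \<Longrightarrow> norm (proj m \<phi> \<zeta>) \<le> M m" using proj_summable[OF \<phi>] by metis
  obtain Cf where Cf: "Cf \<ge> 0" "\<And>\<phi> B. continuous_on (sphere 0 1) \<phi> \<Longrightarrow> (\<And>\<zeta>. norm \<zeta> = 1 \<Longrightarrow> norm (\<phi> \<zeta>) \<le> B) \<Longrightarrow> norm (f \<phi>) \<le> Cf * B"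
    using f_bounded by metis
  obtain C where C: "C \<ge> 0" "\<And>m r. norm (radial_quotient m r) \<le> C" using radial_quotient_bounded by metis
  have fp: "f (proj m \<phi>) = (\<Sum>j<n m. moment m j * coeff m j \<phi>)" for m
  proof -
    have c: "continuous_on (sphere 0 1) (\<lambda>\<zeta>. cnj (Y m j \<zeta>))" if "j < n m" for j
      using that by (intro continuous_intros Y_continuous) auto
    have "f (proj m \<phi>) = (\<Sum>j<n m. f (\<lambda>\<zeta>. cnj (Y m j \<zeta>) * coeff m j \<phi>))"
      unfolding proj_def[abs_def] by (rule f_sum) (auto intro!: continuous_on_mult continuous_on_const c)
    also have "\<dots> = (\<Sum>j<n m. moment m j * coeff m j \<phi>)"
      using c f_cmult[of "\<lambda>\<zeta>. cnj (Y m j \<zeta>)" "coeff m j \<phi>" for j]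
      by (intro sum.cong) (auto simp: moment_def mult.commute)
    finally show ?thesis .
  qed
  have pc: "continuous_on (sphere 0 1) (proj m \<phi>)" for m by (rule proj_continuous) simp
  have ff: "(\<lambda>m. f (proj m \<phi>)) sums f \<phi>"
  proof -
    have "f (\<lambda>\<zeta>. \<Sum>m. proj m \<phi> \<zeta>) = f \<phi>"
      by (rule f_cong[OF f_suminf(1)[OF pc M(2,1)] \<phi>c]) (use harmonic_expansion[OF \<phi>] in \<open>simp_all add: sums_iff\<close>)
    then show ?thesis using f_suminf(2)[OF pc M(2,1)] by simp
  qed
  have bf: "norm (f (proj m \<phi>)) \<le> Cf * M m" for m by (rule Cf(2)[OF pc M(2)])
  obtain MM :: "real \<Rightarrow> nat \<Rightarrow> real" where MM: "\<And>\<rho> m x. norm x \<le> \<rho> \<Longrightarrow> norm (mode m x) \<le> MM \<rho> m"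
    "\<And>\<rho>. 0 \<le> \<rho> \<Longrightarrow> \<rho> < 1 \<Longrightarrow> summable (MM \<rho>)" using mode_majorant by metis
  define J where "J = (\<integral>\<xi>. norm (\<phi> \<xi>) \<partial>sphere_measure)"
  have Ji: "integrable sphere_measure (\<lambda>\<xi>. norm (\<phi> \<xi>))" by (intro integrable_sphere_continuous continuous_intros \<phi>c)
  have int: "(\<integral>\<xi>. extension (r *\<^sub>R \<xi>) * \<phi> \<xi> \<partial>sphere_measure) = (\<Sum>m. of_real (r ^ m) * radial_quotient m r * f (proj m \<phi>))"
    if r: "r \<in> {0<..<1}" for r
  proof -
    have mc: "continuous_on (sphere 0 1) (\<lambda>\<xi>. mode m (r *\<^sub>R \<xi>))" for m
      by (intro continuous_on_compose2[OF mode_continuous] continuous_intros) auto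
    have im: "integrable sphere_measure (\<lambda>\<xi>. mode m (r *\<^sub>R \<xi>) * \<phi> \<xi>)" for m
      by (intro integrable_sphere_continuous continuous_intros mc \<phi>c)
    have bm: "norm (mode m (r *\<^sub>R \<xi>) * \<phi> \<xi>) \<le> MM r m * norm (\<phi> \<xi>)" if "norm \<xi> = 1" for m \<xi>
      unfolding norm_mult using MM(1)[of "r *\<^sub>R \<xi>" r m] that r by (intro mult_right_mono) auto
    have sMM: "summable (MM r)" using MM(2) r by simp
    have "(\<integral>\<xi>. extension (r *\<^sub>R \<xi>) * \<phi> \<xi> \<partial>sphere_measure) = (\<integral>\<xi>. (\<Sum>m. mode m (r *\<^sub>R \<xi>) * \<phi> \<xi>) \<partial>sphere_measure)"
    proof (rule Bochner_Integration.integral_cong[OF refl])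
      fix \<xi> :: 'a assume "\<xi> \<in> space sphere_measure"
      then have "(\<lambda>m. mode m (r *\<^sub>R \<xi>)) sums extension (r *\<^sub>R \<xi>)" using r by (intro mode_sums) auto
      then have "(\<lambda>m. mode m (r *\<^sub>R \<xi>) * \<phi> \<xi>) sums (extension (r *\<^sub>R \<xi>) * \<phi> \<xi>)" by (rule sums_mult2)
      then show "extension (r *\<^sub>R \<xi>) * \<phi> \<xi> = (\<Sum>m. mode m (r *\<^sub>R \<xi>) * \<phi> \<xi>)" by (rule sums_unique)
    qed
    also have "\<dots> = (\<Sum>m. \<integral>\<xi>. mode m (r *\<^sub>R \<xi>) * \<phi> \<xi> \<partial>sphere_measure)"
    proof (rule integral_suminf[OF im])
      show "AE \<xi> in sphere_measure. summable (\<lambda>m. norm (mode m (r *\<^sub>R \<xi>) * \<phi> \<xi>))"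
      proof (rule AE_I2)
        fix \<xi> :: 'a assume "\<xi> \<in> space sphere_measure"
        then show "summable (\<lambda>m. norm (mode m (r *\<^sub>R \<xi>) * \<phi> \<xi>))"
          by (intro summable_comparison_test'[OF summable_mult2[OF sMM, of "norm (\<phi> \<xi>)"]]) (use bm in auto)
      qed
      show "summable (\<lambda>m. \<integral>\<xi>. norm (mode m (r *\<^sub>R \<xi>) * \<phi> \<xi>) \<partial>sphere_measure)"
      proof (rule summable_comparison_test'[OF summable_mult2[OF sMM, of J]])
        fix m
        have "(\<integral>\<xi>. norm (mode m (r *\<^sub>R \<xi>) * \<phi> \<xi>) \<partial>sphere_measure) \<le> (\<integral>\<xi>. MM r m * norm (\<phi> \<xi>) \<partial>sphere_measure)"
          by (intro integral_mono integrable_norm im integrable_mult_right Ji bm) auto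
        then show "norm (\<integral>\<xi>. norm (mode m (r *\<^sub>R \<xi>) * \<phi> \<xi>) \<partial>sphere_measure) \<le> MM r m * J"
          by (simp add: J_def)
      qed
    qed
    also have "(\<lambda>m. \<integral>\<xi>. mode m (r *\<^sub>R \<xi>) * \<phi> \<xi> \<partial>sphere_measure) = (\<lambda>m. of_real (r ^ m) * radial_quotient m r * f (proj m \<phi>))"
    proof
      fix m
      have iy: "integrable sphere_measure (\<lambda>\<xi>. Y m j \<xi> * \<phi> \<xi>)" if "j < n m" for j
        using that by (intro integrable_sphere_continuous continuous_intros Y_continuous \<phi>c) auto
      have "(\<integral>\<xi>. mode m (r *\<^sub>R \<xi>) * \<phi> \<xi> \<partial>sphere_measure) =
        (\<integral>\<xi>. (\<Sum>j<n m. (of_real (r ^ m) * radial_quotient m r * moment m j) * (Y m j \<xi> * \<phi> \<xi>)) \<partial>sphere_measure)"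
        using r by (intro Bochner_Integration.integral_cong refl) (simp add: mode_on_sphere sum_distrib_right mult.assoc)
      also have "\<dots> = (\<Sum>j<n m. (of_real (r ^ m) * radial_quotient m r * moment m j) * coeff m j \<phi>)"
        unfolding coeff_def using iy by (subst Bochner_Integration.integral_sum) auto
      also have "\<dots> = of_real (r ^ m) * radial_quotient m r * f (proj m \<phi>)"
        unfolding fp sum_distrib_left by (simp add: mult.assoc)
      finally show "(\<integral>\<xi>. mode m (r *\<^sub>R \<xi>) * \<phi> \<xi> \<partial>sphere_measure) = of_real (r ^ m) * radial_quotient m r * f (proj m \<phi>)" .
    qed
    finally show ?thesis .
  qed
  have "((\<lambda>r. \<Sum>m. of_real (r ^ m) * radial_quotient m r * f (proj m \<phi>)) \<longlongrightarrow> (\<Sum>m. f (proj m \<phi>))) (at_left 1)"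
  proof (rule tannerys_theorem[THEN conjunct2, THEN conjunct2])
    show "((\<lambda>r. of_real (r ^ m) * radial_quotient m r * f (proj m \<phi>)) \<longlongrightarrow> f (proj m \<phi>)) (at_left 1)" for m
    proof -
      have "((\<lambda>r::real. complex_of_real (r ^ m) * radial_quotient m r * f (proj m \<phi>)) \<longlongrightarrow> complex_of_real (1 ^ m) * 1 * f (proj m \<phi>)) (at_left 1)"
        by (intro tendsto_intros radial_quotient_tendsto)
      then show ?thesis by simp
    qed
    show "summable (\<lambda>m. C * (Cf * M m))" by (intro summable_mult M)
    have "\<forall>\<^sub>F (m, r) in sequentially \<times>\<^sub>F at_left (1::real). r \<in> {0<..<1}"
      using eventually_prod2[THEN iffD2, OF _ ev, of sequentially] by (simp add: case_prod_unfold)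
    then show "\<forall>\<^sub>F (m, r) in sequentially \<times>\<^sub>F at_left 1. norm (of_real (r ^ m) * radial_quotient m r * f (proj m \<phi>)) \<le> C * (Cf * M m)"
    proof (rule eventually_mono, clarify)
      fix m :: nat and r :: real assume r: "r \<in> {0<..<1}"
      have "norm (of_real (r ^ m) * radial_quotient m r * f (proj m \<phi>)) = r ^ m * norm (radial_quotient m r) * norm (f (proj m \<phi>))"
        using r by (simp add: norm_mult norm_power)
      also have "\<dots> \<le> 1 * C * (Cf * M m)"
        using r C bf by (intro mult_mono power_le_one) auto
      finally show "norm (of_real (r ^ m) * radial_quotient m r * f (proj m \<phi>)) \<le> C * (Cf * M m)" by simp
    qed
  qed auto
  also have "(\<Sum>m. f (proj m \<phi>)) = f \<phi>" using ff by (simp add: sums_iff)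
  finally show "((\<lambda>r. \<integral>\<xi>. extension (r *\<^sub>R \<xi>) * \<phi> \<xi> \<partial>sphere_measure) \<longlongrightarrow> f \<phi>) (at_left 1)"
    by (rule Lim_transform_eventually) (use ev in \<open>eventually_elim\<close>, simp add: int)
qed

end

lemma integrable_lebesgue_AE:
  fixes f g :: "'a::euclidean_space \<Rightarrow> complex"
  assumes g: "integrable lborel g" and ae: "AE x in lborel. g x = f x"
  shows "integrable lebesgue f" "(\<integral>x. f x \<partial>lebesgue) = (\<integral>x. g x \<partial>lborel)"
proof -
  have gm: "g \<in> borel_measurable lborel" using g by auto
  have gl: "integrable lebesgue g" using g by (simp only: integrable_completion[OF gm])
  have gml: "g \<in> borel_measurable lebesgue" by (rule measurable_completion[OF gm])
  have ae': "AE x in lebesgue. g x = f x" by (rule AE_completion[OF ae])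
  have fm: "f \<in> borel_measurable lebesgue" by (rule borel_measurable_AE[OF gml ae'])
  show "integrable lebesgue f" by (rule integrable_cong_AE_imp[OF gl fm ae'])
  have "(\<integral>x. f x \<partial>lebesgue) = (\<integral>x. g x \<partial>lebesgue)"
    using ae' by (intro integral_cong_AE fm gml) (auto elim!: eventually_mono)
  then show "(\<integral>x. f x \<partial>lebesgue) = (\<integral>x. g x \<partial>lborel)" by (simp only: integral_completion[OF gm])
qed

context poisson_data
begin

text \<open>
  The potentials \<open>V'\<close> and \<open>V\<close> differ on a null set of radii only, hence as functions of the norm on a
  null set of points.
\<close>

lemma extension_distributional_solution:
  assumes ae: "AE s in lborel. s \<in> {0<..<1} \<longrightarrow> V' s = V s"
  shows "distributional_solution V' extension"
  unfolding distributional_solution_def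
proof (intro conjI allI impI)
  fix K :: "'a set" assume K: "compact K \<and> K \<subseteq> ball 0 1"
  have "integrable lborel (\<lambda>x. indicator K x *\<^sub>R extension x)"
    by (rule borel_integrable_compact) (use K continuous_on_subset[OF extension_continuous] in auto)
  then show "set_integrable lebesgue K extension"
    unfolding set_integrable_def by (rule integrable_lebesgue_AE(1)) simp
next
  fix \<phi> :: "'a \<Rightarrow> complex" assume "test_function_ball \<phi>"
  then obtain K where \<phi>: "Ck_on 2 UNIV \<phi>" "compact K" "K \<subseteq> ball 0 1" "\<And>x. x \<notin> K \<Longrightarrow> \<phi> x = 0"
    unfolding test_function_ball_def smooth_on_def by blast
  define v where "v x = indicator (ball 0 1) x *\<^sub>R extension x" for x
  note W = extension_weak_solution[OF \<phi>, folded v_def]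
  have "AE r in lborel. r > 0 \<longrightarrow> (r \<in> {0<..<1} \<longrightarrow> V' r = V r)" using ae by eventually_elim simp
  from AE_radial[OF this] AE_lborel_nonzero
  have aeV: "AE x in lborel. norm (x::'a) < 1 \<longrightarrow> V' (norm x) = V (norm x)"
    by eventually_elim auto
  show "set_integrable lebesgue (ball 0 1) (\<lambda>x. V' (norm x) * extension x * \<phi> x)"
    unfolding set_integrable_def
  proof (rule integrable_lebesgue_AE(1)[OF W(1)])
    show "AE x in lborel. v x * (V (norm x) * \<phi> x) = indicator (ball 0 1) x *\<^sub>R (V' (norm x) * extension x * \<phi> x)"
      using aeV by eventually_elim (auto simp: v_def indicator_def)
  qed
  have i: "integrable lborel (\<lambda>x. v x * (V (norm x) * \<phi> x) - v x * laplacian \<phi> x)" using W(1,2) by simp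
  have "(LINT x:ball 0 1|lebesgue. extension x * (- laplacian \<phi> x + V' (norm x) * \<phi> x))
    = (\<integral>x. v x * (V (norm x) * \<phi> x) - v x * laplacian \<phi> x \<partial>lborel)"
    unfolding set_lebesgue_integral_def
  proof (rule integrable_lebesgue_AE(2)[OF i])
    show "AE x in lborel. v x * (V (norm x) * \<phi> x) - v x * laplacian \<phi> x =
        indicator (ball 0 1) x *\<^sub>R (extension x * (- laplacian \<phi> x + V' (norm x) * \<phi> x))"
      using aeV by eventually_elim (auto simp: v_def indicator_def algebra_simps)
  qed
  also have "\<dots> = 0" using W by simp
  finally show "(LINT x:ball 0 1|lebesgue. extension x * (- laplacian \<phi> x + V' (norm x) * \<phi> x)) = 0" .
qed

end

section \<open>Square-integrable boundary values\<close>

lemma L2_sphere_mult_continuous: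
  fixes g \<phi> :: "'a::euclidean_space \<Rightarrow> complex"
  assumes g: "L2_sphere g" and \<phi>: "continuous_on (sphere 0 1) \<phi>"
  shows "integrable sphere_measure (\<lambda>\<xi>. g \<xi> * \<phi> \<xi>)"
proof (rule Bochner_Integration.integrable_bound)
  show "integrable sphere_measure (\<lambda>\<xi>. (norm (g \<xi>))\<^sup>2 + (norm (\<phi> \<xi>))\<^sup>2)"
  proof (rule Bochner_Integration.integrable_add)
    show "integrable sphere_measure (\<lambda>\<xi>. (norm (g \<xi>))\<^sup>2)" using g by (simp add: L2_sphere_def)
    show "integrable sphere_measure (\<lambda>\<xi>. (norm (\<phi> \<xi>))\<^sup>2)"
      by (intro integrable_sphere_continuous continuous_intros \<phi>)
  qed
  show "(\<lambda>\<xi>. g \<xi> * \<phi> \<xi>) \<in> borel_measurable sphere_measure"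
    using g measurable_continuous_sphere[OF \<phi>] by (intro borel_measurable_times) (auto simp: L2_sphere_def)
  show "AE \<xi> in sphere_measure. norm (g \<xi> * \<phi> \<xi>) \<le> norm ((norm (g \<xi>))\<^sup>2 + (norm (\<phi> \<xi>))\<^sup>2)"
  proof (rule AE_I2)
    fix \<xi>
    have "0 \<le> (norm (g \<xi>) - norm (\<phi> \<xi>))\<^sup>2" by simp
    moreover have "0 \<le> (norm (g \<xi>))\<^sup>2 + (norm (\<phi> \<xi>))\<^sup>2" by simp
    ultimately have "norm (g \<xi>) * norm (\<phi> \<xi>) \<le> (norm (g \<xi>))\<^sup>2 + (norm (\<phi> \<xi>))\<^sup>2"
      unfolding power2_diff by linarith
    then show "norm (g \<xi> * \<phi> \<xi>) \<le> norm ((norm (g \<xi>))\<^sup>2 + (norm (\<phi> \<xi>))\<^sup>2)"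
      unfolding norm_mult by simp
  qed
qed

lemma radon_measure_functional_of:
  fixes g :: "'a::euclidean_space \<Rightarrow> complex"
  assumes g: "L2_sphere g"
  shows "radon_measure_sphere (functional_of g)"
  unfolding radon_measure_sphere_def
proof (intro conjI allI impI)
  note i = L2_sphere_mult_continuous[OF g]
  fix \<phi> \<psi> :: "'a \<Rightarrow> complex"
  assume c: "continuous_on (sphere 0 1) \<phi>" "continuous_on (sphere 0 1) \<psi>"
  show "functional_of g (\<lambda>\<zeta>. \<phi> \<zeta> + \<psi> \<zeta>) = functional_of g \<phi> + functional_of g \<psi>"
    unfolding functional_of_def distrib_left by (rule Bochner_Integration.integral_add[OF i[OF c(1)] i[OF c(2)]])
next
  fix c and \<phi> :: "'a \<Rightarrow> complex"
  show "functional_of g (\<lambda>\<zeta>. c * \<phi> \<zeta>) = c * functional_of g \<phi>"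
    unfolding functional_of_def by (simp add: mult.left_commute[of "g _" c])
next
  have "integrable sphere_measure (\<lambda>\<xi>. g \<xi> * 1)" by (rule L2_sphere_mult_continuous[OF g]) simp
  then have gi: "integrable sphere_measure (\<lambda>\<xi>. norm (g \<xi>))" by simp
  show "\<exists>C. \<forall>\<phi>. continuous_on (sphere 0 1) \<phi> \<longrightarrow> norm (functional_of g \<phi>) \<le> C * (SUP \<zeta>\<in>sphere 0 1. norm (\<phi> \<zeta>))"
  proof (intro exI allI impI)
    fix \<phi> :: "'a \<Rightarrow> complex" assume \<phi>: "continuous_on (sphere 0 1) \<phi>"
    let ?s = "SUP \<zeta>\<in>sphere 0 1. norm (\<phi> \<zeta>)"
    have "compact ((\<lambda>\<zeta>. norm (\<phi> \<zeta>)) ` sphere 0 1)" by (intro compact_continuous_image continuous_intros \<phi>) auto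
    then have bdd: "bdd_above ((\<lambda>\<zeta>. norm (\<phi> \<zeta>)) ` sphere 0 1)" by (intro bounded_imp_bdd_above compact_imp_bounded)
    have "norm (functional_of g \<phi>) \<le> (\<integral>\<xi>. norm (g \<xi>) * ?s \<partial>sphere_measure)"
      unfolding functional_of_def
    proof (rule order_trans[OF integral_norm_bound], rule integral_mono)
      show "integrable sphere_measure (\<lambda>\<xi>. norm (g \<xi> * \<phi> \<xi>))" by (intro integrable_norm L2_sphere_mult_continuous g \<phi>)
      show "integrable sphere_measure (\<lambda>\<xi>. norm (g \<xi>) * ?s)" using gi by simp
      fix \<xi> :: 'a assume "\<xi> \<in> space sphere_measure"
      then show "norm (g \<xi> * \<phi> \<xi>) \<le> norm (g \<xi>) * ?s"
        unfolding norm_mult by (intro mult_left_mono cSUP_upper bdd) auto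
    qed
    then show "norm (functional_of g \<phi>) \<le> (\<integral>\<xi>. norm (g \<xi>) \<partial>sphere_measure) * ?s" by simp
  qed
qed

lemma bessel_inequality:
  fixes g :: "'b \<Rightarrow> complex" and e :: "'i \<Rightarrow> 'b \<Rightarrow> complex"
  assumes I: "finite I"
    and g: "integrable M (\<lambda>x. (norm (g x))\<^sup>2)"
    and ge: "\<And>i. i \<in> I \<Longrightarrow> integrable M (\<lambda>x. g x * cnj (e i x))"
    and int: "\<And>i j. i \<in> I \<Longrightarrow> j \<in> I \<Longrightarrow> integrable M (\<lambda>x. e i x * cnj (e j x))"
    and orth: "\<And>i j. i \<in> I \<Longrightarrow> j \<in> I \<Longrightarrow> (\<integral>x. e i x * cnj (e j x) \<partial>M) = (if i = j then 1 else 0)"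
  shows "(\<Sum>i\<in>I. (norm (\<integral>x. g x * cnj (e i x) \<partial>M))\<^sup>2) \<le> (\<integral>x. (norm (g x))\<^sup>2 \<partial>M)"
proof -
  define a where "a i = (\<integral>x. g x * cnj (e i x) \<partial>M)" for i
  let ?s = "\<lambda>x. \<Sum>i\<in>I. a i * e i x"
  have S: "integrable M (\<lambda>x. (norm (?s x))\<^sup>2)" "(\<integral>x. (norm (?s x))\<^sup>2 \<partial>M) = (\<Sum>i\<in>I. (norm (a i))\<^sup>2)"
    by (rule norm_square_orthonormal_sum[OF I int orth]; assumption)+
  have ig: "integrable M (\<lambda>x. \<Sum>i\<in>I. cnj (a i) * (g x * cnj (e i x)))"
    using ge by (intro Bochner_Integration.integrable_sum integrable_mult_right) auto
  have "(\<integral>x. (\<Sum>i\<in>I. cnj (a i) * (g x * cnj (e i x))) \<partial>M) = (\<Sum>i\<in>I. cnj (a i) * a i)"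
    using ge by (subst Bochner_Integration.integral_sum) (auto simp: a_def)
  also have "\<dots> = complex_of_real (\<Sum>i\<in>I. (norm (a i))\<^sup>2)"
    by (simp only: of_real_sum complex_norm_square mult.commute)
  finally have "(\<integral>x. (\<Sum>i\<in>I. cnj (a i) * (g x * cnj (e i x))) \<partial>M) = complex_of_real (\<Sum>i\<in>I. (norm (a i))\<^sup>2)" .
  then have R: "(\<integral>x. Re (\<Sum>i\<in>I. cnj (a i) * (g x * cnj (e i x))) \<partial>M) = (\<Sum>i\<in>I. (norm (a i))\<^sup>2)"
    using integral_Re[OF ig] by simp
  have iR: "integrable M (\<lambda>x. Re (\<Sum>i\<in>I. cnj (a i) * (g x * cnj (e i x))))" using ig by (rule integrable_Re)
  have pt: "0 \<le> (norm (g x))\<^sup>2 - 2 * Re (\<Sum>i\<in>I. cnj (a i) * (g x * cnj (e i x))) + (norm (?s x))\<^sup>2" for x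
  proof -
    have s: "(\<Sum>i\<in>I. cnj (a i) * (g x * cnj (e i x))) = g x * cnj (?s x)"
      by (simp add: sum_distrib_left ac_simps)
    have "(norm (z - s))\<^sup>2 = (norm z)\<^sup>2 - 2 * Re (z * cnj s) + (norm s)\<^sup>2" for z s :: complex
      unfolding cmod_power2 by (simp add: power2_eq_square algebra_simps)
    from this[of "g x" "?s x"] show ?thesis
      unfolding s using zero_le_power2[of "norm (g x - ?s x)"] by linarith
  qed
  have "0 \<le> (\<integral>x. (norm (g x))\<^sup>2 - 2 * Re (\<Sum>i\<in>I. cnj (a i) * (g x * cnj (e i x))) + (norm (?s x))\<^sup>2 \<partial>M)"
    by (intro integral_nonneg_AE AE_I2 pt)
  also have "\<dots> = (\<integral>x. (norm (g x))\<^sup>2 \<partial>M) - 2 * (\<Sum>i\<in>I. (norm (a i))\<^sup>2) + (\<Sum>i\<in>I. (norm (a i))\<^sup>2)"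
  proof -
    have i: "integrable M (\<lambda>x. 2 * Re (\<Sum>i\<in>I. cnj (a i) * (g x * cnj (e i x))))" using iR by (rule integrable_mult_right)
    have "(\<integral>x. (norm (g x))\<^sup>2 - 2 * Re (\<Sum>i\<in>I. cnj (a i) * (g x * cnj (e i x))) + (norm (?s x))\<^sup>2 \<partial>M)
      = (\<integral>x. (norm (g x))\<^sup>2 - 2 * Re (\<Sum>i\<in>I. cnj (a i) * (g x * cnj (e i x))) \<partial>M) + (\<integral>x. (norm (?s x))\<^sup>2 \<partial>M)"
      by (rule Bochner_Integration.integral_add[OF Bochner_Integration.integrable_diff[OF g i] S(1)])
    also have "(\<integral>x. (norm (g x))\<^sup>2 - 2 * Re (\<Sum>i\<in>I. cnj (a i) * (g x * cnj (e i x))) \<partial>M)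
      = (\<integral>x. (norm (g x))\<^sup>2 \<partial>M) - (\<integral>x. 2 * Re (\<Sum>i\<in>I. cnj (a i) * (g x * cnj (e i x))) \<partial>M)"
      by (rule Bochner_Integration.integral_diff[OF g i])
    finally show ?thesis by (simp only: integral_mult_right_zero R S(2))
  qed
  finally show ?thesis unfolding a_def by simp
qed

text \<open>
  The moments of \<open>g\<close> are its coefficients in an orthonormal system, so by Bessel's inequality the
  squares of their moduli add up to at most \<open>\<parallel>g\<parallel>\<^sup>2\<close>. On a sphere of radius \<open>r < 1\<close> the coefficients are
  multiplied by factors of modulus at most \<open>C\<close>; Fatou's lemma passes from partial sums to the
  extension, and integrating over \<open>r\<close> in polar coordinates bounds the norm on the ball.
\<close>

lemma (in poisson_data) extension_L2:
  assumes g: "L2_sphere g" and f: "f = functional_of g"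
  shows "L2_ball extension"
proof -
  define G where "G = (\<integral>\<xi>. (norm (g \<xi>))\<^sup>2 \<partial>sphere_measure)"
  obtain C where C: "C \<ge> 0" "\<And>m r. norm (radial_quotient m r) \<le> C" using radial_quotient_bounded by metis
  let ?I = "\<lambda>N. SIGMA m:{..<N}. {..<n m}"
  let ?e = "\<lambda>(m, j) \<xi>. Y m j \<xi>"
  have gi: "integrable sphere_measure (\<lambda>\<xi>. (norm (g \<xi>))\<^sup>2)" using g by (simp add: L2_sphere_def)
  have fin: "finite (?I N)" for N by auto
  have int: "integrable sphere_measure (\<lambda>\<xi>. ?e p \<xi> * cnj (?e q \<xi>))" if "p \<in> ?I N" "q \<in> ?I N" for p q N
    using that by (auto intro!: integrable_sphere_continuous continuous_intros Y_continuous)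
  have orth: "(\<integral>\<xi>. ?e p \<xi> * cnj (?e q \<xi>) \<partial>sphere_measure) = (if p = q then 1 else 0)" if "p \<in> ?I N" "q \<in> ?I N" for p q N
    using that Y_orthonormal[of "snd p" "fst p" "snd q" "fst q"] by (auto simp: split_beta prod_eq_iff)
  have ge: "integrable sphere_measure (\<lambda>\<xi>. g \<xi> * cnj (?e p \<xi>))" if "p \<in> ?I N" for p N
    using that by (auto intro!: L2_sphere_mult_continuous g continuous_intros Y_continuous)
  have mom: "moment m j = (\<integral>\<xi>. g \<xi> * cnj (Y m j \<xi>) \<partial>sphere_measure)" for m j
    unfolding moment_def unfolding f functional_of_def ..
  have bes: "(\<Sum>p\<in>?I N. (norm (moment (fst p) (snd p)))\<^sup>2) \<le> G" for N
    using bessel_inequality[OF fin gi ge int orth, of N] unfolding G_def mom by (simp add: split_beta)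
  have G0: "0 \<le> G" unfolding G_def by simp
  have part: "(\<integral>\<^sup>+\<xi>. ennreal ((norm (\<Sum>m<N. mode m (r *\<^sub>R \<xi>)))\<^sup>2) \<partial>sphere_measure) \<le> ennreal (C\<^sup>2 * G)"
    if r: "r \<in> {0<..<1}" for r N
  proof -
    let ?c = "\<lambda>p. of_real (r ^ fst p) * radial_quotient (fst p) r * moment (fst p) (snd p)"
    have eq: "(\<Sum>m<N. mode m (r *\<^sub>R \<xi>)) = (\<Sum>p\<in>?I N. ?c p * ?e p \<xi>)" if "norm \<xi> = 1" for \<xi>
      using r that by (simp add: mode_on_sphere sum.Sigma split_beta)
    have S: "integrable sphere_measure (\<lambda>\<xi>. (norm (\<Sum>p\<in>?I N. ?c p * ?e p \<xi>))\<^sup>2)"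
      "(\<integral>\<xi>. (norm (\<Sum>p\<in>?I N. ?c p * ?e p \<xi>))\<^sup>2 \<partial>sphere_measure) = (\<Sum>p\<in>?I N. (norm (?c p))\<^sup>2)"
      by (rule norm_square_orthonormal_sum[OF fin int orth]; assumption)+
    have "(\<integral>\<^sup>+\<xi>. ennreal ((norm (\<Sum>m<N. mode m (r *\<^sub>R \<xi>)))\<^sup>2) \<partial>sphere_measure)
      = (\<integral>\<^sup>+\<xi>. ennreal ((norm (\<Sum>p\<in>?I N. ?c p * ?e p \<xi>))\<^sup>2) \<partial>sphere_measure)"
      by (intro nn_integral_cong) (simp add: eq)
    also have "\<dots> = ennreal (\<Sum>p\<in>?I N. (norm (?c p))\<^sup>2)"
      using nn_integral_eq_integral[OF S(1)] unfolding S(2) by simp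
    also have "\<dots> \<le> ennreal (C\<^sup>2 * G)"
    proof (rule ennreal_leI)
      have "(\<Sum>p\<in>?I N. (norm (?c p))\<^sup>2) \<le> (\<Sum>p\<in>?I N. C\<^sup>2 * (norm (moment (fst p) (snd p)))\<^sup>2)"
      proof (rule sum_mono)
        fix p
        have "norm (?c p) = r ^ fst p * norm (radial_quotient (fst p) r) * norm (moment (fst p) (snd p))"
          using r by (simp add: norm_mult norm_power)
        also have "\<dots> \<le> 1 * C * norm (moment (fst p) (snd p))"
          using r C by (intro mult_mono power_le_one) auto
        finally have "(norm (?c p))\<^sup>2 \<le> (1 * C * norm (moment (fst p) (snd p)))\<^sup>2" by (intro power_mono) auto
        then show "(norm (?c p))\<^sup>2 \<le> C\<^sup>2 * (norm (moment (fst p) (snd p)))\<^sup>2" by (simp add: power_mult_distrib)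
      qed
      also have "\<dots> \<le> C\<^sup>2 * G" unfolding sum_distrib_left[symmetric] by (intro mult_left_mono bes) auto
      finally show "(\<Sum>p\<in>?I N. (norm (?c p))\<^sup>2) \<le> C\<^sup>2 * G" .
    qed
    finally show ?thesis .
  qed
  have sph: "(\<integral>\<^sup>+\<xi>. ennreal ((norm (extension (r *\<^sub>R \<xi>)))\<^sup>2) \<partial>sphere_measure) \<le> ennreal (C\<^sup>2 * G)"
    if r: "r \<in> {0<..<1}" for r
  proof -
    have "(\<integral>\<^sup>+\<xi>. ennreal ((norm (extension (r *\<^sub>R \<xi>)))\<^sup>2) \<partial>sphere_measure) =
      (\<integral>\<^sup>+\<xi>. liminf (\<lambda>N. ennreal ((norm (\<Sum>m<N. mode m (r *\<^sub>R \<xi>)))\<^sup>2)) \<partial>sphere_measure)"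
    proof (rule nn_integral_cong)
      fix \<xi> :: 'a assume "\<xi> \<in> space sphere_measure"
      then have "(\<lambda>m. mode m (r *\<^sub>R \<xi>)) sums extension (r *\<^sub>R \<xi>)" using r by (intro mode_sums) auto
      then have "(\<lambda>N. ennreal ((norm (\<Sum>m<N. mode m (r *\<^sub>R \<xi>)))\<^sup>2)) \<longlonglongrightarrow> ennreal ((norm (extension (r *\<^sub>R \<xi>)))\<^sup>2)"
        unfolding sums_def by (intro tendsto_ennrealI tendsto_intros)
      then show "ennreal ((norm (extension (r *\<^sub>R \<xi>)))\<^sup>2) = liminf (\<lambda>N. ennreal ((norm (\<Sum>m<N. mode m (r *\<^sub>R \<xi>)))\<^sup>2))"
        by (intro lim_imp_Liminf[symmetric]) auto
    qed
    also have "\<dots> \<le> liminf (\<lambda>N. \<integral>\<^sup>+\<xi>. ennreal ((norm (\<Sum>m<N. mode m (r *\<^sub>R \<xi>)))\<^sup>2) \<partial>sphere_measure)"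
    proof (rule nn_integral_liminf)
      fix N
      have "continuous_on (sphere 0 1) (\<lambda>\<xi>. (norm (\<Sum>m<N. mode m (r *\<^sub>R \<xi>)))\<^sup>2)"
        by (intro continuous_intros continuous_on_compose2[OF mode_continuous]) auto
      then show "(\<lambda>\<xi>. ennreal ((norm (\<Sum>m<N. mode m (r *\<^sub>R \<xi>)))\<^sup>2)) \<in> borel_measurable sphere_measure"
        by (intro measurable_compose[OF measurable_continuous_sphere measurable_ennreal])
    qed
    also have "\<dots> \<le> ennreal (C\<^sup>2 * G)"
      by (rule Liminf_le) (use part[OF r] in auto)
    finally show ?thesis .
  qed
  define v where "v x = indicator (ball 0 1) x *\<^sub>R extension x" for x
  have vm: "v \<in> borel_measurable borel"
    unfolding v_def by (rule borel_measurable_continuous_on_indicator[OF _ extension_continuous]) auto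
  have vm2: "(\<lambda>x. (norm (v x))\<^sup>2) \<in> borel_measurable borel" using vm by measurable
  have "(\<integral>\<^sup>+x. ennreal ((norm (v x))\<^sup>2) \<partial>lborel) =
    (\<integral>\<^sup>+r. ennreal (indicator {0<..} r * r ^ (DIM('a) - 1)) * (\<integral>\<^sup>+\<xi>. ennreal ((norm (v (r *\<^sub>R \<xi>)))\<^sup>2) \<partial>sphere_measure) \<partial>lborel)"
    by (rule nn_integral_polar) (use vm2 in measurable)
  also have "\<dots> \<le> (\<integral>\<^sup>+r. ennreal (C\<^sup>2 * G) * indicator {0..1} r \<partial>(lborel :: real measure))"
  proof (rule nn_integral_mono)
    fix r :: real
    let ?J = "\<integral>\<^sup>+\<xi>. ennreal ((norm (v (r *\<^sub>R \<xi>)))\<^sup>2) \<partial>sphere_measure"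
    consider "r \<le> 0" | "r \<in> {0<..<1}" | "1 \<le> r" by fastforce
    then show "ennreal (indicator {0<..} r * r ^ (DIM('a) - 1)) * ?J \<le> ennreal (C\<^sup>2 * G) * indicator {0..1} r"
    proof cases
      case 1
      then have "(indicator {0<..} r :: real) = 0" by simp
      then show ?thesis by (simp only: mult_zero_left ennreal_0 zero_le)
    next
      case 2
      have "?J = (\<integral>\<^sup>+\<xi>. ennreal ((norm (extension (r *\<^sub>R \<xi>)))\<^sup>2) \<partial>sphere_measure)"
        using 2 by (intro nn_integral_cong) (auto simp: v_def)
      then have J: "?J \<le> ennreal (C\<^sup>2 * G)" using sph[OF 2] by simp
      have "r ^ (DIM('a) - 1) \<le> 1" using 2 by (intro power_le_one) auto
      then have "ennreal (indicator {0<..} r * r ^ (DIM('a) - 1)) \<le> 1" using 2 by (simp add: ennreal_le_1)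
      then have "ennreal (indicator {0<..} r * r ^ (DIM('a) - 1)) * ?J \<le> 1 * ennreal (C\<^sup>2 * G)"
        using J by (intro mult_mono) auto
      then show ?thesis using 2 by simp
    next
      case 3
      have "?J = (\<integral>\<^sup>+\<xi>. 0 \<partial>(sphere_measure :: 'a measure))"
        using 3 by (intro nn_integral_cong) (auto simp: v_def)
      then have "?J = 0" by simp
      then show ?thesis by (simp only: mult_zero_right zero_le)
    qed
  qed
  also have "\<dots> = ennreal (C\<^sup>2 * G)" by (subst nn_integral_cmult_indicator) auto
  also have "\<dots> < \<infinity>" by simp
  finally have lt: "(\<integral>\<^sup>+x. ennreal ((norm (v x))\<^sup>2) \<partial>lborel) < \<infinity>" .
  have "integrable lborel (\<lambda>x. (norm (v x))\<^sup>2)"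
  proof (rule integrableI_bounded)
    show "(\<lambda>x. (norm (v x))\<^sup>2) \<in> borel_measurable lborel" using vm2 by (simp only: measurable_lborel2)
    show "(\<integral>\<^sup>+x. ennreal (norm ((norm (v x))\<^sup>2)) \<partial>lborel) < \<infinity>" using lt by simp
  qed
  moreover have "(\<lambda>x. (norm (v x))\<^sup>2) \<in> borel_measurable lborel" using vm2 by (simp only: measurable_lborel2)
  ultimately have "integrable lebesgue (\<lambda>x. (norm (v x))\<^sup>2)" by (simp only: integrable_completion)
  also have "(\<lambda>x. (norm (v x))\<^sup>2) = (\<lambda>x. indicator (ball 0 1) x *\<^sub>R (norm (extension x))\<^sup>2)"
    by (auto simp: v_def indicator_def fun_eq_iff)
  finally have "set_integrable lebesgue (ball 0 1) (\<lambda>x. (norm (extension x))\<^sup>2)" unfolding set_integrable_def .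
  moreover have "extension \<in> borel_measurable (lebesgue_on (ball 0 1))"
    by (rule continuous_imp_measurable_on_sets_lebesgue[OF extension_continuous]) auto
  ultimately show ?thesis unfolding L2_ball_def by blast
qed

section \<open>Functions that agree in the ball\<close>

lemma set_integral_eqI:
  assumes "\<And>x. x \<in> A \<Longrightarrow> f x = g x"
  shows "set_integrable M A f = set_integrable M A g"
    "set_lebesgue_integral M A f = set_lebesgue_integral M A g"
proof -
  have "(\<lambda>x. indicator A x *\<^sub>R f x) = (\<lambda>x. indicator A x *\<^sub>R g x)"
  proof
    fix x show "indicator A x *\<^sub>R f x = indicator A x *\<^sub>R g x" by (cases "x \<in> A") (simp_all add: assms)
  qed
  then show "set_integrable M A f = set_integrable M A g"
    "set_lebesgue_integral M A f = set_lebesgue_integral M A g"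
    unfolding set_integrable_def set_lebesgue_integral_def by simp_all
qed

lemma distributional_solution_cong:
  assumes uv: "\<And>x. x \<in> ball 0 1 \<Longrightarrow> u x = v x" and u: "distributional_solution V u"
  shows "distributional_solution V v"
  unfolding distributional_solution_def
proof (intro conjI allI impI)
  fix K :: "'a set" assume K: "compact K \<and> K \<subseteq> ball 0 1"
  then have "set_integrable lebesgue K u" using u unfolding distributional_solution_def by blast
  moreover have "set_integrable lebesgue K u = set_integrable lebesgue K v"
    by (rule set_integral_eqI) (use uv K in blast)
  ultimately show "set_integrable lebesgue K v" by simp
next
  fix \<phi> :: "'a \<Rightarrow> complex" assume "test_function_ball \<phi>"
  then have 1: "set_integrable lebesgue (ball 0 1) (\<lambda>x. V (norm x) * u x * \<phi> x)"
    "(LINT x:ball 0 1|lebesgue. u x * (- laplacian \<phi> x + V (norm x) * \<phi> x)) = 0"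
    using u unfolding distributional_solution_def by blast+
  have "set_integrable lebesgue (ball 0 1) (\<lambda>x. V (norm x) * u x * \<phi> x) =
    set_integrable lebesgue (ball 0 1) (\<lambda>x. V (norm x) * v x * \<phi> x)"
    by (rule set_integral_eqI) (simp add: uv)
  with 1 show "set_integrable lebesgue (ball 0 1) (\<lambda>x. V (norm x) * v x * \<phi> x)" by simp
  have "(LINT x:ball 0 1|lebesgue. u x * (- laplacian \<phi> x + V (norm x) * \<phi> x)) =
    (LINT x:ball 0 1|lebesgue. v x * (- laplacian \<phi> x + V (norm x) * \<phi> x))"
    by (rule set_integral_eqI) (simp add: uv)
  with 1 show "(LINT x:ball 0 1|lebesgue. v x * (- laplacian \<phi> x + V (norm x) * \<phi> x)) = 0" by simp
qed

lemma boundary_value_cong: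
  fixes u v :: "'a::euclidean_space \<Rightarrow> complex"
  assumes uv: "\<And>x. x \<in> ball 0 1 \<Longrightarrow> u x = v x" and u: "has_distributional_boundary_value u f"
  shows "has_distributional_boundary_value v f"
  unfolding has_distributional_boundary_value_def
proof (intro allI impI)
  fix \<phi> :: "'a \<Rightarrow> complex" assume "smooth_on_sphere \<phi>"
  then have 1: "\<forall>\<^sub>F r in at_left (1::real). integrable sphere_measure (\<lambda>\<xi>. u (r *\<^sub>R \<xi>) * \<phi> \<xi>)"
    "((\<lambda>r. \<integral>\<xi>. u (r *\<^sub>R \<xi>) * \<phi> \<xi> \<partial>sphere_measure) \<longlongrightarrow> f \<phi>) (at_left 1)"
    using u unfolding has_distributional_boundary_value_def by blast+
  have ev: "\<forall>\<^sub>F r in at_left (1::real). r \<in> {0<..<1}"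
    using eventually_at_left_real[of 0 1] by simp
  have eq: "u (r *\<^sub>R \<xi>) * \<phi> \<xi> = v (r *\<^sub>R \<xi>) * \<phi> \<xi>" if "r \<in> {0<..<1}" "\<xi> \<in> space sphere_measure" for r and \<xi> :: 'a
    using that by (simp add: uv)
  show "(\<forall>\<^sub>F r in at_left (1::real). integrable sphere_measure (\<lambda>\<xi>. v (r *\<^sub>R \<xi>) * \<phi> \<xi>)) \<and>
    ((\<lambda>r. \<integral>\<xi>. v (r *\<^sub>R \<xi>) * \<phi> \<xi> \<partial>sphere_measure) \<longlongrightarrow> f \<phi>) (at_left 1)"
  proof
    show "\<forall>\<^sub>F r in at_left (1::real). integrable sphere_measure (\<lambda>\<xi>. v (r *\<^sub>R \<xi>) * \<phi> \<xi>)"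
      using 1(1) ev
    proof eventually_elim
      case (elim r)
      have "integrable sphere_measure (\<lambda>\<xi>. u (r *\<^sub>R \<xi>) * \<phi> \<xi>) = integrable sphere_measure (\<lambda>\<xi>. v (r *\<^sub>R \<xi>) * \<phi> \<xi>)"
        by (rule Bochner_Integration.integrable_cong[OF refl]) (rule eq[OF elim(2)])
      then show ?case using elim(1) by simp
    qed
    show "((\<lambda>r. \<integral>\<xi>. v (r *\<^sub>R \<xi>) * \<phi> \<xi> \<partial>sphere_measure) \<longlongrightarrow> f \<phi>) (at_left 1)"
    proof (rule Lim_transform_eventually[OF 1(2)])
      show "\<forall>\<^sub>F r in at_left 1. (\<integral>\<xi>. u (r *\<^sub>R \<xi>) * \<phi> \<xi> \<partial>sphere_measure) = (\<integral>\<xi>. v (r *\<^sub>R \<xi>) * \<phi> \<xi> \<partial>sphere_measure)"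
        using ev by eventually_elim (intro Bochner_Integration.integral_cong refl eq)
    qed
  qed
qed

lemma L2_ball_cong:
  assumes uv: "\<And>x. x \<in> ball 0 1 \<Longrightarrow> u x = v x" and u: "L2_ball u"
  shows "L2_ball v"
proof -
  have "u \<in> borel_measurable (lebesgue_on (ball 0 1)) \<longleftrightarrow> v \<in> borel_measurable (lebesgue_on (ball 0 1))"
    by (rule measurable_cong) (simp add: space_restrict_space uv)
  moreover have "set_integrable lebesgue (ball 0 1) (\<lambda>x. (norm (u x))\<^sup>2) = set_integrable lebesgue (ball 0 1) (\<lambda>x. (norm (v x))\<^sup>2)"
    by (rule set_integral_eqI) (simp add: uv)
  ultimately show ?thesis using u unfolding L2_ball_def by simp
qed

theorem theorem27:
  fixes V :: "real \<Rightarrow> complex"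
    and n :: "nat \<Rightarrow> nat"
    and Y :: "nat \<Rightarrow> nat \<Rightarrow> 'a::euclidean_space \<Rightarrow> complex"
  assumes "3 \<le> DIM('a)"
    and "V \<in> borel_measurable (lebesgue_on {0<..<1})"
    and "set_integrable lebesgue {0<..<1} (\<lambda>r. r * norm (V r))"
    and "\<And>m. alpha DIM('a) V m 1 \<noteq> 0"
    and "\<And>m. orthonormal_basis_spherical_harmonics m (n m) (Y m)"
  shows "(\<forall>f. radon_measure_sphere f \<longrightarrow>
            (\<forall>r \<xi>. 0 \<le> r \<longrightarrow> r < 1 \<longrightarrow> norm \<xi> = 1 \<longrightarrow>
               continuous_on (sphere 0 1) (poisson_kernel V n Y r \<xi>) \<and>
               poisson_integral V n Y f (r *\<^sub>R \<xi>) = f (poisson_kernel V n Y r \<xi>)) \<and>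
            distributional_solution V (poisson_integral V n Y f) \<and>
            continuous_on (ball 0 1) (poisson_integral V n Y f) \<and>
            has_distributional_boundary_value (poisson_integral V n Y f) f) \<and>
         (\<forall>g. L2_sphere g \<longrightarrow>
            radon_measure_sphere (functional_of g) \<and>
            distributional_solution V (poisson_integral V n Y (functional_of g)) \<and>
            continuous_on (ball 0 1) (poisson_integral V n Y (functional_of g)) \<and>
            has_distributional_boundary_value (poisson_integral V n Y (functional_of g))
              (functional_of g) \<and>
            L2_ball (poisson_integral V n Y (functional_of g)))"
proof -
  obtain V' where V': "radial_source V'" "AE s in lborel. s \<in> {0<..<1} \<longrightarrow> V s = V' s"
    using radial_source_representative[OF assms(2,3)] by metis
  note al = alpha_eq_normalized_solution[OF V' assms(1)]
  have P: "poisson_problem n Y V'"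
  proof
    show "normalized_solution (2 * m + DIM('a) - 2) V' 1 \<noteq> 0" for m
      using al[of 1 m] assms(4)[of m] by simp
  qed (use assms V' in auto)
  interpret poisson_problem n Y V' by (rule P)
  have ker: "poisson_kernel V n Y r \<xi> = kernel r \<xi>" if "0 \<le> r" "r < 1" for r \<xi>
  proof -
    have "of_real (r ^ m) * alpha DIM('a) V m r / alpha DIM('a) V m 1 = of_real (r ^ m) * radial_quotient m r" for m
      using al[of r m] al[of 1 m] that by (simp add: radial_quotient_def)
    then show ?thesis unfolding poisson_kernel_def[abs_def] kernel_def[abs_def] by simp
  qed
  have main: "(\<forall>r \<xi>. 0 \<le> r \<longrightarrow> r < 1 \<longrightarrow> norm \<xi> = 1 \<longrightarrow>
               continuous_on (sphere 0 1) (poisson_kernel V n Y r \<xi>) \<and>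
               poisson_integral V n Y f (r *\<^sub>R \<xi>) = f (poisson_kernel V n Y r \<xi>)) \<and>
            distributional_solution V (poisson_integral V n Y f) \<and>
            continuous_on (ball 0 1) (poisson_integral V n Y f) \<and>
            has_distributional_boundary_value (poisson_integral V n Y f) f \<and>
            (\<forall>g. L2_sphere g \<longrightarrow> f = functional_of g \<longrightarrow> L2_ball (poisson_integral V n Y f))"
    if f: "radon_measure_sphere f" for f
  proof -
    interpret sphere_functional f by unfold_locales (rule f)
    interpret poisson_data n Y V' f ..
    have pe: "poisson_integral V n Y f x = extension x" if "norm x < 1" for x
      unfolding poisson_integral_def ker[OF norm_ge_zero that]
      using f_kernel_eq_extension[of "norm x" "direction x"] that by (simp add: direction)
    have eb: "extension x = poisson_integral V n Y f x" if "x \<in> ball 0 1" for x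
      using pe[of x] that by simp
    show ?thesis
    proof (intro conjI allI impI)
      fix r :: real and \<xi> :: 'a assume r: "0 \<le> r" "r < 1" "norm \<xi> = 1"
      show "continuous_on (sphere 0 1) (poisson_kernel V n Y r \<xi>)"
        unfolding ker[OF r(1,2)] by (rule kernel_continuous_and_sums(1)[OF r])
      show "poisson_integral V n Y f (r *\<^sub>R \<xi>) = f (poisson_kernel V n Y r \<xi>)"
        unfolding ker[OF r(1,2)] f_kernel_eq_extension[OF r] by (rule pe) (use r in simp)
    next
      show "distributional_solution V (poisson_integral V n Y f)"
        by (rule distributional_solution_cong[OF eb extension_distributional_solution[OF V'(2)]])
      show "continuous_on (ball 0 1) (poisson_integral V n Y f)"
        by (rule continuous_on_eq[OF extension_continuous eb])
      show "has_distributional_boundary_value (poisson_integral V n Y f) f"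
        by (rule boundary_value_cong[OF eb extension_boundary_value])
      fix g :: "'a \<Rightarrow> complex" assume "L2_sphere g" "f = functional_of g"
      then have "L2_ball extension" by (rule extension_L2)
      then show "L2_ball (poisson_integral V n Y f)" by (rule L2_ball_cong[of extension, rotated]) (rule eb)
    qed
  qed
  then show ?thesis using radon_measure_functional_of by blast
qed

end
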